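(* Let $N\ge 1$, let $f:\mathbb{P}^N\to\mathbb{P}^N$ be an endomorphism defined over $\bar{\mathbb{Q}}$, and assume that there is a point $P_0\in\mathbb{P}^N(\bar{\mathbb{Q}})$ whose forward orbit $\mathcal{O}_f(P_0)$ is Zariski dense in $\mathbb{P}^N$. Then there exists a number field $K$ that is a common field of definition for $f$ and $P_0$ such that the following hold. (a) If $\deg(f)\ge 2$: for every finite collection of grand $f$-orbits $\Gamma_1,\ldots,\Gamma_r\subset\mathbb{P}^N(\bar{\mathbb{Q}})$, the set $\mathbb{P}^N(K)\setminus(\Gamma_1\cup\cdots\cup\Gamma_r)$ is Zariski dense in $\mathbb{P}^N$. Equivalently, there exists a Zariski dense subset of $\mathbb{P}^N(K)$ that contains exactly one point of each grand $f$-orbit that meets $\mathbb{P}^N(K)$. (b) If $\deg(f)\ge 2$: for every proper Zariski closed subset $Y\subsetneq\mathbb{P}^N$, the set $\mathbb{P}^N(K)\setminus\bigcup_{P\in Y(K)}\mathcal{O}_f(P)$ is Zariski dense in $\mathbb{P}^N$. (c) If $\deg(f)=1$: every complete set of representatives in $(\mathbb{P}^N)_f^{\mathrm{dense}}(K)$ for $(\mathbb{P}^N)_f^{\mathrm{dense}}(K)/\equiv_f$ is Zariski dense in $\mathbb{P}^N$.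
   Context: For a morphism $f:X\to X$ and a point $P$, the (forward) orbit is $\mathcal{O}_f(P)=\{f^n(P):n\ge 0\}$ (so $P\in\mathcal{O}_f(P)$). The grand orbit of $P$ is $\mathcal{O}_f^{\mathrm{grand}}(P)=\{Q\in X:\mathcal{O}_f(P)\cap\mathcal{O}_f(Q)\neq\emptyset\}$; a grand $f$-orbit is a set of this form. Write $P\equiv_f Q$ if $\mathcal{O}_f(P)\cap\mathcal{O}_f(Q)\ne\emptyset$; this is an equivalence relation. $X_f^{\mathrm{dense}}$ denotes the set of points $P$ whose orbit $\mathcal{O}_f(P)$ is Zariski dense in $X$, and $X_f^{\mathrm{dense}}(K)=X_f^{\mathrm{dense}}\cap X(K)$. A complete set of representatives for $S/\equiv_f$ (for a subset $S\subseteq X(K)$) is a subset of $S$ containing exactly one point from each $\equiv_f$-equivalence class that meets $S$. *)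

theory Defs
  imports Complex_Main "HOL-Computational_Algebra.Polynomial"
begin

text \<open>Conventions. The algebraic closure of Q is realised as the set of algebraic
complex numbers. A vector in Qbar^(N+1) is a function nat => complex supported in {0..N}.
A point of P^N is the set of all nonzero scalar multiples of a nonzero vector.
A homogeneous polynomial of degree d in x_0..x_N is a coefficient function on the
(finite) set of exponent vectors of total degree d.\<close>

definition is_vec :: "nat \<Rightarrow> (nat \<Rightarrow> complex) \<Rightarrow> bool" where
  "is_vec N v \<longleftrightarrow> (\<forall>i>N. v i = 0)"

definition alg_vec :: "nat \<Rightarrow> (nat \<Rightarrow> complex) \<Rightarrow> bool" where
  "alg_vec N v \<longleftrightarrow> is_vec N v \<and> (\<forall>i\<le>N. algebraic (v i))"

definition proj :: "(nat \<Rightarrow> complex) \<Rightarrow> (nat \<Rightarrow> complex) set" where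
  "proj v = {(\<lambda>i. c * v i) | c. c \<noteq> 0}"

definition PN :: "nat \<Rightarrow> (nat \<Rightarrow> complex) set set" where
  "PN N = {proj v | v. alg_vec N v \<and> v \<noteq> (\<lambda>_. 0)}"

definition PN_K :: "nat \<Rightarrow> complex set \<Rightarrow> (nat \<Rightarrow> complex) set set" where
  "PN_K N K = {P \<in> PN N. \<exists>v\<in>P. \<forall>i\<le>N. v i \<in> K}"

definition monoms :: "nat \<Rightarrow> nat \<Rightarrow> (nat \<Rightarrow> nat) set" where
  "monoms N d = {\<alpha>. (\<forall>i>N. \<alpha> i = 0) \<and> (\<Sum>i\<le>N. \<alpha> i) = d}"

definition heval :: "nat \<Rightarrow> nat \<Rightarrow> ((nat \<Rightarrow> nat) \<Rightarrow> complex) \<Rightarrow> (nat \<Rightarrow> complex) \<Rightarrow> complex" where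
  "heval N d c v = (\<Sum>\<alpha>\<in>monoms N d. c \<alpha> * (\<Prod>i\<le>N. v i ^ \<alpha> i))"

definition alg_hpoly :: "nat \<Rightarrow> nat \<Rightarrow> ((nat \<Rightarrow> nat) \<Rightarrow> complex) \<Rightarrow> bool" where
  "alg_hpoly N d c \<longleftrightarrow> (\<forall>\<alpha>\<in>monoms N d. algebraic (c \<alpha>))"

definition zero_set :: "nat \<Rightarrow> (nat \<times> ((nat \<Rightarrow> nat) \<Rightarrow> complex)) set \<Rightarrow> (nat \<Rightarrow> complex) set set" where
  "zero_set N Fs = {P \<in> PN N. \<forall>(e, c)\<in>Fs. \<forall>v\<in>P. heval N e c v = 0}"

definition zclosed :: "nat \<Rightarrow> (nat \<Rightarrow> complex) set set \<Rightarrow> bool" where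
  "zclosed N Y \<longleftrightarrow> (\<exists>Fs. (\<forall>(e, c)\<in>Fs. alg_hpoly N e c) \<and> Y = zero_set N Fs)"

definition zdense :: "nat \<Rightarrow> (nat \<Rightarrow> complex) set set \<Rightarrow> bool" where
  "zdense N S \<longleftrightarrow> S \<subseteq> PN N \<and> (\<forall>Y. zclosed N Y \<and> S \<subseteq> Y \<longrightarrow> Y = PN N)"

definition endo :: "nat \<Rightarrow> nat \<Rightarrow> (nat \<Rightarrow> (nat \<Rightarrow> nat) \<Rightarrow> complex) \<Rightarrow> bool" where
  "endo N d F \<longleftrightarrow> d \<ge> 1 \<and> (\<forall>i\<le>N. alg_hpoly N d (F i)) \<and>
     (\<forall>v. alg_vec N v \<and> (\<forall>i\<le>N. heval N d (F i) v = 0) \<longrightarrow> v = (\<lambda>_. 0))"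

definition fmap :: "nat \<Rightarrow> nat \<Rightarrow> (nat \<Rightarrow> (nat \<Rightarrow> nat) \<Rightarrow> complex)
    \<Rightarrow> (nat \<Rightarrow> complex) set \<Rightarrow> (nat \<Rightarrow> complex) set" where
  "fmap N d F P = proj (\<lambda>i. if i \<le> N then heval N d (F i) (SOME v. v \<in> P) else 0)"

definition number_field :: "complex set \<Rightarrow> bool" where
  "number_field K \<longleftrightarrow> 0 \<in> K \<and> 1 \<in> K \<and>
     (\<forall>x\<in>K. \<forall>y\<in>K. x + y \<in> K \<and> x - y \<in> K \<and> x * y \<in> K) \<and>
     (\<forall>x\<in>K. x \<noteq> 0 \<longrightarrow> inverse x \<in> K) \<and>
     (\<exists>B. finite B \<and> B \<subseteq> K \<and> (\<forall>x\<in>K. \<exists>q. x = (\<Sum>b\<in>B. of_rat (q b) * b)))"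

definition endo_defined_over :: "nat \<Rightarrow> nat \<Rightarrow> (nat \<Rightarrow> (nat \<Rightarrow> nat) \<Rightarrow> complex) \<Rightarrow> complex set \<Rightarrow> bool" where
  "endo_defined_over N d F K \<longleftrightarrow>
     (\<exists>s. s \<noteq> 0 \<and> (\<forall>i\<le>N. \<forall>\<alpha>\<in>monoms N d. s * F i \<alpha> \<in> K))"

definition orbit :: "('a \<Rightarrow> 'a) \<Rightarrow> 'a \<Rightarrow> 'a set" where
  "orbit f P = {(f ^^ n) P | n. True}"

definition orb_equiv :: "('a \<Rightarrow> 'a) \<Rightarrow> 'a \<Rightarrow> 'a \<Rightarrow> bool" where
  "orb_equiv f P Q \<longleftrightarrow> orbit f P \<inter> orbit f Q \<noteq> {}"

definition grand_orbit :: "('a \<Rightarrow> 'a) \<Rightarrow> 'a set \<Rightarrow> 'a \<Rightarrow> 'a set" where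
  "grand_orbit f X P = {Q \<in> X. orb_equiv f P Q}"

definition dense_pts :: "nat \<Rightarrow> nat \<Rightarrow> (nat \<Rightarrow> (nat \<Rightarrow> nat) \<Rightarrow> complex) \<Rightarrow> complex set
    \<Rightarrow> (nat \<Rightarrow> complex) set set" where
  "dense_pts N d F K = {P \<in> PN_K N K. zdense N (orbit (fmap N d F) P)}"

end

theory Submission
  imports Defs "HOL-Analysis.Continuum_Not_Denumerable" "Jordan_Normal_Form.Char_Poly"
    "HOL-Computational_Algebra.Fundamental_Theorem_Algebra"
begin

text \<open>The field \<open>K\<close> contains the coefficients of \<open>f\<close>, of Nullstellensatz identities
  \<open>x\<^sub>i\<^sup>D = \<Sum>\<^sub>j g\<^sub>i\<^sub>j F\<^sub>j\<close>, and a few auxiliary algebraic numbers. Arithmetic in \<open>K\<close> is done with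
  the valuation rings of the complex numbers.

  (a) If two integral points with first coordinate 1 lie in one grand orbit, then the identities bound
  the denominators of the scalar relating their iterates, so their heights agree up to a power of \<open>d\<close> and a constant
  factor. Hence the points \<open>(x^(b^j - 1))\<^sub>j\<close> with \<open>x = B^n\<close> are pairwise inequivalent for \<open>n\<close> in an interval
  \<open>[M, 2M)\<close>, and for \<open>x\<close> large they avoid any given hypersurface of degree less than \<open>b\<close>.

  (b) If \<open>d\<close> is at least 2, the Jacobian of \<open>F\<close> is singular at some point \<open>v\<close> in a direction \<open>w\<close> not proportional
  to \<open>v\<close>. At a prime \<open>p\<close> of good reduction \<open>f\<close> identifies \<open>v\<close> and \<open>v + p w\<close> modulo \<open>p\<^sup>2\<close>, so it is not injective,
  hence not surjective, on points modulo \<open>p\<^sup>2\<close>. The points of a missed residue class are dense and not in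
  \<open>f(P\<^sup>N(K))\<close>, so they lie in the orbit of a point of \<open>Y\<close> only if they lie in \<open>Y\<close>.

  (c) If \<open>d = 1\<close>, let \<open>T\<close> be the linear lift of \<open>f\<close> and write the annihilating polynomial of a lift \<open>v\<close> of \<open>P\<^sub>0\<close>
  as the product of the \<open>X - \<mu>\<^sub>j\<close>. In the coordinates \<open>y\<^sub>j\<close> with respect to the vectors \<open>\<Prod>\<^sub>l\<^sub><\<^sub>j (T - \<mu>\<^sub>l) v\<close> the map is bidiagonal.
  For a suitable prime, the set of \<open>y\<close> whose coordinates have prescribed, rapidly decreasing valuations is
  stable under \<open>T\<close> and its inverse, and a given form \<open>g\<close> has no zero on it. It contains a \<open>K\<close>-point with dense orbit,
  so every set of representatives contains a point where \<open>g\<close> does not vanish.\<close>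


hide_const (open) module.smult

section \<open>Places of the complex numbers\<close>

text \<open>Valuation rings of the whole complex field serve three purposes. Lying in all of them is
  the same as being an algebraic integer, so denominators are bounded place by place; places over
  large primes give good reduction; and a place with algebraic residue field turns complex witnesses
  into algebraic ones. In (a) the logarithmic heights of two equivalent candidates are n l and n' l
  up to a bounded error, so their ratio is nearly a power of d. With 1 < n'/n < 2 \<le> d this fails
  once l is large. In (b) the square of p is what makes a tangent direction visible: v and v + p w
  agree modulo p and differ modulo the square, while their images differ by p times a vanishing
  derivative plus a multiple of the square. In (c) the representatives are arbitrary, so one good
  point in a class is not enough: a set of vectors is needed that avoids the hypersurface and
  contains, up to scalars, everything equivalent to its members. Spread valuations provide it
  because each coordinate dominates the correction coming from its predecessor, and because no two
  monomials of the form can cancel.\<close>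

definition is_subring :: "complex set \<Rightarrow> bool" where
  "is_subring S \<longleftrightarrow> 1 \<in> S \<and> (\<forall>x\<in>S. \<forall>y\<in>S. x - y \<in> S \<and> x * y \<in> S)"

text \<open>A maximal such set \<open>M\<close> is the maximal ideal of the valuation ring \<open>{a. a M \<subseteq> M}\<close>.\<close>

definition nonunital :: "complex set \<Rightarrow> complex set \<Rightarrow> bool" where
  "nonunital S m \<longleftrightarrow> 0 \<in> m \<and> 1 \<notin> m \<and> (\<forall>x\<in>m. \<forall>y\<in>m. x + y \<in> m \<and> x * y \<in> m) \<and>
     (\<forall>s\<in>S. \<forall>x\<in>m. s * x \<in> m)"

locale place =
  fixes A m :: "complex set"
  assumes one [simp]: "1 \<in> A"
    and diff: "x \<in> A \<Longrightarrow> y \<in> A \<Longrightarrow> x - y \<in> A"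
    and mult: "x \<in> A \<Longrightarrow> y \<in> A \<Longrightarrow> x * y \<in> A"
    and m_sub: "x \<in> m \<Longrightarrow> x \<in> A"
    and m_zero [simp]: "0 \<in> m"
    and m_add: "x \<in> m \<Longrightarrow> y \<in> m \<Longrightarrow> x + y \<in> m"
    and m_mult: "a \<in> A \<Longrightarrow> x \<in> m \<Longrightarrow> a * x \<in> m"
    and one_notin: "1 \<notin> m"
    and total: "x \<in> A \<or> inverse x \<in> A"
    and unit: "a \<in> A \<Longrightarrow> a \<notin> m \<Longrightarrow> inverse a \<in> A"
begin

lemma zero [simp]: "0 \<in> A" using diff[of 1 1] by simp
lemma minus: "x \<in> A \<Longrightarrow> - x \<in> A" using diff[of 0 x] by simp
lemma add: "x \<in> A \<Longrightarrow> y \<in> A \<Longrightarrow> x + y \<in> A" using diff[of x "- y"] minus by simp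
lemma power: "x \<in> A \<Longrightarrow> x ^ k \<in> A" by (induct k) (auto intro: mult)
lemma sum: "(\<And>i. i \<in> I \<Longrightarrow> f i \<in> A) \<Longrightarrow> sum f I \<in> A"
  by (induct I rule: infinite_finite_induct) (auto intro: add)
lemma prod: "(\<And>i. i \<in> I \<Longrightarrow> f i \<in> A) \<Longrightarrow> prod f I \<in> A"
  by (induct I rule: infinite_finite_induct) (auto intro: mult)
lemma of_nat [simp]: "of_nat k \<in> A" by (induct k) (auto intro: add)
lemma of_int [simp]: "of_int k \<in> A" by (cases k) (auto simp del: of_nat_Suc intro: minus)
lemma m_minus: "x \<in> m \<Longrightarrow> - x \<in> m" using m_mult[of "-1" x] minus[OF one] by simp
lemma m_diff: "x \<in> m \<Longrightarrow> y \<in> m \<Longrightarrow> x - y \<in> m" using m_add[of x "- y"] m_minus by simp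
lemma m_mult_right: "x \<in> m \<Longrightarrow> a \<in> A \<Longrightarrow> x * a \<in> m" using m_mult[of a x] by (simp add: mult.commute)
lemma m_sum: "(\<And>i. i \<in> I \<Longrightarrow> f i \<in> m) \<Longrightarrow> sum f I \<in> m"
  by (induct I rule: infinite_finite_induct) (auto intro: m_add)
lemma m_power: "x \<in> m \<Longrightarrow> 0 < k \<Longrightarrow> x ^ k \<in> m"
  by (cases k) (auto intro: m_mult_right power m_sub)
lemma m_prime: "a * b \<in> m \<Longrightarrow> a \<in> A \<Longrightarrow> b \<in> A \<Longrightarrow> a \<in> m \<or> b \<in> m"
proof (rule ccontr)
  assume ab: "a * b \<in> m" "a \<in> A" "b \<in> A" "\<not> (a \<in> m \<or> b \<in> m)"
  then have "inverse a * (inverse b * (a * b)) \<in> m" using m_mult[OF unit m_mult[OF unit ab(1)]] by blast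
  moreover have "a \<noteq> 0" "b \<noteq> 0" using ab m_zero by metis+
  then have "inverse a * (inverse b * (a * b)) = 1" by (simp add: field_simps)
  ultimately show False using one_notin by simp
qed
lemma unit_mult: "a \<in> A - m \<Longrightarrow> b \<in> A - m \<Longrightarrow> a * b \<in> A - m"
  using m_prime mult by blast
lemma unit_power: "a \<in> A - m \<Longrightarrow> a ^ k \<in> A - m"
proof (induct k)
  case (Suc k)
  then show ?case using unit_mult[of a "a ^ k"] by simp
qed (use one_notin in auto)
lemma unit_prod: "(\<And>i. i \<in> I \<Longrightarrow> f i \<in> A - m) \<Longrightarrow> prod f I \<in> A - m"
proof (induct I rule: infinite_finite_induct)
  case (insert x F)
  then show ?case using unit_mult[of "f x" "prod f F"] by simp
qed (auto simp: one_notin)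
lemma unit_inverse: "a \<in> A - m \<Longrightarrow> inverse a \<in> A - m"
  using unit[of a] m_mult_right[of "inverse a" a] one_notin m_zero
  by (cases "a = 0") auto
lemma unit_nonzero: "a \<in> A - m \<Longrightarrow> a \<noteq> 0" by auto
lemma unit_add_m: "a \<in> A - m \<Longrightarrow> x \<in> m \<Longrightarrow> a + x \<in> A - m"
  using m_diff[of "a + x" x] by (auto intro: add m_sub)

end

section \<open>Chevalley's extension theorem by Zorn's lemma\<close>

definition pmod :: "complex set \<Rightarrow> complex \<Rightarrow> complex set" where
  "pmod M x = {poly p x | p. \<forall>i. coeff p i \<in> M}"

lemma nonunital_sum:
  assumes "nonunital S M" "\<And>i. i \<in> I \<Longrightarrow> f i \<in> M"
  shows "sum f I \<in> M"
  using assms(2) by (induct I rule: infinite_finite_induct)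
    (use assms(1) in \<open>auto simp: nonunital_def\<close>)

lemma nonunital_minus:
  assumes "is_subring S" "nonunital S M" "x \<in> M"
  shows "- x \<in> M"
proof -
  have "1 - 1 \<in> S" using assms(1) unfolding is_subring_def by blast
  then have "0 - 1 \<in> S" using assms(1) unfolding is_subring_def by (metis diff_self)
  then have "(0 - 1) * x \<in> M" using assms(2,3) unfolding nonunital_def by blast
  then show ?thesis by simp
qed

text \<open>Adjoining \<open>x\<close> to \<open>M\<close> can fail only by producing 1. For maximal
  \<open>M\<close> the set \<open>pmod M x\<close> therefore either contains 1 or equals
  \<open>M\<close>, and in the latter case \<open>x\<close> multiplies \<open>M\<close> into
  itself.\<close>

lemma nonunital_pmod:
  assumes "is_subring S" "nonunital S M" "1 \<notin> pmod M x"
  shows "nonunital S (pmod M x)"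
  unfolding nonunital_def
proof (intro conjI ballI)
  show "0 \<in> pmod M x" unfolding pmod_def using assms(2)
    by (intro CollectI exI[of _ 0]) (auto simp: nonunital_def)
  show "1 \<notin> pmod M x" by fact
next
  fix y z assume "y \<in> pmod M x" "z \<in> pmod M x"
  then obtain p q where p: "y = poly p x" "\<forall>i. coeff p i \<in> M" and q: "z = poly q x" "\<forall>i. coeff q i \<in> M"
    unfolding pmod_def by blast
  show "y + z \<in> pmod M x" unfolding pmod_def using p q assms(2)
    by (intro CollectI exI[of _ "p + q"]) (auto simp: nonunital_def)
  have "coeff (p * q) i \<in> M" for i
    unfolding coeff_mult using p q assms(2) by (intro nonunital_sum[OF assms(2)]) (auto simp: nonunital_def)
  then show "y * z \<in> pmod M x" unfolding pmod_def using p q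
    by (intro CollectI exI[of _ "p * q"]) auto
next
  fix s y assume "s \<in> S" "y \<in> pmod M x"
  then obtain p where p: "y = poly p x" "\<forall>i. coeff p i \<in> M" unfolding pmod_def by blast
  then show "s * y \<in> pmod M x" unfolding pmod_def using assms(2) \<open>s \<in> S\<close>
    by (intro CollectI exI[of _ "smult s p"]) (auto simp: nonunital_def)
qed

lemma pmod_superset: 
  assumes "nonunital S M" shows "M \<subseteq> pmod M x"
proof
  fix y assume "y \<in> M"
  then show "y \<in> pmod M x" unfolding pmod_def using assms
    by (intro CollectI exI[of _ "[:y:]"]) (auto simp: nonunital_def coeff_pCons split: nat.split)
qed

definition maximal_nonunital :: "complex set \<Rightarrow> complex set \<Rightarrow> bool" where
  "maximal_nonunital S M \<longleftrightarrow> nonunital S M \<and> (\<forall>M'. nonunital S M' \<and> M \<subseteq> M' \<longrightarrow> M' = M)"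

lemma maximal_nonunital_exists:
  assumes "nonunital S m0"
  obtains M where "maximal_nonunital S M" "m0 \<subseteq> M"
proof -
  let ?\<A> = "{M. m0 \<subseteq> M \<and> nonunital S M}"
  have "\<exists>M\<in>?\<A>. \<forall>X\<in>?\<A>. M \<subseteq> X \<longrightarrow> X = M"
  proof (rule subset_Zorn_nonempty)
    show "?\<A> \<noteq> {}" using assms by blast
    fix \<C> assume ne: "\<C> \<noteq> {}" and ch: "subset.chain ?\<A> \<C>"
    have n: "nonunital S X" "m0 \<subseteq> X" if "X \<in> \<C>" for X
      using ch that by (auto simp: subset.chain_def)
    have two: "\<exists>Z\<in>\<C>. x \<in> Z \<and> y \<in> Z" if "x \<in> \<Union>\<C>" "y \<in> \<Union>\<C>" for x y
      using ch that unfolding subset.chain_def by blast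
    have "nonunital S (\<Union>\<C>)"
      unfolding nonunital_def
    proof (intro conjI ballI)
      show "0 \<in> \<Union>\<C>" using ne n(1) unfolding nonunital_def by blast
      show "1 \<notin> \<Union>\<C>" using n(1) unfolding nonunital_def by blast
      fix x y assume "x \<in> \<Union>\<C>" "y \<in> \<Union>\<C>"
      from two[OF this] obtain Z where "Z \<in> \<C>" "x \<in> Z" "y \<in> Z" by blast
      then show "x + y \<in> \<Union>\<C>" "x * y \<in> \<Union>\<C>" using n(1)[of Z] unfolding nonunital_def by blast+
    next
      fix s x assume "s \<in> S" "x \<in> \<Union>\<C>"
      then show "s * x \<in> \<Union>\<C>" using n(1) unfolding nonunital_def by blast
    qed
    then show "\<Union>\<C> \<in> ?\<A>" using ne n(2) by auto
  qed
  then obtain M where "M \<in> ?\<A>" "\<forall>X\<in>?\<A>. M \<subseteq> X \<longrightarrow> X = M" by blast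
  then show thesis using that[of M] unfolding maximal_nonunital_def by blast
qed

text \<open>Localisation at the elements \<open>1 - u\<close>: the fractions
  \<open>z / (1 - u)\<close> form a nonunital set that contains \<open>M\<close>, so by maximality
  nothing new arises.\<close>

lemma maximal_div:
  assumes S: "is_subring S" and M: "maximal_nonunital S M" and z: "z \<in> M" and u: "u \<in> M"
  shows "z / (1 - u) \<in> M"
proof -
  have n: "nonunital S M" using M unfolding maximal_nonunital_def by blast
  have cl: "0 \<in> M" "1 \<notin> M" "\<And>x y. x \<in> M \<Longrightarrow> y \<in> M \<Longrightarrow> x + y \<in> M" 
    "\<And>x y. x \<in> M \<Longrightarrow> y \<in> M \<Longrightarrow> x * y \<in> M" "\<And>x s. s \<in> S \<Longrightarrow> x \<in> M \<Longrightarrow> s * x \<in> M"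
    using n unfolding nonunital_def by blast+
  have mi: "\<And>x. x \<in> M \<Longrightarrow> - x \<in> M" using nonunital_minus[OF S n] .
  have di: "\<And>x y. x \<in> M \<Longrightarrow> y \<in> M \<Longrightarrow> x - y \<in> M" using cl(3) mi by (metis diff_conv_add_uminus)
  have nz: "\<And>x. x \<in> M \<Longrightarrow> 1 - x \<noteq> 0" using cl(2) by auto
  define M' where "M' = {z / (1 - u) | z u. z \<in> M \<and> u \<in> M}"
  have M'I: "a / (1 - b) \<in> M'" if "a \<in> M" "b \<in> M" for a b using that unfolding M'_def by blast
  have "nonunital S M'" unfolding nonunital_def
  proof (intro conjI ballI)
    show "0 \<in> M'" using M'I[of 0 0] cl(1) by simp
    show "1 \<notin> M'"
    proof
      assume "1 \<in> M'"
      then obtain a b where "a \<in> M" "b \<in> M" "1 = a / (1 - b)" unfolding M'_def by blast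
      then have "1 = a + b" using nz[of b] by (simp add: field_simps)
      then show False using cl(2,3) \<open>a \<in> M\<close> \<open>b \<in> M\<close> by metis
    qed
    fix x y assume "x \<in> M'" "y \<in> M'"
    then obtain a b c e where *: "a \<in> M" "b \<in> M" "x = a / (1 - b)" "c \<in> M" "e \<in> M" "y = c / (1 - e)"
      unfolding M'_def by blast
    have d: "(1 - b) * (1 - e) = 1 - (b + e - b * e)" by (simp add: algebra_simps)
    have "x + y = (a + c - a * e - c * b) / (1 - (b + e - b * e))"
      using nz[OF *(2)] nz[OF *(5)] unfolding *(3,6) d[symmetric] by (simp add: field_simps)
    also have "\<dots> \<in> M'" using * by (intro M'I di cl)
    finally show "x + y \<in> M'" .
    have "x * y = (a * c) / (1 - (b + e - b * e))" unfolding *(3,6) d[symmetric] by simp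
    also have "\<dots> \<in> M'" using * by (intro M'I di cl)
    finally show "x * y \<in> M'" .
  next
    fix s x assume "s \<in> S" "x \<in> M'"
    then obtain a b where *: "a \<in> M" "b \<in> M" "x = a / (1 - b)" unfolding M'_def by blast
    have "s * x = (s * a) / (1 - b)" using * by simp
    also have "\<dots> \<in> M'" using * \<open>s \<in> S\<close> by (intro M'I cl)
    finally show "s * x \<in> M'" .
  qed
  moreover have "M \<subseteq> M'" using M'I[of _ 0] cl(1) by auto
  ultimately have "M' = M" using M unfolding maximal_nonunital_def by blast
  then show ?thesis using M'I z u by blast
qed

text \<open>The relation at \<open>inverse x\<close>, multiplied by \<open>x ^ l\<close> and divided
  by \<open>1 - coeff q 0\<close>, expresses \<open>x ^ l\<close> by lower powers of
  \<open>x\<close> with coefficients in \<open>M\<close>. As \<open>l\<close> is at most the degree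
  of \<open>p\<close>, this removes the leading term of \<open>p\<close>.\<close>

lemma maximal_reduce_degree:
  assumes S: "is_subring S" and M: "maximal_nonunital S M" and x: "x \<noteq> 0"
    and p: "\<forall>i. coeff p i \<in> M" "poly p x = 1" and q: "\<forall>i. coeff q i \<in> M" "poly q (inverse x) = 1"
    and le: "degree q \<le> degree p"
  shows "\<exists>p'. (\<forall>i. coeff p' i \<in> M) \<and> poly p' x = 1 \<and> degree p' < degree p"
proof -
  have n: "nonunital S M" using M unfolding maximal_nonunital_def by blast
  have cl: "0 \<in> M" "1 \<notin> M" "\<And>x y. x \<in> M \<Longrightarrow> y \<in> M \<Longrightarrow> x + y \<in> M" 
    "\<And>x y. x \<in> M \<Longrightarrow> y \<in> M \<Longrightarrow> x * y \<in> M" 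
    using n unfolding nonunital_def by blast+
  have mi: "\<And>x. x \<in> M \<Longrightarrow> - x \<in> M" using nonunital_minus[OF S n] .
  define l n where "l = degree q" and "n = degree p"
  define u where "u = coeff q 0"
  have uM: "u \<in> M" using q unfolding u_def by blast
  have u1: "1 - u \<noteq> 0" using uM cl(2) by auto
  have l0: "l > 0"
  proof (rule ccontr)
    assume "\<not> l > 0"
    then have "q = [:u:]" unfolding l_def u_def by (metis degree_eq_zeroE coeff_pCons_0 gr0I)
    then have "u = 1" using q(2) by simp
    then show False using u1 by simp
  qed
  define r where "r = (\<Sum>i\<in>{1..l}. monom (coeff q i / (1 - u)) (l - i))"
  have "1 = (\<Sum>i\<le>l. coeff q i * inverse x ^ i)" using q(2) unfolding poly_altdef l_def by simp
  also have "\<dots> = u + (\<Sum>i\<in>{1..l}. coeff q i * inverse x ^ i)"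
    unfolding u_def by (simp add: atMost_atLeast0 sum.atLeast_Suc_atMost)
  finally have "1 - u = (\<Sum>i\<in>{1..l}. coeff q i * inverse x ^ i)" by (simp add: algebra_simps)
  then have "x ^ l * (1 - u) = (\<Sum>i\<in>{1..l}. coeff q i * x ^ (l - i))"
    using x by (simp add: sum_distrib_left power_diff inverse_eq_divide power_divide mult.commute mult.left_commute)
  then have rx: "poly r x = x ^ l"
    unfolding r_def using u1 by (simp add: poly_sum poly_monom flip: sum_divide_distrib) (simp add: field_simps)
  have rM: "coeff r i \<in> M" for i
    unfolding r_def coeff_sum
    by (intro nonunital_sum[OF n]) (use q(1) cl(1) uM in \<open>auto intro: maximal_div[OF S M]\<close>)
  have dr: "degree r < l" unfolding r_def
    by (rule degree_sum_less) (use l0 in \<open>auto intro: le_less_trans[OF degree_monom_le]\<close>)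
  define a where "a = coeff p n"
  have aM: "a \<in> M" using p unfolding a_def by blast
  define p' where "p' = (p - monom a n) + smult a (monom 1 (n - l) * r)"
  have "poly p' x = 1 - a * x ^ n + a * (x ^ (n - l) * x ^ l)"
    unfolding p'_def using p(2) rx by (simp add: poly_monom)
  also have "\<dots> = 1" using le unfolding l_def n_def by (simp flip: power_add)
  finally have 1: "poly p' x = 1" .
  have 2: "coeff p' i \<in> M" for i
  proof -
    have "coeff (monom 1 (n - l) * r) i \<in> M" using rM cl(1) by (auto simp: coeff_monom_mult)
    then have "a * coeff (monom 1 (n - l) * r) i \<in> M" using aM cl(4) by blast
    moreover have "coeff (p - monom a n) i \<in> M" unfolding a_def using p(1) cl(1) by auto
    ultimately show ?thesis unfolding p'_def using cl(3) by simp
  qed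
  have n0: "0 < n" using l0 le unfolding l_def n_def by simp
  have "degree (p - monom a n) < n"
  proof (rule coeff_0_degree_minus_1[THEN le_less_trans])
    show "coeff (p - monom a n) n = 0" unfolding a_def by simp
    show "degree (p - monom a n) \<le> n" unfolding n_def by (intro degree_diff_le degree_monom_le order.refl)
    show "n - 1 < n" using n0 by simp
  qed
  moreover have "degree (smult a (monom 1 (n - l) * r)) < n"
  proof -
    have "degree (smult a (monom 1 (n - l) * r)) \<le> degree (monom 1 (n - l) * r)" by (rule degree_smult_le)
    also have "\<dots> \<le> degree (monom (1::complex) (n - l)) + degree r" by (rule degree_mult_le)
    also have "\<dots> < n" using dr le degree_monom_le[of "1::complex" "n - l"] unfolding l_def n_def by linarith
    finally show ?thesis .
  qed
  ultimately have "degree p' < n" unfolding p'_def by (rule degree_add_less)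
  then show ?thesis using 1 2 unfolding n_def by blast
qed

text \<open>Two such relations could be shortened without end, always the one of larger
  degree.\<close>

lemma maximal_not_both:
  assumes S: "is_subring S" and M: "maximal_nonunital S M" and x: "x \<noteq> 0"
  shows "1 \<notin> pmod M x \<or> 1 \<notin> pmod M (inverse x)"
proof -
  have "False" if "x \<noteq> 0" "\<forall>i. coeff p i \<in> M" "poly p x = 1" "\<forall>i. coeff q i \<in> M" "poly q (inverse x) = 1"
    for x p q
    using that
  proof (induct "degree p + degree q" arbitrary: x p q rule: less_induct)
    case less
    show False
    proof (cases "degree q \<le> degree p")
      case True
      then obtain p' where "\<forall>i. coeff p' i \<in> M" "poly p' x = 1" "degree p' < degree p"
        using maximal_reduce_degree[OF S M less(2-6)] by blast
      then show False using less(1)[of p' q x] less(2-6) by auto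
    next
      case False
      then have "degree p \<le> degree q" by simp
      then obtain q' where "\<forall>i. coeff q' i \<in> M" "poly q' (inverse x) = 1" "degree q' < degree q"
        using maximal_reduce_degree[OF S M, of "inverse x" q p] less(2-6) by auto
      then show False using less(1)[of p q' x] less(2-6) by auto
    qed
  qed
  then show ?thesis using x unfolding pmod_def by force
qed

lemma place_maximal:
  assumes S: "is_subring S" and M: "maximal_nonunital S M"
  shows "place {a. \<forall>x\<in>M. a * x \<in> M} M" and "S \<subseteq> {a. \<forall>x\<in>M. a * x \<in> M}"
proof -
  let ?A = "{a. \<forall>x\<in>M. a * x \<in> M}"
  have n: "nonunital S M" using M unfolding maximal_nonunital_def by blast
  have cl: "0 \<in> M" "1 \<notin> M" "\<And>x y. x \<in> M \<Longrightarrow> y \<in> M \<Longrightarrow> x + y \<in> M" 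
    "\<And>x y. x \<in> M \<Longrightarrow> y \<in> M \<Longrightarrow> x * y \<in> M" "\<And>x s. s \<in> S \<Longrightarrow> x \<in> M \<Longrightarrow> s * x \<in> M"
    using n unfolding nonunital_def by blast+
  have mi: "\<And>x. x \<in> M \<Longrightarrow> - x \<in> M" using nonunital_minus[OF S n] .
  have di: "\<And>x y. x \<in> M \<Longrightarrow> y \<in> M \<Longrightarrow> x - y \<in> M" using cl(3) mi by (metis diff_conv_add_uminus)
  show "S \<subseteq> ?A" using cl(5) by blast
  have key: "x \<in> ?A" if "1 \<notin> pmod M x" for x
  proof -
    have eq: "pmod M x = M"
      using nonunital_pmod[OF S n that] pmod_superset[OF n] M unfolding maximal_nonunital_def by blast
    have "x * y \<in> M" if "y \<in> M" for y
    proof -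
      have "poly [:0, y:] x \<in> pmod M x" unfolding pmod_def using that cl(1)
        by (intro CollectI exI[of _ "[:0, y:]"]) (auto simp: coeff_pCons split: nat.split)
      then show ?thesis using eq by simp
    qed
    then show ?thesis by blast
  qed
  show "place ?A M"
  proof (unfold_locales)
    show "1 \<in> ?A" by simp
    show "x \<in> ?A \<Longrightarrow> y \<in> ?A \<Longrightarrow> x - y \<in> ?A" for x y using di by (auto simp: left_diff_distrib)
    show "x \<in> ?A \<Longrightarrow> y \<in> ?A \<Longrightarrow> x * y \<in> ?A" for x y by (auto simp: mult.assoc)
    show "x \<in> M \<Longrightarrow> x \<in> ?A" for x using cl by blast
    show "0 \<in> M" "1 \<notin> M" by fact+
    show "x \<in> M \<Longrightarrow> y \<in> M \<Longrightarrow> x + y \<in> M" for x y by (rule cl)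
    show "a \<in> ?A \<Longrightarrow> x \<in> M \<Longrightarrow> a * x \<in> M" for a x by blast
    show "x \<in> ?A \<or> inverse x \<in> ?A" for x
    proof (cases "x = 0")
      case True then show ?thesis using cl(1) by simp
    next
      case False then show ?thesis using maximal_not_both[OF S M False] key by blast
    qed
  next
    fix a assume a: "a \<in> ?A" "a \<notin> M"
    \<comment> \<open>The ideal of the multiplier ring generated by \<open>a\<close> and
      \<open>M\<close>. If it missed 1 it would be a nonunital set larger than \<open>M\<close>; so
      it contains 1, and \<open>a\<close> is invertible modulo \<open>M\<close>.\<close>
    define M' where "M' = {a * b + u | b u. b \<in> ?A \<and> u \<in> M}"
    have M'I: "a * b + u \<in> M'" if "\<And>x. x \<in> M \<Longrightarrow> b * x \<in> M" "u \<in> M" for b u using that unfolding M'_def by blast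
    have a1: "a \<in> M'" using M'I[of 1 0] cl(1) by simp
    have a2: "M \<subseteq> M'" using M'I[of 0] cl(1) by auto
    have aM: "\<And>x. x \<in> M \<Longrightarrow> a * x \<in> M" using a by blast
    have "1 \<in> M'"
    proof (rule ccontr)
      assume "1 \<notin> M'"
      have "nonunital S M'" unfolding nonunital_def
      proof (intro conjI ballI)
        show "0 \<in> M'" using a2 cl(1) by blast
        show "1 \<notin> M'" by fact
        fix x y assume "x \<in> M'" "y \<in> M'"
        then obtain b u c w where *: "x = a * b + u" "b \<in> ?A" "u \<in> M" "y = a * c + w" "c \<in> ?A" "w \<in> M"
          unfolding M'_def by blast
        have bM: "\<And>x. x \<in> M \<Longrightarrow> b * x \<in> M" and cM: "\<And>x. x \<in> M \<Longrightarrow> c * x \<in> M" using * by auto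
        have "x + y = a * (b + c) + (u + w)" using * by (simp add: algebra_simps)
        also have "\<dots> \<in> M'" using bM cM * cl by (intro M'I) (auto simp: distrib_right)
        finally show "x + y \<in> M'" .
        have "x * y = a * (a * b * c) + (a * (b * w) + a * (c * u) + u * w)" using * by (simp add: algebra_simps)
        also have "\<dots> \<in> M'"
        proof (rule M'I)
          show "a * b * c * x \<in> M" if "x \<in> M" for x using aM[OF bM[OF cM[OF that]]] by (simp add: mult.assoc)
          show "a * (b * w) + a * (c * u) + u * w \<in> M" using * by (intro cl aM bM cM)
        qed
        finally show "x * y \<in> M'" .
      next
        fix s x assume s: "s \<in> S" "x \<in> M'"
        then obtain b u where *: "x = a * b + u" "b \<in> ?A" "u \<in> M" unfolding M'_def by blast
        have "s * x = a * (s * b) + s * u" using * by (simp add: algebra_simps)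
        also have "\<dots> \<in> M'" using * s cl(5) by (intro M'I) (auto simp: mult.assoc)
        finally show "s * x \<in> M'" .
      qed
      then have "M' = M" using M a2 unfolding maximal_nonunital_def by blast
      then show False using a1 a(2) by blast
    qed
    then obtain b u where bu: "1 = a * b + u" "b \<in> ?A" "u \<in> M" unfolding M'_def by blast
    have "a \<noteq> 0" using a(2) cl(1) by blast
    have "1 - u \<noteq> 0" using bu cl(2) by auto
    have ab: "a * b = 1 - u" using bu(1) by (simp add: algebra_simps)
    then have inv: "inverse a = b / (1 - u)" using \<open>a \<noteq> 0\<close> \<open>1 - u \<noteq> 0\<close> by (simp add: field_simps)
    have "inverse a * z \<in> M" if "z \<in> M" for z
    proof -
      have "b * (z / (1 - u)) \<in> M" using bu maximal_div[OF S M that bu(3)] by blast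
      then show ?thesis unfolding inv by simp
    qed
    then show "inverse a \<in> ?A" by blast
  qed
qed


lemma place_exists:
  assumes "is_subring S" "nonunital S m0"
  shows "\<exists>A m. place A m \<and> S \<subseteq> A \<and> m0 \<subseteq> m"
proof -
  obtain M where M: "maximal_nonunital S M" "m0 \<subseteq> M" using maximal_nonunital_exists[OF assms(2)] .
  show ?thesis using place_maximal[OF assms(1) M(1)] M(2) by blast
qed

section \<open>Elements integral over a place\<close>

context place
begin

lemma inverse_in_m: "x \<notin> A \<Longrightarrow> inverse x \<in> m"
  using total[of x] unit[of "inverse x"] by auto

text \<open>Multiplying the equation by \<open>a ^ (n - 1)\<close> makes \<open>z = a * x\<close> a
  root of a monic polynomial over \<open>A\<close>. If \<open>z\<close> were outside
  \<open>A\<close>, dividing by \<open>z ^ n\<close> would write 1 as a sum of elements of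
  \<open>m\<close>.\<close>

lemma lead_coeff_mult_root:
  assumes p: "p \<noteq> 0" "\<And>i. coeff p i \<in> A" "poly p x = 0"
  shows "lead_coeff p * x \<in> A"
proof (rule ccontr)
  define a n z where "a = lead_coeff p" and "n = degree p" and "z = a * x"
  assume "lead_coeff p * x \<notin> A"
  then have z: "z \<notin> A" unfolding z_def a_def .
  then have ym: "inverse z \<in> m" by (rule inverse_in_m)
  have z0: "z \<noteq> 0" using z by auto
  have n: "n > 0" using p(1,3) unfolding n_def by (metis degree_eq_zeroE gr0I mult_zero_right pCons_0_0 poly_0 poly_pCons add.right_neutral)
  have aA: "a \<in> A" unfolding a_def using p(2) by blast
  have "0 = a ^ (n - 1) * (\<Sum>i\<le>n. coeff p i * x ^ i)"
    using p(3) unfolding poly_altdef n_def by simp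
  also have "{..n} = insert n {..<n}" by auto
  also have "a ^ (n - 1) * (\<Sum>i\<in>insert n {..<n}. coeff p i * x ^ i) = 
     a ^ (n - 1) * a * x ^ n + (\<Sum>i<n. coeff p i * (a ^ (n - 1) * x ^ i))"
    unfolding a_def n_def by (simp add: algebra_simps sum_distrib_left)
  also have "a ^ (n - 1) * a * x ^ n = z ^ n"
    using n unfolding z_def by (metis Suc_diff_1 mult.commute power_Suc power_mult_distrib)
  also have "(\<Sum>i<n. coeff p i * (a ^ (n - 1) * x ^ i)) = (\<Sum>i<n. coeff p i * a ^ (n - 1 - i) * z ^ i)"
  proof (rule sum.cong)
    fix i assume "i \<in> {..<n}"
    then have "a ^ (n - 1) = a ^ (n - 1 - i) * a ^ i" by (simp flip: power_add)
    then show "coeff p i * (a ^ (n - 1) * x ^ i) = coeff p i * a ^ (n - 1 - i) * z ^ i"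
      unfolding z_def by (simp add: power_mult_distrib)
  qed simp
  finally have "z ^ n = - (\<Sum>i<n. coeff p i * a ^ (n - 1 - i) * z ^ i)" by (simp add: eq_neg_iff_add_eq_0)
  then have "inverse z ^ n * z ^ n = - (\<Sum>i<n. coeff p i * a ^ (n - 1 - i) * (inverse z ^ n * z ^ i))"
    by (simp add: sum_distrib_left algebra_simps)
  moreover have "inverse z ^ n * z ^ n = 1" using z0 by (simp flip: power_mult_distrib)
  moreover have "coeff p i * a ^ (n - 1 - i) * (inverse z ^ n * z ^ i) \<in> m" if "i < n" for i
  proof -
    have "inverse z ^ n = inverse z ^ (n - i) * inverse z ^ i" using that by (simp flip: power_add)
    then have "inverse z ^ n * z ^ i = inverse z ^ (n - i)" using z0 by (simp add: field_simps)
    then show ?thesis using that ym aA p(2) by (auto intro!: m_mult mult power m_power)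
  qed
  then have "- (\<Sum>i<n. coeff p i * a ^ (n - 1 - i) * (inverse z ^ n * z ^ i)) \<in> m"
    by (intro m_minus m_sum) simp
  ultimately have "1 \<in> m" by simp
  then show False using one_notin by simp
qed

lemma Ints_subset: "x \<in> \<int> \<Longrightarrow> x \<in> A" by (auto elim: Ints_cases)

lemma algebraic_int_in: "algebraic_int x \<Longrightarrow> x \<in> A"
proof -
  assume "algebraic_int x"
  then obtain p where "lead_coeff p = 1" "\<forall>i. coeff p i \<in> \<int>" "poly p x = 0" by (auto simp: algebraic_int.simps)
  moreover from this have "p \<noteq> 0" by auto
  ultimately show ?thesis using lead_coeff_mult_root[of p x] Ints_subset by auto
qed

end

section \<open>Algebraic integers and algebraic numbers\<close>

lemma is_subring_Ints: "is_subring \<int>" unfolding is_subring_def by auto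

text \<open>If \<open>b\<close> is not integral, then 1 is not an integer polynomial without
  constant term in \<open>inverse b\<close>, because reversing such a relation gives a monic
  equation for \<open>b\<close>. Some place then has \<open>inverse b\<close> in its maximal ideal,
  which excludes \<open>b\<close>.\<close>

lemma in_all_places_imp_algebraic_int:
  assumes "\<And>A m. place A m \<Longrightarrow> b \<in> A"
  shows "algebraic_int b"
proof (rule ccontr)
  assume na: "\<not> algebraic_int b"
  then have b0: "b \<noteq> 0" by auto
  define y where "y = inverse b"
  define m0 where "m0 = {poly p y | p. (\<forall>i. coeff p i \<in> \<int>) \<and> coeff p 0 = 0}"
  have m0I: "poly p y \<in> m0" if "\<And>i. coeff p i \<in> \<int>" "coeff p 0 = 0" for p using that unfolding m0_def by blast
  have "nonunital \<int> m0" unfolding nonunital_def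
  proof (intro conjI ballI)
    show "0 \<in> m0" using m0I[of 0] by simp
    show "1 \<notin> m0"
    proof
      assume "1 \<in> m0"
      then obtain p where p: "\<And>i. coeff p i \<in> \<int>" "coeff p 0 = 0" "poly p y = 1" unfolding m0_def by force
      have "poly (reflect_poly (1 - p)) b = b ^ degree (1 - p) * poly (1 - p) (inverse b)"
        using b0 by (simp add: poly_reflect_poly_nz)
      then have 1: "poly (reflect_poly (1 - p)) b = 0" using p(3) unfolding y_def by simp
      have "coeff (1 - p) i \<in> \<int>" for i using p(1) by (auto simp: coeff_1)
      then have 2: "coeff (reflect_poly (1 - p)) i \<in> \<int>" for i by (simp add: coeff_reflect_poly)
      have "coeff (1 - p) 0 = 1" using p(2) by simp
      then have 3: "lead_coeff (reflect_poly (1 - p)) = 1" by (metis coeff_0_reflect_poly reflect_poly_reflect_poly zero_neq_one)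
      show False using na algebraic_int.intros[OF 3 _ 1] 2 by blast
    qed
    fix u v assume "u \<in> m0" "v \<in> m0"
    then obtain p q where p: "u = poly p y" "\<And>i. coeff p i \<in> \<int>" "coeff p 0 = 0" 
      and q: "v = poly q y" "\<And>i. coeff q i \<in> \<int>" "coeff q 0 = 0"
      unfolding m0_def by blast
    show "u + v \<in> m0" using m0I[of "p + q"] p q by auto
    have "coeff (p * q) i \<in> \<int>" for i unfolding coeff_mult by (intro Ints_sum Ints_mult p(2) q(2))
    moreover have "coeff (p * q) 0 = 0" using p by (simp add: coeff_mult_0)
    ultimately have "poly (p * q) y \<in> m0" by (rule m0I)
    then show "u * v \<in> m0" unfolding p(1) q(1) poly_mult .
  next
    fix s u :: complex assume s: "s \<in> \<int>" "u \<in> m0"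
    then obtain p where p: "u = poly p y" "\<And>i. coeff p i \<in> \<int>" "coeff p 0 = 0" unfolding m0_def by blast
    show "s * u \<in> m0" using m0I[of "smult s p"] p s by auto
  qed
  then obtain A m where pl: "place A m" "m0 \<subseteq> m" using place_exists[OF is_subring_Ints] by blast
  interpret place A m by fact
  have "poly [:0, 1:] y \<in> m0" by (rule m0I) (auto simp: coeff_pCons split: nat.split)
  then have "y \<in> m" using pl by auto
  moreover have "b \<in> A" using assms pl(1) by blast
  ultimately have "b * y \<in> m" by (rule m_mult[rotated])
  then show False using b0 one_notin unfolding y_def by simp
qed

lemma algebraic_int_add:
  fixes x y :: complex
  assumes "algebraic_int x" "algebraic_int y"
  shows "algebraic_int (x + y)"
proof (rule in_all_places_imp_algebraic_int)
  fix A m assume "place A m"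
  then interpret place A m .
  show "x + y \<in> A" by (intro add algebraic_int_in assms)
qed

lemma algebraic_int_mult:
  fixes x y :: complex
  assumes "algebraic_int x" "algebraic_int y"
  shows "algebraic_int (x * y)"
proof (rule in_all_places_imp_algebraic_int)
  fix A m assume "place A m"
  then interpret place A m .
  show "x * y \<in> A" by (intro mult algebraic_int_in assms)
qed

lemma algebraic_int_lead_coeff_mult_root:
  assumes "p \<noteq> 0" "\<And>i. algebraic_int (coeff p i)" "poly p x = 0"
  shows "algebraic_int (lead_coeff p * x :: complex)"
proof (rule in_all_places_imp_algebraic_int)
  fix A m assume "place A m"
  then interpret place A m .
  have c: "coeff p i \<in> A" for i by (rule algebraic_int_in) (rule assms(2))
  show "lead_coeff p * x \<in> A"
    using assms(1) c assms(3) by (rule lead_coeff_mult_root)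
qed

lemma algebraic_denominator:
  assumes "algebraic (x :: complex)"
  shows "\<exists>s>0::nat. algebraic_int (of_nat s * x)"
proof -
  obtain p where p: "\<forall>i. coeff p i \<in> \<int>" "p \<noteq> 0" "poly p x = 0" using assms unfolding algebraic_def by (elim exE conjE) (rule that)
  have 1: "algebraic_int (lead_coeff p * x)" 
    by (rule algebraic_int_lead_coeff_mult_root[OF p(2) int_imp_algebraic_int[OF p(1)[rule_format]] p(3)])
  obtain c where c: "lead_coeff p = of_int c" using p(1) by (metis Ints_cases)
  have c0: "c \<noteq> 0" using c p(2) by auto
  have "algebraic_int (of_int (sgn c) * (lead_coeff p * x))" 
    using algebraic_int_mult[OF algebraic_int_of_int 1] by simp
  moreover have "of_int (sgn c) * (lead_coeff p * x) = of_nat (nat \<bar>c\<bar>) * x"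
  proof -
    have "of_int (sgn c) * of_int c = (of_nat (nat \<bar>c\<bar>) :: complex)"
      by (simp add: sgn_if)
    then show ?thesis unfolding c by (metis mult.assoc)
  qed
  ultimately show ?thesis using c0 by (intro exI[of _ "nat \<bar>c\<bar>"]) auto
qed

lemma common_denominator:
  assumes "finite Z" "\<And>x. x \<in> Z \<Longrightarrow> algebraic (x :: complex)"
  shows "\<exists>s>0::nat. \<forall>x\<in>Z. algebraic_int (of_nat s * x)"
  using assms
proof (induct Z rule: finite_induct)
  case empty then show ?case by (intro exI[of _ 1]) auto
next
  case (insert x Z)
  then obtain s where s: "s > 0" "\<forall>x\<in>Z. algebraic_int (of_nat s * x)" by auto
  obtain t where t: "t > 0" "algebraic_int (of_nat t * x)" using algebraic_denominator insert by blast
  have "algebraic_int (of_nat s * (of_nat t * x))" by (intro algebraic_int_mult t) auto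
  moreover have "algebraic_int (of_nat t * (of_nat s * z))" if "z \<in> Z" for z
    using algebraic_int_mult[of "of_nat t" "of_nat s * z"] that s by simp
  moreover have "of_nat t * (of_nat s * z) = of_nat (s * t) * (z::complex)" for z
    by (simp add: mult_ac)
  moreover have "of_nat s * (of_nat t * z) = of_nat (s * t) * (z::complex)" for z
    by (simp add: mult_ac)
  ultimately have "algebraic_int (of_nat (s * t) * z)" if "z \<in> insert x Z" for z
    using that by (metis insertE)
  then show ?case using s(1) t(1) by (intro exI[of _ "s * t"]) auto
qed

lemma algebraic_of_nat_mult_cancel:
  assumes "s > 0" "algebraic (of_nat s * x :: complex)"
  shows "algebraic x"
proof -
  obtain p where p: "\<forall>i. coeff p i \<in> \<int>" "p \<noteq> 0" "poly p (of_nat s * x) = 0" using assms(2) unfolding algebraic_def by (elim exE conjE) (rule that)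
  let ?q = "p \<circ>\<^sub>p [:0, of_nat s:]"
  have "coeff ?q i \<in> \<int>" for i using p(1) by (auto simp: coeff_pcompose_linear)
  moreover have "?q \<noteq> 0" using p(2) assms(1) by (simp add: pcompose_eq_0_iff)
  moreover have "poly ?q x = 0" using p(3) by (simp add: poly_pcompose mult.commute)
  ultimately show ?thesis by (rule algebraicI)
qed

lemma algebraic_add [intro]:
  assumes "algebraic x" "algebraic y" shows "algebraic (x + y :: complex)"
proof -
  obtain s where s: "s > 0" "\<forall>z\<in>{x,y}. algebraic_int (of_nat s * z)" using common_denominator[of "{x,y}"] assms by auto
  then have "algebraic_int (of_nat s * x + of_nat s * y)" using algebraic_int_add by simp
  then have "algebraic (of_nat s * (x + y))" by (auto simp: distrib_left)
  then show ?thesis using s(1) algebraic_of_nat_mult_cancel[of s "x + y"] by simp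
qed

lemma algebraic_mult [intro]:
  assumes "algebraic x" "algebraic y" shows "algebraic (x * y :: complex)"
proof -
  obtain s where s: "s > 0" "\<forall>z\<in>{x,y}. algebraic_int (of_nat s * z)" using common_denominator[of "{x,y}"] assms by auto
  then have "algebraic_int ((of_nat s * x) * (of_nat s * y))" using algebraic_int_mult by simp
  moreover have "(of_nat s * x) * (of_nat s * y) = of_nat (s * s) * (x * y)" by simp
  ultimately have "algebraic (of_nat (s * s) * (x * y))" using algebraic_int_imp_algebraic by metis
  then show ?thesis using s(1) algebraic_of_nat_mult_cancel[of "s * s" "x * y"] by simp
qed

lemma algebraic_diff [intro]: "algebraic x \<Longrightarrow> algebraic y \<Longrightarrow> algebraic (x - y :: complex)"
  using algebraic_add[of x "- y"] by simp
lemma algebraic_divide [intro]: "algebraic x \<Longrightarrow> algebraic y \<Longrightarrow> algebraic (x / y :: complex)"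
  by (auto simp: divide_inverse)
lemma algebraic_power [intro]: "algebraic x \<Longrightarrow> algebraic (x ^ k :: complex)"
  by (induct k) auto
lemma algebraic_sum [intro]: "(\<And>i. i \<in> I \<Longrightarrow> algebraic (f i :: complex)) \<Longrightarrow> algebraic (sum f I)"
  by (induct I rule: infinite_finite_induct) auto
lemma algebraic_prod [intro]: "(\<And>i. i \<in> I \<Longrightarrow> algebraic (f i :: complex)) \<Longrightarrow> algebraic (prod f I)"
  by (induct I rule: infinite_finite_induct) auto

lemma algebraic_coeffs_root:
  assumes p: "p \<noteq> 0" "\<And>i. algebraic (coeff p i)" "poly p x = 0"
  shows "algebraic (x :: complex)"
proof -
  obtain s :: nat where s: "s > 0" "\<forall>c\<in>coeff p ` {..degree p}. algebraic_int (of_nat s * c)"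
    using common_denominator[of "coeff p ` {..degree p}"] p(2) by auto
  let ?q = "smult (of_nat s) p"
  have "algebraic_int (coeff ?q i)" for i
    using s(2) by (cases "i \<le> degree p") (auto simp: coeff_eq_0)
  then have "algebraic_int (lead_coeff ?q * x)"
    using p s by (intro algebraic_int_lead_coeff_mult_root) auto
  then have "algebraic (lead_coeff ?q * x)" by auto
  moreover have "algebraic (lead_coeff ?q)" using p(2) by auto
  ultimately have "algebraic ((lead_coeff ?q * x) / lead_coeff ?q)" by blast
  then show ?thesis using p(1) s(1) by simp
qed

section \<open>Places over large primes\<close>

lemma place_over_prime:
  assumes "prime (p :: nat)"
  shows "\<exists>A m. place A m \<and> of_nat p \<in> m"
proof -
  let ?m = "{of_nat p * of_int k | k. True} :: complex set"
  have I: "of_nat p * of_int k \<in> ?m" for k by blast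
  have "nonunital \<int> ?m" unfolding nonunital_def
  proof (intro conjI ballI)
    show "0 \<in> ?m" using I[of 0] by simp
    show "1 \<notin> ?m"
    proof
      assume "1 \<in> ?m"
      then obtain k where "(1::complex) = of_nat p * of_int k" by blast
      then have "(1::complex) = of_int (int p * k)" by simp
      then have "1 = int p * k" by (metis of_int_1 of_int_eq_iff)
      then have "int p dvd 1" by (metis dvd_triv_left)
      then show False using assms by auto
    qed
    fix x y assume "x \<in> ?m" "y \<in> ?m"
    then obtain k l where "x = of_nat p * of_int k" "y = of_nat p * of_int l" by blast
    then show "x + y \<in> ?m" "x * y \<in> ?m" using I[of "k + l"] I[of "k * (int p * l)"] by (auto simp: algebra_simps)
  next
    fix s x :: complex assume "s \<in> \<int>" "x \<in> ?m"
    then obtain l where l: "x = of_nat p * of_int l" by blast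
    obtain k where k: "s = of_int k" using \<open>s \<in> \<int>\<close> by (rule Ints_cases)
    have "s * x = of_nat p * of_int (k * l)" unfolding l k by simp
    then show "s * x \<in> ?m" using I by metis
  qed
  then obtain A m where "place A m" "?m \<subseteq> m" using place_exists[OF is_subring_Ints] by blast
  moreover have "of_nat p \<in> ?m" using I[of 1] by simp
  ultimately show ?thesis by blast
qed

lemma (in place) prime_not_dvd_unit:
  assumes "prime (p :: nat)" "of_nat p \<in> m" "\<not> p dvd s"
  shows "of_nat s \<in> A - m"
proof -
  have "coprime (int s) (int p)" using assms prime_imp_coprime[of p s] by (simp add: coprime_commute)
  then obtain u v where "u * int s + v * int p = 1" 
    by (metis bezout_int coprime_imp_gcd_eq_1)
  then have "(of_int (u * int s + v * int p) :: complex) = 1" by simp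
  then have *: "of_int u * of_nat s + of_int v * of_nat p = (1::complex)" by simp
  have "of_nat s \<notin> m" using * one_notin assms(2) m_mult[OF of_int] m_add by metis
  then show ?thesis by simp
qed

text \<open>Take \<open>s\<close> to clear the denominators of the members of \<open>Z\<close> and
  of their inverses. Where \<open>s\<close> is a unit both lie in \<open>A\<close>, so the nonzero
  members are units.\<close>

lemma unit_at_almost_all_places:
  assumes "finite Z" "\<And>x. x \<in> Z \<Longrightarrow> algebraic (x :: complex)"
  shows "\<exists>s>0::nat. \<forall>A m. place A m \<and> of_nat s \<notin> m \<longrightarrow> (\<forall>x\<in>Z. x \<in> A \<and> (x \<noteq> 0 \<longrightarrow> x \<notin> m))"
proof -
  have "\<exists>s>0::nat. \<forall>x\<in>Z \<union> inverse ` Z. algebraic_int (of_nat s * x)"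
    using assms by (intro common_denominator) auto
  then obtain s :: nat where s: "s > 0" "\<forall>x\<in>Z \<union> inverse ` Z. algebraic_int (of_nat s * x)" by blast
  show ?thesis
  proof (intro exI[of _ s] conjI allI impI ballI; (elim conjE)?)
    show "s > 0" by fact
    fix A m x assume pl: "place A m" "of_nat s \<notin> m" "x \<in> Z"
    interpret place A m by fact
    have u: "inverse (of_nat s) \<in> A" using unit pl(2) by simp
    have 1: "y \<in> A" if "y \<in> Z \<union> inverse ` Z" for y
    proof -
      have "of_nat s * y \<in> A" using algebraic_int_in s(2) that by blast
      then have "inverse (of_nat s) * (of_nat s * y) \<in> A" using u mult by blast
      then show ?thesis using s(1) by (simp add: field_simps)
    qed
    show "x \<in> A" using 1 pl(3) by blast
    assume "x \<noteq> 0"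
    show "x \<notin> m"
    proof
      assume "x \<in> m"
      then have "inverse x * x \<in> m" using 1[of "inverse x"] pl(3) m_mult by blast
      then show False using one_notin \<open>x \<noteq> 0\<close> by simp
    qed
  qed
qed

lemma exists_good_place:
  assumes "finite Z" "\<And>x. x \<in> Z \<Longrightarrow> algebraic (x :: complex)"
  obtains A m p where "place A m" "prime (p :: nat)" "of_nat p \<in> m"
    "\<And>x. x \<in> Z \<Longrightarrow> x \<in> A" "\<And>x. x \<in> Z \<Longrightarrow> x \<noteq> 0 \<Longrightarrow> x \<in> A - m"
proof -
  obtain s where s: "s > (0::nat)" 
    "\<And>A m x. place A m \<Longrightarrow> of_nat s \<notin> m \<Longrightarrow> x \<in> Z \<Longrightarrow> x \<in> A \<and> (x \<noteq> 0 \<longrightarrow> x \<notin> m)"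
    using unit_at_almost_all_places[OF assms] by meson
  obtain p :: nat where p: "prime p" "p > s" using bigger_prime by blast
  obtain A m where pl: "place A m" "of_nat p \<in> m" using place_over_prime[OF p(1)] by blast
  have "\<not> p dvd s" using p s(1) by (auto dest: dvd_imp_le)
  then have "of_nat s \<notin> m" using place.prime_not_dvd_unit[OF pl(1) p(1) pl(2)] by blast
  then show thesis using that[OF pl(1) p(1) pl(2)] s(2)[OF pl(1)] by blast
qed

text \<open>Divisibility is total in a valuation ring, so among finitely many entries one divides
  all others.\<close>

lemma (in place) exists_max_entry:
  assumes "finite I" "\<exists>i\<in>I. f i \<noteq> 0"
  shows "\<exists>i\<in>I. f i \<noteq> 0 \<and> (\<forall>j\<in>I. f j / f i \<in> A)"
  using assms
proof (induct I rule: finite_induct)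
  case (insert x F)
  show ?case
  proof (cases "\<exists>i\<in>F. f i \<noteq> 0")
    case True
    then obtain i where i: "i \<in> F" "f i \<noteq> 0" "\<forall>j\<in>F. f j / f i \<in> A" using insert by blast
    show ?thesis
    proof (cases "f x / f i \<in> A")
      case True then show ?thesis using i by blast
    next
      case False
      then have "f i / f x \<in> A" using total[of "f x / f i"] by simp
      have "f x \<noteq> 0" using False by auto
      have "f j / f x \<in> A" if "j \<in> F" for j
        using mult[of "f j / f i" "f i / f x"] i that \<open>f i / f x \<in> A\<close> by auto
      then show ?thesis using \<open>f x \<noteq> 0\<close> by (intro bexI[of _ x]) auto
    qed
  next
    case False
    then show ?thesis using insert(4) by (intro bexI[of _ x]) auto
  qed
qed simp

text \<open>Extend the zero ideal of the field of algebraic numbers to a maximal nonunital set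
  \<open>M\<close>. For a ring element \<open>a\<close> the algebraic polynomials with value in
  \<open>M\<close> at \<open>a\<close> have a common root \<open>c\<close>; were
  \<open>a - c\<close> not in \<open>M\<close>, it could be adjoined to \<open>M\<close>.\<close>

lemma place_over_algebraic:
  shows "\<exists>A m. place A m \<and> {x. algebraic x} \<subseteq> A \<and> (\<forall>a\<in>A. \<exists>c. algebraic c \<and> a - c \<in> m)"
proof -
  let ?S = "{x :: complex. algebraic x}"
  have S: "is_subring ?S" unfolding is_subring_def by auto
  have "nonunital ?S {0}" unfolding nonunital_def by auto
  then obtain M where M: "maximal_nonunital ?S M" using maximal_nonunital_exists by blast
  let ?A = "{a. \<forall>x\<in>M. a * x \<in> M}"
  have pl: "place ?A M" "?S \<subseteq> ?A" using place_maximal[OF S M] by auto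
  interpret place ?A M by fact
  have "\<exists>c. algebraic c \<and> a - c \<in> M" if a: "a \<in> ?A" for a
  proof -
    define J where "J = {q. (\<forall>i. algebraic (coeff q i)) \<and> poly q a \<in> M}"
    have "\<exists>c. algebraic c \<and> (\<forall>q\<in>J. poly q c = 0)"
    proof (cases "\<exists>q\<in>J. q \<noteq> 0")
      case False
      then show ?thesis by (intro exI[of _ 0]) auto
    next
      case True
      then obtain q where q: "q \<in> J" "q \<noteq> 0" and qmin: "\<And>r. r \<in> J \<Longrightarrow> r \<noteq> 0 \<Longrightarrow> degree q \<le> degree r"
        using exists_least_iff[of "\<lambda>n. \<exists>q\<in>J. q \<noteq> 0 \<and> degree q = n"] by (metis not_le)
      have algq: "algebraic (coeff q i)" for i using q(1) unfolding J_def by blast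
      have "degree q \<noteq> 0"
      proof
        assume "degree q = 0"
        then obtain k where k: "q = [:k:]" by (metis degree_eq_zeroE)
        then have "k \<in> M" "k \<noteq> 0" "algebraic k" using q algq[of 0] unfolding J_def by auto
        then have "inverse k \<in> ?S" by auto
        then have "inverse k * k \<in> M" using pl(2) m_mult \<open>k \<in> M\<close> by blast
        then show False using one_notin \<open>k \<noteq> 0\<close> by simp
      qed
      then have "\<nexists>a l. a \<noteq> 0 \<and> l = 0 \<and> q = pCons a l" by (metis degree_pCons_0)
      then obtain c where c: "poly q c = 0" using fundamental_theorem_of_algebra_alt[of q] by blast
      have algc: "algebraic c" using algebraic_coeffs_root[OF q(2) algq c] .
      \<comment> \<open>A nonzero member of least degree divides every member of \<open>J\<close>,
        by cancelling leading terms, so its root \<open>c\<close> is common to all.\<close>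
      have "poly r c = 0" if "r \<in> J" for r
        using that
      proof (induct "degree r" arbitrary: r rule: less_induct)
        case less
        show ?case
        proof (cases "r = 0")
          case False
          have algr: "algebraic (coeff r i)" for i using less(2) unfolding J_def by blast
          have le: "degree q \<le> degree r" using qmin less(2) False by blast
          define t where "t = lead_coeff r / lead_coeff q"
          define h where "h = monom t (degree r - degree q)"
          define r' where "r' = r - h * q"
          have algt: "algebraic t" unfolding t_def using algr algq by auto
          have "poly r' a \<in> M"
          proof -
            have "poly h a \<in> ?A" unfolding h_def poly_monom using algt pl(2) a
              by (intro mult power) auto
            then have "poly r a - poly h a * poly q a \<in> M"
              using less(2) q(1) unfolding J_def by (intro m_diff m_mult) auto
            then show ?thesis unfolding r'_def by simp
          qed
          moreover have "algebraic (coeff r' i)" for i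
            unfolding r'_def h_def using algr algq algt by (auto simp: coeff_monom_mult)
          ultimately have r'J: "r' \<in> J" unfolding J_def by blast
          have "poly r' c = 0"
          proof (cases "r' = 0")
            case False
            have "degree r' < degree r"
            proof -
              have "coeff r' (degree r) = 0" unfolding r'_def h_def t_def using le q(2) by (simp add: coeff_monom_mult)
              moreover have "degree r' \<le> degree r" unfolding r'_def h_def
                by (intro degree_diff_le order.refl order.trans[OF degree_mult_le]) 
                   (use le degree_monom_le[of t "degree r - degree q"] in linarith)
              ultimately show ?thesis using False by (metis le_neq_implies_less leading_coeff_0_iff)
            qed
            then show ?thesis using less(1) r'J by blast
          qed simp
          then show ?thesis unfolding r'_def using c by simp
        qed simp
      qed
      then show ?thesis using algc by blast
    qed
    then obtain c where c: "algebraic c" "\<And>q. q \<in> J \<Longrightarrow> poly q c = 0" by blast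
    define M' where "M' = {u + (a - c) * poly r a | u r. u \<in> M \<and> (\<forall>i. algebraic (coeff r i))}"
    have M'I: "u + (a - c) * poly r a \<in> M'" if "u \<in> M" "\<And>i. algebraic (coeff r i)" for u r
      using that unfolding M'_def by blast
    have cA: "c \<in> ?A" using c(1) pl(2) by blast
    have pA: "poly r a \<in> ?A" if "\<And>i. algebraic (coeff r i)" for r
      unfolding poly_altdef using that pl(2) a by (intro sum mult power) auto
    have "nonunital ?S M'" unfolding nonunital_def
    proof (intro conjI ballI)
      show "0 \<in> M'" using M'I[of 0 0] by simp
      show "1 \<notin> M'"
      proof
        assume "1 \<in> M'"
        then obtain u r where ur: "1 = u + (a - c) * poly r a" "u \<in> M" "\<And>i. algebraic (coeff r i)"
          unfolding M'_def by blast
        \<comment> \<open>A relation producing 1 would give a member of \<open>J\<close> with value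
          1 at the common root \<open>c\<close>.\<close>
        have "1 - [:-c, 1:] * r \<in> J"
        proof -
          have "poly (1 - [:-c, 1:] * r) a = u" using ur(1) by (simp add: algebra_simps)
          moreover have "algebraic (coeff (1 - [:-c, 1:] * r) i)" for i
            using c(1) ur(3) by (auto simp: coeff_pCons coeff_1 split: nat.split)
          ultimately show ?thesis using ur(2) unfolding J_def by auto
        qed
        from c(2)[OF this] show False by simp
      qed
      fix x y assume "x \<in> M'" "y \<in> M'"
      then obtain u r w s where *: "x = u + (a - c) * poly r a" "u \<in> M" "\<And>i. algebraic (coeff r i)"
        "y = w + (a - c) * poly s a" "w \<in> M" "\<And>i. algebraic (coeff s i)" unfolding M'_def by blast
      have "x + y = (u + w) + (a - c) * poly (r + s) a" unfolding *(1,4) by (simp add: algebra_simps)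
      also have "\<dots> \<in> M'" using * by (intro M'I m_add) auto
      finally show "x + y \<in> M'" .
      have "x * y = (u * w + u * ((a - c) * poly s a) + w * ((a - c) * poly r a)) + (a - c) * poly ([:-c, 1:] * (r * s)) a"
        unfolding *(1,4) by (simp add: algebra_simps)
      also have "\<dots> \<in> M'"
      proof (intro M'I m_add)
        show "u * w \<in> M" using *(2,5) m_mult[OF m_sub] by blast
        show "u * ((a - c) * poly s a) \<in> M" using * a cA by (intro m_mult_right mult diff pA) auto
        show "w * ((a - c) * poly r a) \<in> M" using * a cA by (intro m_mult_right mult diff pA) auto
        have "algebraic (coeff (r * s) i)" for i unfolding coeff_mult using * by (intro algebraic_sum) auto
        then show "algebraic (coeff ([:-c, 1:] * (r * s)) i)" for i
          using c(1) by (auto simp: coeff_pCons split: nat.split)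
      qed
      finally show "x * y \<in> M'" .
    next
      fix s x assume s: "s \<in> ?S" "x \<in> M'"
      then obtain u r where *: "x = u + (a - c) * poly r a" "u \<in> M" "\<And>i. algebraic (coeff r i)" unfolding M'_def by blast
      have "s * x = s * u + (a - c) * poly (smult s r) a" unfolding *(1) by (simp add: algebra_simps)
      also have "\<dots> \<in> M'"
      proof (rule M'I)
        show "s * u \<in> M" using s(1) pl(2) *(2) by blast
      qed (use * s in auto)
      finally show "s * x \<in> M'" .
    qed
    moreover have "M \<subseteq> M'" using M'I[of _ 0] by auto
    ultimately have "M' = M" using M unfolding maximal_nonunital_def by blast
    moreover have "0 + (a - c) * poly 1 a \<in> M'" by (rule M'I) (auto simp: coeff_1)
    ultimately show ?thesis using c(1) by auto
  qed
  then show ?thesis using pl by blast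
qed


section \<open>Polynomial functions\<close>

text \<open>Polynomials are kept as functions, with constants restricted to \<open>S\<close>; the
  coefficients then lie in the semiring generated by \<open>S\<close> and 1. This is enough to move
  a polynomial between coefficient domains and to estimate it at each place by induction.\<close>

inductive_set Pol :: "complex set \<Rightarrow> nat \<Rightarrow> ((nat \<Rightarrow> complex) \<Rightarrow> complex) set"
  for S :: "complex set" and n :: nat
where
  Pol_const: "c \<in> S \<Longrightarrow> (\<lambda>x. c) \<in> Pol S n"
| Pol_var: "i < n \<Longrightarrow> (\<lambda>x. x i) \<in> Pol S n"
| Pol_add: "f \<in> Pol S n \<Longrightarrow> g \<in> Pol S n \<Longrightarrow> (\<lambda>x. f x + g x) \<in> Pol S n"
| Pol_mult: "f \<in> Pol S n \<Longrightarrow> g \<in> Pol S n \<Longrightarrow> (\<lambda>x. f x * g x) \<in> Pol S n"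

lemma Pol_mono:
  assumes "f \<in> Pol S n" "S \<subseteq> S'" "n \<le> n'" shows "f \<in> Pol S' n'"
  using assms(1) by induct (use assms(2,3) in \<open>auto intro: Pol.intros\<close>)

lemma Pol_power: "1 \<in> S \<Longrightarrow> f \<in> Pol S n \<Longrightarrow> (\<lambda>x. f x ^ k) \<in> Pol S n"
  by (induct k) (auto intro: Pol_const Pol_mult)

lemma Pol_sum: 
  assumes "0 \<in> S" "\<And>i. i \<in> I \<Longrightarrow> f i \<in> Pol S n" shows "(\<lambda>x. \<Sum>i\<in>I. f i x) \<in> Pol S n"
  using assms(2) by (induct I rule: infinite_finite_induct) (auto intro: Pol_const Pol_add assms(1))

lemma Pol_prod: 
  assumes "1 \<in> S" "\<And>i. i \<in> I \<Longrightarrow> f i \<in> Pol S n" shows "(\<lambda>x. \<Prod>i\<in>I. f i x) \<in> Pol S n"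
  using assms(2) by (induct I rule: infinite_finite_induct) (auto intro: Pol_const Pol_mult assms(1))

lemma Pol_uminus: "-1 \<in> S \<Longrightarrow> f \<in> Pol S n \<Longrightarrow> (\<lambda>x. - f x) \<in> Pol S n"
  using Pol_mult[OF Pol_const[of "-1" S n]] by simp

lemma Pol_diff: "-1 \<in> S \<Longrightarrow> f \<in> Pol S n \<Longrightarrow> g \<in> Pol S n \<Longrightarrow> (\<lambda>x. f x - g x) \<in> Pol S n"
  using Pol_add[OF _ Pol_uminus] by simp

lemma Pol_local:
  assumes "f \<in> Pol S n" "\<And>i. i < n \<Longrightarrow> x i = y i" shows "f x = f y"
  using assms(1) by induct (use assms(2) in auto)

lemma Pol_finite_coeffs:
  assumes "f \<in> Pol S n" shows "\<exists>S0. finite S0 \<and> S0 \<subseteq> S \<and> f \<in> Pol S0 n"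
  using assms
proof induct
  case (Pol_const c)
  then show ?case by (intro exI[of _ "{c}"]) (auto intro: Pol.Pol_const)
next
  case (Pol_var i)
  then show ?case by (intro exI[of _ "{}"]) (auto intro: Pol.Pol_var)
next
  case (Pol_add f g)
  then obtain S1 S2 where "finite S1" "S1 \<subseteq> S" "f \<in> Pol S1 n" "finite S2" "S2 \<subseteq> S" "g \<in> Pol S2 n" by blast
  then show ?case by (intro exI[of _ "S1 \<union> S2"]) (auto intro!: Pol.Pol_add elim: Pol_mono)
next
  case (Pol_mult f g)
  then obtain S1 S2 where "finite S1" "S1 \<subseteq> S" "f \<in> Pol S1 n" "finite S2" "S2 \<subseteq> S" "g \<in> Pol S2 n" by blast
  then show ?case by (intro exI[of _ "S1 \<union> S2"]) (auto intro!: Pol.Pol_mult elim: Pol_mono)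
qed

lemma Pol_value_in:
  assumes "f \<in> Pol S n" "S \<subseteq> A" "\<And>x y. x \<in> A \<Longrightarrow> y \<in> A \<Longrightarrow> x + y \<in> A"
    "\<And>x y. x \<in> A \<Longrightarrow> y \<in> A \<Longrightarrow> x * y \<in> A" "\<And>i. i < n \<Longrightarrow> x i \<in> A"
  shows "f x \<in> A"
  using assms(1) by induct (use assms(2-) in auto)

lemma Pol_comp:
  assumes "f \<in> Pol S n" "\<And>i. i < n \<Longrightarrow> g i \<in> Pol S k"
  shows "(\<lambda>x. f (\<lambda>i. g i x)) \<in> Pol S k"
  using assms(1) by induct (use assms(2) in \<open>auto intro: Pol.intros\<close>)

lemma Pol_univariate:
  assumes "f \<in> Pol S n" "\<And>i. i < n \<Longrightarrow> \<exists>p. \<forall>t. h t i = poly p t"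
  shows "\<exists>p. \<forall>t. f (h t) = poly p t"
  using assms(1)
proof induct
  case (Pol_const c)
  then show ?case by (intro exI[of _ "[:c:]"]) auto
next
  case (Pol_var i)
  then show ?case using assms(2) by blast
next
  case (Pol_add f g)
  then obtain p q where "\<forall>t. f (h t) = poly p t" "\<forall>t. g (h t) = poly q t" by blast
  then show ?case by (intro exI[of _ "p + q"]) auto
next
  case (Pol_mult f g)
  then obtain p q where "\<forall>t. f (h t) = poly p t" "\<forall>t. g (h t) = poly q t" by blast
  then show ?case by (intro exI[of _ "p * q"]) auto
qed

lemma Pol_zero_grid:
  assumes f: "f \<in> Pol S n" and G: "\<And>i. i < n \<Longrightarrow> infinite (G i)"
    and z: "\<And>x. (\<And>i. i < n \<Longrightarrow> x i \<in> G i) \<Longrightarrow> f x = 0"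
  shows "f x = 0"
proof -
  \<comment> \<open>The coordinates below \<open>k\<close> are arbitrary, the others still in the
    grid. Freeing one more coordinate uses that a nonzero polynomial in one variable has finitely
    many roots.\<close>
  have "f x = 0" if "k \<le> n" "\<And>i. k \<le> i \<Longrightarrow> i < n \<Longrightarrow> x i \<in> G i" for k x
    using that
  proof (induct k arbitrary: x)
    case 0
    then show ?case using z by auto
  next
    case (Suc k)
    have "\<exists>p. \<forall>t. f (x(k := t)) = poly p t"
    proof (rule Pol_univariate[OF f])
      fix i show "\<exists>p. \<forall>t. (x(k := t)) i = poly p t"
        by (cases "i = k") (auto intro: exI[of _ "[:0,1:]"] exI[of _ "[:x i:]"])
    qed
    then obtain p where p: "\<And>t. f (x(k := t)) = poly p t" by blast
    have "poly p t = 0" if "t \<in> G k" for t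
      unfolding p[symmetric] using Suc that by (intro Suc(1)) auto
    then have "G k \<subseteq> {t. poly p t = 0}" by blast
    then have "infinite {t. poly p t = 0}" using G[of k] Suc(2) finite_subset by auto
    then have "p = 0" using poly_roots_finite by blast
    then have "f (x(k := x k)) = 0" unfolding p by simp
    then show ?case by simp
  qed
  from this[of n x] show ?thesis by auto
qed

text \<open>The conjugate polynomial \<open>f'\<close> arises by applying \<open>\<sigma>\<close> to
  the constants. It is a polynomial over all complex numbers although \<open>\<sigma>\<close> is a
  homomorphism only on \<open>K\<close>.\<close>

lemma Pol_ring_hom:
  assumes "f \<in> Pol K n" "\<And>x y. x \<in> K \<Longrightarrow> y \<in> K \<Longrightarrow> x + y \<in> K \<and> \<sigma> (x + y) = \<sigma> x + \<sigma> y"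
    "\<And>x y. x \<in> K \<Longrightarrow> y \<in> K \<Longrightarrow> x * y \<in> K \<and> \<sigma> (x * y) = \<sigma> x * \<sigma> y"
  shows "\<exists>f'\<in>Pol UNIV n. \<forall>x. (\<forall>i<n. x i \<in> K) \<longrightarrow> f x \<in> K \<and> \<sigma> (f x) = f' (\<lambda>i. \<sigma> (x i))"
  using assms(1)
proof induct
  case (Pol_const c)
  then show ?case by (intro bexI[of _ "\<lambda>x. \<sigma> c"]) (auto intro: Pol.Pol_const)
next
  case (Pol_var i)
  then show ?case by (intro bexI[of _ "\<lambda>x. x i"]) (auto intro: Pol.Pol_var)
next
  case (Pol_add f g)
  then obtain f' g' where "f' \<in> Pol UNIV n" "\<forall>x. (\<forall>i<n. x i \<in> K) \<longrightarrow> f x \<in> K \<and> \<sigma> (f x) = f' (\<lambda>i. \<sigma> (x i))"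
    "g' \<in> Pol UNIV n" "\<forall>x. (\<forall>i<n. x i \<in> K) \<longrightarrow> g x \<in> K \<and> \<sigma> (g x) = g' (\<lambda>i. \<sigma> (x i))" by blast
  then show ?case using assms(2) by (intro bexI[of _ "\<lambda>x. f' x + g' x"]) (auto intro: Pol.Pol_add)
next
  case (Pol_mult f g)
  then obtain f' g' where "f' \<in> Pol UNIV n" "\<forall>x. (\<forall>i<n. x i \<in> K) \<longrightarrow> f x \<in> K \<and> \<sigma> (f x) = f' (\<lambda>i. \<sigma> (x i))"
    "g' \<in> Pol UNIV n" "\<forall>x. (\<forall>i<n. x i \<in> K) \<longrightarrow> g x \<in> K \<and> \<sigma> (g x) = g' (\<lambda>i. \<sigma> (x i))" by blast
  then show ?case using assms(3) by (intro bexI[of _ "\<lambda>x. f' x * g' x"]) (auto intro: Pol.Pol_mult)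
qed

lemma Pol_bounded:
  assumes "f \<in> Pol S n"
  shows "\<exists>C>0. \<forall>x. (\<forall>i<n. cmod (x i) \<le> 1) \<longrightarrow> cmod (f x) \<le> C"
  using assms
proof induct
  case (Pol_const c)
  then show ?case by (intro exI[of _ "cmod c + 1"]) (auto intro: add_nonneg_pos)
next
  case (Pol_var i)
  then show ?case by (intro exI[of _ 1]) auto
next
  case (Pol_add f g)
  then obtain C D where "C > 0" "D > 0" "\<forall>x. (\<forall>i<n. cmod (x i) \<le> 1) \<longrightarrow> cmod (f x) \<le> C"
     "\<forall>x. (\<forall>i<n. cmod (x i) \<le> 1) \<longrightarrow> cmod (g x) \<le> D" by blast
  then show ?case by (intro exI[of _ "C + D"]) (auto intro: norm_triangle_le add_mono)
next
  case (Pol_mult f g)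
  then obtain C D where "C > 0" "D > 0" "\<forall>x. (\<forall>i<n. cmod (x i) \<le> 1) \<longrightarrow> cmod (f x) \<le> C"
     "\<forall>x. (\<forall>i<n. cmod (x i) \<le> 1) \<longrightarrow> cmod (g x) \<le> D" by blast
  then show ?case by (intro exI[of _ "C * D"]) (auto simp: norm_mult intro!: mult_mono)
qed

section \<open>Expansion into monomials\<close>

definition monomial_sum :: "complex set \<Rightarrow> nat \<Rightarrow> ((nat \<Rightarrow> complex) \<Rightarrow> complex) \<Rightarrow> bool" where
  "monomial_sum S n f \<longleftrightarrow> (\<exists>T c. finite T \<and> (\<forall>\<alpha>\<in>T. c \<alpha> \<in> S \<and> (\<forall>i\<ge>n. \<alpha> i = (0::nat))) \<and>
     f = (\<lambda>x. \<Sum>\<alpha>\<in>T. c \<alpha> * (\<Prod>i<n. x i ^ \<alpha> i)))"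

lemma monomial_sum_add:
  assumes "0 \<in> S" "\<And>x y. x \<in> S \<Longrightarrow> y \<in> S \<Longrightarrow> x + y \<in> S" and f: "monomial_sum S n f" and g: "monomial_sum S n g"
  shows "monomial_sum S n (\<lambda>x. f x + g x)"
proof -
  obtain T c where T: "finite T" "\<forall>\<alpha>\<in>T. c \<alpha> \<in> S \<and> (\<forall>i\<ge>n. \<alpha> i = (0::nat))" and
     f: "f = (\<lambda>x. \<Sum>\<alpha>\<in>T. c \<alpha> * (\<Prod>i<n. x i ^ \<alpha> i))" using f unfolding monomial_sum_def by blast
  obtain U e where U: "finite U" "\<forall>\<alpha>\<in>U. e \<alpha> \<in> S \<and> (\<forall>i\<ge>n. \<alpha> i = (0::nat))" and
     g: "g = (\<lambda>x. \<Sum>\<alpha>\<in>U. e \<alpha> * (\<Prod>i<n. x i ^ \<alpha> i))" using g unfolding monomial_sum_def by blast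
  define c' e' where "c' = (\<lambda>\<alpha>. if \<alpha> \<in> T then c \<alpha> else 0)" and "e' = (\<lambda>\<alpha>. if \<alpha> \<in> U then e \<alpha> else 0)"
  have "f x = (\<Sum>\<alpha>\<in>T \<union> U. c' \<alpha> * (\<Prod>i<n. x i ^ \<alpha> i))" for x
    unfolding f using T U by (intro sum.mono_neutral_cong_left) (auto simp: c'_def)
  moreover have "g x = (\<Sum>\<alpha>\<in>T \<union> U. e' \<alpha> * (\<Prod>i<n. x i ^ \<alpha> i))" for x
    unfolding g using T U by (intro sum.mono_neutral_cong_left) (auto simp: e'_def)
  ultimately have "(\<lambda>x. f x + g x) = (\<lambda>x. \<Sum>\<alpha>\<in>T \<union> U. (c' \<alpha> + e' \<alpha>) * (\<Prod>i<n. x i ^ \<alpha> i))"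
    by (simp add: sum.distrib distrib_right)
  moreover have "c' \<alpha> + e' \<alpha> \<in> S" if "\<alpha> \<in> T \<union> U" for \<alpha>
    using that T U assms(1,2) unfolding c'_def e'_def by auto
  ultimately show ?thesis unfolding monomial_sum_def using T U
    by (intro exI[of _ "T \<union> U"] exI[of _ "\<lambda>\<alpha>. c' \<alpha> + e' \<alpha>"]) auto
qed

lemma monomial_sum_single:
  assumes "c \<in> S" "\<And>i. i \<ge> n \<Longrightarrow> \<alpha> i = (0::nat)"
  shows "monomial_sum S n (\<lambda>x. c * (\<Prod>i<n. x i ^ \<alpha> i))"
  unfolding monomial_sum_def using assms by (intro exI[of _ "{\<alpha>}"] exI[of _ "\<lambda>_. c"]) auto

lemma Pol_monomial_sum:
  assumes "f \<in> Pol S n" and S: "0 \<in> S" "1 \<in> S" "\<And>x y. x \<in> S \<Longrightarrow> y \<in> S \<Longrightarrow> x + y \<in> S" "\<And>x y. x \<in> S \<Longrightarrow> y \<in> S \<Longrightarrow> x * y \<in> S"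
  shows "monomial_sum S n f"
  using assms(1)
proof induct
  case (Pol_const c)
  then show ?case using monomial_sum_single[of c S n "\<lambda>_. 0"] by simp
next
  case (Pol_var i)
  have "(\<Prod>j<n. x j ^ (if j = i then 1 else 0)) = x i" for x :: "nat \<Rightarrow> complex"
  proof -
    have "(\<Prod>j<n. x j ^ (if j = i then 1 else 0)) = (\<Prod>j<n. if j = i then x j else 1)"
      by (intro prod.cong) auto
    then show ?thesis using Pol_var by simp
  qed
  then show ?case using monomial_sum_single[OF S(2), of n "\<lambda>j. if j = i then 1 else 0"] Pol_var by auto
next
  case (Pol_add f g)
  then show ?case by (intro monomial_sum_add S)
next
  case (Pol_mult f g)
  obtain T c where T: "finite T" "\<forall>\<alpha>\<in>T. c \<alpha> \<in> S \<and> (\<forall>i\<ge>n. \<alpha> i = (0::nat))" and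
     f: "f = (\<lambda>x. \<Sum>\<alpha>\<in>T. c \<alpha> * (\<Prod>i<n. x i ^ \<alpha> i))" using Pol_mult unfolding monomial_sum_def by blast
  obtain U e where U: "finite U" "\<forall>\<alpha>\<in>U. e \<alpha> \<in> S \<and> (\<forall>i\<ge>n. \<alpha> i = (0::nat))" and
     g: "g = (\<lambda>x. \<Sum>\<alpha>\<in>U. e \<alpha> * (\<Prod>i<n. x i ^ \<alpha> i))" using Pol_mult unfolding monomial_sum_def by blast
  have sm: "monomial_sum S n (\<lambda>x. \<Sum>i\<in>I. h i x)" if "\<And>i. i \<in> I \<Longrightarrow> monomial_sum S n (h i)" 
    for I :: "((nat \<Rightarrow> nat) \<times> (nat \<Rightarrow> nat)) set" and h
    using that
  proof (induct I rule: infinite_finite_induct)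
    case (insert x F)
    then show ?case using monomial_sum_add[OF S(1,3)] by simp
  qed (use monomial_sum_single[OF S(1), of n "\<lambda>_. 0"] in simp_all)
  have "f x * g x = (\<Sum>p\<in>T \<times> U. (c (fst p) * e (snd p)) * (\<Prod>i<n. x i ^ (fst p i + snd p i)))" for x
  proof -
    have "f x * g x = (\<Sum>\<alpha>\<in>T. \<Sum>\<beta>\<in>U. (c \<alpha> * (\<Prod>i<n. x i ^ \<alpha> i)) * (e \<beta> * (\<Prod>i<n. x i ^ \<beta> i)))"
      unfolding f g by (rule sum_product)
    also have "\<dots> = (\<Sum>p\<in>T \<times> U. (c (fst p) * (\<Prod>i<n. x i ^ fst p i)) * (e (snd p) * (\<Prod>i<n. x i ^ snd p i)))"
      by (simp only: sum.cartesian_product case_prod_unfold)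
    also have "\<dots> = (\<Sum>p\<in>T \<times> U. (c (fst p) * e (snd p)) * (\<Prod>i<n. x i ^ (fst p i + snd p i)))"
      by (intro sum.cong refl) (simp only: power_add prod.distrib mult_ac)
    finally show ?thesis .
  qed
  then have "(\<lambda>x. f x * g x) = (\<lambda>x. \<Sum>p\<in>T \<times> U. (c (fst p) * e (snd p)) * (\<Prod>i<n. x i ^ (fst p i + snd p i)))"
    by (rule ext)
  moreover have "monomial_sum S n (\<lambda>x. \<Sum>p\<in>T \<times> U. (c (fst p) * e (snd p)) * (\<Prod>i<n. x i ^ (fst p i + snd p i)))"
  proof (rule sm)
    fix p assume "p \<in> T \<times> U"
    then have p: "fst p \<in> T" "snd p \<in> U" by auto
    show "monomial_sum S n (\<lambda>x. c (fst p) * e (snd p) * (\<Prod>i<n. x i ^ (fst p i + snd p i)))"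
    proof (rule monomial_sum_single)
      show "c (fst p) * e (snd p) \<in> S" using T(2) U(2) p S(4) by simp
      show "i \<ge> n \<Longrightarrow> fst p i + snd p i = 0" for i using T(2) U(2) p by simp
    qed
  qed
  ultimately show ?case by simp
qed

section \<open>Homogeneous forms and projective points\<close>

lemma finite_monoms [simp]: "finite (monoms N d)"
proof -
  have "monoms N d \<subseteq> (\<lambda>f i. if i \<le> N then f i else 0) ` (PiE {..N} (\<lambda>_. {..d}))"
  proof
    fix \<alpha> assume a: "\<alpha> \<in> monoms N d"
    then have "\<alpha> i \<le> d" if "i \<le> N" for i
      using that member_le_sum[of i "{..N}" \<alpha>] unfolding monoms_def by auto
    then have "restrict \<alpha> {..N} \<in> PiE {..N} (\<lambda>_. {..d})" by auto
    moreover have "\<alpha> = (\<lambda>i. if i \<le> N then restrict \<alpha> {..N} i else 0)"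
      using a unfolding monoms_def by auto
    ultimately show "\<alpha> \<in> (\<lambda>f i. if i \<le> N then f i else 0) ` (PiE {..N} (\<lambda>_. {..d}))" by blast
  qed
  then show ?thesis by (rule finite_subset) (intro finite_imageI finite_PiE; simp)
qed

lemma monoms_0: "monoms N 0 = {\<lambda>_. 0}"
  unfolding monoms_def by (auto simp: fun_eq_iff) (metis atMost_iff not_le)

lemma monoms_le: "\<alpha> \<in> monoms N d \<Longrightarrow> \<alpha> i \<le> d"
  using member_le_sum[of i "{..N}" \<alpha>] unfolding monoms_def by (cases "i \<le> N") auto

lemma heval_scale: "heval N d c (\<lambda>i. t * v i) = t ^ d * heval N d c v"
proof -
  have "(\<Prod>i\<le>N. (t * v i) ^ \<alpha> i) = t ^ d * (\<Prod>i\<le>N. v i ^ \<alpha> i)" if "\<alpha> \<in> monoms N d" for \<alpha>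
    using that unfolding monoms_def by (simp add: power_mult_distrib prod.distrib flip: power_sum)
  then show ?thesis unfolding heval_def by (simp add: sum_distrib_left mult_ac)
qed

lemma heval_cong: "(\<And>i. i \<le> N \<Longrightarrow> v i = w i) \<Longrightarrow> heval N d c v = heval N d c w"
  unfolding heval_def by (auto intro!: sum.cong prod.cong)

lemma heval_Pol:
  assumes "0 \<in> S" "1 \<in> S" "\<And>\<alpha>. \<alpha> \<in> monoms N d \<Longrightarrow> c \<alpha> \<in> S"
  shows "heval N d c \<in> Pol S (Suc N)"
  unfolding heval_def[abs_def]
  by (intro Pol_sum Pol_mult Pol_prod Pol_power Pol_const Pol_var assms) auto

lemma proj_self [simp]: "v \<in> proj v"
  unfolding proj_def by (rule CollectI, rule exI[of _ 1]) auto

lemma proj_scale: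
  assumes c: "c \<noteq> 0" shows "proj (\<lambda>i. c * v i) = proj v"
proof (rule Set.set_eqI, rule iffI)
  fix w
  { assume "w \<in> proj (\<lambda>i. c * v i)"
    then obtain e where "w = (\<lambda>i. e * (c * v i))" "e \<noteq> 0" unfolding proj_def by blast
    then show "w \<in> proj v" unfolding proj_def using c by (intro CollectI exI[of _ "e * c"]) (auto simp: mult_ac) }
  { assume "w \<in> proj v"
    then obtain e where "w = (\<lambda>i. e * v i)" "e \<noteq> 0" unfolding proj_def by blast
    then show "w \<in> proj (\<lambda>i. c * v i)" unfolding proj_def using c by (intro CollectI exI[of _ "e / c"]) auto }
qed

lemma proj_memE: assumes "w \<in> proj v" obtains c where "c \<noteq> 0" "w = (\<lambda>i. c * v i)"
  using assms unfolding proj_def by blast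

lemma proj_mem_eq: "w \<in> proj v \<Longrightarrow> proj w = proj v"
  by (elim proj_memE) (simp add: proj_scale)

definition Fvec :: "nat \<Rightarrow> nat \<Rightarrow> (nat \<Rightarrow> (nat \<Rightarrow> nat) \<Rightarrow> complex) \<Rightarrow> (nat \<Rightarrow> complex) \<Rightarrow> nat \<Rightarrow> complex" where
  "Fvec N d F v = (\<lambda>i. if i \<le> N then heval N d (F i) v else 0)"

lemma Fvec_scale: "Fvec N d F (\<lambda>i. c * v i) = (\<lambda>i. c ^ d * Fvec N d F v i)"
  unfolding Fvec_def by (auto simp: heval_scale)

text \<open>The representative picked by \<open>SOME\<close> differs from \<open>v\<close> by a
  factor \<open>c\<close>, which changes the value only by \<open>c ^ d\<close>.\<close>

lemma fmap_proj: "fmap N d F (proj v) = proj (Fvec N d F v)"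
proof -
  have "(SOME w. w \<in> proj v) \<in> proj v" by (rule someI[of "\<lambda>w. w \<in> proj v", OF proj_self])
  then obtain c where "c \<noteq> 0" "(SOME w. w \<in> proj v) = (\<lambda>i. c * v i)" by (rule proj_memE)
  then show ?thesis unfolding fmap_def Fvec_def[symmetric] by (simp add: Fvec_scale proj_scale)
qed

lemma fmap_funpow_proj: "(fmap N d F ^^ k) (proj v) = proj ((Fvec N d F ^^ k) v)"
  by (induct k) (auto simp: fmap_proj)

lemma is_vec_Fvec: "is_vec N (Fvec N d F v)"
  unfolding is_vec_def Fvec_def by auto

lemma PN_E:
  assumes "P \<in> PN N" obtains v where "P = proj v" "alg_vec N v" "v \<noteq> (\<lambda>_. 0)"
  using assms unfolding PN_def by blast

lemma PN_I: "alg_vec N v \<Longrightarrow> v \<noteq> (\<lambda>_. 0) \<Longrightarrow> proj v \<in> PN N"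
  unfolding PN_def by blast

lemma alg_vec_heval:
  assumes "alg_vec N v" "alg_hpoly N d c" shows "algebraic (heval N d c v)"
  using assms unfolding heval_def alg_vec_def alg_hpoly_def
  by (intro algebraic_sum algebraic_mult algebraic_prod algebraic_power) auto

lemma alg_vec_Fvec:
  assumes "endo N d F" "alg_vec N v" shows "alg_vec N (Fvec N d F v)"
  using assms alg_vec_heval unfolding alg_vec_def[of N "Fvec N d F v"] endo_def
  by (auto simp: is_vec_Fvec) (simp add: Fvec_def)

lemma Fvec_nonzero:
  assumes "endo N d F" "alg_vec N v" "v \<noteq> (\<lambda>_. 0)" shows "Fvec N d F v \<noteq> (\<lambda>_. 0)"
proof
  assume "Fvec N d F v = (\<lambda>_. 0)"
  then have "\<forall>i\<le>N. heval N d (F i) v = 0" unfolding Fvec_def by metis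
  then show False using assms unfolding endo_def by blast
qed

lemma alg_vec_Fvec_funpow:
  assumes "endo N d F" "alg_vec N v" "v \<noteq> (\<lambda>_. 0)"
  shows "alg_vec N ((Fvec N d F ^^ k) v) \<and> (Fvec N d F ^^ k) v \<noteq> (\<lambda>_. 0)"
  using assms by (induct k) (simp_all add: alg_vec_Fvec Fvec_nonzero)

lemma zclosed_proper_form:
  assumes "zclosed N Y" "Y \<noteq> PN N"
  obtains e c v where "alg_hpoly N e c" "alg_vec N v" "v \<noteq> (\<lambda>_. 0)" "heval N e c v \<noteq> 0"
    "\<And>P w. P \<in> Y \<Longrightarrow> w \<in> P \<Longrightarrow> heval N e c w = 0"
proof -
  obtain Fs where Fs: "\<forall>(e, c)\<in>Fs. alg_hpoly N e c" "Y = zero_set N Fs" using assms(1) unfolding zclosed_def by blast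
  then obtain P where "P \<in> PN N" "P \<notin> zero_set N Fs" using assms(2) unfolding zero_set_def by blast
  then obtain e c w where *: "(e, c) \<in> Fs" "w \<in> P" "heval N e c w \<noteq> 0" unfolding zero_set_def by auto
  obtain v where v: "P = proj v" "alg_vec N v" "v \<noteq> (\<lambda>_. 0)" using PN_E[OF \<open>P \<in> PN N\<close>] .
  obtain t where t: "t \<noteq> 0" "w = (\<lambda>i. t * v i)" using *(2) unfolding v(1) by (rule proj_memE)
  show thesis
  proof (rule that[of e c v])
    show "alg_hpoly N e c" using Fs(1) *(1) by blast
    show "alg_vec N v" "v \<noteq> (\<lambda>_. 0)" by fact+
    have "heval N e c w = t ^ e * heval N e c v" unfolding t(2) by (rule heval_scale)
    then show "heval N e c v \<noteq> 0" using *(3) by simp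
    fix P w assume P: "P \<in> Y" "w \<in> P"
    have all: "\<forall>(e, c)\<in>Fs. \<forall>v\<in>P. heval N e c v = 0" using P(1) unfolding Fs(2) zero_set_def by simp
    show "heval N e c w = 0" using bspec[OF all *(1)] P(2) by simp
  qed
qed

lemma zdenseI:
  assumes "S \<subseteq> PN N" 
    "\<And>e c v. alg_hpoly N e c \<Longrightarrow> alg_vec N v \<Longrightarrow> heval N e c v \<noteq> 0 \<Longrightarrow> \<exists>w. proj w \<in> S \<and> heval N e c w \<noteq> 0"
  shows "zdense N S"
  unfolding zdense_def
proof (intro conjI allI impI; (elim conjE)?)
  fix Y assume Y: "zclosed N Y" "S \<subseteq> Y"
  show "Y = PN N"
  proof (rule ccontr)
    assume neq: "Y \<noteq> PN N"
    obtain e c v where *: "alg_hpoly N e c" "alg_vec N v" "v \<noteq> (\<lambda>_. 0)" "heval N e c v \<noteq> 0"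
    "\<And>P w. P \<in> Y \<Longrightarrow> w \<in> P \<Longrightarrow> heval N e c w = 0"
    by (rule zclosed_proper_form[OF Y(1) neq]) (rule that)
    obtain w where w: "proj w \<in> S" "heval N e c w \<noteq> 0" using assms(2)[OF *(1,2,4)] by (elim exE conjE) (rule that)
    then have "proj w \<in> Y" using Y(2) by (rule_tac subsetD)
    then show False using *(5)[OF _ proj_self] w(2) by simp
  qed
qed (rule assms(1))

lemma zdense_formD:
  assumes "zdense N S" "alg_hpoly N e c" "\<And>w. proj w \<in> S \<Longrightarrow> heval N e c w = 0" "alg_vec N v" 
  shows "heval N e c v = 0"
proof (cases "v = (\<lambda>_. 0)")
  case False
  let ?Y = "zero_set N {(e, c)}"
  have "zclosed N ?Y" unfolding zclosed_def by (rule exI[of _ "{(e, c)}"]) (use assms(2) in simp)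
  moreover have "S \<subseteq> ?Y"
  proof
    fix P assume P: "P \<in> S"
    have SP: "S \<subseteq> PN N" using assms(1) unfolding zdense_def by (rule conjunct1)
    then have "P \<in> PN N" using P by (rule subsetD)
    then obtain u where u: "P = proj u" by (rule PN_E)
    have "heval N e c w = 0" if "w \<in> P" for w
    proof -
      have "proj w = P" using proj_mem_eq[of w u] that u by simp
      then show ?thesis using assms(3)[of w] P by simp
    qed
    then show "P \<in> ?Y" using \<open>P \<in> PN N\<close> unfolding zero_set_def by simp
  qed
  ultimately have "?Y = PN N" using assms(1) unfolding zdense_def by simp
  then have "proj v \<in> ?Y" using PN_I[OF assms(4) False] by simp
  then show ?thesis using proj_self[of v] unfolding zero_set_def by simp
next
  case True
  show ?thesis
  proof (rule ccontr)
    assume nz: "heval N e c v \<noteq> 0"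
    \<comment> \<open>A form of positive degree vanishes at the zero vector. A constant form takes
      the same value at a point of \<open>S\<close>, and \<open>S\<close> is nonempty because the
      constant form 1 has no zeros.\<close>
    then have e: "e = 0" using heval_scale[of N e c 0 v] True by (cases e) auto
    have "\<exists>P. P \<in> S"
    proof (rule ccontr)
      assume "\<nexists>P. P \<in> S"
      then have "S = {}" by simp
      then have "S \<subseteq> zero_set N {(0, \<lambda>_. 1)}" by simp
      moreover have "zclosed N (zero_set N {(0, \<lambda>_. 1)})" unfolding zclosed_def alg_hpoly_def
        by (rule exI[of _ "{(0, \<lambda>_. 1)}"]) simp
      ultimately have eq: "zero_set N {(0, \<lambda>_. 1)} = PN N" using assms(1) unfolding zdense_def by simp
      let ?e = "\<lambda>i::nat. if i = 0 then 1 else 0 :: complex"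
      have "proj ?e \<in> PN N" by (rule PN_I) (auto simp: alg_vec_def is_vec_def fun_eq_iff)
      then have "proj ?e \<in> zero_set N {(0, \<lambda>_. 1)}" unfolding eq .
      then have "heval N 0 (\<lambda>_. 1) ?e = 0" using proj_self[of ?e] unfolding zero_set_def by simp
      then show False unfolding heval_def monoms_0 by simp
    qed
    then obtain P where P: "P \<in> S" by (rule exE)
    have SP: "S \<subseteq> PN N" using assms(1) unfolding zdense_def by (rule conjunct1)
    obtain u where "P = proj u" using PN_E[OF subsetD[OF SP P]] .
    then have "heval N e c u = 0" using assms(3)[of u] P by simp
    moreover have "heval N e c u = heval N e c v"
    proof -
      show ?thesis unfolding e heval_def monoms_0 by simp
    qed
    ultimately show False using nz by simp
  qed
qed


section \<open>Hilbert's Nullstellensatz\<close>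

text \<open>Gaussian elimination: a vector \<open>k\<close> with nonzero entry at \<open>m\<close>
  serves as pivot and clears this coordinate from all others, at the cost of one vector and one
  coordinate.\<close>

lemma more_vectors_than_coordinates:
  fixes a :: "'i \<Rightarrow> 'j \<Rightarrow> 'k::field"
  assumes "finite T" "finite I" "card T < card I"
  shows "\<exists>b. (\<exists>i\<in>I. b i \<noteq> 0) \<and> (\<forall>m\<in>T. (\<Sum>i\<in>I. b i * a i m) = 0)"
  using assms
proof (induct T arbitrary: I a rule: finite_induct)
  case empty
  then have "I \<noteq> {}" by auto
  then show ?case by (intro exI[of _ "\<lambda>_. 1"]) auto
next
  case (insert m T)
  show ?case
  proof (cases "\<forall>i\<in>I. a i m = 0")
    case True
    have "card T < card I" using insert by simp
    from insert(3)[OF insert(4) this, of a] obtain b where b: "\<exists>i\<in>I. b i \<noteq> 0" "\<forall>m\<in>T. (\<Sum>i\<in>I. b i * a i m) = 0"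
      by (elim exE conjE) (rule that)
    then show ?thesis using True by (intro exI[of _ b]) simp
  next
    case False
    then obtain k where k: "k \<in> I" "a k m \<noteq> 0" by auto
    define I' where "I' = I - {k}"
    define a' where "a' = (\<lambda>i j. a i j - a i m / a k m * a k j)"
    have "finite I'" "card T < card I'" using insert k unfolding I'_def by auto
    from insert(3)[OF this, of a'] obtain b where b: "\<exists>i\<in>I'. b i \<noteq> 0" "\<forall>j\<in>T. (\<Sum>i\<in>I'. b i * a' i j) = 0"
      by (elim exE conjE) (rule that)
    define e where "e = (\<lambda>i. if i = k then - (\<Sum>i\<in>I'. b i * (a i m / a k m)) else b i)"
    have s: "(\<Sum>i\<in>I. e i * a i j) = (\<Sum>i\<in>I'. b i * a' i j)" for j
    proof -
      have "(\<Sum>i\<in>I. e i * a i j) = e k * a k j + (\<Sum>i\<in>I'. e i * a i j)"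
        unfolding I'_def using k insert(4) by (simp add: sum.remove)
      also have "(\<Sum>i\<in>I'. e i * a i j) = (\<Sum>i\<in>I'. b i * a i j)"
        by (rule sum.cong) (auto simp: e_def I'_def)
      also have "e k * a k j + (\<Sum>i\<in>I'. b i * a i j) = (\<Sum>i\<in>I'. b i * a' i j)"
        unfolding e_def a'_def by (simp add: algebra_simps sum_subtractf sum_distrib_left sum_distrib_right)
      finally show ?thesis .
    qed
    have am: "a' i m = 0" for i unfolding a'_def using k by simp
    have 1: "\<exists>i\<in>I. e i \<noteq> 0" using b(1) unfolding e_def I'_def by auto
    have 2: "\<forall>j\<in>insert m T. (\<Sum>i\<in>I. e i * a i j) = 0" unfolding s using b(2) am by simp
    show ?thesis by (rule exI[of _ e]) (rule conjI[OF 1 2])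
  qed
qed

section \<open>Ideals of polynomial functions and their zeros\<close>

definition pideal :: "nat \<Rightarrow> ((nat \<Rightarrow> complex) \<Rightarrow> complex) set \<Rightarrow> bool" where
  "pideal n I \<longleftrightarrow> I \<subseteq> Pol UNIV n \<and> (\<lambda>x. 0) \<in> I \<and> (\<forall>f\<in>I. \<forall>g\<in>I. (\<lambda>x. f x + g x) \<in> I) \<and>
     (\<forall>f\<in>I. \<forall>g\<in>Pol UNIV n. (\<lambda>x. g x * f x) \<in> I)"

lemma pideal_add: "pideal n I \<Longrightarrow> f \<in> I \<Longrightarrow> g \<in> I \<Longrightarrow> (\<lambda>x. f x + g x) \<in> I"
  unfolding pideal_def by simp
lemma pideal_mult: "pideal n I \<Longrightarrow> f \<in> I \<Longrightarrow> g \<in> Pol UNIV n \<Longrightarrow> (\<lambda>x. g x * f x) \<in> I"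
  unfolding pideal_def by simp
lemma pideal_zero: "pideal n I \<Longrightarrow> (\<lambda>x. 0) \<in> I"
  unfolding pideal_def by simp
lemma pideal_Pol: "pideal n I \<Longrightarrow> f \<in> I \<Longrightarrow> f \<in> Pol UNIV n"
  unfolding pideal_def by (elim conjE) (rule subsetD)
lemma pideal_sum: 
  assumes "pideal n I" "\<And>i. i \<in> J \<Longrightarrow> f i \<in> I" shows "(\<lambda>x. \<Sum>i\<in>J. f i x) \<in> I"
  using assms(2)
proof (induct J rule: infinite_finite_induct)
  case (insert j J)
  then show ?case using pideal_add[OF assms(1)] by simp
qed (use pideal_zero[OF assms(1)] in simp_all)

lemma Pol_subst_last:
  assumes "f \<in> Pol S (Suc n)" "c \<in> S"
  shows "(\<lambda>x. f (x(n := c))) \<in> Pol S n"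
proof (rule Pol_comp[OF assms(1)])
  fix i assume "i < Suc n"
  then show "(\<lambda>x. (x(n := c)) i) \<in> Pol S n"
    using assms(2) by (cases "i = n") (auto intro: Pol_const Pol_var)
qed

text \<open>The factor theorem in the last variable: congruence modulo \<open>x n - c\<close> is
  compatible with sums and products.\<close>

lemma Pol_diff_subst_last:
  assumes "f \<in> Pol UNIV (Suc n)"
  shows "\<exists>h\<in>Pol UNIV (Suc n). \<forall>x. f x - f (x(n := c)) = (x n - c) * h x"
  using assms
proof induct
  case (Pol_const k)
  then show ?case by (intro bexI[of _ "\<lambda>x. 0"]) (auto intro: Pol.Pol_const)
next
  case (Pol_var i)
  show ?case
  proof (cases "i = n")
    case True
    then show ?thesis by (intro bexI[of _ "\<lambda>x. 1"]) (auto intro: Pol.Pol_const)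
  next
    case False
    then show ?thesis by (intro bexI[of _ "\<lambda>x. 0"]) (auto intro: Pol.Pol_const)
  qed
next
  case (Pol_add f g)
  from Pol_add(2,4) obtain h k where h: "h \<in> Pol UNIV (Suc n)" "\<And>x. f x - f (x(n := c)) = (x n - c) * h x"
    and k: "k \<in> Pol UNIV (Suc n)" "\<And>x. g x - g (x(n := c)) = (x n - c) * k x"
    by (elim bexE) (rule that, assumption, erule spec, assumption, erule spec)
  have eq: "f x + g x - (f (x(n := c)) + g (x(n := c))) = (x n - c) * (h x + k x)" for x
    using h(2)[of x] k(2)[of x] by (simp add: algebra_simps)
  show ?case by (rule bexI[OF _ Pol.Pol_add[OF h(1) k(1)]]) (rule allI, rule eq)
next
  case (Pol_mult f g)
  from Pol_mult(2,4) obtain h k where h: "h \<in> Pol UNIV (Suc n)" "\<And>x. f x - f (x(n := c)) = (x n - c) * h x"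
    and k: "k \<in> Pol UNIV (Suc n)" "\<And>x. g x - g (x(n := c)) = (x n - c) * k x"
    by (elim bexE) (rule that, assumption, erule spec, assumption, erule spec)
  have eq: "f x * g x - f (x(n := c)) * g (x(n := c)) = (x n - c) * (h x * g x + f (x(n := c)) * k x)" for x
  proof -
    have "f x * g x - f (x(n := c)) * g (x(n := c)) = (f x - f (x(n := c))) * g x + f (x(n := c)) * (g x - g (x(n := c)))"
      by (simp add: algebra_simps)
    then show ?thesis unfolding h(2) k(2) by (simp add: algebra_simps)
  qed
  have fc: "(\<lambda>x. f (x(n := c))) \<in> Pol UNIV (Suc n)"
    using Pol_subst_last[OF Pol_mult(1), of c] by (rule Pol_mono) auto
  show ?case
    by (rule bexI[OF _ Pol.Pol_add[OF Pol.Pol_mult[OF h(1) Pol_mult(3)] Pol.Pol_mult[OF fc k(1)]]]) (rule allI, rule eq)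
qed

lemma uncountable_complex: "uncountable (UNIV :: complex set)"
proof
  assume "countable (UNIV :: complex set)"
  then have "countable (range complex_of_real)" by (rule countable_subset[rotated]) simp
  then have "countable (UNIV :: real set)" by (rule countable_image_inj_on) (simp add: inj_on_def)
  then show False using uncountable_UNIV_real by simp
qed

lemma countable_fibres:
  fixes f :: "complex \<Rightarrow> 'a::countable"
  shows "\<exists>a. infinite {c. f c = a}"
proof (rule ccontr)
  assume "\<nexists>a. infinite {c. f c = a}"
  then have "countable (\<Union>a. {c. f c = a})" by (intro countable_UN) (auto intro: countable_finite)
  moreover have "(\<Union>a. {c. f c = a}) = UNIV" by auto
  ultimately show False using uncountable_complex by simp
qed

text \<open>Exponent vectors are coded by lists of naturals because these form a countable type, as
  \<open>countable_fibres\<close> requires; functions on the naturals do not.\<close>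

definition expo :: "nat list \<Rightarrow> nat \<Rightarrow> nat" where "expo xs i = (if i < length xs then xs ! i else 0)"

lemma Pol_expo_sum:
  assumes "f \<in> Pol UNIV n"
  shows "\<exists>xss a. f = (\<lambda>x. \<Sum>\<alpha>\<in>expo ` set xss. a \<alpha> * (\<Prod>i<n. x i ^ \<alpha> i))"
proof -
  have "monomial_sum UNIV n f" by (rule Pol_monomial_sum[OF assms]) auto
  then obtain T c where T: "finite T" "\<forall>\<alpha>\<in>T. \<forall>i\<ge>n. \<alpha> i = (0::nat)" "f = (\<lambda>x. \<Sum>\<alpha>\<in>T. c \<alpha> * (\<Prod>i<n. x i ^ \<alpha> i))"
    unfolding monomial_sum_def by auto
  have "expo (map \<alpha> [0..<n]) = \<alpha>" if "\<alpha> \<in> T" for \<alpha>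
    using T(2) that by (auto simp: expo_def fun_eq_iff)
  then have 1: "T = expo ` (\<lambda>\<alpha>. map \<alpha> [0..<n]) ` T" by (auto simp: image_image)
  obtain xss where "set xss = (\<lambda>\<alpha>. map \<alpha> [0..<n]) ` T" using finite_list[of "(\<lambda>\<alpha>. map \<alpha> [0..<n]) ` T"] T(1) by auto
  then have "T = expo ` set xss" using 1 by simp
  then show ?thesis using T(3) by (intro exI[of _ xss] exI[of _ c]) simp
qed

text \<open>Every \<open>x n - c\<close> has the inverse \<open>h c\<close> modulo \<open>I\<close>,
  so the linear factors of \<open>q\<close> can be cancelled one after another until a nonzero
  constant is left.\<close>

lemma univariate_in_pideal:
  assumes I: "pideal (Suc n) I" and h: "\<And>c. h c \<in> Pol UNIV (Suc n)" "\<And>c. (\<lambda>x. 1 - (x n - c) * h c x) \<in> I"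
    and q: "q \<noteq> 0" "(\<lambda>x. poly q (x n)) \<in> I"
  shows "(\<lambda>x. 1) \<in> I"
  using q
proof (induct "degree q" arbitrary: q rule: less_induct)
  case less
  show ?case
  proof (cases "degree q = 0")
    case True
    then obtain k where k: "q = [:k:]" by (metis degree_eq_zeroE)
    have "(\<lambda>x. inverse k * poly q (x n)) \<in> I"
      by (rule pideal_mult[OF I less(3)]) (rule Pol_const, simp)
    then show ?thesis using k less(2) by simp
  next
    case False
    then have "\<nexists>a l. a \<noteq> 0 \<and> l = 0 \<and> q = pCons a l" by (metis degree_pCons_0)
    then obtain b where b: "poly q b = 0" using fundamental_theorem_of_algebra_alt[of q] by auto
    then obtain r where r: "q = [:-b, 1:] * r" by (metis poly_eq_0_iff_dvd dvdE)
    have r0: "r \<noteq> 0" using less(2) r by auto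
    have "degree r < degree q" unfolding r using r0 by (subst degree_mult_eq) auto
    have rP: "(\<lambda>x. poly r (x n)) \<in> Pol UNIV (Suc n)"
      unfolding poly_altdef by (intro Pol_sum Pol_mult Pol_const Pol_power Pol_var) auto
    have "(\<lambda>x. h b x * poly q (x n) + poly r (x n) * (1 - (x n - b) * h b x)) \<in> I"
      by (rule pideal_add[OF I pideal_mult[OF I less(3) h(1)] pideal_mult[OF I h(2) rP]])
    moreover have "(\<lambda>x. h b x * poly q (x n) + poly r (x n) * (1 - (x n - b) * h b x)) = (\<lambda>x. poly r (x n))"
      unfolding r by (simp add: algebra_simps)
    ultimately have "(\<lambda>x. poly r (x n)) \<in> I" by simp
    then show ?thesis using less(1)[OF \<open>degree r < degree q\<close> r0] by simp
  qed
qed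

text \<open>The inverses of the uncountably many \<open>x n - c\<close> modulo \<open>I\<close> live in a space of countable
  dimension, hence are linearly dependent; clearing denominators gives a univariate element of \<open>I\<close>.\<close>

lemma exists_value_last:
  assumes I: "pideal (Suc n) I" and "(\<lambda>x. 1) \<notin> I"
  shows "\<exists>c. \<forall>h\<in>Pol UNIV (Suc n). (\<lambda>x. 1 - (x n - c) * h x) \<notin> I"
proof (rule ccontr)
  assume "\<not> ?thesis"
  then have "\<forall>c. \<exists>h. h \<in> Pol UNIV (Suc n) \<and> (\<lambda>x. 1 - (x n - c) * h x) \<in> I" by auto
  from choice[OF this] obtain h where h: "\<And>c. h c \<in> Pol UNIV (Suc n)" "\<And>c. (\<lambda>x. 1 - (x n - c) * h c x) \<in> I" by auto
  have "\<forall>c. \<exists>xss. \<exists>a. h c = (\<lambda>x. \<Sum>\<alpha>\<in>expo ` set xss. a \<alpha> * (\<Prod>i<Suc n. x i ^ \<alpha> i))" using Pol_expo_sum[OF h(1)] by auto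
  from choice[OF this] obtain X where "\<forall>c. \<exists>a. h c = (\<lambda>x. \<Sum>\<alpha>\<in>expo ` set (X c). a \<alpha> * (\<Prod>i<Suc n. x i ^ \<alpha> i))" by auto
  from choice[OF this] obtain a where a: "\<And>c. h c = (\<lambda>x. \<Sum>\<alpha>\<in>expo ` set (X c). a c \<alpha> * (\<Prod>i<Suc n. x i ^ \<alpha> i))" by auto
  \<comment> \<open>Infinitely many of the inverses \<open>h c\<close> involve only one and the same
    finite list of monomials.\<close>
  obtain xs where xs: "infinite {c. X c = xs}" using countable_fibres[of X] by auto
  define T where "T = expo ` set xs"
  obtain C where C: "C \<subseteq> {c. X c = xs}" "finite C" "card C = Suc (card T)"
    using infinite_arbitrarily_large[OF xs] by blast
  have hC: "h c x = (\<Sum>\<alpha>\<in>T. a c \<alpha> * (\<Prod>i<Suc n. x i ^ \<alpha> i))" if "c \<in> C" for c x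
  proof -
    have "X c = xs" using that C(1) by auto
    then show ?thesis using a[of c] unfolding T_def by simp
  qed
  have "finite T" unfolding T_def by simp
  from more_vectors_than_coordinates[OF this C(2), of a] C(3)
  obtain b where b: "\<exists>c\<in>C. b c \<noteq> 0" "\<forall>\<alpha>\<in>T. (\<Sum>c\<in>C. b c * a c \<alpha>) = 0" by auto
  have bh: "(\<Sum>c\<in>C. b c * h c x) = 0" for x
  proof -
    have "(\<Sum>c\<in>C. b c * h c x) = (\<Sum>c\<in>C. \<Sum>\<alpha>\<in>T. b c * a c \<alpha> * (\<Prod>i<Suc n. x i ^ \<alpha> i))"
      by (rule sum.cong) (simp_all only: hC sum_distrib_left mult.assoc)
    also have "\<dots> = (\<Sum>\<alpha>\<in>T. (\<Sum>c\<in>C. b c * a c \<alpha>) * (\<Prod>i<Suc n. x i ^ \<alpha> i))"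
      by (subst sum.swap) (simp only: sum_distrib_right)
    also have "\<dots> = 0" using b(2) by simp
    finally show ?thesis .
  qed
  \<comment> \<open>The dependency between the inverses, multiplied by all the
    \<open>x n - c\<close>. At the root \<open>k\<close> only the summand of \<open>k\<close>
    survives, so \<open>q\<close> is not zero.\<close>
  define q where "q = (\<Sum>c\<in>C. smult (b c) (\<Prod>c'\<in>C - {c}. [:-c', 1:]))"
  obtain k where k: "k \<in> C" "b k \<noteq> 0" using b(1) by auto
  have pq: "poly q t = (\<Sum>c\<in>C. b c * (\<Prod>c'\<in>C - {c}. t - c'))" for t
    unfolding q_def by (simp add: poly_sum poly_prod)
  have "poly q k = b k * (\<Prod>c'\<in>C - {k}. k - c') + (\<Sum>c\<in>C - {k}. b c * (\<Prod>c'\<in>C - {c}. k - c'))"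
    unfolding pq using k C(2) by (simp add: sum.remove)
  also have "(\<Sum>c\<in>C - {k}. b c * (\<Prod>c'\<in>C - {c}. k - c')) = 0"
  proof (rule sum.neutral, rule ballI)
    fix c assume "c \<in> C - {k}"
    then have "(\<Prod>c'\<in>C - {c}. k - c') = 0" using k C(2) by (intro prod_zero) auto
    then show "b c * (\<Prod>c'\<in>C - {c}. k - c') = 0" by simp
  qed
  finally have "poly q k \<noteq> 0" using k C(2) by simp
  then have q0: "q \<noteq> 0" by auto
  have "(\<lambda>x. \<Sum>c\<in>C. (b c * (\<Prod>c'\<in>C - {c}. x n - c')) * (1 - (x n - c) * h c x)) \<in> I"
    by (intro pideal_sum[OF I] pideal_mult[OF I h(2)] Pol_mult Pol_const Pol_prod Pol_diff Pol_var) auto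
  moreover have "(\<Sum>c\<in>C. (b c * (\<Prod>c'\<in>C - {c}. t - c')) * (1 - (t - c) * h c x)) = poly q t" for t x
  proof -
    have "(\<Sum>c\<in>C. (b c * (\<Prod>c'\<in>C - {c}. t - c')) * (1 - (t - c) * h c x))
      = (\<Sum>c\<in>C. b c * (\<Prod>c'\<in>C - {c}. t - c') - (\<Prod>c'\<in>C. t - c') * (b c * h c x))"
    proof (rule sum.cong[OF refl])
      fix c assume "c \<in> C"
      then have eq: "(\<Prod>c'\<in>C. t - c') = (t - c) * (\<Prod>c'\<in>C - {c}. t - c')" using C(2) by (rule prod.remove[rotated])
      show "(b c * (\<Prod>c'\<in>C - {c}. t - c')) * (1 - (t - c) * h c x) = b c * (\<Prod>c'\<in>C - {c}. t - c') - (\<Prod>c'\<in>C. t - c') * (b c * h c x)"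
        unfolding eq by (simp add: algebra_simps)
    qed
    also have "\<dots> = poly q t - (\<Prod>c'\<in>C. t - c') * (\<Sum>c\<in>C. b c * h c x)"
      unfolding pq by (simp add: sum_subtractf sum_distrib_left)
    finally show ?thesis using bh by simp
  qed
  ultimately have "(\<lambda>x. poly q (x n)) \<in> I" by simp
  then have "(\<lambda>x. 1) \<in> I" by (rule univariate_in_pideal[OF I h q0])
  then show False using assms(2) by simp
qed

text \<open>Induction on the number of variables: some value \<open>c\<close> of the last one leaves
  \<open>x n - c\<close> without an inverse modulo \<open>I\<close>, so that substituting it yields
  a proper ideal again.\<close>

theorem weak_nullstellensatz:
  assumes "pideal n I" "(\<lambda>x. 1) \<notin> I"
  shows "\<exists>\<xi>. \<forall>f\<in>I. f \<xi> = 0"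
  using assms
proof (induct n arbitrary: I)
  case 0
  have "f (\<lambda>_. 0) = 0" if f: "f \<in> I" for f
  proof (rule ccontr)
    assume nz: "f (\<lambda>_. 0) \<noteq> 0"
    have "(\<lambda>x. inverse (f (\<lambda>_. 0)) * f x) \<in> I"
      by (rule pideal_mult[OF 0(1) f]) (rule Pol_const, simp)
    moreover have "f x = f (\<lambda>_. 0)" for x by (rule Pol_local[OF pideal_Pol[OF 0(1) f]]) simp
    then have "(\<lambda>x. inverse (f (\<lambda>_. 0)) * f x) = (\<lambda>x. 1)" using nz by (metis left_inverse)
    ultimately show False using 0(2) by simp
  qed
  then show ?case by auto
next
  case (Suc n)
  note I = Suc(2)
  obtain c where c: "\<And>h. h \<in> Pol UNIV (Suc n) \<Longrightarrow> (\<lambda>x. 1 - (x n - c) * h x) \<notin> I"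
    using exists_value_last[OF Suc(2,3)] by auto
  define r where "r = (\<lambda>(f :: (nat \<Rightarrow> complex) \<Rightarrow> complex) x. f (x(n := c)))"
  define J where "J = r ` I"
  have "pideal n J" unfolding pideal_def
  proof (intro conjI ballI subsetI)
    fix f assume "f \<in> J"
    then obtain g where g: "f = r g" "g \<in> I" unfolding J_def by (rule imageE)
    show "f \<in> Pol UNIV n" unfolding g(1) r_def
      by (rule Pol_subst_last[OF pideal_Pol[OF I g(2)]]) simp
  next
    have "r (\<lambda>x. 0) \<in> J" unfolding J_def by (rule imageI[OF pideal_zero[OF I]])
    then show "(\<lambda>x. 0) \<in> J" unfolding r_def .
  next
    fix f g assume "f \<in> J" "g \<in> J"
    then obtain f' g' where *: "f = r f'" "f' \<in> I" "g = r g'" "g' \<in> I" unfolding J_def by (elim imageE) (rule that)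
    have "r (\<lambda>x. f' x + g' x) \<in> J" unfolding J_def by (rule imageI[OF pideal_add[OF I *(2,4)]])
    then show "(\<lambda>x. f x + g x) \<in> J" unfolding * r_def .
  next
    fix f g :: "(nat \<Rightarrow> complex) \<Rightarrow> complex" assume "f \<in> J" and g: "g \<in> Pol UNIV n"
    then obtain f' where *: "f = r f'" "f' \<in> I" unfolding J_def by (elim imageE) (rule that)
    have gS: "g \<in> Pol UNIV (Suc n)" by (rule Pol_mono[OF g]) auto
    have "r (\<lambda>x. g x * f' x) \<in> J" unfolding J_def by (rule imageI[OF pideal_mult[OF I *(2) gS]])
    moreover have "g (x(n := c)) = g x" for x by (rule Pol_local[OF g]) simp
    ultimately show "(\<lambda>x. g x * f x) \<in> J" unfolding * r_def by simp
  qed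
  moreover have "(\<lambda>x. 1) \<notin> J"
  proof
    assume "(\<lambda>x. 1) \<in> J"
    then obtain f where f: "(\<lambda>x. 1) = r f" "f \<in> I" unfolding J_def by (rule imageE)
    obtain h where h: "h \<in> Pol UNIV (Suc n)" "\<And>x. f x - f (x(n := c)) = (x n - c) * h x"
      using Pol_diff_subst_last[OF pideal_Pol[OF I f(2)], of c] by auto
    have "f x = 1 - (x n - c) * (- h x)" for x
      using h(2)[of x] fun_cong[OF f(1), of x] unfolding r_def by (simp add: algebra_simps)
    then have "(\<lambda>x. 1 - (x n - c) * (- h x)) = f" by auto
    moreover have "(\<lambda>x. - h x) \<in> Pol UNIV (Suc n)" using h(1) by (intro Pol_uminus) simp
    ultimately show False using c[of "\<lambda>x. - h x"] f(2) by simp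
  qed
  ultimately obtain \<xi> where \<xi>: "\<forall>f\<in>J. f \<xi> = 0" using Suc(1)[of J] by auto
  have "f (\<xi>(n := c)) = 0" if "f \<in> I" for f
  proof -
    have "r f \<in> J" unfolding J_def using that by (rule imageI)
    then show ?thesis using \<xi> unfolding r_def by auto
  qed
  then show ?case by auto
qed

text \<open>Preparation for Rabinowitsch's substitution. All exponents from \<open>D\<close> on are
  allowed so that finitely many polynomials can share one.\<close>

lemma Pol_clear_denominator:
  assumes "g \<in> Pol UNIV (Suc n)" "i < n"
  shows "\<exists>D. \<forall>E\<ge>D. \<exists>g'\<in>Pol UNIV n. \<forall>x. x i \<noteq> 0 \<longrightarrow> x i ^ E * g (x(n := 1 / x i)) = g' x"
  using assms(1)
proof induct
  case (Pol_const c)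
  have "\<exists>g'\<in>Pol UNIV n. \<forall>x. x i \<noteq> 0 \<longrightarrow> x i ^ E * c = g' x" for E
    using assms(2) by (intro bexI[of _ "\<lambda>x. x i ^ E * c"] Pol_mult Pol_power Pol.Pol_var Pol.Pol_const) auto
  then show ?case by auto
next
  case (Pol_var k)
  show ?case
  proof (cases "k = n")
    case True
    have "\<exists>g'\<in>Pol UNIV n. \<forall>x. x i \<noteq> 0 \<longrightarrow> x i ^ E * (x(n := 1 / x i)) k = g' x" if "E \<ge> 1" for E
      using assms(2) True that by (intro bexI[of _ "\<lambda>x. x i ^ (E - 1)"] Pol_power Pol.Pol_var) (auto simp: power_diff)
    then show ?thesis by blast
  next
    case False
    have "\<exists>g'\<in>Pol UNIV n. \<forall>x. x i \<noteq> 0 \<longrightarrow> x i ^ E * (x(n := 1 / x i)) k = g' x" for E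
      using assms(2) False Pol_var by (intro bexI[of _ "\<lambda>x. x i ^ E * x k"] Pol_mult Pol_power Pol.Pol_var) auto
    then show ?thesis by auto
  qed
next
  case (Pol_add f g)
  from Pol_add(2,4) obtain D D' where D: "\<And>E. E \<ge> D \<Longrightarrow> \<exists>g'\<in>Pol UNIV n. \<forall>x. x i \<noteq> 0 \<longrightarrow> x i ^ E * f (x(n := 1 / x i)) = g' x"
    "\<And>E. E \<ge> D' \<Longrightarrow> \<exists>g'\<in>Pol UNIV n. \<forall>x. x i \<noteq> 0 \<longrightarrow> x i ^ E * g (x(n := 1 / x i)) = g' x"
    by (elim exE) (rule that, erule allE, erule (1) mp, erule allE, erule (1) mp)
  show ?case
  proof (intro exI[of _ "max D D'"] allI impI)
    fix E assume "max D D' \<le> E"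
    then obtain f' g' where "f' \<in> Pol UNIV n" "\<forall>x. x i \<noteq> 0 \<longrightarrow> x i ^ E * f (x(n := 1 / x i)) = f' x"
      "g' \<in> Pol UNIV n" "\<forall>x. x i \<noteq> 0 \<longrightarrow> x i ^ E * g (x(n := 1 / x i)) = g' x" using D[of E] by auto
    then show "\<exists>g'\<in>Pol UNIV n. \<forall>x. x i \<noteq> 0 \<longrightarrow> x i ^ E * (f (x(n := 1 / x i)) + g (x(n := 1 / x i))) = g' x"
      by (intro bexI[of _ "\<lambda>x. f' x + g' x"] Pol.Pol_add) (auto simp: distrib_left)
  qed
next
  case (Pol_mult f g)
  from Pol_mult(2,4) obtain D D' where D: "\<And>E. E \<ge> D \<Longrightarrow> \<exists>g'\<in>Pol UNIV n. \<forall>x. x i \<noteq> 0 \<longrightarrow> x i ^ E * f (x(n := 1 / x i)) = g' x"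
    "\<And>E. E \<ge> D' \<Longrightarrow> \<exists>g'\<in>Pol UNIV n. \<forall>x. x i \<noteq> 0 \<longrightarrow> x i ^ E * g (x(n := 1 / x i)) = g' x"
    by (elim exE) (rule that, erule allE, erule (1) mp, erule allE, erule (1) mp)
  show ?case
  proof (intro exI[of _ "D + D'"] allI impI)
    fix E assume E: "D + D' \<le> E"
    then have E': "D' \<le> E - D" by simp
    obtain f' g' where *: "f' \<in> Pol UNIV n" "\<forall>x. x i \<noteq> 0 \<longrightarrow> x i ^ D * f (x(n := 1 / x i)) = f' x"
      "g' \<in> Pol UNIV n" "\<forall>x. x i \<noteq> 0 \<longrightarrow> x i ^ (E - D) * g (x(n := 1 / x i)) = g' x" 
      using D(1)[OF order.refl] D(2)[OF E'] by (elim bexE) (rule that)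
    have "x i ^ E * (f (x(n := 1 / x i)) * g (x(n := 1 / x i))) = f' x * g' x" if "x i \<noteq> 0" for x
    proof -
      have "x i ^ E = x i ^ D * x i ^ (E - D)" using E by (simp flip: power_add)
      then have "x i ^ E * (f (x(n := 1 / x i)) * g (x(n := 1 / x i))) = (x i ^ D * f (x(n := 1 / x i))) * (x i ^ (E - D) * g (x(n := 1 / x i)))"
        by (simp only: mult_ac)
      then show ?thesis using * that by simp
    qed
    then show "\<exists>g'\<in>Pol UNIV n. \<forall>x. x i \<noteq> 0 \<longrightarrow> x i ^ E * (f (x(n := 1 / x i)) * g (x(n := 1 / x i))) = g' x"
      by (intro bexI[of _ "\<lambda>x. f' x * g' x"] Pol.Pol_mult * allI impI)
  qed
qed

lemma nullstellensatz_coordinate: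
  assumes F: "\<And>j. j \<le> N \<Longrightarrow> F j \<in> Pol UNIV n" and i: "i < n"
    and nz: "\<And>x. (\<And>j. j \<le> N \<Longrightarrow> F j x = 0) \<Longrightarrow> x i = 0"
  shows "\<exists>D g. (\<forall>j\<le>(N::nat). g j \<in> Pol UNIV n) \<and> (\<forall>x. x i ^ D = (\<Sum>j\<le>N. g j x * F j x))"
proof -
  let ?P = "Pol UNIV (Suc n)"
  \<comment> \<open>Rabinowitsch's trick: the extra variable \<open>x n\<close> plays the inverse of
    \<open>x i\<close>, so a zero of this ideal would have \<open>x i\<close> nonzero although all
    \<open>F j\<close> vanish there.\<close>
  define comb where "comb = (\<lambda>g h (x :: nat \<Rightarrow> complex). (\<Sum>j\<le>N. g j x * F j x) + h x * (x i * x n - 1))"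
  define I where "I = {comb g h | g h. (\<forall>j\<le>N. g j \<in> ?P) \<and> h \<in> ?P}"
  have FS: "F j \<in> ?P" if "j \<le> N" for j by (rule Pol_mono[OF F[OF that]]) auto
  have II: "comb g h \<in> I" if "\<And>j. j \<le> N \<Longrightarrow> g j \<in> ?P" "h \<in> ?P" for g h 
    unfolding I_def using that by auto
  have IE: "\<exists>g h. f = comb g h \<and> (\<forall>j\<le>N. g j \<in> ?P) \<and> h \<in> ?P" if "f \<in> I" for f using that unfolding I_def by simp
  have c: "(\<lambda>x. k) \<in> ?P" for k by (rule Pol_const) simp
  have pI: "pideal (Suc n) I" unfolding pideal_def
  proof (intro conjI ballI subsetI)
    fix f assume "f \<in> I"
    from IE[OF this] obtain g h where "f = comb g h" "\<forall>j\<le>N. g j \<in> ?P" "h \<in> ?P" by (elim exE conjE) (rule that)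
    then show "f \<in> ?P" unfolding comb_def using i FS
      by (auto intro!: Pol_add Pol_mult Pol_diff Pol_sum Pol_var c)
  next
    have "comb (\<lambda>j x. 0) (\<lambda>x. 0) \<in> I" by (rule II) (rule c)+
    then show "(\<lambda>x. 0) \<in> I" unfolding comb_def by simp
  next
    fix f f' assume "f \<in> I" "f' \<in> I"
    then obtain g h g' h' where *: "f = comb g h" "\<forall>j\<le>N. g j \<in> ?P" "h \<in> ?P" "f' = comb g' h'" "\<forall>j\<le>N. g' j \<in> ?P" "h' \<in> ?P" 
      using IE[OF \<open>f \<in> I\<close>] IE[OF \<open>f' \<in> I\<close>] by (elim exE conjE) (rule that)
    have "comb (\<lambda>j x. g j x + g' j x) (\<lambda>x. h x + h' x) \<in> I" using * by (intro II Pol_add) auto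
    moreover have "comb (\<lambda>j x. g j x + g' j x) (\<lambda>x. h x + h' x) = (\<lambda>x. f x + f' x)"
      unfolding *(1,4) comb_def by (simp add: algebra_simps sum.distrib)
    ultimately show "(\<lambda>x. f x + f' x) \<in> I" by simp
  next
    fix f k assume "f \<in> I" and k: "k \<in> ?P"
    from IE[OF this(1)] obtain g h where *: "f = comb g h" "\<forall>j\<le>N. g j \<in> ?P" "h \<in> ?P" by (elim exE conjE) (rule that)
    have "comb (\<lambda>j x. k x * g j x) (\<lambda>x. k x * h x) \<in> I" using * k by (intro II Pol_mult) auto
    moreover have "comb (\<lambda>j x. k x * g j x) (\<lambda>x. k x * h x) = (\<lambda>x. k x * f x)"
      unfolding *(1) comb_def by (simp add: algebra_simps sum_distrib_left)
    ultimately show "(\<lambda>x. k x * f x) \<in> I" by simp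
  qed
  have "(\<lambda>x. 1) \<in> I"
  proof (rule ccontr)
    assume "(\<lambda>x. 1) \<notin> I"
    then obtain \<xi> where \<xi>: "\<And>f. f \<in> I \<Longrightarrow> f \<xi> = 0" using weak_nullstellensatz[OF pI] by auto
    have "F j \<xi> = 0" if j: "j \<le> N" for j
    proof -
      have "comb (\<lambda>k x. if k = j then 1 else 0) (\<lambda>x. 0) \<in> I"
      proof (rule II)
        show "(\<lambda>x. if k = j then 1 else 0) \<in> ?P" for k by (cases "k = j") (simp_all add: c)
      qed (rule c)
      from \<xi>[OF this] show ?thesis unfolding comb_def using j by (simp add: if_distrib[of "\<lambda>u. u * _"] cong: if_cong)
    qed
    then have z: "\<xi> i = 0" using nz by simp
    have "comb (\<lambda>k x. 0) (\<lambda>x. 1) \<in> I" by (rule II) (rule c)+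
    from \<xi>[OF this] show False unfolding comb_def using z by simp
  qed
  from IE[OF this] obtain g h where gh: "(\<lambda>x. 1) = comb g h" "\<And>j. j \<le> N \<Longrightarrow> g j \<in> ?P"
    by (elim exE conjE) (rule that, assumption, erule allE, erule (1) mp)
  have "\<forall>j. \<exists>D. j \<le> N \<longrightarrow> (\<forall>E\<ge>D. \<exists>g'\<in>Pol UNIV n. \<forall>x. x i \<noteq> 0 \<longrightarrow> x i ^ E * g j (x(n := 1 / x i)) = g' x)"
    using Pol_clear_denominator[OF gh(2) i] by auto
  from choice[OF this] obtain D where D: "\<And>j E. j \<le> N \<Longrightarrow> E \<ge> D j \<Longrightarrow> \<exists>g'\<in>Pol UNIV n. \<forall>x. x i \<noteq> 0 \<longrightarrow> x i ^ E * g j (x(n := 1 / x i)) = g' x"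
    by auto
  define E where "E = (\<Sum>j\<le>N. D j)"
  have "D j \<le> E" if "j \<le> N" for j unfolding E_def using that by (intro member_le_sum) auto
  then have "\<forall>j. \<exists>g'. j \<le> N \<longrightarrow> g' \<in> Pol UNIV n \<and> (\<forall>x. x i \<noteq> 0 \<longrightarrow> x i ^ E * g j (x(n := 1 / x i)) = g' x)"
    using D by blast
  from choice[OF this] obtain g' where g': "\<And>j. j \<le> N \<Longrightarrow> g' j \<in> Pol UNIV n"
     "\<And>j x. j \<le> N \<Longrightarrow> x i \<noteq> 0 \<Longrightarrow> x i ^ E * g j (x(n := 1 / x i)) = g' j x" by auto
  \<comment> \<open>One more factor \<open>x i\<close> makes the identity true also where
    \<open>x i = 0\<close>.\<close>
  have "x i ^ Suc E = (\<Sum>j\<le>N. (x i * g' j x) * F j x)" for x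
  proof (cases "x i = 0")
    case False
    have "1 = comb g h (x(n := 1 / x i))" using fun_cong[OF gh(1), of "x(n := 1 / x i)"] by simp
    also have "\<dots> = (\<Sum>j\<le>N. g j (x(n := 1 / x i)) * F j (x(n := 1 / x i)))" unfolding comb_def using False i by simp
    also have "\<dots> = (\<Sum>j\<le>N. g j (x(n := 1 / x i)) * F j x)"
    proof (rule sum.cong[OF refl])
      fix j assume "j \<in> {..N}"
      then have "F j (x(n := 1 / x i)) = F j x" by (intro Pol_local[OF F]) auto
      then show "g j (x(n := 1 / x i)) * F j (x(n := 1 / x i)) = g j (x(n := 1 / x i)) * F j x" by simp
    qed
    finally have "x i ^ Suc E * 1 = x i ^ Suc E * (\<Sum>j\<le>N. g j (x(n := 1 / x i)) * F j x)" by simp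
    also have "\<dots> = (\<Sum>j\<le>N. (x i * (x i ^ E * g j (x(n := 1 / x i)))) * F j x)"
      by (simp add: sum_distrib_left mult_ac)
    also have "\<dots> = (\<Sum>j\<le>N. (x i * g' j x) * F j x)" using g'(2) False by (intro sum.cong) auto
    finally show ?thesis by simp
  qed simp
  then show ?thesis using g'(1) i by (intro exI[of _ "Suc E"] exI[of _ "\<lambda>j x. x i * g' j x"]) (auto intro!: Pol_mult Pol_var)
qed

text \<open>A projection, linear over the algebraic numbers, from the span of 1 and the
  \<open>c i\<close> to the span of 1, given by its values \<open>\<pi> i\<close>. If
  \<open>c k\<close> depends on the earlier ones its image is forced; otherwise 0 is a possible
  image.\<close>

lemma algebraic_linear_retraction:
  fixes c :: "'i \<Rightarrow> complex"
  assumes "finite I"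
  shows "\<exists>\<pi>. (\<forall>i\<in>I. algebraic (\<pi> i)) \<and> (\<forall>a0 a. algebraic a0 \<and> (\<forall>i\<in>I. algebraic (a i)) \<and> a0 + (\<Sum>i\<in>I. a i * c i) = 0 \<longrightarrow>
     a0 + (\<Sum>i\<in>I. a i * \<pi> i) = 0)"
  using assms
proof (induct I rule: finite_induct)
  case (insert k I)
  then obtain \<pi> where \<pi>: "\<And>i. i \<in> I \<Longrightarrow> algebraic (\<pi> i)" 
    "\<And>a0 a. algebraic a0 \<Longrightarrow> (\<And>i. i \<in> I \<Longrightarrow> algebraic (a i)) \<Longrightarrow> a0 + (\<Sum>i\<in>I. a i * c i) = 0 \<Longrightarrow> a0 + (\<Sum>i\<in>I. a i * \<pi> i) = 0"
    by (elim exE conjE) (rule that, erule (1) bspec, erule allE, erule allE, erule mp, simp)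
  have upd: "(\<Sum>i\<in>I. f i ((\<pi>(k := t)) i)) = (\<Sum>i\<in>I. f i (\<pi> i))" for f t
    using insert(2) by (intro sum.cong) auto
  show ?case
  proof (cases "\<exists>b0 b. algebraic b0 \<and> (\<forall>i\<in>I. algebraic (b i)) \<and> c k = b0 + (\<Sum>i\<in>I. b i * c i)")
    case True
    then obtain b0 b where b: "algebraic b0" "\<And>i. i \<in> I \<Longrightarrow> algebraic (b i)" "c k = b0 + (\<Sum>i\<in>I. b i * c i)" by auto
    define t where "t = b0 + (\<Sum>i\<in>I. b i * \<pi> i)"
    have "a0 + (\<Sum>i\<in>insert k I. a i * (\<pi>(k := t)) i) = 0"
      if a: "algebraic a0" "\<forall>i\<in>insert k I. algebraic (a i)" "a0 + (\<Sum>i\<in>insert k I. a i * c i) = 0" for a0 a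
    proof -
      have "(a0 + a k * b0) + (\<Sum>i\<in>I. (a i + a k * b i) * c i) = 0"
        using a(3) insert(1,2) b(3) by (simp add: algebra_simps sum.distrib sum_distrib_left)
      then have "(a0 + a k * b0) + (\<Sum>i\<in>I. (a i + a k * b i) * \<pi> i) = 0"
        using a b by (intro \<pi>(2)) auto
      then show ?thesis using insert(1,2) upd[of "\<lambda>i x. a i * x"] unfolding t_def
        by (simp add: algebra_simps sum.distrib sum_distrib_left)
    qed
    moreover have "algebraic t" unfolding t_def by (intro algebraic_add algebraic_sum algebraic_mult b \<pi>(1))
    then have "algebraic ((\<pi>(k := t)) i)" if "i \<in> insert k I" for i
      using that \<pi>(1) insert(2) by auto
    ultimately show ?thesis by (intro exI[of _ "\<pi>(k := t)"]) simp
  next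
    case False
    have "a0 + (\<Sum>i\<in>insert k I. a i * (\<pi>(k := 0)) i) = 0"
      if a: "algebraic a0" "\<forall>i\<in>insert k I. algebraic (a i)" "a0 + (\<Sum>i\<in>insert k I. a i * c i) = 0" for a0 a
    proof -
      have eq: "a k * c k + (a0 + (\<Sum>i\<in>I. a i * c i)) = 0" using a(3) insert(1,2) by (simp add: algebra_simps)
      have "a k = 0"
      proof (rule ccontr)
        assume "a k \<noteq> 0"
        define S where "S = (\<Sum>i\<in>I. a i * c i)"
        have "(\<Sum>i\<in>I. (- a i / a k) * c i) = - S / a k"
          unfolding S_def by (simp add: sum_negf sum_divide_distrib)
        moreover have "a k * c k = - a0 - S" using eq unfolding S_def[symmetric] by (simp add: algebra_simps eq_neg_iff_add_eq_0)
        then have "c k = (- a0 - S) / a k" using \<open>a k \<noteq> 0\<close> by (simp add: eq_divide_eq mult.commute)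
        ultimately have "c k = (- a0 / a k) + (\<Sum>i\<in>I. (- a i / a k) * c i)"
          by (simp add: diff_divide_distrib)
        moreover have "algebraic (- a0 / a k)" "\<forall>i\<in>I. algebraic (- a i / a k)" using a by auto
        ultimately show False using False
          by (elim notE) (rule exI[of _ "- a0 / a k"], rule exI[of _ "\<lambda>i. - a i / a k"], simp)
      qed
      then have "a0 + (\<Sum>i\<in>I. a i * c i) = 0" using eq by simp
      then have "a0 + (\<Sum>i\<in>I. a i * \<pi> i) = 0" using a by (intro \<pi>(2)) auto
      then show ?thesis using insert(1,2) upd[of "\<lambda>i x. a i * x"] \<open>a k = 0\<close> by simp
    qed
    moreover have "algebraic ((\<pi>(k := 0)) i)" if "i \<in> insert k I" for i
      using that \<pi>(1) insert(2) by auto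
    ultimately show ?thesis by (intro exI[of _ "\<pi>(k := 0)"]) simp
  qed
qed simp

lemma (in place) Pol_congruent:
  assumes "f \<in> Pol S n" "S \<subseteq> A" "\<And>i. i < n \<Longrightarrow> x i \<in> A" "\<And>i. i < n \<Longrightarrow> y i \<in> A" "\<And>i. i < n \<Longrightarrow> x i - y i \<in> m"
  shows "f x - f y \<in> m"
proof -
  have "f x \<in> A \<and> f y \<in> A \<and> f x - f y \<in> m" using assms(1)
  proof induct
    case (Pol_add f g)
    then have "(f x - f y) + (g x - g y) \<in> m" by (intro m_add) auto
    then show ?case using Pol_add by (auto intro: add simp: algebra_simps)
  next
    case (Pol_mult f g)
    then have "f x * (g x - g y) + g y * (f x - f y) \<in> m" by (intro m_add m_mult) auto
    then show ?case using Pol_mult by (auto intro: mult simp: algebra_simps)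
  qed (use assms in auto)
  then show ?thesis by simp
qed

lemma (in place) algebraic_in_m:
  assumes "{x. algebraic x} \<subseteq> A" "algebraic c" "c \<in> m" shows "c = 0"
proof (rule ccontr)
  assume "c \<noteq> 0"
  have "inverse c \<in> A" using assms(1,2) by auto
  then have "inverse c * c \<in> m" using assms(3) by (rule m_mult)
  then show False using one_notin \<open>c \<noteq> 0\<close> by simp
qed

lemma alg_hpoly_Pol: "alg_hpoly N d c \<Longrightarrow> heval N d c \<in> Pol {x. algebraic x} (Suc N)"
  unfolding alg_hpoly_def by (intro heval_Pol) auto

text \<open>\<open>endo\<close> excludes only algebraic common zeros. A complex one, scaled to be
  integral with an entry 1, would reduce at a place with algebraic residue field to a nonzero
  algebraic one.\<close>

lemma endo_no_common_zero:
  assumes "endo N d F" "\<And>j. j \<le> N \<Longrightarrow> heval N d (F j) x = 0" "i \<le> N"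
  shows "x i = 0"
proof (rule ccontr)
  assume "x i \<noteq> 0"
  obtain A m where pl: "place A m" and alg: "{x. algebraic x} \<subseteq> A" and res: "\<And>a. a \<in> A \<Longrightarrow> \<exists>c. algebraic c \<and> a - c \<in> m"
    using place_over_algebraic by auto
  interpret place A m by fact
  obtain k where k: "k \<le> N" "x k \<noteq> 0" "\<And>j. j \<le> N \<Longrightarrow> x j / x k \<in> A"
    using exists_max_entry[of "{..N}" x] \<open>x i \<noteq> 0\<close> assms(3) by auto
  define u where "u = (\<lambda>j. inverse (x k) * x j)"
  have uA: "u j \<in> A" if "j \<le> N" for j using k(3)[OF that] unfolding u_def by (simp add: field_simps)
  have "\<forall>j. \<exists>c. j \<le> N \<longrightarrow> algebraic c \<and> u j - c \<in> m" using res uA by auto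
  from choice[OF this] obtain c where c: "\<And>j. j \<le> N \<Longrightarrow> algebraic (c j) \<and> u j - c j \<in> m" by auto
  define v where "v = (\<lambda>j. if j \<le> N then c j else 0)"
  have v: "alg_vec N v" unfolding alg_vec_def is_vec_def v_def using c by auto
  have "heval N d (F j) v = 0" if j: "j \<le> N" for j
  proof -
    have P: "heval N d (F j) \<in> Pol {x. algebraic x} (Suc N)" using assms(1) j unfolding endo_def by (intro alg_hpoly_Pol) auto
    have "heval N d (F j) u = 0" unfolding u_def heval_scale using assms(2)[OF j] by simp
    moreover have "heval N d (F j) u - heval N d (F j) v \<in> m"
    proof (rule Pol_congruent[OF P alg])
      fix i assume "i < Suc N"
      then have i: "i \<le> N" by simp
      show "u i \<in> A" by (rule uA[OF i])
      show "v i \<in> A" using c[OF i] alg i unfolding v_def by auto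
      show "u i - v i \<in> m" using c[OF i] i unfolding v_def by auto
    qed
    ultimately have "heval N d (F j) v \<in> m" using m_minus by fastforce
    moreover have "algebraic (heval N d (F j) v)" using v assms(1) j unfolding endo_def by (intro alg_vec_heval) auto
    ultimately show ?thesis using algebraic_in_m[OF alg] by simp
  qed
  then have "v = (\<lambda>_. 0)" using assms(1) v unfolding endo_def by simp
  then have "c k = 0" using k(1) unfolding v_def by (metis)
  then have "u k \<in> m" using c[OF k(1)] by simp
  then show False using one_notin k(2) unfolding u_def by simp
qed

text \<open>The complex identity is pushed down by the retraction: at a point with natural
  coordinates it is an affine relation with algebraic coefficients between the coefficients of the
  \<open>g j\<close>, hence survives, and such points determine a polynomial.\<close>

theorem endo_nullstellensatz:
  assumes "endo N d F" "i \<le> N"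
  shows "\<exists>D g. (\<forall>j\<le>N. g j \<in> Pol {x. algebraic x} (Suc N)) \<and> (\<forall>x. x i ^ D = (\<Sum>j\<le>N. g j x * heval N d (F j) x))"
proof -
  have alg: "alg_hpoly N d (F j)" if "j \<le> N" for j using assms(1) that unfolding endo_def by simp
  have FP: "heval N d (F j) \<in> Pol UNIV (Suc N)" if "j \<le> N" for j using alg_hpoly_Pol[OF alg[OF that]] by (rule Pol_mono) auto
  have "x i = 0" if "\<And>j. j \<le> N \<Longrightarrow> heval N d (F j) x = 0" for x
    using endo_no_common_zero[OF assms(1) that assms(2)] by simp
  with FP assms(2) have "\<exists>D g. (\<forall>j\<le>N. g j \<in> Pol UNIV (Suc N)) \<and> (\<forall>x. x i ^ D = (\<Sum>j\<le>N. g j x * heval N d (F j) x))"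
    by (intro nullstellensatz_coordinate) simp_all
  then obtain D g where g: "\<And>j. j \<le> N \<Longrightarrow> g j \<in> Pol UNIV (Suc N)" and id: "\<And>x. x i ^ D = (\<Sum>j\<le>N. g j x * heval N d (F j) x)"
    by (elim exE conjE) (rule that, erule allE, erule (1) mp, erule spec)
  have "\<forall>j. \<exists>T. \<exists>c. j \<le> N \<longrightarrow> finite T \<and> g j = (\<lambda>x. \<Sum>\<alpha>\<in>T. c \<alpha> * (\<Prod>i<Suc N. x i ^ (\<alpha> i :: nat)))"
  proof
    fix j show "\<exists>T. \<exists>c. j \<le> N \<longrightarrow> finite T \<and> g j = (\<lambda>x. \<Sum>\<alpha>\<in>T. c \<alpha> * (\<Prod>i<Suc N. x i ^ (\<alpha> i :: nat)))"
    proof (cases "j \<le> N")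
      case True
      have "monomial_sum UNIV (Suc N) (g j)" by (rule Pol_monomial_sum[OF g[OF True]]) auto
      then show ?thesis unfolding monomial_sum_def by auto
    qed simp
  qed
  from choice[OF this] obtain T where "\<forall>j. \<exists>c. j \<le> N \<longrightarrow> finite (T j) \<and> g j = (\<lambda>x. \<Sum>\<alpha>\<in>T j. c \<alpha> * (\<Prod>i<Suc N. x i ^ (\<alpha> i :: nat)))" by auto
  from choice[OF this] obtain c where T: "\<And>j. j \<le> N \<Longrightarrow> finite (T j)" 
     and gj: "\<And>j. j \<le> N \<Longrightarrow> g j = (\<lambda>x. \<Sum>\<alpha>\<in>T j. c j \<alpha> * (\<Prod>i<Suc N. x i ^ (\<alpha> i :: nat)))" by auto
  define Z where "Z = (SIGMA j:{..N}. T j)"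
  have "finite Z" unfolding Z_def using T by auto
  from algebraic_linear_retraction[OF this, of "\<lambda>p. c (fst p) (snd p)"]
  obtain \<pi> where \<pi>: "\<And>p. p \<in> Z \<Longrightarrow> algebraic (\<pi> p)" 
    "\<And>a0 a. algebraic a0 \<Longrightarrow> \<forall>p\<in>Z. algebraic (a p) \<Longrightarrow> a0 + (\<Sum>p\<in>Z. a p * c (fst p) (snd p)) = 0 \<Longrightarrow> a0 + (\<Sum>p\<in>Z. a p * \<pi> p) = 0"
    by (elim exE conjE) (rule that, erule (1) bspec, erule allE, erule allE, erule mp, simp)
  define G where "G = (\<lambda>j x. \<Sum>\<alpha>\<in>T j. \<pi> (j, \<alpha>) * (\<Prod>i<Suc N. x i ^ (\<alpha> i :: nat)))"
  have GP: "G j \<in> Pol {x. algebraic x} (Suc N)" if "j \<le> N" for j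
    unfolding G_def using \<pi>(1) that by (intro Pol_sum Pol_mult Pol_const Pol_prod Pol_power Pol_var) (auto simp: Z_def)
  have flat: "(\<Sum>j\<le>N. (\<Sum>\<alpha>\<in>T j. e j \<alpha> * (\<Prod>i<Suc N. x i ^ (\<alpha> i :: nat))) * heval N d (F j) x)
    = (\<Sum>p\<in>Z. ((\<Prod>i<Suc N. x i ^ snd p i) * heval N d (F (fst p)) x) * e (fst p) (snd p))" for e x
  proof -
    have "(\<Sum>j\<le>N. (\<Sum>\<alpha>\<in>T j. e j \<alpha> * (\<Prod>i<Suc N. x i ^ (\<alpha> i :: nat))) * heval N d (F j) x)
      = (\<Sum>j\<le>N. \<Sum>\<alpha>\<in>T j. ((\<Prod>i<Suc N. x i ^ \<alpha> i) * heval N d (F j) x) * e j \<alpha>)"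
      by (simp only: sum_distrib_right) (simp only: mult_ac)
    also have "\<dots> = (\<Sum>p\<in>Z. ((\<Prod>i<Suc N. x i ^ snd p i) * heval N d (F (fst p)) x) * e (fst p) (snd p))"
      unfolding Z_def by (subst sum.Sigma) (use T in \<open>auto simp: case_prod_unfold\<close>)
    finally show ?thesis .
  qed
  define H where "H = (\<lambda>x. - (x i ^ D) + (\<Sum>j\<le>N. G j x * heval N d (F j) x))"
  have HP: "H \<in> Pol UNIV (Suc N)"
  proof -
    have "G j \<in> Pol UNIV (Suc N)" if "j \<le> N" for j using GP[OF that] by (rule Pol_mono) auto
    then show ?thesis unfolding H_def using FP assms(2)
      by (intro Pol_add Pol_uminus Pol_sum Pol_mult Pol_power Pol_var) auto
  qed
  have Hg: "H x = 0" if x: "\<And>i. i < Suc N \<Longrightarrow> x i \<in> range of_nat" for x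
  proof -
    define v where "v = (\<lambda>j. if j \<le> N then x j else 0)"
    have vx: "v j = x j" if "j < Suc N" for j using that unfolding v_def by simp
    have av: "algebraic (v j)" for j using x[of j] unfolding v_def by auto
    have v: "alg_vec N v" unfolding alg_vec_def is_vec_def by (intro conjI allI impI av) (simp add: v_def)
    have "- (v i ^ D) + (\<Sum>p\<in>Z. ((\<Prod>i<Suc N. v i ^ snd p i) * heval N d (F (fst p)) v) * \<pi> p) = 0"
    proof (rule \<pi>(2))
      show "algebraic (- (v i ^ D))" using av by auto
      show "\<forall>p\<in>Z. algebraic ((\<Prod>i<Suc N. v i ^ snd p i) * heval N d (F (fst p)) v)"
        using av alg v unfolding Z_def by (auto intro!: algebraic_mult algebraic_prod algebraic_power alg_vec_heval)
      have "v i ^ D = (\<Sum>j\<le>N. (\<Sum>\<alpha>\<in>T j. c j \<alpha> * (\<Prod>i<Suc N. v i ^ \<alpha> i)) * heval N d (F j) v)"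
        unfolding id by (rule sum.cong) (simp_all add: gj)
      then show "- (v i ^ D) + (\<Sum>p\<in>Z. (\<Prod>i<Suc N. v i ^ snd p i) * heval N d (F (fst p)) v * c (fst p) (snd p)) = 0"
        unfolding flat by simp
    qed
    then have "H v = 0" unfolding H_def G_def flat by simp
    moreover have "H v = H x" by (rule Pol_local[OF HP vx])
    ultimately show ?thesis by simp
  qed
  have Hz: "H x = 0" for x
  proof (rule Pol_zero_grid[OF HP, of "\<lambda>_. range of_nat"])
    show "infinite (range of_nat :: complex set)" by (rule range_inj_infinite) (simp add: inj_on_def)
  qed (rule Hg)
  have "x i ^ D = (\<Sum>j\<le>N. G j x * heval N d (F j) x)" for x using Hz[of x] unfolding H_def by (simp add: neg_eq_iff_add_eq_0)
  then show ?thesis using GP by auto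
qed


section \<open>Number fields and their embeddings\<close>

definition ev :: "rat poly \<Rightarrow> complex \<Rightarrow> complex" where
  "ev p x = poly (map_poly of_rat p) x"

lemma ev_0 [simp]: "ev 0 x = 0" unfolding ev_def by simp
lemma ev_pCons [simp]: "ev (pCons a p) x = of_rat a + x * ev p x" unfolding ev_def by (subst Polynomial.map_poly_pCons) simp_all
lemma ev_1 [simp]: "ev 1 x = 1" unfolding one_pCons by simp
lemma ev_add [simp]: "ev (p + q) x = ev p x + ev q x"
  by (induct p q rule: poly_induct2) (simp_all add: of_rat_add algebra_simps)
lemma ev_smult [simp]: "ev (Polynomial.smult a p) x = of_rat a * ev p x"
  by (induct p) (simp_all add: of_rat_mult algebra_simps)
lemma ev_mult [simp]: "ev (p * q) x = ev p x * ev q x"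
  by (induct p) (simp_all add: algebra_simps)
lemma ev_minus [simp]: "ev (- p) x = - ev p x"
  using ev_smult[of "-1" p x] by simp
lemma ev_diff [simp]: "ev (p - q) x = ev p x - ev q x"
  using ev_add[of p "- q" x] by simp
lemma ev_pcompose [simp]: "ev (p \<circ>\<^sub>p q) x = ev p (ev q x)"
  by (induct p) (simp_all add: pcompose_pCons)

definition Qadjoin :: "complex \<Rightarrow> complex set" where "Qadjoin \<theta> = range (\<lambda>p. ev p \<theta>)"

definition is_subfield :: "complex set \<Rightarrow> bool" where
  "is_subfield L \<longleftrightarrow> 0 \<in> L \<and> 1 \<in> L \<and> (\<forall>x\<in>L. \<forall>y\<in>L. x + y \<in> L \<and> x - y \<in> L \<and> x * y \<in> L) \<and> (\<forall>x\<in>L. inverse x \<in> L)"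

lemma is_subfieldD:
  assumes "is_subfield L"
  shows "0 \<in> L" "1 \<in> L" "\<And>x y. x \<in> L \<Longrightarrow> y \<in> L \<Longrightarrow> x + y \<in> L" "\<And>x y. x \<in> L \<Longrightarrow> y \<in> L \<Longrightarrow> x - y \<in> L"
    "\<And>x y. x \<in> L \<Longrightarrow> y \<in> L \<Longrightarrow> x * y \<in> L" "\<And>x. x \<in> L \<Longrightarrow> inverse x \<in> L"
    "\<And>x. x \<in> L \<Longrightarrow> - x \<in> L"
proof -
  show 1: "0 \<in> L" "1 \<in> L" "\<And>x y. x \<in> L \<Longrightarrow> y \<in> L \<Longrightarrow> x + y \<in> L" "\<And>x y. x \<in> L \<Longrightarrow> y \<in> L \<Longrightarrow> x - y \<in> L"
    "\<And>x y. x \<in> L \<Longrightarrow> y \<in> L \<Longrightarrow> x * y \<in> L" "\<And>x. x \<in> L \<Longrightarrow> inverse x \<in> L"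
    using assms unfolding is_subfield_def by simp_all
  show "- x \<in> L" if "x \<in> L" for x using 1(4)[OF 1(1) that] by simp
qed

lemma is_subfield_of_nat: "is_subfield L \<Longrightarrow> of_nat k \<in> L"
  by (induct k) (simp_all add: is_subfieldD)
lemma is_subfield_of_int: "is_subfield L \<Longrightarrow> of_int k \<in> L"
  by (cases k) (simp_all add: is_subfieldD is_subfield_of_nat del: of_nat_Suc)
lemma is_subfield_of_rat: "is_subfield L \<Longrightarrow> of_rat q \<in> L"
  by (cases q) (simp add: of_rat_rat divide_inverse is_subfieldD is_subfield_of_int)
lemma is_subfield_power: "is_subfield L \<Longrightarrow> x \<in> L \<Longrightarrow> x ^ k \<in> L"
  by (induct k) (simp_all add: is_subfieldD)
lemma is_subfield_sum: "is_subfield L \<Longrightarrow> (\<And>i. i \<in> I \<Longrightarrow> f i \<in> L) \<Longrightarrow> sum f I \<in> L"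
  by (induct I rule: infinite_finite_induct) (simp_all add: is_subfieldD)
lemma is_subfield_ev: "is_subfield L \<Longrightarrow> x \<in> L \<Longrightarrow> ev p x \<in> L"
  by (induct p) (simp_all add: is_subfieldD is_subfield_of_rat)

lemma algebraic_ev: "algebraic x \<Longrightarrow> algebraic (ev p x)"
proof (induct p)
  case (pCons a p)
  have "algebraic (of_rat a :: complex)" by (rule rat_imp_algebraic) simp
  then show ?case using pCons by (simp add: algebraic_add algebraic_mult)
qed simp

lemma algebraic_ev_root:
  assumes "algebraic x" shows "\<exists>p. p \<noteq> 0 \<and> ev p x = 0"
proof -
  obtain q :: "int poly" where q: "q \<noteq> 0" "poly (map_poly of_int q) x = 0" by (rule algebraicE'[OF assms])
  have "map_poly of_rat (map_poly of_int q :: rat poly) = (map_poly of_int q :: complex poly)"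
    by (subst map_poly_map_poly) (simp_all add: o_def)
  then have "ev (map_poly of_int q) x = 0" using q(2) unfolding ev_def by simp
  moreover have "map_poly of_int q \<noteq> (0 :: rat poly)" using q(1) by simp
  ultimately show ?thesis by blast
qed

lemma is_subfield_Qadjoin:
  assumes "algebraic \<theta>" shows "is_subfield (Qadjoin \<theta>)"
proof -
  have I: "ev p \<theta> \<in> Qadjoin \<theta>" for p unfolding Qadjoin_def by simp
  have "inverse (ev p \<theta>) \<in> Qadjoin \<theta>" for p
  proof (cases "ev p \<theta> = 0")
    case True then show ?thesis using I[of 0] by simp
  next
    case False
    define a where "a = ev p \<theta>"
    obtain q where q: "q \<noteq> 0" "ev q a = 0" using algebraic_ev_root[OF algebraic_ev[OF assms, of p]] unfolding a_def by blast
    have "\<exists>r. ev r a = inverse a" using q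
    proof (induct q)
      case (pCons c q)
      show ?case
      proof (cases "c = 0")
        case True
        then show ?thesis using pCons False unfolding a_def by auto
      next
        case c: False
        have "a * ev q a = - of_rat c" using pCons(4) by (simp add: eq_neg_iff_add_eq_0 add.commute)
        then have "a * (ev (Polynomial.smult (- inverse c) q) a) = 1" using c
          by (simp add: of_rat_minus of_rat_inverse) (metis (no_types, opaque_lifting) minus_mult_right left_inverse mult.left_commute of_rat_eq_0_iff minus_minus)
        then show ?thesis by (metis inverse_unique)
      qed
    qed simp
    then obtain r where "ev r a = inverse a" by blast
    then show ?thesis using I[of "r \<circ>\<^sub>p p"] unfolding a_def by simp
  qed
  then show ?thesis using I[of 0] I[of 1] I[of "_ + _"] I[of "_ - _"] I[of "_ * _"]
    unfolding is_subfield_def Qadjoin_def by auto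
qed

lemma Qadjoin_self: "\<theta> \<in> Qadjoin \<theta>"
  unfolding Qadjoin_def by (rule range_eqI[of _ _ "[:0, 1:]"]) simp

lemma Qadjoin_subset: "algebraic \<theta>' \<Longrightarrow> \<theta> \<in> Qadjoin \<theta>' \<Longrightarrow> Qadjoin \<theta> \<subseteq> Qadjoin \<theta>'"
  unfolding Qadjoin_def[of \<theta>] using is_subfield_ev[OF is_subfield_Qadjoin] by blast

lemma Qadjoin_algebraic: "algebraic \<theta> \<Longrightarrow> x \<in> Qadjoin \<theta> \<Longrightarrow> algebraic x"
  unfolding Qadjoin_def using algebraic_ev by blast

section \<open>Primitive elements\<close>

lemma minimal_poly_over_subfield:
  assumes L: "is_subfield L" and f: "f \<noteq> 0" "\<And>i. coeff f i \<in> L" "poly f b = 0"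
  obtains M where "lead_coeff M = 1" "\<And>i. coeff M i \<in> L" "poly M b = 0"
    "\<forall>f. (\<forall>i. coeff f i \<in> L) \<and> poly f b = 0 \<longrightarrow> M dvd f"
proof -
  let ?J = "{f. f \<noteq> 0 \<and> (\<forall>i. coeff f i \<in> L) \<and> poly f b = 0}"
  have "\<exists>g. g \<in> ?J" using f by auto
  then obtain g where g: "g \<in> ?J" and gmin: "\<And>f. f \<in> ?J \<Longrightarrow> degree g \<le> degree f"
    using ex_has_least_nat[of "\<lambda>g. g \<in> ?J" _ degree] by blast
  define M where "M = Polynomial.smult (inverse (lead_coeff g)) g"
  have M1: "lead_coeff M = 1" using g unfolding M_def by simp
  have Mc: "coeff M i \<in> L" for i using g L unfolding M_def by (simp add: is_subfieldD)
  have M0: "poly M b = 0" using g unfolding M_def by simp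
  have dM: "degree M = degree g" using g unfolding M_def by simp
  have dvd: "M dvd f" if "\<And>i. coeff f i \<in> L" "poly f b = 0" for f
    using that
  proof (induct "degree f" arbitrary: f rule: less_induct)
    case less
    show ?case
    proof (cases "f = 0")
      case False
      then have le: "degree M \<le> degree f" using gmin[of f] less(2,3) dM by simp
      define h where "h = monom (lead_coeff f) (degree f - degree M)"
      define r where "r = f - h * M"
      have rL: "coeff r i \<in> L" for i
      proof -
        have "coeff (h * M) i \<in> L" unfolding h_def using Mc less(2) L
          by (auto simp: coeff_monom_mult is_subfieldD)
        then show ?thesis unfolding r_def using less(2) L by (simp add: is_subfieldD)
      qed
      have r0: "poly r b = 0" unfolding r_def using less(3) M0 by simp
      have "M dvd r"
      proof (cases "r = 0")
        case nz: False
        have "coeff r (degree f) = 0" unfolding r_def h_def using le M1 by (simp add: coeff_monom_mult)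
        moreover have "degree r \<le> degree f" unfolding r_def h_def
          by (intro degree_diff_le order.refl order.trans[OF degree_mult_le]) 
             (use le degree_monom_le[of "lead_coeff f" "degree f - degree M"] in linarith)
        ultimately have "degree r < degree f" using nz by (metis le_neq_implies_less leading_coeff_0_iff)
        then show ?thesis using less(1)[OF _ rL r0] by simp
      qed simp
      then have "M dvd r + h * M" by simp
      then show ?thesis unfolding r_def by simp
    qed simp
  qed
  show thesis by (rule that[OF M1 Mc M0]) (simp add: dvd)
qed

text \<open>In characteristic zero this coefficient recovers \<open>b\<close> from a power of X - b,
  which replaces a separability argument for the minimal polynomial.\<close>

lemma coeff_linear_power_second: "coeff ([:- b, 1:] ^ Suc k) k = - (of_nat (Suc k) * (b :: complex))"
proof (induct k)
  case (Suc k)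
  define p where "p = [:- b, 1:] ^ Suc k"
  have "lead_coeff p = 1" unfolding p_def by (simp add: lead_coeff_power del: power_Suc)
  moreover have "degree p = Suc k" unfolding p_def by (simp add: degree_power_eq del: power_Suc)
  ultimately have p1: "coeff p (Suc k) = 1" by metis
  have "coeff ([:- b, 1:] * p) (Suc k) = - b * coeff p (Suc k) + coeff p k" by simp
  also have "\<dots> = - b + - (of_nat (Suc k) * b)" using Suc p1 unfolding p_def by simp
  finally show ?case unfolding p_def by (simp add: algebra_simps)
qed simp

lemma coeff_pcompose_in:
  assumes L: "is_subfield L" and "\<And>i. coeff p i \<in> L" "\<And>i. coeff q i \<in> L"
  shows "coeff (p \<circ>\<^sub>p q) i \<in> L"
  using assms(2)
proof (induct p arbitrary: i)
  case 0 then show ?case using L by (simp add: is_subfieldD)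
next
  case (pCons a p)
  have "a \<in> L" using pCons(3)[of 0] by simp
  have "coeff p j \<in> L" for j using pCons(3)[of "Suc j"] by simp
  then have 1: "coeff (p \<circ>\<^sub>p q) j \<in> L" for j using pCons(2) by simp
  have "coeff (q * (p \<circ>\<^sub>p q)) i \<in> L" unfolding coeff_mult by (intro is_subfield_sum is_subfieldD L assms(3) 1)
  then show ?case unfolding pcompose_pCons using L \<open>a \<in> L\<close>
    by (auto simp: coeff_pCons is_subfieldD split: nat.split)
qed

lemma monic_single_root:
  assumes "lead_coeff M = 1" "\<And>t. poly M t = 0 \<Longrightarrow> t = b"
  shows "M = [:- b, 1:] ^ degree (M :: complex poly)"
proof -
  obtain as where as: "Polynomial.smult (lead_coeff M) (\<Prod>a\<leftarrow>as. [:- a, 1:]) = M" "length as = degree M"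
    using fundamental_theorem_algebra_factorized[of M] by blast
  then have M: "M = (\<Prod>a\<leftarrow>as. [:- a, 1:])" using assms(1) by simp
  have "a = b" if "a \<in> set as" for a
  proof (rule assms(2))
    show "poly M a = 0" unfolding M using that by (induct as) auto
  qed
  then have "as = replicate (degree M) b" using as(2) by (metis replicate_length_same)
  then show ?thesis using M by (metis map_replicate prod_list_replicate)
qed

text \<open>For \<open>\<theta> = \<alpha> + c * \<beta>\<close> the polynomials g(X) and f(\<theta>
  - c X) have coefficients in the field of \<open>\<theta>\<close> and share the root
  \<open>\<beta>\<close>; for all but finitely many \<open>c\<close> they share no other. So the
  minimal polynomial of \<open>\<beta>\<close> over that field is a power of X - \<beta>.\<close>

lemma primitive_element_two:
  assumes "algebraic \<alpha>" "algebraic \<beta>"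
  shows "\<exists>\<theta>. algebraic \<theta> \<and> \<alpha> \<in> Qadjoin \<theta> \<and> \<beta> \<in> Qadjoin \<theta>"
proof -
  obtain f g where f: "f \<noteq> 0" "ev f \<alpha> = 0" and g: "g \<noteq> 0" "ev g \<beta> = 0"
    using algebraic_ev_root assms by metis
  let ?f = "map_poly of_rat f :: complex poly" and ?g = "map_poly of_rat g :: complex poly"
  have f0: "?f \<noteq> 0" and g0: "?g \<noteq> 0" using f g by simp_all
  \<comment> \<open>The slopes \<open>c\<close> for which another pair of roots yields the same
    \<open>\<theta>\<close>. Pairs with \<open>b = \<beta>\<close> contribute the value 0 of a
    division by zero, which merely excludes \<open>c = 0\<close> as well.\<close>
  define bad where "bad = (\<lambda>(a, b). (a - \<alpha>) / (\<beta> - b)) ` ({a. poly ?f a = 0} \<times> {b. poly ?g b = 0})"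
  have "finite bad" unfolding bad_def using f0 g0 by (intro finite_imageI finite_cartesian_product poly_roots_finite)
  have "infinite (range of_nat :: complex set)" by (rule range_inj_infinite) (simp add: inj_on_def)
  then have "\<not> range of_nat \<subseteq> bad" using finite_subset[OF _ \<open>finite bad\<close>] by metis
  then obtain c :: nat where c: "of_nat c \<notin> bad" by blast
  define \<theta> where "\<theta> = \<alpha> + of_nat c * \<beta>"
  have th: "algebraic \<theta>" unfolding \<theta>_def using assms by auto
  note L = is_subfield_Qadjoin[OF th]
  have gL: "coeff ?g i \<in> Qadjoin \<theta>" and fL: "coeff ?f i \<in> Qadjoin \<theta>" for i using L by (simp_all add: coeff_map_poly is_subfield_of_rat)
  have g\<beta>: "poly ?g \<beta> = 0" using g(2) unfolding ev_def .
  obtain M where M: "lead_coeff M = 1" "\<And>i. coeff M i \<in> Qadjoin \<theta>" "poly M \<beta> = 0"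
    and Md: "\<forall>f. (\<forall>i. coeff f i \<in> Qadjoin \<theta>) \<and> poly f \<beta> = 0 \<longrightarrow> M dvd f"
    by (rule minimal_poly_over_subfield[OF L g0 gL g\<beta>]) (rule that)
  have Mdvd: "M dvd f" if "\<And>i. coeff f i \<in> Qadjoin \<theta>" "poly f \<beta> = 0" for f using Md that by simp
  define G where "G = ?f \<circ>\<^sub>p [:\<theta>, - of_nat c:]"
  have linL: "coeff [:\<theta>, - of_nat c:] i \<in> Qadjoin \<theta>" for i
    using L Qadjoin_self by (auto simp: coeff_pCons is_subfieldD is_subfield_of_nat split: nat.split)
  have "coeff G i \<in> Qadjoin \<theta>" for i unfolding G_def by (rule coeff_pcompose_in[OF L fL linL])
  moreover have "poly G \<beta> = 0" using f(2) unfolding G_def \<theta>_def ev_def by (simp add: poly_pcompose algebra_simps)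
  ultimately have MG: "M dvd G" by (rule Mdvd)
  have Mg: "M dvd ?g" by (rule Mdvd[OF gL g\<beta>])
  have root: "t = \<beta>" if t: "poly M t = 0" for t
  proof (rule ccontr)
    assume ne: "t \<noteq> \<beta>"
    have 1: "poly ?g t = 0" using Mg t by (auto elim!: dvdE)
    have "poly G t = 0" using MG t by (auto elim!: dvdE)
    then have 2: "poly ?f (\<theta> - of_nat c * t) = 0" unfolding G_def by (simp add: poly_pcompose algebra_simps)
    have "((\<theta> - of_nat c * t) - \<alpha>) / (\<beta> - t) \<in> bad" unfolding bad_def using 1 2 by (intro image_eqI[of _ _ "(\<theta> - of_nat c * t, t)"]) auto
    moreover have "((\<theta> - of_nat c * t) - \<alpha>) / (\<beta> - t) = of_nat c" using ne unfolding \<theta>_def by (simp add: field_simps)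
    ultimately show False using c by simp
  qed
  define n where "n = degree M"
  have Mn: "M = [:- \<beta>, 1:] ^ n" unfolding n_def by (rule monic_single_root[OF M(1) root])
  have "n \<noteq> 0" using M(3) Mn by (intro notI) simp
  then obtain k where k: "n = Suc k" by (cases n) auto
  have "- (of_nat (Suc k) * \<beta>) \<in> Qadjoin \<theta>" using M(2)[of k] unfolding Mn k coeff_linear_power_second .
  then have "- (inverse (of_nat (Suc k))) * - (of_nat (Suc k) * \<beta>) \<in> Qadjoin \<theta>"
    by (rule is_subfieldD(5)[OF L is_subfieldD(7)[OF L is_subfieldD(6)[OF L is_subfield_of_nat[OF L]]]])
  moreover have "- (inverse (of_nat (Suc k))) * - (of_nat (Suc k) * \<beta>) = \<beta>" by (simp del: of_nat_Suc)
  ultimately have b: "\<beta> \<in> Qadjoin \<theta>" by metis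
  have "\<theta> - of_nat c * \<beta> \<in> Qadjoin \<theta>" by (intro is_subfieldD L is_subfield_of_nat b Qadjoin_self)
  then have "\<alpha> \<in> Qadjoin \<theta>" unfolding \<theta>_def by simp
  then show ?thesis using th b by blast
qed

lemma primitive_element:
  assumes "finite Z" "\<And>z. z \<in> Z \<Longrightarrow> algebraic z"
  shows "\<exists>\<theta>. algebraic \<theta> \<and> Z \<subseteq> Qadjoin \<theta>"
  using assms
proof (induct Z rule: finite_induct)
  case empty then show ?case by (intro exI[of _ 0]) auto
next
  case (insert z Z)
  then obtain \<theta> where t: "algebraic \<theta>" "Z \<subseteq> Qadjoin \<theta>" by auto
  obtain \<eta> where e: "algebraic \<eta>" "\<theta> \<in> Qadjoin \<eta>" "z \<in> Qadjoin \<eta>" using primitive_element_two[OF t(1), of z] insert(4) by auto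
  have "Z \<subseteq> Qadjoin \<eta>" using t(2) Qadjoin_subset[OF e(1,2)] by (rule order.trans)
  then show ?case using e by (intro exI[of _ \<eta>]) simp
qed

text \<open>Up to powers of the leading coefficients this product is the resultant of
  \<open>h\<close> and \<open>g\<close>. The two can be exchanged and \<open>h\<close> reduced
  modulo \<open>g\<close>, as in Euclid's algorithm, until the polynomial evaluated is
  constant.\<close>

lemma prod_ev_rational:
  assumes "h \<noteq> 0" "map_poly of_rat h = Polynomial.smult (of_rat c) (\<Prod>a\<leftarrow>as. [:- a, 1:])"
  shows "(\<Prod>a\<leftarrow>as. ev g a) \<in> \<rat>"
  using assms
proof (induct "degree g" arbitrary: g h c as rule: less_induct)
  case less
  show ?case
  proof (cases "degree g = 0")
    case True
    then obtain k where "g = [:k:]" by (metis degree_eq_zeroE)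
    then have "(\<Prod>a\<leftarrow>as. ev g a) = of_rat k ^ length as" by (induct as) simp_all
    then show ?thesis by simp
  next
    case False
    then have g0: "g \<noteq> 0" by auto
    let ?g = "map_poly of_rat g :: complex poly"
    have lc: "lead_coeff ?g = of_rat (lead_coeff g)" by (simp add: degree_map_poly)
    obtain bs where bs: "Polynomial.smult (lead_coeff ?g) (\<Prod>a\<leftarrow>bs. [:- a, 1:]) = ?g"
      using fundamental_theorem_algebra_factorized[of ?g] by blast
    then have bs': "?g = Polynomial.smult (of_rat (lead_coeff g)) (\<Prod>a\<leftarrow>bs. [:- a, 1:])" using lc by simp
    have c0: "c \<noteq> 0" using less(2,3) by auto
    have h_ev: "ev h x = of_rat c * (\<Prod>a\<leftarrow>as. x - a)" for x
    proof -
      have "poly (\<Prod>a\<leftarrow>as. [:- a, 1:]) x = (\<Prod>a\<leftarrow>as. x - a)" by (induct as) (simp_all add: left_diff_distrib)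
      then show ?thesis unfolding ev_def less(3) by simp
    qed
    have g_ev: "ev g x = of_rat (lead_coeff g) * (\<Prod>b\<leftarrow>bs. x - b)" for x
    proof -
      have "poly (\<Prod>a\<leftarrow>bs. [:- a, 1:]) x = (\<Prod>a\<leftarrow>bs. x - a)" by (induct bs) (simp_all add: left_diff_distrib)
      then show ?thesis unfolding ev_def bs' by simp
    qed
    have swap: "(\<Prod>a\<leftarrow>as. \<Prod>b\<leftarrow>bs. a - b) = (-1) ^ (length as * length bs) * (\<Prod>b\<leftarrow>bs. \<Prod>a\<leftarrow>as. b - a)" for as bs :: "complex list"
    proof (induct as)
      case Nil
      have "(\<Prod>b\<leftarrow>bs. 1) = (1::complex)" by (induct bs) simp_all
      then show ?case by simp
    next
      case (Cons x as)
      have 1: "(\<Prod>b\<leftarrow>bs. x - b) = (-1) ^ length bs * (\<Prod>b\<leftarrow>bs. b - x)" by (induct bs) (simp_all add: algebra_simps)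
      have 2: "(\<Prod>b\<leftarrow>bs. (b - x) * (\<Prod>a\<leftarrow>as. b - a)) = (\<Prod>b\<leftarrow>bs. b - x) * (\<Prod>b\<leftarrow>bs. \<Prod>a\<leftarrow>as. b - a)" by (induct bs) simp_all
      show ?case using Cons by (simp add: 1 2 power_add)
    qed
    have pull: "(\<Prod>b\<leftarrow>xs. k * f b) = k ^ length xs * (\<Prod>b\<leftarrow>xs. f b)" for xs :: "complex list" and k :: complex and f
      by (induct xs) simp_all
    have r: "ev (h mod g) b = ev h b" if "b \<in> set bs" for b
    proof -
      have "(\<Prod>a\<leftarrow>bs. b - a) = 0" using that by (induct bs) auto
      then have "ev g b = 0" unfolding g_ev by simp
      then have "ev (h div g * g + h mod g) b = ev (h mod g) b" unfolding ev_add ev_mult by simp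
      then show ?thesis unfolding div_mult_mod_eq by simp
    qed
    have "degree (h mod g) < degree g" using False degree_mod_less[OF g0, of h] by auto
    then have IH: "(\<Prod>b\<leftarrow>bs. ev (h mod g) b) \<in> \<rat>" using less(1) g0 bs' by blast
    have "(\<Prod>b\<leftarrow>bs. ev (h mod g) b) = (\<Prod>b\<leftarrow>bs. ev h b)" using r by (metis (mono_tags, lifting) map_eq_conv)
    also have "\<dots> = of_rat c ^ length bs * (\<Prod>b\<leftarrow>bs. \<Prod>a\<leftarrow>as. b - a)" unfolding h_ev by (rule pull)
    finally have "(\<Prod>b\<leftarrow>bs. \<Prod>a\<leftarrow>as. b - a) = inverse (of_rat c ^ length bs) * (\<Prod>b\<leftarrow>bs. ev (h mod g) b)" using c0 by simp
    then have "(\<Prod>b\<leftarrow>bs. \<Prod>a\<leftarrow>as. b - a) \<in> \<rat>" using IH by (simp add: Rats_mult)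
    moreover have "(\<Prod>a\<leftarrow>as. ev g a) = of_rat (lead_coeff g) ^ length as * ((-1) ^ (length as * length bs) * (\<Prod>b\<leftarrow>bs. \<Prod>a\<leftarrow>as. b - a))"
      unfolding g_ev swap[symmetric] by (rule pull)
    ultimately show ?thesis by (simp add: Rats_mult)
  qed
qed

text \<open>A list rather than a set: it gets one entry for each root of a minimal polynomial, so
  that the product is the absolute norm. Each \<open>\<sigma>\<close> is total, but a homomorphism
  only on \<open>K\<close>.\<close>

definition embeddings :: "complex set \<Rightarrow> (complex \<Rightarrow> complex) list \<Rightarrow> bool" where
  "embeddings K \<sigma>s \<longleftrightarrow> \<sigma>s \<noteq> [] \<and> (\<forall>\<sigma>\<in>set \<sigma>s. (\<forall>k. \<sigma> (of_nat k) = of_nat k) \<and>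
      (\<forall>x\<in>K. \<forall>y\<in>K. \<sigma> (x + y) = \<sigma> x + \<sigma> y \<and> \<sigma> (x * y) = \<sigma> x * \<sigma> y)) \<and>
    (\<forall>b\<in>K. algebraic_int b \<and> b \<noteq> 0 \<longrightarrow> 1 \<le> (\<Prod>\<sigma>\<leftarrow>\<sigma>s. cmod (\<sigma> b)))"

section \<open>Conjugates and norms in a simple extension\<close>

lemma Qadjoin_minpoly:
  assumes "algebraic \<theta>"
  obtains h :: "rat poly" where "h \<noteq> 0" "degree h > 0" "\<And>p. ev p \<theta> = 0 \<longleftrightarrow> h dvd p" "\<And>p. p \<noteq> 0 \<Longrightarrow> ev p \<theta> = 0 \<Longrightarrow> degree h \<le> degree p"
proof -
  obtain p0 where p0: "p0 \<noteq> 0 \<and> ev p0 \<theta> = 0" using algebraic_ev_root[OF assms] by (rule exE)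
  have "\<exists>h. (h \<noteq> 0 \<and> ev h \<theta> = 0) \<and> (\<forall>p. p \<noteq> 0 \<and> ev p \<theta> = 0 \<longrightarrow> degree h \<le> degree p)"
    by (rule ex_has_least_nat[of "\<lambda>p. p \<noteq> 0 \<and> ev p \<theta> = 0" p0 degree]) (rule p0)
  then obtain h where h: "h \<noteq> 0" "ev h \<theta> = 0" and hmin: "\<And>p. p \<noteq> 0 \<Longrightarrow> ev p \<theta> = 0 \<Longrightarrow> degree h \<le> degree p"
    by (elim exE conjE) (rule that, assumption, assumption, erule allE, erule mp, simp)
  have "degree h \<noteq> 0"
  proof
    assume "degree h = 0"
    then obtain k where "h = [:k:]" by (metis degree_eq_zeroE)
    then show False using h by simp
  qed
  moreover have "h dvd p" if "ev p \<theta> = 0" for p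
  proof (rule ccontr)
    assume "\<not> h dvd p"
    then have m: "p mod h \<noteq> 0" by (simp add: dvd_eq_mod_eq_0)
    have "ev (p div h * h + p mod h) \<theta> = ev (p mod h) \<theta>" unfolding ev_add ev_mult using h(2) by simp
    then have "ev (p mod h) \<theta> = 0" using that unfolding div_mult_mod_eq by simp
    then have "degree h \<le> degree (p mod h)" using hmin m by blast
    then show False using degree_mod_less'[of h p] h(1) m by simp
  qed
  moreover have "ev p \<theta> = 0" if "h dvd p" for p using that h(2) by (auto elim!: dvdE)
  ultimately show thesis using that[OF h(1)] hmin by blast
qed

lemma number_field_embeddings:
  assumes "algebraic \<theta>"
  shows "\<exists>\<sigma>s. embeddings (Qadjoin \<theta>) \<sigma>s"
proof -
  obtain h :: "rat poly" where h: "h \<noteq> 0" "degree h > 0" and hdvd: "\<And>p. ev p \<theta> = 0 \<longleftrightarrow> h dvd p"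
    and hmin: "\<And>p. p \<noteq> 0 \<Longrightarrow> ev p \<theta> = 0 \<Longrightarrow> degree h \<le> degree p"
    by (rule Qadjoin_minpoly[OF assms]) (rule that)
  let ?h = "map_poly of_rat h :: complex poly"
  have lc: "lead_coeff ?h = of_rat (lead_coeff h)" by (simp add: degree_map_poly)
  obtain as where as: "Polynomial.smult (lead_coeff ?h) (\<Prod>a\<leftarrow>as. [:- a, 1:]) = ?h" "length as = degree ?h"
    using fundamental_theorem_algebra_factorized[of ?h] by blast
  then have as': "?h = Polynomial.smult (of_rat (lead_coeff h)) (\<Prod>a\<leftarrow>as. [:- a, 1:])" using lc by simp
  \<comment> \<open>Any polynomial in \<open>\<theta>\<close> representing \<open>x\<close> will do:
    two of them differ by a multiple of \<open>h\<close>, which vanishes at each conjugate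
    \<open>t\<close>.\<close>
  define pl where "pl = (\<lambda>x. SOME p. ev p \<theta> = x)"
  define \<sigma> where "\<sigma> = (\<lambda>t x. ev (pl x) t)"
  have as_root: "ev h t = 0" if "t \<in> set as" for t
  proof -
    have "poly (\<Prod>a\<leftarrow>as. [:- a, 1:]) t = 0" using that by (induct as) auto
    then show ?thesis unfolding ev_def as' by simp
  qed
  have pl: "ev (pl (ev p \<theta>)) \<theta> = ev p \<theta>" for p unfolding pl_def by (rule someI[of _ p]) simp
  have dvd0: "ev p t = 0" if "h dvd p" "t \<in> set as" for p t using that as_root by (auto elim!: dvdE)
  have \<sigma>: "\<sigma> t (ev p \<theta>) = ev p t" if t: "t \<in> set as" for t p
  proof -
    have "ev (pl (ev p \<theta>) - p) \<theta> = 0" using pl by simp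
    then have "ev (pl (ev p \<theta>) - p) t = 0" using hdvd dvd0 t by blast
    then show ?thesis unfolding \<sigma>_def by simp
  qed
  have norm: "1 \<le> (\<Prod>\<sigma>\<leftarrow>map \<sigma> as. cmod (\<sigma> b))" if b: "b \<in> Qadjoin \<theta>" "algebraic_int b" "b \<noteq> 0" for b
  proof -
    obtain p where p: "b = ev p \<theta>" using b(1) unfolding Qadjoin_def by blast
    have ai: "algebraic_int (ev p t)" if t: "t \<in> set as" for t
    proof -
      obtain q :: "int poly" where q: "poly (map_poly of_int q) b = 0" "lead_coeff q = 1" using b(2) unfolding algebraic_int_altdef_ipoly by blast
      have m: "map_poly of_rat (map_poly of_int q :: rat poly) = (map_poly of_int q :: complex poly)"
        by (subst map_poly_map_poly) (simp_all add: o_def)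
      have "ev (map_poly of_int q \<circ>\<^sub>p p) \<theta> = 0" using q(1) p unfolding ev_pcompose by (simp add: ev_def m)
      then have "ev (map_poly of_int q \<circ>\<^sub>p p) t = 0" using hdvd dvd0 t by blast
      then have "poly (map_poly of_int q) (ev p t) = 0" unfolding ev_pcompose by (simp add: ev_def m)
      then show ?thesis using q(2) unfolding algebraic_int_altdef_ipoly by blast
    qed
    have nz: "ev p t \<noteq> 0" if t: "t \<in> set as" for t
    proof
      assume 0: "ev p t = 0"
      have "?h \<noteq> 0" using h(1) by simp
      then have "algebraic t" using as_root[OF t] unfolding ev_def by (intro algebraicI'[of ?h]) (auto simp: coeff_map_poly)
      obtain k :: "rat poly" where k: "k \<noteq> 0" "degree k > 0" "\<And>p. ev p t = 0 \<longleftrightarrow> k dvd p"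
        by (rule Qadjoin_minpoly[OF \<open>algebraic t\<close>]) (rule that)
      \<comment> \<open>Irreducibility of \<open>h\<close>: its factor \<open>k\<close>, the minimal
        polynomial of \<open>t\<close>, vanishes at \<open>\<theta>\<close> since the cofactor has
        too small a degree to do so. But then \<open>k\<close> cannot divide \<open>p\<close>, whose
        value at \<open>\<theta>\<close> is the nonzero \<open>b\<close>.\<close>
      have "k dvd h" using k(3) as_root[OF t] by blast
      then obtain s where s: "h = k * s" by (rule dvdE)
      have s0: "s \<noteq> 0" using s h(1) by auto
      have "ev h \<theta> = 0" using hdvd[of h] by simp
      then have "ev k \<theta> = 0 \<or> ev s \<theta> = 0" unfolding s by simp
      moreover have "ev s \<theta> \<noteq> 0"
      proof
        assume "ev s \<theta> = 0"
        then have "degree h \<le> degree s" using hmin s0 by blast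
        then show False using k(1,2) s0 unfolding s by (simp add: degree_mult_eq)
      qed
      moreover have "k dvd p" using k(3) 0 by blast
      then have "ev k \<theta> \<noteq> 0" using p b(3) by (auto elim!: dvdE)
      ultimately show False by blast
    qed
    define P where "P = (\<Prod>t\<leftarrow>as. ev p t)"
    have "P \<in> \<rat>" unfolding P_def by (rule prod_ev_rational[OF h(1) as'])
    moreover have "algebraic_int P" unfolding P_def using ai by (induct as) (auto intro: algebraic_int_mult)
    ultimately have "P \<in> \<int>" using rational_algebraic_int_is_int by blast
    moreover have "P \<noteq> 0" unfolding P_def using nz by (induct as) auto
    ultimately have "1 \<le> cmod P" by (auto elim!: Ints_cases)
    also have "cmod P = (\<Prod>t\<leftarrow>as. cmod (ev p t))" unfolding P_def by (induct as) (simp_all add: norm_mult)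
    also have "\<dots> = (\<Prod>t\<leftarrow>as. cmod (\<sigma> t b))" unfolding p using \<sigma> by (metis (mono_tags, lifting) map_eq_conv)
    finally show ?thesis by (simp add: o_def)
  qed
  have hom: "(\<forall>k. \<sigma> t (of_nat k) = of_nat k) \<and> (\<forall>x\<in>Qadjoin \<theta>. \<forall>y\<in>Qadjoin \<theta>. \<sigma> t (x + y) = \<sigma> t x + \<sigma> t y \<and> \<sigma> t (x * y) = \<sigma> t x * \<sigma> t y)"
    if t: "t \<in> set as" for t
  proof (intro conjI allI ballI)
    fix k show "\<sigma> t (of_nat k) = of_nat k" using \<sigma>[OF t, of "[:of_nat k:]"] by simp
  next
    fix x y assume "x \<in> Qadjoin \<theta>" "y \<in> Qadjoin \<theta>"
    then obtain p q where pq: "x = ev p \<theta>" "y = ev q \<theta>" unfolding Qadjoin_def by blast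
    show "\<sigma> t (x + y) = \<sigma> t x + \<sigma> t y" using \<sigma>[OF t, of "p + q"] \<sigma>[OF t, of p] \<sigma>[OF t, of q] unfolding pq by simp
    show "\<sigma> t (x * y) = \<sigma> t x * \<sigma> t y" using \<sigma>[OF t, of "p * q"] \<sigma>[OF t, of p] \<sigma>[OF t, of q] unfolding pq by simp
  qed
  have "degree ?h = degree h" by (simp add: degree_map_poly)
  then have "map \<sigma> as \<noteq> []" using as(2) h(2) by auto
  then show ?thesis unfolding embeddings_def using norm hom by (intro exI[of _ "map \<sigma> as"]) auto
qed

lemma number_field_Qadjoin:
  assumes "algebraic \<theta>" shows "number_field (Qadjoin \<theta>)"
proof -
  note L = is_subfield_Qadjoin[OF assms]
  obtain h :: "rat poly" where h: "h \<noteq> 0" "degree h > 0" and hdvd: "\<And>p. ev p \<theta> = 0 \<longleftrightarrow> h dvd p"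
    by (rule Qadjoin_minpoly[OF assms]) (rule that)
  define n where "n = degree h"
  define B where "B = (\<lambda>i. \<theta> ^ i) ` {..<n}"
  have "\<exists>q. x = (\<Sum>b\<in>B. of_rat (q b) * b)" if x: "x \<in> Qadjoin \<theta>" for x
  proof -
    obtain p where p: "x = ev p \<theta>" using x unfolding Qadjoin_def by blast
    define r where "r = p mod h"
    have "ev h \<theta> = 0" using hdvd[of h] by simp
    then have "ev (p div h * h + p mod h) \<theta> = ev r \<theta>" unfolding ev_add ev_mult r_def by simp
    then have xr: "x = ev r \<theta>" unfolding div_mult_mod_eq p .
    have dr: "degree r < n" unfolding r_def n_def using degree_mod_less'[of h p] h by (cases "p mod h = 0") auto
    have "x = (\<Sum>i\<le>degree r. of_rat (coeff r i) * \<theta> ^ i)" unfolding xr ev_def poly_altdef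
      by (simp add: degree_map_poly coeff_map_poly)
    also have "\<dots> = (\<Sum>i<n. of_rat (coeff r i) * \<theta> ^ i)"
      using dr by (intro sum.mono_neutral_left) (auto simp: coeff_eq_0)
    \<comment> \<open>The sum must run over the set \<open>B\<close>, so equal powers, if any, are
      grouped by value.\<close>
    also have "\<dots> = (\<Sum>b\<in>B. \<Sum>i\<in>{i \<in> {..<n}. \<theta> ^ i = b}. of_rat (coeff r i) * \<theta> ^ i)"
      unfolding B_def by (rule sum.image_gen) simp
    also have "\<dots> = (\<Sum>b\<in>B. of_rat (\<Sum>i\<in>{i \<in> {..<n}. \<theta> ^ i = b}. coeff r i) * b)"
      by (intro sum.cong refl) (simp add: of_rat_sum sum_distrib_right)
    finally show ?thesis by (intro exI[of _ "\<lambda>b. \<Sum>i\<in>{i \<in> {..<n}. \<theta> ^ i = b}. coeff r i"])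
  qed
  moreover have "finite B" unfolding B_def by simp
  moreover have "B \<subseteq> Qadjoin \<theta>" unfolding B_def using is_subfield_power[OF L Qadjoin_self] by blast
  ultimately show ?thesis unfolding number_field_def using L[unfolded is_subfield_def] by blast
qed

theorem number_field_with_embeddings:
  assumes "finite Z" "\<And>z. z \<in> Z \<Longrightarrow> algebraic z"
  obtains K \<sigma>s where "number_field K" "is_subfield K" "Z \<subseteq> K" "K \<subseteq> {x. algebraic x}" "embeddings K \<sigma>s"
proof -
  obtain \<theta> where \<theta>: "algebraic \<theta>" "Z \<subseteq> Qadjoin \<theta>" using primitive_element[OF assms] by auto
  obtain \<sigma>s where "embeddings (Qadjoin \<theta>) \<sigma>s" using number_field_embeddings[OF \<theta>(1)] by auto
  moreover have "Qadjoin \<theta> \<subseteq> {x. algebraic x}" using Qadjoin_algebraic[OF \<theta>(1)] by auto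
  ultimately show thesis using that number_field_Qadjoin[OF \<theta>(1)] is_subfield_Qadjoin[OF \<theta>(1)] \<theta>(2) by metis
qed


section \<open>Heights and grand orbits\<close>

definition vnorm :: "nat \<Rightarrow> (nat \<Rightarrow> complex) \<Rightarrow> real" where
  "vnorm N v = (\<Sum>i\<le>N. cmod (v i))"

lemma vnorm_nonneg: "vnorm N v \<ge> 0" unfolding vnorm_def by (simp add: sum_nonneg)
lemma vnorm_ge: "i \<le> N \<Longrightarrow> cmod (v i) \<le> vnorm N v" unfolding vnorm_def by (intro member_le_sum) auto
lemma vnorm_scale: "vnorm N (\<lambda>i. c * v i) = cmod c * vnorm N v"
  unfolding vnorm_def by (simp add: norm_mult sum_distrib_left)

text \<open>The denominators of the constants multiply up to one number \<open>R\<close> that serves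
  every place and every point integral there. This uniformity is what keeps the height estimates
  independent of the point.\<close>

lemma place_denominator:
  assumes "f \<in> Pol S n" "S \<subseteq> {x. algebraic x}"
  shows "\<exists>R>0::nat. \<forall>A m x. place A m \<and> (\<forall>i<n. x i \<in> A) \<longrightarrow> of_nat R * f x \<in> A"
  using assms(1)
proof induct
  case (Pol_const c)
  then have "algebraic c" using assms(2) by auto
  from algebraic_denominator[OF this] obtain R :: nat where R: "R > 0" "algebraic_int (of_nat R * c)" by auto
  show ?case
    by (rule exI[of _ R], intro conjI allI impI, rule R(1)) (elim conjE, erule place.algebraic_int_in, rule R(2))
next
  case (Pol_var i)
  then show ?case by (intro exI[of _ 1]) simp
next
  case (Pol_add f g)
  from Pol_add(2) obtain R :: nat where R: "R > 0" and Rf: "\<And>A m x. place A m \<Longrightarrow> \<forall>i<n. x i \<in> A \<Longrightarrow> of_nat R * f x \<in> A"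
    by (elim exE conjE) (rule that, assumption, simp)
  from Pol_add(4) obtain T :: nat where T: "T > 0" and Tg: "\<And>A m x. place A m \<Longrightarrow> \<forall>i<n. x i \<in> A \<Longrightarrow> of_nat T * g x \<in> A"
    by (elim exE conjE) (rule that, assumption, simp)
  have key: "of_nat (R * T) * (f x + g x) \<in> A" if pl: "place A m" and x: "\<forall>i<n. x i \<in> A" for A m x
  proof -
    interpret place A m by (rule pl)
    have "of_nat T * (of_nat R * f x) + of_nat R * (of_nat T * g x) \<in> A"
      by (intro add mult of_nat Rf[OF pl x] Tg[OF pl x])
    then show ?thesis by (simp add: algebra_simps)
  qed
  show ?case
    by (rule exI[of _ "R * T"], intro conjI allI impI) (simp add: R T, elim conjE, erule (1) key)
next
  case (Pol_mult f g)
  from Pol_mult(2) obtain R :: nat where R: "R > 0" and Rf: "\<And>A m x. place A m \<Longrightarrow> \<forall>i<n. x i \<in> A \<Longrightarrow> of_nat R * f x \<in> A"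
    by (elim exE conjE) (rule that, assumption, simp)
  from Pol_mult(4) obtain T :: nat where T: "T > 0" and Tg: "\<And>A m x. place A m \<Longrightarrow> \<forall>i<n. x i \<in> A \<Longrightarrow> of_nat T * g x \<in> A"
    by (elim exE conjE) (rule that, assumption, simp)
  have key: "of_nat (R * T) * (f x * g x) \<in> A" if pl: "place A m" and x: "\<forall>i<n. x i \<in> A" for A m x
  proof -
    interpret place A m by (rule pl)
    have "(of_nat R * f x) * (of_nat T * g x) \<in> A"
      by (intro mult Rf[OF pl x] Tg[OF pl x])
    then show ?thesis by (simp add: algebra_simps)
  qed
  show ?case
    by (rule exI[of _ "R * T"], intro conjI allI impI) (simp add: R T, elim conjE, erule (1) key)
qed

lemma place_denominator_family:
  assumes "finite J" "\<And>j. j \<in> J \<Longrightarrow> f j \<in> Pol S n" "S \<subseteq> {x. algebraic x}"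
  shows "\<exists>R>0::nat. \<forall>j\<in>J. \<forall>A m x. place A m \<and> (\<forall>i<n. x i \<in> A) \<longrightarrow> of_nat R * f j x \<in> A"
  using assms(1,2)
proof (induct J rule: finite_induct)
  case empty then show ?case by (intro exI[of _ 1]) simp
next
  case (insert k J)
  have "\<forall>j\<in>J. f j \<in> Pol S n" using insert by simp
  with insert(3) obtain R :: nat where R: "R > 0" and Rf: "\<And>j A m x. j \<in> J \<Longrightarrow> place A m \<Longrightarrow> \<forall>i<n. x i \<in> A \<Longrightarrow> of_nat R * f j x \<in> A"
    by (elim meta_impE exE conjE) (simp, rule that, assumption, simp)
  from place_denominator[OF insert(4) assms(3), of k] obtain T :: nat where T: "T > 0"
    and Tf: "\<And>A m x. place A m \<Longrightarrow> \<forall>i<n. x i \<in> A \<Longrightarrow> of_nat T * f k x \<in> A"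
    by (elim meta_impE exE conjE) (simp, rule that, assumption, simp)
  have key: "of_nat (R * T) * f j x \<in> A" if j: "j \<in> insert k J" and pl: "place A m" and x: "\<forall>i<n. x i \<in> A" for j A m x
  proof -
    interpret place A m by (rule pl)
    show ?thesis
    proof (cases "j = k")
      case True
      have "of_nat R * (of_nat T * f j x) \<in> A" unfolding True by (intro mult of_nat Tf[OF pl x])
      then show ?thesis by (simp add: mult.assoc)
    next
      case False
      then have "of_nat T * (of_nat R * f j x) \<in> A" using j by (intro mult of_nat Rf[OF _ pl x]) simp
      then show ?thesis by (simp add: mult_ac)
    qed
  qed
  show ?case
    by (rule exI[of _ "R * T"], intro conjI ballI allI impI) (simp add: R T, elim conjE, erule (2) key)
qed

text \<open>The entry is 1 and not merely a unit: dividing by an entry of least valuation produces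
  it, and the certificate at that coordinate then has 1 on its left side.\<close>

definition primitive :: "complex set \<Rightarrow> nat \<Rightarrow> (nat \<Rightarrow> complex) \<Rightarrow> bool" where
  "primitive A N y \<longleftrightarrow> (\<forall>i\<le>N. y i \<in> A) \<and> (\<exists>i\<le>N. y i = 1)"

lemma (in place) primitive_multiple:
  assumes "\<exists>i\<le>N. x i \<noteq> 0"
  shows "\<exists>k y. k \<le> N \<and> x k \<noteq> 0 \<and> x = (\<lambda>i. x k * y i) \<and> primitive A N y"
proof -
  have "\<exists>i\<in>{..N}. x i \<noteq> 0" using assms by auto
  from exists_max_entry[OF _ this] obtain k where k: "k \<le> N" "x k \<noteq> 0" "\<And>j. j \<le> N \<Longrightarrow> x j / x k \<in> A" by auto
  show ?thesis
    by (rule exI[of _ k], rule exI[of _ "\<lambda>i. x i / x k"]) (use k in \<open>auto simp: primitive_def\<close>)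
qed

text \<open>A Nullstellensatz certificate over \<open>K\<close> that the forms \<open>F\<close> have no common zero.\<close>

definition certificate :: "complex set \<Rightarrow> nat \<Rightarrow> nat \<Rightarrow> (nat \<Rightarrow> (nat \<Rightarrow> nat) \<Rightarrow> complex) \<Rightarrow> (nat \<Rightarrow> nat) \<Rightarrow>
   (nat \<Rightarrow> nat \<Rightarrow> (nat \<Rightarrow> complex) \<Rightarrow> complex) \<Rightarrow> bool" where
  "certificate K N d F D g \<longleftrightarrow> (\<forall>i\<le>N. \<forall>\<alpha>\<in>monoms N d. F i \<alpha> \<in> K) \<and> (\<forall>i\<le>N. \<forall>j\<le>N. g i j \<in> Pol K (Suc N)) \<and>
     (\<forall>i\<le>N. \<forall>x. x i ^ D i = (\<Sum>j\<le>N. g i j x * heval N d (F j) x))"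

lemma certificateD:
  assumes "certificate K N d F D g"
  shows "\<And>i \<alpha>. i \<le> N \<Longrightarrow> \<alpha> \<in> monoms N d \<Longrightarrow> F i \<alpha> \<in> K" "\<And>i j. i \<le> N \<Longrightarrow> j \<le> N \<Longrightarrow> g i j \<in> Pol K (Suc N)"
    "\<And>i x. i \<le> N \<Longrightarrow> x i ^ D i = (\<Sum>j\<le>N. g i j x * heval N d (F j) x)"
  using assms unfolding certificate_def by simp_all

lemma certificate_heval_Pol:
  assumes "certificate K N d F D g" "is_subfield K" "i \<le> N"
  shows "heval N d (F i) \<in> Pol K (Suc N)"
  by (intro heval_Pol is_subfieldD assms(2) certificateD(1)[OF assms(1) assms(3)])

lemma certificate_nonzero:
  assumes "certificate K N d F D g" "x i \<noteq> 0" "i \<le> N"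
  shows "\<exists>j\<le>N. Fvec N d F x j \<noteq> 0"
proof (rule ccontr)
  assume "\<not> ?thesis"
  then have z: "heval N d (F j) x = 0" if "j \<le> N" for j using that unfolding Fvec_def by auto
  have "x i ^ D i = 0" unfolding certificateD(3)[OF assms(1,3)] using z by simp
  then show False using assms(2) by simp
qed

text \<open>\<open>\<pi>\<close> is the content of the iterate. One application raises it to the
  power \<open>d\<close> and multiplies it by the content \<open>\<rho>\<close> of \<open>F\<close>
  at a primitive vector. Here \<open>\<rho>\<close> is integral up to the denominators of
  \<open>F\<close>, and \<open>inverse \<rho>\<close> up to those of \<open>F\<close> and
  \<open>g\<close>, by the certificate at a coordinate equal to 1.\<close>

lemma content_bound:
  assumes cert: "certificate K N d F D g" and K: "is_subfield K" "K \<subseteq> {x. algebraic x}" and d: "d \<ge> 2"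
  shows "\<exists>R>0::nat. \<forall>A m v. place A m \<and> primitive A N v \<longrightarrow> (\<forall>a. \<exists>\<pi> y. \<pi> \<noteq> 0 \<and> (\<forall>i\<le>N. (Fvec N d F ^^ a) v i = \<pi> * y i) \<and>
    primitive A N y \<and> of_nat R ^ (d ^ a) * \<pi> \<in> A \<and> of_nat R ^ (d ^ a) * inverse \<pi> \<in> A)"
proof -
  have "\<exists>R>0::nat. \<forall>j\<in>{..N}. \<forall>A m x. place A m \<and> (\<forall>i<Suc N. x i \<in> A) \<longrightarrow> of_nat R * heval N d (F j) x \<in> A"
    by (rule place_denominator_family[OF _ certificate_heval_Pol[OF cert K(1)] K(2)]) simp_all
  then obtain R1 :: nat where R1: "R1 > 0" and R1F: "\<And>j A m x. j \<le> N \<Longrightarrow> place A m \<Longrightarrow> \<forall>i<Suc N. x i \<in> A \<Longrightarrow> of_nat R1 * heval N d (F j) x \<in> A"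
    by (elim exE conjE) (rule that, assumption, simp)
  have "\<exists>R>0::nat. \<forall>p\<in>{..N} \<times> {..N}. \<forall>A m x. place A m \<and> (\<forall>i<Suc N. x i \<in> A) \<longrightarrow> of_nat R * g (fst p) (snd p) x \<in> A"
    by (rule place_denominator_family[OF _ certificateD(2)[OF cert] K(2)]) auto
  then obtain R2 :: nat where R2: "R2 > 0" and R2g: "\<And>i j A m x. i \<le> N \<Longrightarrow> j \<le> N \<Longrightarrow> place A m \<Longrightarrow> \<forall>i<Suc N. x i \<in> A \<Longrightarrow> of_nat R2 * g i j x \<in> A"
    by (elim exE conjE) (rule that, assumption, simp)
  define R where "R = R1 * R2"
  have R0: "R > 0" using R1 R2 unfolding R_def by simp
  \<comment> \<open>The exponent \<open>d ^ a - 1\<close> leaves room for one new factor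
    \<open>R\<close> in each step: \<open>(d ^ a - 1) * d + 1 \<le> d ^ Suc a - 1\<close> because
    \<open>d \<ge> 2\<close>.\<close>
  have main: "\<exists>\<pi> y. \<pi> \<noteq> 0 \<and> (\<forall>i\<le>N. (Fvec N d F ^^ a) v i = \<pi> * y i) \<and>
    primitive A N y \<and> of_nat R ^ (d ^ a - 1) * \<pi> \<in> A \<and> of_nat R ^ (d ^ a - 1) * inverse \<pi> \<in> A"
    if pl: "place A m" and v: "primitive A N v" for A m v a
  proof (induct a)
    case 0
    interpret place A m by (rule pl)
    show ?case using v by (intro exI[of _ 1] exI[of _ v]) simp
  next
    case (Suc a)
    interpret place A m by (rule pl)
    obtain \<pi> y where IH: "\<pi> \<noteq> 0" "\<forall>i\<le>N. (Fvec N d F ^^ a) v i = \<pi> * y i" "primitive A N y"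
      "of_nat R ^ (d ^ a - 1) * \<pi> \<in> A" "of_nat R ^ (d ^ a - 1) * inverse \<pi> \<in> A" using Suc by (elim exE conjE) (rule that)
    have yA: "\<forall>i<Suc N. y i \<in> A" using IH(3) unfolding primitive_def by simp
    obtain k where k: "k \<le> N" "y k = 1" using IH(3) unfolding primitive_def by auto
    define z where "z = Fvec N d F y"
    have "\<exists>j\<le>N. z j \<noteq> 0" unfolding z_def using certificate_nonzero[OF cert _ k(1), of y] k(2) by simp
    from primitive_multiple[OF this] obtain l w where w: "l \<le> N" "z l \<noteq> 0" "z = (\<lambda>i. z l * w i)" "primitive A N w"
      by (elim exE conjE) (rule that)
    have wA: "w i \<in> A" if "i \<le> N" for i using w(4) that unfolding primitive_def by simp
    define \<rho> where "\<rho> = z l"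
    have zi: "z i = \<rho> * w i" for i using fun_cong[OF w(3), of i] unfolding \<rho>_def .
    have r1: "of_nat R * \<rho> \<in> A"
    proof -
      have "of_nat R2 * (of_nat R1 * heval N d (F l) y) \<in> A" by (intro mult of_nat R1F[OF w(1) pl yA])
      then show ?thesis unfolding \<rho>_def z_def R_def Fvec_def using w(1) by (simp add: mult_ac)
    qed
    have r2: "of_nat R * inverse \<rho> \<in> A"
    proof -
      have "1 = (\<Sum>j\<le>N. g k j y * heval N d (F j) y)" using certificateD(3)[OF cert k(1), of y] k(2) by simp
      also have "\<dots> = \<rho> * (\<Sum>j\<le>N. g k j y * w j)" unfolding sum_distrib_left
      proof (rule sum.cong[OF refl])
        fix j assume "j \<in> {..N}"
        then have "heval N d (F j) y = \<rho> * w j" using zi[of j] unfolding z_def Fvec_def by simp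
        then show "g k j y * heval N d (F j) y = \<rho> * (g k j y * w j)" by simp
      qed
      finally have "inverse \<rho> = (\<Sum>j\<le>N. g k j y * w j)" by (rule inverse_unique[OF sym])
      then have "of_nat R * inverse \<rho> = (\<Sum>j\<le>N. of_nat R1 * ((of_nat R2 * g k j y) * w j))"
        unfolding R_def by (simp add: sum_distrib_left mult_ac)
      also have "\<dots> \<in> A" by (intro sum mult of_nat wA R2g[OF k(1) _ pl yA]) simp_all
      finally show ?thesis .
    qed
    have "(Fvec N d F ^^ Suc a) v i = (\<pi> ^ d * \<rho>) * w i" if i: "i \<le> N" for i
    proof -
      have "(Fvec N d F ^^ Suc a) v i = heval N d (F i) ((Fvec N d F ^^ a) v)" using i unfolding Fvec_def by simp
      also have "\<dots> = heval N d (F i) (\<lambda>j. \<pi> * y j)" using IH(2) by (intro heval_cong) simp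
      also have "\<dots> = \<pi> ^ d * z i" unfolding heval_scale z_def Fvec_def using i by simp
      finally show ?thesis unfolding zi by simp
    qed
    moreover have "(d ^ a - 1) * d + 1 \<le> d ^ Suc a - 1"
    proof -
      have "d ^ a \<ge> 1" using d by simp
      then have "(d ^ a - 1) * d = d ^ Suc a - d" by (simp add: diff_mult_distrib diff_mult_distrib2 mult.commute)
      moreover have "d \<le> d ^ Suc a" using \<open>d ^ a \<ge> 1\<close> by simp
      ultimately show ?thesis using d by linarith
    qed
    then obtain e where e: "d ^ Suc a - 1 = e + ((d ^ a - 1) * d + 1)" by (metis le_add_diff_inverse2)
    have Re: "of_nat R ^ (d ^ Suc a - 1) * (t ^ d * s) = of_nat R ^ e * ((of_nat R ^ (d ^ a - 1) * t) ^ d * (of_nat R * s))" for t s :: complex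
    proof -
      have rr: "(of_nat R :: complex) ^ ((d ^ a - 1) * d) = (of_nat R ^ (d ^ a - 1)) ^ d" by (rule power_mult)
      show ?thesis unfolding e power_add rr power_mult_distrib by (simp only: power_one_right mult_ac)
    qed
    have "of_nat R ^ (d ^ Suc a - 1) * (\<pi> ^ d * \<rho>) \<in> A"
      unfolding Re by (intro mult power of_nat IH(4) r1)
    moreover have "of_nat R ^ (d ^ Suc a - 1) * inverse (\<pi> ^ d * \<rho>) \<in> A"
    proof -
      have "inverse (\<pi> ^ d * \<rho>) = inverse \<pi> ^ d * inverse \<rho>" by (simp add: power_inverse)
      then show ?thesis unfolding Re by (simp only: Re) (intro mult power of_nat IH(5) r2)
    qed
    moreover have "\<pi> ^ d * \<rho> \<noteq> 0" using IH(1) w(2) unfolding \<rho>_def by simp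
    ultimately show ?case using w(4) by (intro exI[of _ "\<pi> ^ d * \<rho>"] exI[of _ w] conjI allI impI)
  qed
  show ?thesis
  proof (rule exI[of _ R], intro conjI allI impI; (elim conjE)?)
    show "R > 0" by (rule R0)
    fix A m v a assume pl: "place A m" and v: "primitive A N v"
    interpret place A m by (rule pl)
    from main[OF pl v, of a] obtain \<pi> y where *: "\<pi> \<noteq> 0" "\<forall>i\<le>N. (Fvec N d F ^^ a) v i = \<pi> * y i" "primitive A N y"
      "of_nat R ^ (d ^ a - 1) * \<pi> \<in> A" "of_nat R ^ (d ^ a - 1) * inverse \<pi> \<in> A" by (elim exE conjE) (rule that)
    have R: "of_nat R ^ (d ^ a) = of_nat R * (of_nat R ^ (d ^ a - 1) :: complex)"
      using d by (metis Suc_diff_1 power_Suc pos2 less_le_trans zero_less_power)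
    show "\<exists>\<pi> y. \<pi> \<noteq> 0 \<and> (\<forall>i\<le>N. (Fvec N d F ^^ a) v i = \<pi> * y i) \<and> primitive A N y \<and> of_nat R ^ (d ^ a) * \<pi> \<in> A \<and> of_nat R ^ (d ^ a) * inverse \<pi> \<in> A"
      by (rule exI[of _ \<pi>], rule exI[of _ y]) (intro conjI *(1-3), simp_all only: R mult.assoc mult[OF of_nat *(4)] mult[OF of_nat *(5)])
  qed
qed

lemma Fvec_in_subfield:
  assumes K: "is_subfield K" and F: "\<And>i \<alpha>. i \<le> N \<Longrightarrow> \<alpha> \<in> monoms N d \<Longrightarrow> F i \<alpha> \<in> K" and v: "\<And>i. v i \<in> K"
  shows "(Fvec N d F ^^ a) v i \<in> K"
proof (induct a arbitrary: i)
  case 0 then show ?case using v by simp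
next
  case (Suc a)
  show ?case
  proof (cases "i \<le> N")
    case True
    have "heval N d (F i) \<in> Pol K (Suc N)" by (intro heval_Pol is_subfieldD K F[OF True])
    then have "heval N d (F i) ((Fvec N d F ^^ a) v) \<in> K" by (rule Pol_value_in) (use Suc K in \<open>simp_all add: is_subfieldD\<close>)
    then show ?thesis using True unfolding Fvec_def[of N d F "(Fvec N d F ^^ a) v"] funpow.simps o_def by simp
  next
    case False
    then show ?thesis using K unfolding funpow.simps o_def Fvec_def[of N d F "(Fvec N d F ^^ a) v"] by (simp add: is_subfieldD)
  qed
qed

section \<open>Archimedean growth of iterates and comparison of heights\<close>

lemma embedding_heval:
  assumes K: "is_subfield K" and s0: "\<sigma> 0 = 0" and s1: "\<sigma> 1 = 1"
    and hom: "\<And>x y. x \<in> K \<Longrightarrow> y \<in> K \<Longrightarrow> \<sigma> (x + y) = \<sigma> x + \<sigma> y \<and> \<sigma> (x * y) = \<sigma> x * \<sigma> y"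
    and c: "\<And>\<alpha>. \<alpha> \<in> monoms N d \<Longrightarrow> c \<alpha> \<in> K" and v: "\<And>i. v i \<in> K"
  shows "\<sigma> (heval N d c v) = heval N d (\<lambda>\<alpha>. \<sigma> (c \<alpha>)) (\<lambda>i. \<sigma> (v i))"
proof -
  have sp: "\<sigma> (x ^ k) = \<sigma> x ^ k \<and> x ^ k \<in> K" if "x \<in> K" for x k
    using that by (induct k) (simp_all add: s1 hom K is_subfieldD)
  have sprod: "\<sigma> (\<Prod>i\<in>I. f i) = (\<Prod>i\<in>I. \<sigma> (f i)) \<and> (\<Prod>i\<in>I. f i) \<in> K" if "\<And>i. f i \<in> K" for f and I :: "nat set"
    using that by (induct I rule: infinite_finite_induct) (simp_all add: s1 hom K is_subfieldD)
  have ssum: "\<sigma> (\<Sum>\<alpha>\<in>I. f \<alpha>) = (\<Sum>\<alpha>\<in>I. \<sigma> (f \<alpha>)) \<and> (\<Sum>\<alpha>\<in>I. f \<alpha>) \<in> K" if "\<And>\<alpha>. \<alpha> \<in> I \<Longrightarrow> f \<alpha> \<in> K" for f and I :: "(nat \<Rightarrow> nat) set"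
    using that by (induct I rule: infinite_finite_induct) (simp_all add: s0 hom K is_subfieldD)
  have mon: "\<sigma> (\<Prod>i\<le>N. v i ^ \<alpha> i) = (\<Prod>i\<le>N. \<sigma> (v i) ^ \<alpha> i) \<and> (\<Prod>i\<le>N. v i ^ \<alpha> i) \<in> K" for \<alpha> :: "nat \<Rightarrow> nat"
    using sprod[of "\<lambda>i. v i ^ \<alpha> i" "{..N}"] sp[OF v] by simp
  have "\<sigma> (\<Sum>\<alpha>\<in>monoms N d. c \<alpha> * (\<Prod>i\<le>N. v i ^ \<alpha> i)) = (\<Sum>\<alpha>\<in>monoms N d. \<sigma> (c \<alpha> * (\<Prod>i\<le>N. v i ^ \<alpha> i)))"
    using ssum[of "monoms N d" "\<lambda>\<alpha>. c \<alpha> * (\<Prod>i\<le>N. v i ^ \<alpha> i)"] c mon K by (simp add: is_subfieldD)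
  also have "\<dots> = (\<Sum>\<alpha>\<in>monoms N d. \<sigma> (c \<alpha>) * (\<Prod>i\<le>N. \<sigma> (v i) ^ \<alpha> i))"
    using c mon hom by (intro sum.cong refl) simp
  finally show ?thesis unfolding heval_def .
qed

lemma vnorm_iterate_bounds:
  assumes d: "d \<ge> 2" and C: "C \<ge> 1" and b: "\<And>x. vnorm N x ^ d \<le> C * vnorm N (f x) \<and> vnorm N (f x) \<le> C * vnorm N x ^ d"
  shows "(vnorm N x / C) ^ (d ^ a) \<le> vnorm N ((f ^^ a) x) \<and> vnorm N ((f ^^ a) x) \<le> (C * vnorm N x) ^ (d ^ a)"
proof -
  have C2: "C ^ 2 \<le> C ^ d" using C d by (intro power_increasing) auto
  \<comment> \<open>Strengthened by a factor \<open>C\<close> on each side: a step produces the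
    constant \<open>C ^ 2\<close>, and \<open>C ^ 2 \<le> C ^ d\<close> lets the power absorb
    it.\<close>
  have "(vnorm N x / C) ^ (d ^ a) \<le> vnorm N ((f ^^ a) x) / C \<and> C * vnorm N ((f ^^ a) x) \<le> (C * vnorm N x) ^ (d ^ a)"
  proof (induct a)
    case 0 then show ?case by simp
  next
    case (Suc a)
    define y where "y = (f ^^ a) x"
    have y0: "vnorm N y \<ge> 0" by (rule vnorm_nonneg)
    have "(vnorm N x / C) ^ (d ^ Suc a) = ((vnorm N x / C) ^ (d ^ a)) ^ d" by (simp add: power_mult[symmetric] mult.commute)
    also have "\<dots> \<le> (vnorm N y / C) ^ d" using Suc C unfolding y_def by (intro power_mono) (auto simp: vnorm_nonneg)
    also have "\<dots> = vnorm N y ^ d / C ^ d" by (simp add: power_divide)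
    also have "\<dots> \<le> vnorm N y ^ d / C ^ 2" using C2 C y0 by (intro divide_left_mono) auto
    also have "\<dots> \<le> (C * vnorm N (f y)) / C ^ 2" using b[of y] C by (intro divide_right_mono) auto
    also have "\<dots> = vnorm N (f y) / C" using C by (simp add: power2_eq_square)
    finally have 1: "(vnorm N x / C) ^ (d ^ Suc a) \<le> vnorm N (f y) / C" .
    have "C * vnorm N (f y) \<le> C * (C * vnorm N y ^ d)" using b[of y] C by (intro mult_left_mono) auto
    also have "\<dots> = C ^ 2 * vnorm N y ^ d" by (simp add: power2_eq_square)
    also have "\<dots> \<le> C ^ d * vnorm N y ^ d" using C2 y0 by (intro mult_right_mono) auto
    also have "\<dots> = (C * vnorm N y) ^ d" by (simp add: power_mult_distrib)
    also have "\<dots> \<le> ((C * vnorm N x) ^ (d ^ a)) ^ d" using Suc C y0 unfolding y_def by (intro power_mono) auto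
    also have "\<dots> = (C * vnorm N x) ^ (d ^ Suc a)" by (simp add: power_mult[symmetric] mult.commute)
    finally show ?case using 1 unfolding y_def by simp
  qed
  moreover have "vnorm N ((f ^^ a) x) / C \<le> vnorm N ((f ^^ a) x)" using C vnorm_nonneg[of N "(f ^^ a) x"] by (simp add: divide_le_eq mult_le_cancel_left1)
  moreover have "vnorm N ((f ^^ a) x) \<le> C * vnorm N ((f ^^ a) x)" using C vnorm_nonneg[of N "(f ^^ a) x"] by (simp add: mult_le_cancel_right1)
  ultimately show ?thesis by linarith
qed

text \<open>By homogeneity the unit sphere suffices. Polynomials are bounded there, which gives the
  upper bound; the lower one holds because, by the identities, the forms cannot all be small where
  some coordinate is not.\<close>

lemma archimedean_bounds:
  assumes d: "d > 0" and F: "\<And>j. j \<le> N \<Longrightarrow> heval N d (G j) \<in> Pol UNIV (Suc N)" and g: "\<And>i j. i \<le> N \<Longrightarrow> j \<le> N \<Longrightarrow> g i j \<in> Pol UNIV (Suc N)"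
    and id: "\<And>i x. i \<le> N \<Longrightarrow> x i ^ D i = (\<Sum>j\<le>N. g i j x * heval N d (G j) x)"
  shows "\<exists>C\<ge>1. \<forall>x. vnorm N x ^ d \<le> C * vnorm N (Fvec N d G x) \<and> vnorm N (Fvec N d G x) \<le> C * vnorm N x ^ d"
proof -
  have "\<forall>j. \<exists>C. j \<le> N \<longrightarrow> C > 0 \<and> (\<forall>x. (\<forall>i<Suc N. cmod (x i) \<le> 1) \<longrightarrow> cmod (heval N d (G j) x) \<le> C)"
    using Pol_bounded[OF F] by blast
  from choice[OF this] obtain c where c: "\<And>j x. j \<le> N \<Longrightarrow> \<forall>i<Suc N. cmod (x i) \<le> 1 \<Longrightarrow> cmod (heval N d (G j) x) \<le> c j" "\<And>j. j \<le> N \<Longrightarrow> c j > 0" by auto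
  have "\<forall>p. \<exists>C. p \<in> {..N} \<times> {..N} \<longrightarrow> C > 0 \<and> (\<forall>x. (\<forall>i<Suc N. cmod (x i) \<le> 1) \<longrightarrow> cmod (g (fst p) (snd p) x) \<le> C)"
    using Pol_bounded[OF g] by force
  from choice[OF this] obtain e where e0: "\<forall>p. p \<in> {..N} \<times> {..N} \<longrightarrow> e p > 0 \<and> (\<forall>x. (\<forall>i<Suc N. cmod (x i) \<le> 1) \<longrightarrow> cmod (g (fst p) (snd p) x) \<le> e p)"
    by (rule exE)
  have e: "cmod (g i j x) \<le> e (i, j)" if "i \<le> N" "j \<le> N" "\<forall>i<Suc N. cmod (x i) \<le> 1" for i j x
    using e0[rule_format, of "(i, j)"] that by simp
  have epos: "e (i, j) > 0" if "i \<le> N" "j \<le> N" for i j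
    using e0[rule_format, of "(i, j)"] that by simp
  define B where "B = (\<Sum>p\<in>{..N} \<times> {..N}. e p)"
  have eB: "e (i, j) \<le> B" if "i \<le> N" "j \<le> N" for i j
    unfolding B_def using that epos by (intro member_le_sum) (auto intro: less_imp_le)
  have B0: "B > 0" using eB[of 0 0] epos[of 0 0] by simp
  define U where "U = (\<Sum>j\<le>N. c j)"
  define D' where "D' = (\<Sum>i\<le>N. D i)"
  \<comment> \<open>On the unit sphere \<open>U\<close> bounds the values of the forms and
    \<open>B\<close> those of the \<open>g i j\<close>. Some coordinate \<open>i\<close> there has
    size at least \<open>1 / real (Suc N)\<close>, and \<open>D'\<close> replaces its unknown
    exponent \<open>D i\<close>.\<close>
  define C where "C = 1 + U + B * real (Suc N) ^ D'"
  have U0: "U \<ge> 0" unfolding U_def using c(2) by (intro sum_nonneg) (auto intro: less_imp_le)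
  have C1: "C \<ge> 1" unfolding C_def using U0 B0 by simp
  have unit: "1 \<le> C * vnorm N (Fvec N d G x) \<and> vnorm N (Fvec N d G x) \<le> C" if x: "vnorm N x = 1" for x
  proof
    have x1: "\<forall>i<Suc N. cmod (x i) \<le> 1" using vnorm_ge[of _ N x] x by simp
    have "vnorm N (Fvec N d G x) = (\<Sum>j\<le>N. cmod (heval N d (G j) x))" unfolding vnorm_def Fvec_def by simp
    also have "\<dots> \<le> U" unfolding U_def by (intro sum_mono c(1) x1) simp
    also have "\<dots> \<le> C" unfolding C_def using B0 by simp
    finally show "vnorm N (Fvec N d G x) \<le> C" .
    have "\<exists>i\<le>N. cmod (x i) \<ge> 1 / real (Suc N)"
    proof (rule ccontr)
      assume "\<not> ?thesis"
      then have lt: "cmod (x i) < 1 / real (Suc N)" if "i \<le> N" for i using that by auto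
      have "vnorm N x < (\<Sum>i\<le>N. 1 / real (Suc N))" unfolding vnorm_def by (rule sum_strict_mono) (use lt in auto)
      then show False using x by simp
    qed
    then obtain i where i: "i \<le> N" "cmod (x i) \<ge> 1 / real (Suc N)" by auto
    have "1 = (real (Suc N) * (1 / real (Suc N))) ^ D i" by simp
    also have "\<dots> \<le> (real (Suc N) * cmod (x i)) ^ D i" using i by (intro power_mono mult_left_mono) auto
    also have "\<dots> = real (Suc N) ^ D i * cmod (x i ^ D i)" by (simp add: power_mult_distrib norm_power)
    also have "cmod (x i ^ D i) \<le> (\<Sum>j\<le>N. B * cmod (heval N d (G j) x))"
      unfolding id[OF i(1)]
    proof (rule sum_norm_le)
      fix j assume "j \<in> {..N}"
      then have "cmod (g i j x) \<le> B" using e[OF i(1) _ x1, of j] eB[OF i(1), of j] by simp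
      then show "cmod (g i j x * heval N d (G j) x) \<le> B * cmod (heval N d (G j) x)"
        by (simp add: norm_mult mult_right_mono)
    qed
    also have "(\<Sum>j\<le>N. B * cmod (heval N d (G j) x)) = B * vnorm N (Fvec N d G x)"
      unfolding vnorm_def Fvec_def by (simp add: sum_distrib_left)
    finally have "1 \<le> real (Suc N) ^ D i * (B * vnorm N (Fvec N d G x))" by (simp add: mult_left_mono)
    also have "\<dots> \<le> real (Suc N) ^ D' * (B * vnorm N (Fvec N d G x))"
    proof (intro mult_right_mono power_increasing)
      show "D i \<le> D'" unfolding D'_def using i by (intro member_le_sum) auto
    qed (use B0 vnorm_nonneg in auto)
    also have "\<dots> \<le> C * vnorm N (Fvec N d G x)"
    proof -
      have "B * real (Suc N) ^ D' \<le> C" unfolding C_def using U0 by simp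
      then have "(B * real (Suc N) ^ D') * vnorm N (Fvec N d G x) \<le> C * vnorm N (Fvec N d G x)" by (intro mult_right_mono vnorm_nonneg)
      then show ?thesis by (simp add: mult_ac)
    qed
    finally show "1 \<le> C * vnorm N (Fvec N d G x)" .
  qed
  have pos: "vnorm N x ^ d \<le> C * vnorm N (Fvec N d G x) \<and> vnorm N (Fvec N d G x) \<le> C * vnorm N x ^ d" if nz: "vnorm N x \<noteq> 0" for x
  proof -
    define t where "t = vnorm N x"
    have t0: "t > 0" using nz vnorm_nonneg[of N x] unfolding t_def by simp
    define y where "y = (\<lambda>i. inverse (of_real t) * x i)"
    have y1: "vnorm N y = 1" unfolding y_def vnorm_scale using t0 by (simp add: norm_inverse t_def)
    have xy: "x = (\<lambda>i. of_real t * y i)" unfolding y_def using t0 by (simp add: fun_eq_iff)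
    have "vnorm N (Fvec N d G x) = t ^ d * vnorm N (Fvec N d G y)" 
      by (subst xy) (use t0 in \<open>simp add: Fvec_scale vnorm_scale norm_power\<close>)
    moreover have "t ^ d * 1 \<le> t ^ d * (C * vnorm N (Fvec N d G y))" "t ^ d * vnorm N (Fvec N d G y) \<le> t ^ d * C"
      using unit[OF y1] t0 by (intro mult_left_mono; simp)+
    ultimately show ?thesis unfolding t_def[symmetric] by (simp add: mult_ac)
  qed
  have zero: "vnorm N x ^ d \<le> C * vnorm N (Fvec N d G x) \<and> vnorm N (Fvec N d G x) \<le> C * vnorm N x ^ d" if z: "vnorm N x = 0" for x
  proof -
    have "\<forall>i\<in>{..N}. cmod (x i) = 0" using z unfolding vnorm_def by (subst (asm) sum_nonneg_eq_0_iff) auto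
    then have x0: "x i = 0" if "i \<le> N" for i using that by simp
    have h: "heval N d (G j) x = 0 ^ d * heval N d (G j) (\<lambda>_. 1)" for j
      unfolding heval_scale[symmetric] by (rule heval_cong) (simp add: x0)
    have hz: "heval N d (G j) x = 0" for j using h[of j] d by simp
    show ?thesis using z d unfolding vnorm_def Fvec_def hz by (simp add: zero_power)
  qed
  show ?thesis using pos zero C1 by (intro exI[of _ C]) blast
qed

lemma prod_list_less_one:
  assumes "xs \<noteq> []" "\<And>x. x \<in> set xs \<Longrightarrow> 0 \<le> x \<and> x < (1::real)"
  shows "prod_list xs < 1"
  using assms
proof (induct xs)
  case (Cons x xs)
  have nn: "0 \<le> prod_list xs" using Cons(3) by (intro prod_list_nonneg) auto
  have "prod_list xs \<le> 1"
  proof (cases "xs = []")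
    case False then show ?thesis using Cons by (intro less_imp_le) auto
  qed simp
  moreover have "0 \<le> x" "x < 1" using Cons(3)[of x] by auto
  ultimately have "x * prod_list xs \<le> x * 1" by (intro mult_left_mono)
  then show ?case using \<open>x < 1\<close> by simp
qed simp

text \<open>The product formula enters only through the fact that the conjugates of a nonzero algebraic integer
  have product at least one in absolute value: up to a bounded denominator, the scalar \<open>t\<close> is such an integer.\<close>

lemma height_comparison:
  assumes cert: "certificate K N d F D g" and K: "is_subfield K" "K \<subseteq> {x. algebraic x}" and emb: "embeddings K \<sigma>s" and d: "d \<ge> 2"
  shows "\<exists>C\<ge>1. \<forall>v v' a b t. is_vec N v \<and> is_vec N v' \<and> (\<forall>i. v i \<in> \<nat>) \<and> (\<forall>i. v' i \<in> \<nat>) \<and> v 0 = 1 \<and> v' 0 = 1 \<and> t \<noteq> 0 \<and>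
     (Fvec N d F ^^ a) v = (\<lambda>i. t * (Fvec N d F ^^ b) v' i) \<longrightarrow> (vnorm N v' / C) ^ (d ^ b) \<le> (C * vnorm N v) ^ (d ^ a)"
proof -
  from content_bound[OF cert K d] obtain R :: nat where R: "R > 0" and content: "\<And>A m v a. place A m \<Longrightarrow> primitive A N v \<Longrightarrow> \<exists>\<pi> y. \<pi> \<noteq> 0 \<and> (\<forall>i\<le>N. (Fvec N d F ^^ a) v i = \<pi> * y i) \<and>
    primitive A N y \<and> of_nat R ^ (d ^ a) * \<pi> \<in> A \<and> of_nat R ^ (d ^ a) * inverse \<pi> \<in> A" by (elim exE conjE) (rule that, assumption, simp)
  have snat: "\<sigma> (of_nat k) = of_nat k" and hom: "x \<in> K \<Longrightarrow> y \<in> K \<Longrightarrow> \<sigma> (x + y) = \<sigma> x + \<sigma> y \<and> \<sigma> (x * y) = \<sigma> x * \<sigma> y" if "\<sigma> \<in> set \<sigma>s" for \<sigma> k x y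
    using emb that unfolding embeddings_def by simp_all
  have s0: "\<sigma> 0 = 0" and s1: "\<sigma> 1 = 1" if "\<sigma> \<in> set \<sigma>s" for \<sigma> using snat[OF that, of 0] snat[OF that, of 1] by simp_all
  \<comment> \<open>The conjugate forms: their iterates at a vector of natural numbers are the
    conjugates of the iterates of \<open>F\<close>.\<close>
  define G where "G = (\<lambda>\<sigma> i \<alpha>. (\<sigma> (F i \<alpha>) :: complex))"
  have Gmap: "Fvec N d (G \<sigma>) (\<lambda>i. \<sigma> (x i)) = (\<lambda>i. \<sigma> (Fvec N d F x i))" if s: "\<sigma> \<in> set \<sigma>s" and x: "\<And>i. x i \<in> K" for \<sigma> x
  proof
    fix i show "Fvec N d (G \<sigma>) (\<lambda>i. \<sigma> (x i)) i = \<sigma> (Fvec N d F x i)"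
      using embedding_heval[OF K(1) s0[OF s] s1[OF s] hom[OF s] certificateD(1)[OF cert, of i] x] s0[OF s]
      unfolding Fvec_def G_def by simp
  qed
  have Giter: "(Fvec N d (G \<sigma>) ^^ a) v = (\<lambda>i. \<sigma> ((Fvec N d F ^^ a) v i))" if s: "\<sigma> \<in> set \<sigma>s" and v: "\<And>i. v i \<in> \<nat>" for \<sigma> v a
  proof (induct a)
    case 0
    have "\<sigma> (v i) = v i" for i using v[of i] snat[OF s] by (auto elim!: Nats_cases)
    then show ?case by simp
  next
    case (Suc a)
    have vK: "v i \<in> K" for i using v[of i] is_subfield_of_nat[OF K(1)] by (auto elim!: Nats_cases)
    have FK: "(Fvec N d F ^^ a) v i \<in> K" for i by (rule Fvec_in_subfield[OF K(1) certificateD(1)[OF cert] vK])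
    show ?case using Gmap[OF s FK] Suc by simp
  qed
  have bd: "\<exists>C\<ge>1. \<forall>x. vnorm N x ^ d \<le> C * vnorm N (Fvec N d (G \<sigma>) x) \<and> vnorm N (Fvec N d (G \<sigma>) x) \<le> C * vnorm N x ^ d" if s: "\<sigma> \<in> set \<sigma>s" for \<sigma>
  proof -
    have "\<exists>g'. i \<le> N \<and> j \<le> N \<longrightarrow> g' \<in> Pol UNIV (Suc N) \<and> (\<forall>x. (\<forall>i<Suc N. x i \<in> K) \<longrightarrow> g i j x \<in> K \<and> \<sigma> (g i j x) = g' (\<lambda>i. \<sigma> (x i)))" for i j
    proof (cases "i \<le> N \<and> j \<le> N")
      case True
      then have "g i j \<in> Pol K (Suc N)" using certificateD(2)[OF cert] by simp
      then have "\<exists>f'\<in>Pol UNIV (Suc N). \<forall>x. (\<forall>i<Suc N. x i \<in> K) \<longrightarrow> g i j x \<in> K \<and> \<sigma> (g i j x) = f' (\<lambda>i. \<sigma> (x i))"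
        by (rule Pol_ring_hom) (simp_all add: hom[OF s] is_subfieldD(3,5)[OF K(1)])
      then obtain f' where "f' \<in> Pol UNIV (Suc N)" "\<forall>x. (\<forall>i<Suc N. x i \<in> K) \<longrightarrow> g i j x \<in> K \<and> \<sigma> (g i j x) = f' (\<lambda>i. \<sigma> (x i))"
        by (elim bexE) (rule that)
      then show ?thesis by (intro exI[of _ f'] impI conjI)
    next
      case False
      then show ?thesis by (intro exI impI) (erule (1) notE)
    qed
    then have "\<forall>i. \<exists>g'. \<forall>j. i \<le> N \<and> j \<le> N \<longrightarrow> g' j \<in> Pol UNIV (Suc N) \<and> (\<forall>x. (\<forall>i<Suc N. x i \<in> K) \<longrightarrow> g i j x \<in> K \<and> \<sigma> (g i j x) = g' j (\<lambda>i. \<sigma> (x i)))"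
      by (intro allI choice)
    from choice[OF this] obtain g' where g0: "\<forall>i j. i \<le> N \<and> j \<le> N \<longrightarrow> g' i j \<in> Pol UNIV (Suc N) \<and> (\<forall>x. (\<forall>i<Suc N. x i \<in> K) \<longrightarrow> g i j x \<in> K \<and> \<sigma> (g i j x) = g' i j (\<lambda>i. \<sigma> (x i)))"
      by (rule exE)
    have g'P: "g' i j \<in> Pol UNIV (Suc N)" if "i \<le> N" "j \<le> N" for i j using g0[rule_format, of i j] that by simp
    have g'v: "g i j x \<in> K \<and> \<sigma> (g i j x) = g' i j (\<lambda>i. \<sigma> (x i))" if "i \<le> N" "j \<le> N" "\<forall>i<Suc N. x i \<in> K" for i j x
      using g0[rule_format, of i j] that by simp
    have GP: "heval N d (G \<sigma> j) \<in> Pol UNIV (Suc N)" if "j \<le> N" for j by (intro heval_Pol) auto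
    \<comment> \<open>The certificate is conjugated through its values: \<open>\<sigma>\<close>
      fixes points with natural coordinates, and a polynomial vanishing at all of these is
      zero.\<close>
    have ident: "x i ^ D i = (\<Sum>j\<le>N. g' i j x * heval N d (G \<sigma> j) x)" if i: "i \<le> N" for i x
    proof -
      define H where "H = (\<lambda>x :: nat \<Rightarrow> complex. x i ^ D i - (\<Sum>j\<le>N. g' i j x * heval N d (G \<sigma> j) x))"
      have HP: "H \<in> Pol UNIV (Suc N)" unfolding H_def using i GP g'P
        by (intro Pol_diff Pol_power Pol_var Pol_sum Pol_mult) auto
      have "H y = 0" if y: "\<And>i. i < Suc N \<Longrightarrow> y i \<in> range of_nat" for y
      proof -
        define v where "v = (\<lambda>j. if j \<le> N then y j else 0)"
        have vn: "v j \<in> \<nat>" for j using y[of j] unfolding v_def Nats_def by auto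
        have vK: "v j \<in> K" for j using vn[of j] is_subfield_of_nat[OF K(1)] by (auto elim!: Nats_cases)
        have sv: "\<sigma> (v j) = v j" for j using vn[of j] snat[OF s] by (auto elim!: Nats_cases)
        have FK: "heval N d (F j) v \<in> K" if "j \<le> N" for j
          by (rule Pol_value_in[OF certificate_heval_Pol[OF cert K(1) that] order.refl]) (simp_all add: is_subfieldD[OF K(1)] vK)
        have Fs: "\<sigma> (heval N d (F j) v) = heval N d (G \<sigma> j) v" if "j \<le> N" for j
          using embedding_heval[OF K(1) s0[OF s] s1[OF s] hom[OF s] certificateD(1)[OF cert that] vK] sv unfolding G_def by simp
        have ssum: "\<sigma> (\<Sum>j\<in>I. f j) = (\<Sum>j\<in>I. \<sigma> (f j)) \<and> (\<Sum>j\<in>I. f j) \<in> K" if "\<And>j. j \<in> I \<Longrightarrow> f j \<in> K" for f and I :: "nat set"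
          using that by (induct I rule: infinite_finite_induct) (simp_all add: s0[OF s] hom[OF s] is_subfieldD[OF K(1)])
        have gK: "g i j v \<in> K" and gs: "\<sigma> (g i j v) = g' i j v" if "j \<le> N" for j using g'v[OF i that, of v] vK sv by simp_all
        have spow: "\<sigma> (v i ^ k) = v i ^ k" for k
          using is_subfield_power[OF K(1) vK, of i] by (induct k) (simp_all add: s1[OF s] hom[OF s] vK sv)
        have "v i ^ D i = \<sigma> (\<Sum>j\<le>N. g i j v * heval N d (F j) v)" using certificateD(3)[OF cert i, of v] spow by metis
        also have "\<dots> = (\<Sum>j\<le>N. \<sigma> (g i j v * heval N d (F j) v))"
          using ssum[of "{..N}" "\<lambda>j. g i j v * heval N d (F j) v"] gK FK is_subfieldD(5)[OF K(1)] by simp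
        also have "\<dots> = (\<Sum>j\<le>N. g' i j v * heval N d (G \<sigma> j) v)"
          by (intro sum.cong refl) (simp add: hom[OF s gK FK] gs Fs)
        finally have "H v = 0" unfolding H_def by simp
        moreover have "H v = H y" by (rule Pol_local[OF HP]) (simp add: v_def)
        ultimately show ?thesis by simp
      qed
      note Hg = this
      have "H x = 0"
      proof (rule Pol_zero_grid[OF HP, of "\<lambda>_. range of_nat"])
        show "infinite (range of_nat :: complex set)" by (rule range_inj_infinite) (simp add: inj_on_def)
      qed (rule Hg)
      then show ?thesis unfolding H_def by simp
    qed
    show ?thesis by (rule archimedean_bounds[OF _ GP g'P ident]) (use d in simp)
  qed
  then have "\<forall>\<sigma>. \<exists>C. \<sigma> \<in> set \<sigma>s \<longrightarrow> C \<ge> 1 \<and> (\<forall>x. vnorm N x ^ d \<le> C * vnorm N (Fvec N d (G \<sigma>) x) \<and> vnorm N (Fvec N d (G \<sigma>) x) \<le> C * vnorm N x ^ d)"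
    by blast
  from choice[OF this] obtain c where c: "\<And>\<sigma>. \<sigma> \<in> set \<sigma>s \<Longrightarrow> c \<sigma> \<ge> 1"
    "\<And>\<sigma> x. \<sigma> \<in> set \<sigma>s \<Longrightarrow> vnorm N x ^ d \<le> c \<sigma> * vnorm N (Fvec N d (G \<sigma>) x) \<and> vnorm N (Fvec N d (G \<sigma>) x) \<le> c \<sigma> * vnorm N x ^ d" by auto
  define C0 where "C0 = 1 + (\<Sum>\<sigma>\<in>set \<sigma>s. c \<sigma>)"
  have "0 \<le> (\<Sum>\<sigma>\<in>set \<sigma>s. c \<sigma>)" using c(1) by (intro sum_nonneg) (auto intro: order.trans[OF zero_le_one])
  then have C01: "C0 \<ge> 1" unfolding C0_def by simp
  have cC0: "c \<sigma> \<le> C0" if "\<sigma> \<in> set \<sigma>s" for \<sigma>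
  proof -
    have "c \<sigma> \<le> (\<Sum>\<sigma>\<in>set \<sigma>s. c \<sigma>)" using that c(1) by (intro member_le_sum) (auto intro: order.trans[OF zero_le_one])
    then show ?thesis unfolding C0_def by simp
  qed
  have iter: "(vnorm N x / C0) ^ (d ^ a) \<le> vnorm N ((Fvec N d (G \<sigma>) ^^ a) x) \<and> vnorm N ((Fvec N d (G \<sigma>) ^^ a) x) \<le> (C0 * vnorm N x) ^ (d ^ a)"
    if s: "\<sigma> \<in> set \<sigma>s" for \<sigma> x a
  proof (rule vnorm_iterate_bounds[OF d C01])
    fix x
    have "c \<sigma> * vnorm N (Fvec N d (G \<sigma>) x) \<le> C0 * vnorm N (Fvec N d (G \<sigma>) x)" "c \<sigma> * vnorm N x ^ d \<le> C0 * vnorm N x ^ d"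
      using cC0[OF s] by (intro mult_right_mono; simp add: vnorm_nonneg)+
    then show "vnorm N x ^ d \<le> C0 * vnorm N (Fvec N d (G \<sigma>) x) \<and> vnorm N (Fvec N d (G \<sigma>) x) \<le> C0 * vnorm N x ^ d"
      using c(2)[OF s, of x] by linarith
  qed
  define C where "C = C0 * real R"
  have R1: "real R \<ge> 1" using R by simp
  have C1: "C \<ge> 1" unfolding C_def using mult_mono[OF C01 R1] C01 by simp
  have main: "(vnorm N v' / C) ^ (d ^ b) \<le> (C * vnorm N v) ^ (d ^ a)"
    if v: "is_vec N v" "is_vec N v'" "\<And>i. v i \<in> \<nat>" "\<And>i. v' i \<in> \<nat>" "v 0 = 1" "v' 0 = 1" and t: "t \<noteq> 0" 
      "(Fvec N d F ^^ a) v = (\<lambda>i. t * (Fvec N d F ^^ b) v' i)" for v v' a b t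
  proof -
    have vK: "v i \<in> K" "v' i \<in> K" for i using v(3)[of i] v(4)[of i] is_subfield_of_nat[OF K(1)] by (auto elim!: Nats_cases)
    have prim: "primitive A N v" "primitive A N v'" if "place A m" for A m
    proof -
      have "v i \<in> A" "v' i \<in> A" for i
        by (rule Nats_cases[OF v(3)[of i]], simp add: place.of_nat[OF that], rule Nats_cases[OF v(4)[of i]], simp add: place.of_nat[OF that])
      then show "primitive A N v" "primitive A N v'" using v(5,6) unfolding primitive_def by auto
    qed
    \<comment> \<open>At each place \<open>t\<close> is a quotient of two contents times an integral
      entry, and the powers of \<open>R\<close> clear the denominators of content and inverse
      content.\<close>
    define \<beta> where "\<beta> = t * of_nat R ^ (d ^ a + d ^ b)"
    have ai: "algebraic_int \<beta>"
    proof (rule in_all_places_imp_algebraic_int)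
      fix A m assume pl: "place A m"
      interpret place A m by (rule pl)
      from content[OF pl prim(1)[OF pl], of a] obtain \<pi> y where p: "\<pi> \<noteq> 0" "\<forall>i\<le>N. (Fvec N d F ^^ a) v i = \<pi> * y i"
        "primitive A N y" "of_nat R ^ (d ^ a) * \<pi> \<in> A" by (elim exE conjE) (rule that)
      from content[OF pl prim(2)[OF pl], of b] obtain \<rho> z where q: "\<rho> \<noteq> 0" "\<forall>i\<le>N. (Fvec N d F ^^ b) v' i = \<rho> * z i"
        "primitive A N z" "of_nat R ^ (d ^ b) * inverse \<rho> \<in> A" by (elim exE conjE) (rule that)
      obtain k where k: "k \<le> N" "z k = 1" using q(3) unfolding primitive_def by auto
      have "\<pi> * y k = t * \<rho>" using fun_cong[OF t(2), of k] p(2) q(2) k by simp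
      then have "t = \<pi> * y k * inverse \<rho>" using q(1) by (simp add: field_simps)
      then have "\<beta> = (of_nat R ^ (d ^ a) * \<pi>) * y k * (of_nat R ^ (d ^ b) * inverse \<rho>)" unfolding \<beta>_def by (simp add: power_add mult_ac)
      moreover have "y k \<in> A" using p(3) k(1) unfolding primitive_def by simp
      ultimately show "\<beta> \<in> A" by (simp only:) (intro mult p(4) q(4))
    qed
    have vnz: "\<exists>i\<le>N. (Fvec N d F ^^ b) v' i \<noteq> 0"
    proof (induct b)
      case 0 then show ?case using v(6) by (intro exI[of _ 0]) simp
    next
      case (Suc b)
      then obtain i where "i \<le> N" "(Fvec N d F ^^ b) v' i \<noteq> 0" by auto
      then show ?case using certificate_nonzero[OF cert, of "(Fvec N d F ^^ b) v'" i] by simp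
    qed
    then obtain k where k: "(Fvec N d F ^^ b) v' k \<noteq> 0" by auto
    have aK: "(Fvec N d F ^^ a) v i \<in> K" "(Fvec N d F ^^ b) v' i \<in> K" for i
      using Fvec_in_subfield[OF K(1) certificateD(1)[OF cert] vK(1)] Fvec_in_subfield[OF K(1) certificateD(1)[OF cert] vK(2)] by simp_all
    have "t = (Fvec N d F ^^ a) v k * inverse ((Fvec N d F ^^ b) v' k)" using fun_cong[OF t(2), of k] k by (simp add: field_simps)
    then have tK: "t \<in> K" using aK is_subfieldD[OF K(1)] by metis
    have RK: "of_nat R ^ (d ^ a + d ^ b) \<in> K" by (intro is_subfield_power is_subfield_of_nat K(1))
    have bK: "\<beta> \<in> K" unfolding \<beta>_def using is_subfieldD(5)[OF K(1) tK RK] .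
    have b0: "\<beta> \<noteq> 0" unfolding \<beta>_def using t(1) R by simp
    define X Y where "X = (vnorm N v' / C0) ^ (d ^ b)" and "Y = real R ^ (d ^ a + d ^ b) * (C0 * vnorm N v) ^ (d ^ a)"
    have v'pos: "vnorm N v' > 0" using vnorm_ge[of 0 N v'] v(6) by simp
    have X0: "X > 0" unfolding X_def using v'pos C01 by simp
    have le: "cmod (\<sigma> \<beta>) * X \<le> Y" if s: "\<sigma> \<in> set \<sigma>s" for \<sigma>
    proof -
      have sR: "\<sigma> (of_nat R ^ k) = of_nat R ^ k" for k using snat[OF s, of "R ^ k"] by simp
      have "\<sigma> \<beta> = \<sigma> t * of_nat R ^ (d ^ a + d ^ b)" unfolding \<beta>_def using hom[OF s tK RK] sR by simp
      then have 1: "cmod (\<sigma> \<beta>) = cmod (\<sigma> t) * real R ^ (d ^ a + d ^ b)" by (simp add: norm_mult norm_power)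
      have "(Fvec N d (G \<sigma>) ^^ a) v = (\<lambda>i. \<sigma> t * (Fvec N d (G \<sigma>) ^^ b) v' i)"
        unfolding Giter[OF s v(3)] Giter[OF s v(4)] using t(2) hom[OF s tK aK(2)] by simp
      then have "vnorm N ((Fvec N d (G \<sigma>) ^^ a) v) = cmod (\<sigma> t) * vnorm N ((Fvec N d (G \<sigma>) ^^ b) v')" by (simp add: vnorm_scale)
      moreover have "cmod (\<sigma> t) * X \<le> cmod (\<sigma> t) * vnorm N ((Fvec N d (G \<sigma>) ^^ b) v')"
        unfolding X_def using iter[OF s, of v' b] by (intro mult_left_mono) auto
      ultimately have "cmod (\<sigma> t) * X \<le> (C0 * vnorm N v) ^ (d ^ a)" using iter[OF s, of v a] by linarith
      then have "real R ^ (d ^ a + d ^ b) * (cmod (\<sigma> t) * X) \<le> Y" unfolding Y_def by (intro mult_left_mono) auto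
      then show ?thesis unfolding 1 by (simp add: mult_ac)
    qed
    \<comment> \<open>Otherwise all conjugates of the nonzero algebraic integer
      \<open>\<beta>\<close> would have absolute value below 1.\<close>
    have "X \<le> Y"
    proof (rule ccontr)
      assume "\<not> X \<le> Y"
      then have "Y < X" by simp
      have "cmod (\<sigma> \<beta>) < 1" if "\<sigma> \<in> set \<sigma>s" for \<sigma>
      proof -
        have "cmod (\<sigma> \<beta>) * X < 1 * X" using le[OF that] \<open>Y < X\<close> by simp
        then show ?thesis using X0 by simp
      qed
      then have "(\<Prod>\<sigma>\<leftarrow>\<sigma>s. cmod (\<sigma> \<beta>)) < 1" using emb by (intro prod_list_less_one) (auto simp: embeddings_def)
      moreover have "1 \<le> (\<Prod>\<sigma>\<leftarrow>\<sigma>s. cmod (\<sigma> \<beta>))" using emb bK ai b0 unfolding embeddings_def by simp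
      ultimately show False by simp
    qed
    have "(vnorm N v' / C) ^ (d ^ b) = X / real R ^ (d ^ b)" unfolding X_def C_def by (simp add: power_divide power_mult_distrib)
    also have "\<dots> \<le> Y / real R ^ (d ^ b)" using \<open>X \<le> Y\<close> R by (intro divide_right_mono) auto
    also have "\<dots> = (C * vnorm N v) ^ (d ^ a)" unfolding Y_def C_def using R by (simp add: power_add power_mult_distrib)
    finally show ?thesis .
  qed
  show ?thesis using C1 main by (intro exI[of _ C]) blast
qed


section \<open>Inequivalent points and grand orbits\<close>

lemma orb_equiv_iff: "orb_equiv f P Q \<longleftrightarrow> (\<exists>a b. (f ^^ a) P = (f ^^ b) Q)"
  unfolding orb_equiv_def orbit_def by auto

lemma orb_equiv_refl: "orb_equiv f P P"
  unfolding orb_equiv_iff by auto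

lemma orb_equiv_sym: "orb_equiv f P Q \<Longrightarrow> orb_equiv f Q P"
  unfolding orb_equiv_iff by metis

lemma orb_equiv_trans:
  assumes "orb_equiv f P Q" "orb_equiv f Q R" shows "orb_equiv f P R"
proof -
  obtain a b where 1: "(f ^^ a) P = (f ^^ b) Q" using assms(1) unfolding orb_equiv_iff by auto
  obtain c e where 2: "(f ^^ c) Q = (f ^^ e) R" using assms(2) unfolding orb_equiv_iff by auto
  have "(f ^^ (c + a)) P = (f ^^ c) ((f ^^ b) Q)" using 1 by (simp add: funpow_add)
  also have "\<dots> = (f ^^ b) ((f ^^ c) Q)" by (metis funpow_add add.commute comp_apply)
  also have "\<dots> = (f ^^ (b + e)) R" using 2 by (simp add: funpow_add)
  finally show ?thesis unfolding orb_equiv_iff by blast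
qed

lemma orb_equiv_projE:
  assumes "orb_equiv (fmap N d F) (proj v) (proj w)"
  obtains a b t where "t \<noteq> 0" "(Fvec N d F ^^ a) v = (\<lambda>i. t * (Fvec N d F ^^ b) w i)"
proof -
  obtain a b where "(fmap N d F ^^ a) (proj v) = (fmap N d F ^^ b) (proj w)" using assms unfolding orb_equiv_iff by auto
  then have "proj ((Fvec N d F ^^ a) v) = proj ((Fvec N d F ^^ b) w)" unfolding fmap_funpow_proj .
  then have "(Fvec N d F ^^ a) v \<in> proj ((Fvec N d F ^^ b) w)" using proj_self[of "(Fvec N d F ^^ a) v"] by simp
  then obtain t where "t \<noteq> 0" "(Fvec N d F ^^ a) v = (\<lambda>i. t * (Fvec N d F ^^ b) w i)" by (rule proj_memE)
  then show thesis by (rule that)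
qed

lemma digits_unique:
  fixes \<alpha> \<beta> :: "nat \<Rightarrow> nat"
  assumes "\<And>j. \<alpha> j < b" "\<And>j. \<beta> j < b" "(\<Sum>j<n. \<alpha> j * b ^ j) = (\<Sum>j<n. \<beta> j * b ^ j)" "j < n"
  shows "\<alpha> j = \<beta> j"
  using assms
proof (induct n arbitrary: \<alpha> \<beta> j)
  case (Suc n)
  have s: "(\<Sum>j<Suc n. \<gamma> j * b ^ j) = \<gamma> 0 + b * (\<Sum>j<n. \<gamma> (Suc j) * b ^ j)" for \<gamma> :: "nat \<Rightarrow> nat"
    by (simp only: sum.lessThan_Suc_shift) (simp add: sum_distrib_left mult_ac)
  have eq: "\<alpha> 0 + b * (\<Sum>j<n. \<alpha> (Suc j) * b ^ j) = \<beta> 0 + b * (\<Sum>j<n. \<beta> (Suc j) * b ^ j)" using Suc(4) unfolding s .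
  have "(\<alpha> 0 + b * (\<Sum>j<n. \<alpha> (Suc j) * b ^ j)) mod b = \<alpha> 0" using Suc(2)[of 0] by simp
  moreover have "(\<beta> 0 + b * (\<Sum>j<n. \<beta> (Suc j) * b ^ j)) mod b = \<beta> 0" using Suc(3)[of 0] by simp
  ultimately have z: "\<alpha> 0 = \<beta> 0" using eq by simp
  then have "b * (\<Sum>j<n. \<alpha> (Suc j) * b ^ j) = b * (\<Sum>j<n. \<beta> (Suc j) * b ^ j)" using eq by simp
  moreover have "b > 0" using Suc(2)[of 0] by simp
  ultimately have "(\<Sum>j<n. \<alpha> (Suc j) * b ^ j) = (\<Sum>j<n. \<beta> (Suc j) * b ^ j)" by simp
  then have IH: "\<alpha> (Suc i) = \<beta> (Suc i)" if "i < n" for i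
    using Suc(1)[of "\<lambda>j. \<alpha> (Suc j)" "\<lambda>j. \<beta> (Suc j)" i] Suc(2,3) that by blast
  show ?case using z IH Suc(5) by (cases j) auto
qed simp

text \<open>Kronecker substitution: distinct monomials of degree below \<open>b\<close> take distinct powers of \<open>x\<close>.\<close>

definition kron :: "nat \<Rightarrow> nat \<Rightarrow> nat \<Rightarrow> nat \<Rightarrow> complex" where
  "kron N b x = (\<lambda>j. if j \<le> N then of_nat x ^ (b ^ j - 1) else 0)"

lemma form_nonzero_at_kron:
  assumes "heval N e c v \<noteq> 0"
  shows "\<exists>X. \<forall>b>e. \<forall>x\<ge>X. heval N e c (kron N b x) \<noteq> 0"
proof -
  define T where "T = {\<alpha> \<in> monoms N e. c \<alpha> \<noteq> 0}"
  have fT: "finite T" unfolding T_def by simp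
  have Tne: "T \<noteq> {}"
  proof
    assume "T = {}"
    then have "heval N e c v = 0" unfolding heval_def T_def by (intro sum.neutral) auto
    then show False using assms by simp
  qed
  define \<mu> where "\<mu> = Min ((\<lambda>\<alpha>. cmod (c \<alpha>)) ` T)"
  have \<mu>0: "\<mu> > 0" unfolding \<mu>_def using fT Tne by (subst Min_gr_iff) (auto simp: T_def)
  have \<mu>le: "\<mu> \<le> cmod (c \<alpha>)" if "\<alpha> \<in> T" for \<alpha> unfolding \<mu>_def using fT that by (intro Min_le) auto
  define S where "S = (\<Sum>\<alpha>\<in>T. cmod (c \<alpha>))"
  \<comment> \<open>\<open>\<mu>\<close> is the least size of a nonzero coefficient and
    \<open>S\<close> the total size of all: once \<open>x\<close> exceeds \<open>S / \<mu>\<close>,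
    the term with the largest exponent outweighs the others together.\<close>
  define X where "X = nat \<lceil>S / \<mu>\<rceil> + 1"
  have "heval N e c (kron N b x) \<noteq> 0" if b: "b > e" and x: "x \<ge> X" for b x
  proof -
    have x1: "x \<ge> 1" using x unfolding X_def by simp
    define E where "E = (\<lambda>\<alpha> :: nat \<Rightarrow> nat. \<Sum>j<Suc N. \<alpha> j * b ^ j)"
    \<comment> \<open>Scaling by \<open>x\<close> turns the entries into the powers
      \<open>x ^ (b ^ j)\<close>. The exponents \<open>b ^ j - 1\<close> of \<open>kron\<close>
      serve to make the entry at index 0 equal to 1.\<close>
    define u where "u = (\<lambda>j. of_nat x * kron N b x j)"
    have uj: "u j = of_nat x ^ (b ^ j)" if "j \<le> N" for j
    proof -
      have "b ^ j \<ge> 1" using b by simp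
      then have "x * x ^ (b ^ j - 1) = x ^ (b ^ j)" by (metis Suc_diff_1 One_nat_def less_eq_Suc_le power_Suc)
      then have "(of_nat (x * x ^ (b ^ j - 1)) :: complex) = of_nat (x ^ (b ^ j))" by simp
      then show ?thesis unfolding u_def kron_def using that by simp
    qed
    have hu: "heval N e c u = (\<Sum>\<alpha>\<in>T. c \<alpha> * of_nat x ^ E \<alpha>)"
    proof -
      have "(\<Prod>i\<le>N. u i ^ \<alpha> i) = of_nat x ^ E \<alpha>" for \<alpha>
      proof -
        have "(\<Prod>i\<le>N. u i ^ \<alpha> i) = (\<Prod>i\<le>N. of_nat x ^ (\<alpha> i * b ^ i))"
          using uj by (intro prod.cong refl) (simp add: power_mult[symmetric] mult.commute)
        also have "\<dots> = of_nat x ^ E \<alpha>" unfolding E_def lessThan_Suc_atMost by (simp add: power_sum)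
        finally show ?thesis .
      qed
      then have "heval N e c u = (\<Sum>\<alpha>\<in>monoms N e. c \<alpha> * of_nat x ^ E \<alpha>)" unfolding heval_def by simp
      also have "\<dots> = (\<Sum>\<alpha>\<in>T. c \<alpha> * of_nat x ^ E \<alpha>)" unfolding T_def by (intro sum.mono_neutral_right) auto
      finally show ?thesis .
    qed
    have inj: "E \<alpha> \<noteq> E \<beta>" if "\<alpha> \<in> T" "\<beta> \<in> T" "\<alpha> \<noteq> \<beta>" for \<alpha> \<beta>
    proof
      assume eq: "E \<alpha> = E \<beta>"
      have lt: "\<gamma> j < b" if "\<gamma> \<in> T" for \<gamma> j using monoms_le[of \<gamma> N e j] that b unfolding T_def by simp
      have "\<alpha> j = \<beta> j" for j
      proof (cases "j < Suc N")
        case True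
        show ?thesis by (rule digits_unique[OF lt[OF that(1)] lt[OF that(2)] eq[unfolded E_def] True])
      next
        case False
        then show ?thesis using that unfolding T_def monoms_def by simp
      qed
      then show False using that(3) by auto
    qed
    obtain \<mu>\<alpha> where m: "\<mu>\<alpha> \<in> T" "\<And>\<alpha>. \<alpha> \<in> T \<Longrightarrow> E \<alpha> \<le> E \<mu>\<alpha>"
    proof -
      have "Max (E ` T) \<in> E ` T" using fT Tne by (intro Max_in) auto
      then obtain a where "a \<in> T" "E a = Max (E ` T)" by (elim imageE) auto
      then show thesis using fT by (intro that[of a]) auto
    qed
    have "heval N e c u \<noteq> 0"
    proof
      assume "heval N e c u = 0"
      then have "c \<mu>\<alpha> * of_nat x ^ E \<mu>\<alpha> = - (\<Sum>\<alpha>\<in>T - {\<mu>\<alpha>}. c \<alpha> * of_nat x ^ E \<alpha>)"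
        unfolding hu using sum.remove[OF fT m(1), of "\<lambda>\<alpha>. c \<alpha> * of_nat x ^ E \<alpha>"] by (simp add: eq_neg_iff_add_eq_0)
      then have "cmod (c \<mu>\<alpha>) * real x ^ E \<mu>\<alpha> = cmod (\<Sum>\<alpha>\<in>T - {\<mu>\<alpha>}. c \<alpha> * of_nat x ^ E \<alpha>)"
        by (metis norm_minus_cancel norm_mult norm_of_nat norm_power)
      also have "\<dots> \<le> (\<Sum>\<alpha>\<in>T - {\<mu>\<alpha>}. cmod (c \<alpha>) * (real x ^ E \<mu>\<alpha> / real x))"
      proof (rule sum_norm_le)
        fix \<alpha> assume a: "\<alpha> \<in> T - {\<mu>\<alpha>}"
        then have "E \<alpha> < E \<mu>\<alpha>" using m inj[of \<alpha> \<mu>\<alpha>] by (metis DiffE insertI1 le_neq_implies_less)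
        then have "real x * real x ^ E \<alpha> \<le> real x ^ E \<mu>\<alpha>" using x1 by (simp only: power_Suc[symmetric]) (intro power_increasing; simp)
        then have "real x ^ E \<alpha> \<le> real x ^ E \<mu>\<alpha> / real x" using x1 by (simp add: field_simps)
        then have "cmod (c \<alpha>) * real x ^ E \<alpha> \<le> cmod (c \<alpha>) * (real x ^ E \<mu>\<alpha> / real x)" by (intro mult_left_mono) auto
        then show "cmod (c \<alpha> * of_nat x ^ E \<alpha>) \<le> cmod (c \<alpha>) * (real x ^ E \<mu>\<alpha> / real x)"
          by (simp only: norm_mult norm_power norm_of_nat)
      qed
      also have "\<dots> = (\<Sum>\<alpha>\<in>T - {\<mu>\<alpha>}. cmod (c \<alpha>)) * (real x ^ E \<mu>\<alpha> / real x)" by (simp only: sum_distrib_right)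
      also have "\<dots> \<le> S * (real x ^ E \<mu>\<alpha> / real x)"
        unfolding S_def using fT by (intro mult_right_mono sum_mono2) auto
      finally have "cmod (c \<mu>\<alpha>) * real x ^ E \<mu>\<alpha> * real x \<le> S * real x ^ E \<mu>\<alpha>" using x1 by (simp add: field_simps)
      then have "cmod (c \<mu>\<alpha>) * real x \<le> S" using x1 by (simp add: mult_ac)
      moreover have "\<mu> * real x \<le> cmod (c \<mu>\<alpha>) * real x" using \<mu>le[OF m(1)] by (intro mult_right_mono) auto
      moreover have "S < \<mu> * real x"
      proof -
        have "S / \<mu> \<le> real (nat \<lceil>S / \<mu>\<rceil>)" by (rule real_nat_ceiling_ge)
        also have "\<dots> < real x" using x unfolding X_def by linarith
        finally show ?thesis using \<mu>0 by (simp add: field_simps)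
      qed
      ultimately show False by linarith
    qed
    then show ?thesis unfolding u_def heval_scale by auto
  qed
  then show ?thesis by (intro exI[of _ X]) simp
qed

text \<open>If \<open>a \<le> b\<close>, the first inequality gives
  \<open>n' * l \<le> n * l + 2 * c\<close>, against \<open>n < n'\<close>. Otherwise
  \<open>d ^ a\<close> is at least twice \<open>d ^ b\<close>, and the second gives
  \<open>2 * n * l \<le> n' * l + 3 * c\<close>, against \<open>n' < 2 * n\<close>. In both cases
  the integer gap is worth \<open>l > 3 * c\<close>.\<close>

lemma log_heights_incompatible:
  fixes l c :: real and n n' d a b :: nat
  assumes l: "l > 3 * c" "c \<ge> 0" and d: "d \<ge> 2" and n: "n < n'" "n' < 2 * n"
    and 1: "real d ^ b * (real n' * l - c) \<le> real d ^ a * (real n * l + c)"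
    and 2: "real d ^ a * (real n * l - c) \<le> real d ^ b * (real n' * l + c)"
  shows False
proof (cases "a \<le> b")
  case True
  have l0: "l > 0" using l by linarith
  have p: "real d ^ a > 0" using d by simp
  have "real n' \<ge> real n + 1" using n by simp
  then have "real n' * l \<ge> (real n + 1) * l" using l0 by (intro mult_right_mono) auto
  then have n': "real n' * l \<ge> real n * l + l" by (simp add: distrib_right)
  have "real n * l \<ge> 0" using l0 by simp
  then have pos: "real n' * l - c \<ge> 0" using n' l by linarith
  have "real d ^ a * (real n' * l - c) \<le> real d ^ b * (real n' * l - c)"
    using True d pos by (intro mult_right_mono power_increasing) auto
  then have "real d ^ a * (real n' * l - c) \<le> real d ^ a * (real n * l + c)" using 1 by linarith
  then have "real n' * l - c \<le> real n * l + c" using p by simp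
  then show False using n' l by linarith
next
  case False
  have l0: "l > 0" using l by linarith
  have p: "real d ^ b > 0" using d by simp
  have "real n \<ge> 1" using n by simp
  then have "real n * l \<ge> 1 * l" using l0 by (intro mult_right_mono) auto
  then have pos: "real n * l - c \<ge> 0" using l by linarith
  have "real d ^ b * 2 \<le> real d ^ b * real d" using d by (intro mult_left_mono) auto
  also have "\<dots> = real d ^ Suc b" by simp
  also have "\<dots> \<le> real d ^ a" using False d by (intro power_increasing) auto
  finally have "(real d ^ b * 2) * (real n * l - c) \<le> real d ^ a * (real n * l - c)" using pos by (intro mult_right_mono)
  then have "(real d ^ b * 2) * (real n * l - c) \<le> real d ^ b * (real n' * l + c)" using 2 by linarith
  then have "real d ^ b * (2 * (real n * l - c)) \<le> real d ^ b * (real n' * l + c)" by (simp only: mult.assoc)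
  then have "2 * (real n * l - c) \<le> real n' * l + c" using p by (simp only: mult_le_cancel_left_pos)
  moreover have "real n' + 1 \<le> 2 * real n" using n by simp
  then have "(real n' + 1) * l \<le> 2 * real n * l" using l0 by (intro mult_right_mono) auto
  then have "real n' * l + l \<le> 2 * (real n * l)" by (simp add: distrib_right)
  ultimately show False using l by (simp add: right_diff_distrib)
qed

lemma vnorm_kron:
  assumes "b \<ge> 1" "x \<ge> 1"
  shows "real x ^ (b ^ N - 1) \<le> vnorm N (kron N b x)" "vnorm N (kron N b x) \<le> real (Suc N) * real x ^ (b ^ N - 1)"
proof -
  have "cmod (kron N b x N) \<le> vnorm N (kron N b x)" by (rule vnorm_ge) simp
  then show "real x ^ (b ^ N - 1) \<le> vnorm N (kron N b x)" unfolding kron_def by (simp add: norm_power)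
  have "vnorm N (kron N b x) \<le> (\<Sum>j\<le>N. real x ^ (b ^ N - 1))"
    unfolding vnorm_def
  proof (rule sum_mono)
    fix j assume "j \<in> {..N}"
    then have "b ^ j - 1 \<le> b ^ N - 1" using assms(1) by (intro diff_le_mono power_increasing) auto
    then show "cmod (kron N b x j) \<le> real x ^ (b ^ N - 1)" unfolding kron_def using assms(2) \<open>j \<in> {..N}\<close>
      by (simp add: norm_power power_increasing)
  qed
  then show "vnorm N (kron N b x) \<le> real (Suc N) * real x ^ (b ^ N - 1)" by simp
qed

lemma kron_basic:
  shows "is_vec N (kron N b x)" "kron N b x i \<in> \<nat>" "kron N b x 0 = 1" "alg_vec N (kron N b x)" "kron N b x \<noteq> (\<lambda>_. 0)"
proof -
  show n: "kron N b x i \<in> \<nat>" for i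
  proof (cases "i \<le> N")
    case True
    then have "kron N b x i = of_nat (x ^ (b ^ i - 1))" unfolding kron_def by simp
    then show ?thesis by (metis of_nat_in_Nats)
  qed (simp add: kron_def)
  show 1: "is_vec N (kron N b x)" "kron N b x 0 = 1" unfolding is_vec_def kron_def by simp_all
  have "algebraic (kron N b x i)" for i by (rule Nats_cases[OF n[of i]]) simp
  then show "alg_vec N (kron N b x)" using 1 unfolding alg_vec_def by simp
  show "kron N b x \<noteq> (\<lambda>_. 0)"
  proof
    assume "kron N b x = (\<lambda>_. 0)"
    then have "kron N b x 0 = 0" by metis
    then show False using 1 by simp
  qed
qed

text \<open>\<open>B0\<close> does not depend on \<open>b\<close>, so that \<open>b\<close> can grow
  along a sequence of such points. That is needed for avoiding forms of every degree.\<close>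

lemma inequivalent_points:
  assumes cert: "certificate K N d F D g" and K: "is_subfield K" "K \<subseteq> {x. algebraic x}" and emb: "embeddings K \<sigma>s" and d: "d \<ge> 2" and N: "N \<ge> 1"
  shows "\<exists>B0. \<forall>b\<ge>2. \<forall>B\<ge>B0. \<forall>n n'. n < n' \<and> n' < 2 * n \<longrightarrow> \<not> orb_equiv (fmap N d F) (proj (kron N b (B ^ n))) (proj (kron N b (B ^ n')))"
proof -
  obtain C where C: "C \<ge> 1" and hc': "\<forall>v v' a b t. is_vec N v \<and> is_vec N v' \<and> (\<forall>i. v i \<in> \<nat>) \<and> (\<forall>i. v' i \<in> \<nat>) \<and> v 0 = 1 \<and> v' 0 = 1 \<and> t \<noteq> 0 \<and>
     (Fvec N d F ^^ a) v = (\<lambda>i. t * (Fvec N d F ^^ b) v' i) \<longrightarrow> (vnorm N v' / C) ^ (d ^ b) \<le> (C * vnorm N v) ^ (d ^ a)"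
    using height_comparison[OF cert K emb d] by (elim exE conjE) (rule that)
  have hc: "(vnorm N (kron N b y) / C) ^ (d ^ e) \<le> (C * vnorm N (kron N b x)) ^ (d ^ a)"
    if "t \<noteq> 0" "(Fvec N d F ^^ a) (kron N b x) = (\<lambda>i. t * (Fvec N d F ^^ e) (kron N b y) i)" for a b e t x y
    by (rule hc'[THEN spec, THEN spec, THEN spec, THEN spec, THEN spec[of _ t], THEN mp]) (intro conjI allI kron_basic that)
  \<comment> \<open>The height constant together with the factor \<open>N + 1\<close> by which
    \<open>vnorm\<close> can exceed the largest entry. \<open>B0\<close> is chosen to make
    \<open>ln B\<close> exceed the \<open>3 * c\<close> demanded by
    \<open>log_heights_incompatible\<close>.\<close>
  define c where "c = ln (C * real (Suc N))"
  have CN: "C * real (Suc N) \<ge> 1" using mult_mono[OF C, of 1 "real (Suc N)"] C by simp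
  have c0: "c \<ge> 0" unfolding c_def using CN by simp
  define B0 where "B0 = nat \<lceil>exp (3 * c)\<rceil> + 1"
  have B0: "real B > exp (3 * c)" if "B \<ge> B0" for B
  proof -
    have "exp (3 * c) \<le> real (nat \<lceil>exp (3 * c)\<rceil>)" by (rule of_nat_ceiling)
    then show ?thesis using that unfolding B0_def by linarith
  qed
  have key: "real d ^ e * (real n' * (real (b ^ N - 1) * ln (real B)) - c) \<le> real d ^ a * (real n * (real (b ^ N - 1) * ln (real B)) + c)"
    if b: "b \<ge> 2" and B: "B \<ge> B0" and t: "t \<noteq> 0" "(Fvec N d F ^^ a) (kron N b (B ^ n)) = (\<lambda>i. t * (Fvec N d F ^^ e) (kron N b (B ^ n')) i)"
    for b B a e t n n'
  proof -
    have B1: "B \<ge> 1" using B unfolding B0_def by simp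
    define M where "M = b ^ N - 1"
    have lo: "(real B ^ n') ^ M \<le> vnorm N (kron N b (B ^ n'))" using vnorm_kron(1)[of b "B ^ n'" N] b B1 unfolding M_def by simp
    have hi: "vnorm N (kron N b (B ^ n)) \<le> real (Suc N) * (real B ^ n) ^ M" using vnorm_kron(2)[of b "B ^ n" N] b B1 unfolding M_def by simp
    have P: "real B ^ k > 0" for k using B1 by simp
    have CC: "C \<le> C * real (Suc N)" using C by simp
    have "((real B ^ n') ^ M / (C * real (Suc N))) ^ (d ^ e) \<le> (vnorm N (kron N b (B ^ n')) / C) ^ (d ^ e)"
      using lo C CC P[of n'] by (intro power_mono frac_le) (auto simp: vnorm_nonneg)
    also have "\<dots> \<le> (C * vnorm N (kron N b (B ^ n))) ^ (d ^ a)"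
      by (rule hc[OF t])
    also have "\<dots> \<le> (C * (real (Suc N) * (real B ^ n) ^ M)) ^ (d ^ a)"
      using hi C vnorm_nonneg[of N] by (intro power_mono mult_left_mono) auto
    finally have le: "((real B ^ n') ^ M / (C * real (Suc N))) ^ (d ^ e) \<le> ((C * real (Suc N)) * (real B ^ n) ^ M) ^ (d ^ a)" by (simp add: mult.assoc)
    have p1: "(real B ^ n') ^ M / (C * real (Suc N)) > 0" and p2: "(C * real (Suc N)) * (real B ^ n) ^ M > 0"
      using P CN by (simp_all del: of_nat_Suc)
    have "ln (((real B ^ n') ^ M / (C * real (Suc N))) ^ (d ^ e)) \<le> ln (((C * real (Suc N)) * (real B ^ n) ^ M) ^ (d ^ a))"
      using le p1 p2 by (subst ln_le_cancel_iff) auto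
    then have "real (d ^ e) * ln ((real B ^ n') ^ M / (C * real (Suc N))) \<le> real (d ^ a) * ln ((C * real (Suc N)) * (real B ^ n) ^ M)"
      using p1 p2 by (simp only: ln_realpow)
    moreover have "ln ((real B ^ n') ^ M / (C * real (Suc N))) = real n' * (real M * ln (real B)) - c"
    proof -
      have "ln ((real B ^ n') ^ M / (C * real (Suc N))) = ln ((real B ^ n') ^ M) - c" unfolding c_def using P CN by (intro ln_divide_pos) (auto simp del: of_nat_Suc)
      then show ?thesis using P[of n'] B1 by (simp add: ln_realpow)
    qed
    moreover have "ln ((C * real (Suc N)) * (real B ^ n) ^ M) = real n * (real M * ln (real B)) + c"
    proof -
      have "ln ((C * real (Suc N)) * (real B ^ n) ^ M) = c + ln ((real B ^ n) ^ M)" unfolding c_def using P CN by (intro ln_mult_pos) (auto simp del: of_nat_Suc)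
      then show ?thesis using P[of n] B1 by (simp add: ln_realpow)
    qed
    ultimately show ?thesis unfolding M_def by simp
  qed
  have "\<not> orb_equiv (fmap N d F) (proj (kron N b (B ^ n))) (proj (kron N b (B ^ n')))"
    if b: "b \<ge> 2" and B: "B \<ge> B0" and n: "n < n'" "n' < 2 * n" for b B n n'
  proof
    assume "orb_equiv (fmap N d F) (proj (kron N b (B ^ n))) (proj (kron N b (B ^ n')))"
    then obtain a e t where t: "t \<noteq> 0" "(Fvec N d F ^^ a) (kron N b (B ^ n)) = (\<lambda>i. t * (Fvec N d F ^^ e) (kron N b (B ^ n')) i)"
      by (rule orb_equiv_projE)
    have t': "inverse t \<noteq> 0" "(Fvec N d F ^^ e) (kron N b (B ^ n')) = (\<lambda>i. inverse t * (Fvec N d F ^^ a) (kron N b (B ^ n)) i)"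
      using t(1) unfolding t(2) by (simp_all add: mult.assoc[symmetric])
    define l where "l = real (b ^ N - 1) * ln (real B)"
    have "b ^ 1 \<le> b ^ N" using b N by (intro power_increasing) auto
    then have "b ^ N - 1 \<ge> 1" using b by simp
    then have E1: "real (b ^ N - 1) \<ge> 1" by linarith
    have lnB: "ln (real B) > 3 * c" using B0[OF B] by (metis exp_gt_zero less_trans ln_exp ln_less_cancel_iff)
    then have "ln (real B) \<ge> 0" using c0 by linarith
    then have "1 * ln (real B) \<le> l" unfolding l_def by (rule mult_right_mono[OF E1])
    then have l3: "l > 3 * c" using lnB by simp
    show False
      using log_heights_incompatible[OF l3 c0 d n] key[OF b B t] key[OF b B t'] unfolding l_def by blast
  qed
  then show ?thesis by (intro exI[of _ B0]) blast
qed

lemma inequivalent_sequence: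
  fixes eq :: "'a \<Rightarrow> 'a \<Rightarrow> bool" and cand :: "nat \<Rightarrow> 'a set"
  assumes step: "\<And>i S. finite S \<Longrightarrow> \<exists>p\<in>cand i. \<forall>s\<in>S. \<not> eq s p"
  shows "\<exists>p. (\<forall>i. p i \<in> cand i) \<and> (\<forall>i j. j < i \<longrightarrow> \<not> eq (p j) (p i))"
proof -
  define P where "P = (\<lambda>n (s :: 'a set \<times> 'a). finite (fst s) \<and> snd s \<in> cand n \<and> (\<forall>t\<in>fst s. \<not> eq t (snd s)))"
  have "\<exists>f. \<forall>n. P n (f n) \<and> fst (f (Suc n)) = insert (snd (f n)) (fst (f n))"
  proof (rule dependent_nat_choice)
    show "\<exists>s. P 0 s" using step[of "{}" 0] unfolding P_def by (auto intro: exI[of _ "({}, _)"])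
    fix s n assume "P n s"
    then have "finite (insert (snd s) (fst s))" unfolding P_def by simp
    from step[OF this, of "Suc n"] obtain p where "p \<in> cand (Suc n)" "\<forall>t\<in>insert (snd s) (fst s). \<not> eq t p" by auto
    then show "\<exists>s'. P (Suc n) s' \<and> fst s' = insert (snd s) (fst s)"
      using \<open>finite _\<close> unfolding P_def by (intro exI[of _ "(insert (snd s) (fst s), p)"]) auto
  qed
  then obtain f where f: "\<And>n. P n (f n)" "\<And>n. fst (f (Suc n)) = insert (snd (f n)) (fst (f n))" by auto
  have mem: "snd (f j) \<in> fst (f i)" if "j < i" for i j
    using that by (induct i) (auto simp: f(2) less_Suc_eq)
  show ?thesis using f(1) mem unfolding P_def by (intro exI[of _ "\<lambda>i. snd (f i)"]) blast
qed

lemma dense_inequivalent_sequence: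
  assumes cert: "certificate K N d F D g" and K: "is_subfield K" "K \<subseteq> {x. algebraic x}" and emb: "embeddings K \<sigma>s" and d: "d \<ge> 2" and N: "N \<ge> 1"
  shows "\<exists>p :: nat \<Rightarrow> (nat \<Rightarrow> complex) set. (\<forall>i j. i \<noteq> j \<longrightarrow> \<not> orb_equiv (fmap N d F) (p i) (p j)) \<and> (\<forall>i. p i \<in> PN_K N K) \<and>
    (\<forall>e c v. heval N e c v \<noteq> 0 \<longrightarrow> (\<exists>n0. \<forall>i\<ge>n0. \<exists>w. p i = proj w \<and> heval N e c w \<noteq> 0))"
proof -
  let ?eq = "orb_equiv (fmap N d F)"
  obtain B0 where B0': "\<forall>b\<ge>2. \<forall>B\<ge>B0. \<forall>n n'. n < n' \<and> n' < 2 * n \<longrightarrow> \<not> ?eq (proj (kron N b (B ^ n))) (proj (kron N b (B ^ n')))"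
    using inequivalent_points[OF cert K emb d N] by (rule exE)
  have B0: "\<not> ?eq (proj (kron N b (B ^ n))) (proj (kron N b (B ^ n')))" if "b \<ge> 2" "B \<ge> B0" "n < n'" "n' < 2 * n" for b B n n'
    using B0'[rule_format, of b B n n'] that by simp
  \<comment> \<open>Both the base \<open>i + 2\<close> and the bound on \<open>x\<close> grow with
    \<open>i\<close>, so every form that is not identically zero is nonzero at all but finitely many
    of the chosen points.\<close>
  define cand where "cand = (\<lambda>i. {proj (kron N (i + 2) x) | x. x \<ge> i})"
  have step: "\<exists>p\<in>cand i. \<forall>s\<in>S. \<not> ?eq s p" if fin: "finite S" for i S
  proof (rule ccontr)
    assume no: "\<not> ?thesis"
    define r where "r = card S"
    define B where "B = B0 + i + 1"
    \<comment> \<open>For \<open>k \<le> r\<close> the exponents \<open>r + 1 + k\<close> stay below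
      \<open>2 * (r + 1)\<close>, so these \<open>r + 1\<close> points are pairwise inequivalent and
      cannot all be equivalent to members of a set of size \<open>r\<close>.\<close>
    define q where "q = (\<lambda>k. proj (kron N (i + 2) (B ^ (r + 1 + k))))"
    have ne: "\<not> ?eq (q k) (q l)" if "k \<le> r" "l \<le> r" "k < l" for k l
      unfolding q_def by (rule B0) (use that in \<open>auto simp: B_def\<close>)
    have qc: "q k \<in> cand i" for k
    proof -
      have "B ^ 1 \<le> B ^ (r + 1 + k)" by (intro power_increasing) (auto simp: B_def)
      then have "B \<le> B ^ (r + 1 + k)" by (simp only: power_one_right)
      moreover have "i \<le> B" unfolding B_def by simp
      ultimately have "i \<le> B ^ (r + 1 + k)" by (rule order.trans[rotated])
      then show ?thesis unfolding cand_def q_def by auto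
    qed
    have "\<forall>k. \<exists>s. s \<in> S \<and> ?eq s (q k)" using no qc by blast
    from choice[OF this] obtain h where h: "\<And>k. h k \<in> S" "\<And>k. ?eq (h k) (q k)" by auto
    have "\<not> inj_on h {..r}"
    proof
      assume "inj_on h {..r}"
      then have "card {..r} \<le> card S" using h(1) fin by (intro card_inj_on_le) auto
      then show False unfolding r_def by simp
    qed
    then obtain k l where kl: "k \<le> r" "l \<le> r" "k \<noteq> l" "h k = h l" unfolding inj_on_def by auto
    have eq: "?eq (q k) (q l)" "?eq (q l) (q k)" using orb_equiv_trans[OF orb_equiv_sym[OF h(2)]] h(2) kl(4) by metis+
    show False using ne[OF kl(1,2)] ne[OF kl(2,1)] eq kl(3) by (cases "k < l") auto
  qed
  from inequivalent_sequence[of cand ?eq, OF step] obtain p where p: "\<And>i. p i \<in> cand i" "\<And>i j. j < i \<Longrightarrow> \<not> ?eq (p j) (p i)" by auto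
  have "\<forall>i. \<exists>x. x \<ge> i \<and> p i = proj (kron N (i + 2) x)" using p(1) unfolding cand_def by auto
  from choice[OF this] obtain x where x: "\<And>i. x i \<ge> i" "\<And>i. p i = proj (kron N (i + 2) (x i))" by auto
  have A1: "\<not> ?eq (p i) (p j)" if "i \<noteq> j" for i j
    using p(2)[of i j] p(2)[of j i] orb_equiv_sym that by (metis linorder_neqE_nat)
  have A2: "p i \<in> PN_K N K" for i
  proof -
    have "p i \<in> PN N" unfolding x(2) by (rule PN_I) (rule kron_basic)+
    moreover have "kron N (i + 2) (x i) \<in> p i" unfolding x(2) by (rule proj_self)
    moreover have "kron N (i + 2) (x i) j \<in> K" for j by (rule Nats_cases[OF kron_basic(2)[of N "i + 2" "x i" j]]) (simp add: is_subfield_of_nat[OF K(1)])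
    ultimately show ?thesis unfolding PN_K_def by blast
  qed
  have A3: "\<exists>n0. \<forall>i\<ge>n0. \<exists>w. p i = proj w \<and> heval N e c w \<noteq> 0" if "heval N e c v \<noteq> 0" for e c v
  proof -
    from form_nonzero_at_kron[OF that] obtain X where X: "\<And>b x. b > e \<Longrightarrow> x \<ge> X \<Longrightarrow> heval N e c (kron N b x) \<noteq> 0" by auto
    have "heval N e c (kron N (i + 2) (x i)) \<noteq> 0" if "i \<ge> e + X" for i
      by (rule X) (use that x(1)[of i] in linarith)+
    then show ?thesis using x(2) by (intro exI[of _ "e + X"]) blast
  qed
  have "(\<forall>i j. i \<noteq> j \<longrightarrow> \<not> ?eq (p i) (p j)) \<and> (\<forall>i. p i \<in> PN_K N K) \<and>
    (\<forall>e c v. heval N e c v \<noteq> 0 \<longrightarrow> (\<exists>n0. \<forall>i\<ge>n0. \<exists>w. p i = proj w \<and> heval N e c w \<noteq> 0))"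
    by (intro conjI allI impI) (erule A1, rule A2, erule A3)
  then show ?thesis by (intro exI[of _ p])
qed

lemma PN_K_subset: "PN_K N K \<subseteq> PN N"
  unfolding PN_K_def by auto

theorem grand_orbits_part:
  assumes cert: "certificate K N d F D g" and K: "is_subfield K" "K \<subseteq> {x. algebraic x}" and emb: "embeddings K \<sigma>s" and d: "d \<ge> 2" and N: "N \<ge> 1"
  shows "finite Qs \<Longrightarrow> zdense N (PN_K N K - (\<Union>Q\<in>Qs. grand_orbit (fmap N d F) (PN N) Q))"
    and "\<exists>S. S \<subseteq> PN_K N K \<and> zdense N S \<and> (\<forall>P\<in>PN_K N K. \<exists>!Q. Q \<in> S \<and> orb_equiv (fmap N d F) P Q)"
proof -
  let ?eq = "orb_equiv (fmap N d F)"
  obtain p :: "nat \<Rightarrow> (nat \<Rightarrow> complex) set" where ineq': "\<forall>i j. i \<noteq> j \<longrightarrow> \<not> ?eq (p i) (p j)" and pK': "\<forall>i. p i \<in> PN_K N K"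
    and nz': "\<forall>e c v. heval N e c v \<noteq> 0 \<longrightarrow> (\<exists>n0. \<forall>i\<ge>n0. \<exists>w. p i = proj w \<and> heval N e c w \<noteq> 0)"
    using dense_inequivalent_sequence[OF cert K emb d N] by (elim exE conjE) (rule that)
  have ineq: "\<not> ?eq (p i) (p j)" if "i \<noteq> j" for i j using ineq' that by simp
  have pK: "p i \<in> PN_K N K" for i using pK' by simp
  have nz: "\<exists>n0. \<forall>i\<ge>n0. \<exists>w. p i = proj w \<and> heval N e c w \<noteq> 0" if "heval N e c v \<noteq> 0" for e c v
    by (rule nz'[THEN spec, THEN spec, THEN spec, THEN mp, OF that])
  show "zdense N (PN_K N K - (\<Union>Q\<in>Qs. grand_orbit (fmap N d F) (PN N) Q))" if fin: "finite Qs"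
  proof (rule zdenseI)
    show "PN_K N K - (\<Union>Q\<in>Qs. grand_orbit (fmap N d F) (PN N) Q) \<subseteq> PN N" using PN_K_subset by auto
    fix e c v assume "heval N e c v \<noteq> 0"
    from nz[OF this] obtain n0 where n0: "\<And>i. i \<ge> n0 \<Longrightarrow> \<exists>w. p i = proj w \<and> heval N e c w \<noteq> 0" by auto
    have "\<exists>i\<ge>n0. \<forall>Q\<in>Qs. \<not> ?eq Q (p i)"
    proof (rule ccontr)
      assume "\<not> ?thesis"
      then have "\<forall>i. \<exists>Q. i \<ge> n0 \<longrightarrow> Q \<in> Qs \<and> ?eq Q (p i)" by blast
      from choice[OF this] obtain h where h: "\<And>i. i \<ge> n0 \<Longrightarrow> h i \<in> Qs" "\<And>i. i \<ge> n0 \<Longrightarrow> ?eq (h i) (p i)" by auto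
      have "inj_on h {n0..}"
      proof (rule inj_onI, rule ccontr)
        fix i j assume ij: "i \<in> {n0..}" "j \<in> {n0..}" "h i = h j" "i \<noteq> j"
        have "?eq (p i) (h i)" using orb_equiv_sym[OF h(2)[of i]] ij(1) by simp
        moreover have "?eq (h i) (p j)" using h(2)[of j] ij(2,3) by simp
        ultimately have "?eq (p i) (p j)" by (rule orb_equiv_trans)
        then show False using ineq[OF ij(4)] by simp
      qed
      moreover have "h ` {n0..} \<subseteq> Qs" using h(1) by auto
      then have "finite (h ` {n0..})" using fin by (rule finite_subset)
      ultimately have "finite {n0..}" by (intro finite_imageD[of h])
      then obtain k where "\<forall>m\<in>{n0..}. m < k" unfolding finite_nat_set_iff_bounded by (rule exE)
      then have "n0 + k < k" by (rule bspec) simp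
      then show False by simp
    qed
    then obtain i where i: "i \<ge> n0" "\<And>Q. Q \<in> Qs \<Longrightarrow> \<not> ?eq Q (p i)" by auto
    obtain w where w: "p i = proj w" "heval N e c w \<noteq> 0" using n0[OF i(1)] by auto
    have "p i \<in> PN_K N K - (\<Union>Q\<in>Qs. grand_orbit (fmap N d F) (PN N) Q)" using pK[of i] i(2) unfolding grand_orbit_def by simp
    then show "\<exists>w. proj w \<in> PN_K N K - (\<Union>Q\<in>Qs. grand_orbit (fmap N d F) (PN N) Q) \<and> heval N e c w \<noteq> 0"
      using w by metis
  qed
  \<comment> \<open>A class that meets the sequence \<open>p\<close> is represented by its unique
    member \<open>p i\<close>, which makes the representatives dense; any other class gets an
    arbitrary \<open>K\<close>-point.\<close>
  define rep where "rep = (\<lambda>P. if \<exists>i. ?eq P (p i) then p (SOME i. ?eq P (p i)) else SOME Q. Q \<in> PN_K N K \<and> ?eq P Q)"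
  have rep1: "rep P \<in> PN_K N K \<and> ?eq P (rep P)" if P: "P \<in> PN_K N K" for P
  proof (cases "\<exists>i. ?eq P (p i)")
    case True
    then have "?eq P (p (SOME i. ?eq P (p i)))" by (rule someI_ex)
    then show ?thesis unfolding rep_def using True pK by simp
  next
    case False
    have "\<exists>Q. Q \<in> PN_K N K \<and> ?eq P Q" by (rule exI[of _ P]) (rule conjI[OF P orb_equiv_refl])
    from someI_ex[OF this] show ?thesis unfolding rep_def using False by simp
  qed
  have rep2: "rep P = rep P'" if "?eq P P'" for P P'
  proof -
    have "?eq P Q = ?eq P' Q" for Q
      using orb_equiv_trans[OF that] orb_equiv_trans[OF orb_equiv_sym[OF that]] by (rule iffI[rotated])
    then show ?thesis unfolding rep_def by simp
  qed
  have rep3: "rep (p i) = p i" for i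
  proof -
    have ex: "\<exists>j. ?eq (p i) (p j)" by (rule exI[of _ i]) (rule orb_equiv_refl)
    then have 1: "?eq (p i) (p (SOME j. ?eq (p i) (p j)))" by (rule someI_ex)
    have "i = (SOME j. ?eq (p i) (p j))"
    proof (rule ccontr)
      assume "i \<noteq> (SOME j. ?eq (p i) (p j))"
      from ineq[OF this] 1 show False by (rule notE)
    qed
    then have "p (SOME j. ?eq (p i) (p j)) = p i" by simp
    then show ?thesis unfolding rep_def using ex by simp
  qed
  let ?S = "rep ` PN_K N K"
  have S1: "?S \<subseteq> PN_K N K" using rep1 by auto
  have Sd: "zdense N ?S"
  proof (rule zdenseI)
    show "?S \<subseteq> PN N" using S1 PN_K_subset by (rule order.trans)
    fix e c v assume "heval N e c v \<noteq> 0"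
    from nz[OF this] obtain n0 w where w: "p n0 = proj w" "heval N e c w \<noteq> 0" by auto
    have "p n0 \<in> ?S" using rep3[of n0] pK[of n0] by (metis imageI)
    then show "\<exists>w. proj w \<in> ?S \<and> heval N e c w \<noteq> 0" using w by metis
  qed
  have Su: "\<exists>!Q. Q \<in> ?S \<and> ?eq P Q" if P: "P \<in> PN_K N K" for P
  proof (rule ex1I[of _ "rep P"])
    show "rep P \<in> ?S \<and> ?eq P (rep P)" using rep1[OF P] P by simp
    fix Q assume Q: "Q \<in> ?S \<and> ?eq P Q"
    then obtain P' where P': "P' \<in> PN_K N K" "Q = rep P'" by auto
    have "?eq P' Q" using rep1[OF P'(1)] P'(2) by simp
    from orb_equiv_trans[OF conjunct2[OF Q] orb_equiv_sym[OF this]] have "rep P = rep P'" by (rule rep2)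
    then show "Q = rep P" using P'(2) by simp
  qed
  show "\<exists>S. S \<subseteq> PN_K N K \<and> zdense N S \<and> (\<forall>P\<in>PN_K N K. \<exists>!Q. Q \<in> S \<and> ?eq P Q)"
    by (rule exI[of _ ?S], rule conjI[OF S1 conjI[OF Sd]], rule ballI, erule Su)
qed


section \<open>Derivatives of polynomial functions and critical points\<close>

text \<open>Polynomial functions together with their directional derivatives \<open>D v w\<close> at \<open>v\<close> in direction \<open>w\<close>.\<close>

inductive PolD :: "complex set \<Rightarrow> nat \<Rightarrow> ((nat \<Rightarrow> complex) \<Rightarrow> complex) \<Rightarrow> ((nat \<Rightarrow> complex) \<Rightarrow> (nat \<Rightarrow> complex) \<Rightarrow> complex) \<Rightarrow> bool"
  for S :: "complex set" and n :: nat
where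
  PolD_const: "c \<in> S \<Longrightarrow> PolD S n (\<lambda>x. c) (\<lambda>v w. 0)"
| PolD_var: "i < n \<Longrightarrow> PolD S n (\<lambda>x. x i) (\<lambda>v w. w i)"
| PolD_add: "PolD S n f D \<Longrightarrow> PolD S n g E \<Longrightarrow> PolD S n (\<lambda>x. f x + g x) (\<lambda>v w. D v w + E v w)"
| PolD_mult: "PolD S n f D \<Longrightarrow> PolD S n g E \<Longrightarrow> PolD S n (\<lambda>x. f x * g x) (\<lambda>v w. f v * E v w + g v * D v w)"

lemma PolD_exists: "f \<in> Pol S n \<Longrightarrow> \<exists>D. PolD S n f D"
  by (induct rule: Pol.induct) (blast intro: PolD.intros)+

lemma PolD_Pol: "PolD S n f D \<Longrightarrow> f \<in> Pol S n"
  by (induct rule: PolD.induct) (auto intro: Pol.intros)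

lemma PolD_deriv:
  assumes "PolD S n f D"
  shows "((\<lambda>t. f (\<lambda>i. v i + t * w i)) has_field_derivative D v w) (at 0)"
  using assms
proof induct
  case (PolD_mult f D g E)
  from DERIV_mult[OF PolD_mult(2,4)] show ?case by (simp add: algebra_simps)
qed (auto intro!: derivative_eq_intros)

definition unitv :: "nat \<Rightarrow> nat \<Rightarrow> complex" where "unitv j = (\<lambda>i. if i = j then 1 else 0)"

lemma PolD_linear:
  assumes "PolD S n f D" shows "D v w = (\<Sum>j<n. w j * D v (unitv j))"
  using assms
proof induct
  case (PolD_var i)
  have "(\<Sum>j<n. w j * unitv j i) = (\<Sum>j<n. if j = i then w j else 0)"
    by (rule sum.cong) (auto simp: unitv_def)
  then show ?case using PolD_var by simp
next
  case (PolD_add f D g E)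
  then show ?case by (simp add: distrib_left sum.distrib)
next
  case (PolD_mult f D g E)
  have "(\<Sum>j<n. w j * (f v * E v (unitv j) + g v * D v (unitv j))) = f v * (\<Sum>j<n. w j * E v (unitv j)) + g v * (\<Sum>j<n. w j * D v (unitv j))"
    by (simp add: distrib_left sum.distrib sum_distrib_left mult_ac)
  then show ?case using PolD_mult(2,4) by simp
qed simp

lemma PolD_partial_Pol:
  assumes "PolD S n f D" "0 \<in> S" "1 \<in> S" shows "(\<lambda>v. D v (unitv j)) \<in> Pol S n"
  using assms(1)
proof induct
  case (PolD_var i)
  then show ?case using assms(2,3) by (cases "i = j") (simp_all add: unitv_def Pol_const)
next
  case (PolD_mult f D g E)
  show ?case
    by (rule Pol_add[OF Pol_mult[OF PolD_Pol[OF PolD_mult(1)] PolD_mult(4)] Pol_mult[OF PolD_Pol[OF PolD_mult(3)] PolD_mult(2)]])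
qed (auto intro: Pol_const Pol_add assms(2))

lemma (in place) PolD_taylor:
  assumes "PolD S n f D" "S \<subseteq> A" "\<And>i. i < n \<Longrightarrow> v i \<in> A" "\<And>i. i < n \<Longrightarrow> w i \<in> A" "\<epsilon> \<in> A"
  shows "\<exists>r\<in>A. f (\<lambda>i. v i + \<epsilon> * w i) = f v + \<epsilon> * D v w + \<epsilon>^2 * r"
proof -
  have "f v \<in> A \<and> D v w \<in> A \<and> (\<exists>r\<in>A. f (\<lambda>i. v i + \<epsilon> * w i) = f v + \<epsilon> * D v w + \<epsilon>^2 * r)"
    using assms(1)
  proof induct
    case (PolD_const c)
    then show ?case using assms(2) by (auto intro!: bexI[of _ 0])
  next
    case (PolD_var i)
    then show ?case using assms(3,4) by (auto intro!: bexI[of _ 0])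
  next
    case (PolD_add f D g E)
    then obtain r s where *: "r \<in> A" "f (\<lambda>i. v i + \<epsilon> * w i) = f v + \<epsilon> * D v w + \<epsilon>^2 * r"
      "s \<in> A" "g (\<lambda>i. v i + \<epsilon> * w i) = g v + \<epsilon> * E v w + \<epsilon>^2 * s" by (elim conjE bexE) (rule that)
    have "f (\<lambda>i. v i + \<epsilon> * w i) + g (\<lambda>i. v i + \<epsilon> * w i) = f v + g v + \<epsilon> * (D v w + E v w) + \<epsilon>^2 * (r + s)"
      unfolding *(2,4) by (simp add: algebra_simps)
    then show ?case using PolD_add(2,4) add[OF *(1,3)] add by (intro conjI bexI[of _ "r + s"]) auto
  next
    case (PolD_mult f D g E)
    then obtain r s where *: "r \<in> A" "f (\<lambda>i. v i + \<epsilon> * w i) = f v + \<epsilon> * D v w + \<epsilon>^2 * r"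
      "s \<in> A" "g (\<lambda>i. v i + \<epsilon> * w i) = g v + \<epsilon> * E v w + \<epsilon>^2 * s" by (elim conjE bexE) (rule that)
    have A: "f v \<in> A" "D v w \<in> A" "g v \<in> A" "E v w \<in> A" using PolD_mult(2,4) by simp_all
    define T where "T = f v * s + r * g v + D v w * E v w + \<epsilon> * (D v w * s + r * E v w) + \<epsilon>^2 * (r * s)"
    have "f (\<lambda>i. v i + \<epsilon> * w i) * g (\<lambda>i. v i + \<epsilon> * w i) = f v * g v + \<epsilon> * (f v * E v w + g v * D v w) + \<epsilon>^2 * T"
      unfolding *(2,4) T_def by (simp add: algebra_simps power2_eq_square)
    moreover have "T \<in> A" unfolding T_def by (intro add mult power A *(1,3) assms(5))
    moreover have "f v * g v \<in> A" "f v * E v w + g v * D v w \<in> A" by (intro add mult A)+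
    ultimately show ?case by (intro conjI bexI[of _ T])
  qed
  then show ?thesis by simp
qed

lemma PolD_euler:
  assumes "PolD S n (heval N d c) D" shows "D v v = of_nat d * heval N d c v"
proof -
  have 1: "((\<lambda>t. heval N d c (\<lambda>i. v i + t * v i)) has_field_derivative D v v) (at 0)" by (rule PolD_deriv[OF assms])
  have "heval N d c (\<lambda>i. v i + t * v i) = (1 + t) ^ d * heval N d c v" for t
    using heval_scale[of N d c "1 + t" v] by (simp add: distrib_right)
  then have 2: "((\<lambda>t. heval N d c (\<lambda>i. v i + t * v i)) has_field_derivative of_nat d * heval N d c v) (at 0)"
    by (auto intro!: derivative_eq_intros)
  show ?thesis by (rule DERIV_unique[OF 1 2])
qed

lemma PolD_homogeneous:
  assumes "PolD S n (heval N d c) D" "k \<noteq> 0" "d \<ge> 1" shows "D (\<lambda>i. k * v i) w = k ^ (d - 1) * D v w"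
proof -
  have 1: "((\<lambda>t. heval N d c (\<lambda>i. k * v i + t * w i)) has_field_derivative D (\<lambda>i. k * v i) w) (at 0)" by (rule PolD_deriv[OF assms(1)])
  have eq: "heval N d c (\<lambda>i. k * v i + t * w i) = k ^ d * heval N d c (\<lambda>i. v i + (t / k) * w i)" for t
  proof -
    have "(\<lambda>i. k * v i + t * w i) = (\<lambda>i. k * (v i + (t / k) * w i))" using assms(2) by (simp add: distrib_left)
    then show ?thesis by (simp only: heval_scale)
  qed
  have "((\<lambda>t. heval N d c (\<lambda>i. v i + t * w i)) has_field_derivative D v w) (at (0 / k))" using PolD_deriv[OF assms(1)] by simp
  moreover have "((\<lambda>t. t / k) has_field_derivative 1 / k) (at 0)" using assms(2) by (auto intro!: derivative_eq_intros)
  ultimately have "((\<lambda>t. heval N d c (\<lambda>i. v i + (t / k) * w i)) has_field_derivative D v w * (1 / k)) (at 0)"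
    by (rule DERIV_chain2[where f = "\<lambda>s. heval N d c (\<lambda>i. v i + s * w i)" and g = "\<lambda>t. t / k"])
  from DERIV_cmult[OF this, of "k ^ d"] have 2: "((\<lambda>t. heval N d c (\<lambda>i. k * v i + t * w i)) has_field_derivative k ^ d * (D v w * (1 / k))) (at 0)"
    unfolding eq .
  have "k ^ d = k * k ^ (d - 1)" using assms(3) by (simp add: power_eq_if)
  then show ?thesis using DERIV_unique[OF 1 2] assms(2) by simp
qed

lemma det_polynomial:
  assumes "\<And>i j. i < n \<Longrightarrow> j < n \<Longrightarrow> \<exists>p. \<forall>t. M t $$ (i, j) = poly p t" "\<And>t. M t \<in> carrier_mat n n"
  shows "\<exists>p. \<forall>t. det (M t) = poly p (t :: complex)"
proof -
  have "\<forall>i. \<exists>e. \<forall>j. i < n \<longrightarrow> j < n \<longrightarrow> (\<forall>t. M t $$ (i, j) = poly (e j) t)"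
    using assms(1) by (intro allI choice) blast
  from choice[OF this] obtain e where e: "\<forall>i j. i < n \<longrightarrow> j < n \<longrightarrow> (\<forall>t. M t $$ (i, j) = poly (e i j) t)" by (rule exE)
  have "det (M t) = poly (\<Sum>\<sigma>\<in>{\<sigma>. \<sigma> permutes {0..<n}}. signof \<sigma> * (\<Prod>i = 0..<n. e i (\<sigma> i))) t" for t
  proof -
    have d: "dim_row (M t) = n" "dim_col (M t) = n" using assms(2) by auto
    have "det (M t) = (\<Sum>\<sigma>\<in>{\<sigma>. \<sigma> permutes {0..<n}}. signof \<sigma> * (\<Prod>i = 0..<n. M t $$ (i, \<sigma> i)))"
      unfolding det_def using d by simp
    also have "\<dots> = (\<Sum>\<sigma>\<in>{\<sigma>. \<sigma> permutes {0..<n}}. signof \<sigma> * (\<Prod>i = 0..<n. poly (e i (\<sigma> i)) t))"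
    proof (intro sum.cong refl arg_cong2[of _ _ _ _ "times"] prod.cong)
      fix \<sigma> i assume "\<sigma> \<in> {\<sigma>. \<sigma> permutes {0..<n}}" "i \<in> {0..<n}"
      moreover from this have "\<sigma> i < n" using permutes_in_image[of \<sigma> "{0..<n}" i] by simp
      ultimately show "M t $$ (i, \<sigma> i) = poly (e i (\<sigma> i)) t" using e by simp
    qed
    finally show ?thesis by (simp add: poly_sum poly_prod)
  qed
  then show ?thesis by (intro exI allI)
qed

text \<open>On the line through the first two unit vectors the Jacobian determinant is homogeneous
  of degree \<open>(d - 1) * n\<close>, which is positive. So it vanishes at a point
  \<open>v\<close> of this line, and \<open>w\<close> is a kernel vector there.\<close>

lemma critical_pair_complex:
  assumes D: "\<And>i. i \<le> N \<Longrightarrow> PolD UNIV (Suc N) (heval N d (F i)) (D i)" and d: "d \<ge> 2" and N: "N \<ge> 1"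
  shows "\<exists>v w. (\<exists>i\<le>N. v i \<noteq> 0) \<and> (\<exists>i\<le>N. w i \<noteq> 0) \<and> (\<forall>i\<le>N. D i v w = 0)"
proof -
  define n where "n = Suc N"
  define J where "J = (\<lambda>v. mat n n (\<lambda>(i, j). D i v (unitv j)))"
  have Jc: "J v \<in> carrier_mat n n" for v unfolding J_def by simp
  define L where "L = (\<lambda>(s::complex) (t::complex) i. s * unitv 0 i + t * unitv 1 i)"
  have entry: "\<exists>p. \<forall>t. D i (h t) (unitv j) = poly p t" if i: "i < n" and h: "\<And>k. k < n \<Longrightarrow> \<exists>p. \<forall>t. h t k = poly p t" for i j h
  proof -
    have "(\<lambda>v. D i v (unitv j)) \<in> Pol UNIV n" using D[of i] i unfolding n_def by (intro PolD_partial_Pol) auto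
    from Pol_univariate[OF this h] show ?thesis .
  qed
  have "\<exists>p. \<forall>t. det (J (L 1 t)) = poly p t"
  proof (rule det_polynomial[OF _ Jc])
    fix i j assume ij: "i < n" "j < n"
    have "\<exists>p. \<forall>t. D i (L 1 t) (unitv j) = poly p t"
    proof (rule entry[OF ij(1)])
      fix k show "\<exists>p. \<forall>t. L 1 t k = poly p t" unfolding L_def by (intro exI[of _ "[:unitv 0 k, unitv 1 k:]"]) simp
    qed
    then show "\<exists>p. \<forall>t. J (L 1 t) $$ (i, j) = poly p t" unfolding J_def using ij by simp
  qed
  then obtain p where p: "\<And>t. det (J (L 1 t)) = poly p t" by auto
  have "\<exists>r. \<forall>s. det (J (L s 1)) = poly r s"
  proof (rule det_polynomial[OF _ Jc])
    fix i j assume ij: "i < n" "j < n"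
    have "\<exists>p. \<forall>s. D i (L s 1) (unitv j) = poly p s"
    proof (rule entry[OF ij(1)])
      fix k show "\<exists>p. \<forall>s. L s 1 k = poly p s" unfolding L_def by (intro exI[of _ "[:unitv 1 k, unitv 0 k:]"]) simp
    qed
    then show "\<exists>p. \<forall>s. J (L s 1) $$ (i, j) = poly p s" unfolding J_def using ij by simp
  qed
  then obtain r where r: "\<And>s. det (J (L s 1)) = poly r s" by auto
  have scale: "det (J (L s 1)) = s ^ ((d - 1) * n) * det (J (L 1 (1 / s)))" if s: "s \<noteq> 0" for s
  proof -
    have Ls: "L s 1 = (\<lambda>i. s * L 1 (1 / s) i)" unfolding L_def using s by (simp add: distrib_left)
    have "J (L s 1) = s ^ (d - 1) \<cdot>\<^sub>m J (L 1 (1 / s))"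
    proof (rule eq_matI)
      fix i j assume "i < dim_row (s ^ (d - 1) \<cdot>\<^sub>m J (L 1 (1 / s)))" "j < dim_col (s ^ (d - 1) \<cdot>\<^sub>m J (L 1 (1 / s)))"
      then have ij: "i < n" "j < n" using Jc by (auto simp: J_def)
      have "D i (L s 1) (unitv j) = s ^ (d - 1) * D i (L 1 (1 / s)) (unitv j)"
        unfolding Ls using ij d s by (intro PolD_homogeneous[OF D]) (auto simp: n_def)
      then show "J (L s 1) $$ (i, j) = (s ^ (d - 1) \<cdot>\<^sub>m J (L 1 (1 / s))) $$ (i, j)" unfolding J_def using ij by simp
    qed (simp_all add: J_def)
    then have "det (J (L s 1)) = (s ^ (d - 1)) ^ n * det (J (L 1 (1 / s)))" by (simp add: det_smult J_def)
    then show ?thesis by (simp add: power_mult)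
  qed
  have "\<exists>v. (\<exists>i\<le>N. v i \<noteq> 0) \<and> det (J v) = 0"
  proof (cases "\<exists>t. poly p t = 0")
    case True
    then obtain t where "poly p t = 0" by auto
    then have "det (J (L 1 t)) = 0" using p by simp
    moreover have "L 1 t 0 \<noteq> 0" unfolding L_def unitv_def by simp
    ultimately show ?thesis by (intro exI[of _ "L 1 t"]) auto
  next
    case False
    then obtain c where c: "p = [:c:]" using fundamental_theorem_of_algebra_alt[of p] by auto
    \<comment> \<open>Without a zero at the points \<open>L 1 t\<close> the determinant is constant
      in \<open>t\<close>. Homogeneity then makes it \<open>c * s ^ M\<close> at
      \<open>L s 1\<close>, which vanishes at \<open>s = 0\<close>.\<close>
    define M where "M = (d - 1) * n"
    have M: "M > 0" unfolding M_def n_def using d by simp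
    have "poly r s = poly (monom c M) s" if "s \<in> UNIV - {0}" for s
      using scale[of s] r p c that unfolding M_def by (simp add: poly_monom mult.commute)
    then have "UNIV - {0} \<subseteq> {s. poly (r - monom c M) s = 0}" by auto
    moreover have "infinite (UNIV - {0} :: complex set)" using infinite_UNIV_char_0 by (simp add: infinite_remove)
    ultimately have "infinite {s. poly (r - monom c M) s = 0}" using finite_subset by blast
    then have "r - monom c M = 0" using poly_roots_finite by blast
    then have "poly r 0 = 0" using M by (simp add: poly_monom)
    then have "det (J (L 0 1)) = 0" using r by simp
    moreover have "L 0 1 1 \<noteq> 0" unfolding L_def unitv_def by simp
    ultimately show ?thesis using N by (intro exI[of _ "L 0 1"]) auto
  qed
  then obtain v where v: "\<exists>i\<le>N. v i \<noteq> 0" "det (J v) = 0" by (elim exE) (elim conjE, rule that)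
  obtain x where x: "x \<in> carrier_vec n" "x \<noteq> 0\<^sub>v n" "J v *\<^sub>v x = 0\<^sub>v n"
    using v(2) det_0_iff_vec_prod_zero[OF Jc, of v] by auto
  define w where "w = (\<lambda>j. if j < n then x $ j else 0)"
  have "\<exists>j<n. x $ j \<noteq> 0"
  proof (rule ccontr)
    assume "\<not> ?thesis"
    then have "x = 0\<^sub>v n" using x(1) by (intro eq_vecI) auto
    then show False using x(2) by simp
  qed
  then have w: "\<exists>i\<le>N. w i \<noteq> 0" unfolding w_def n_def by (auto simp: less_Suc_eq_le)
  have "D i v w = 0" if i: "i \<le> N" for i
  proof -
    have i': "i < n" using i unfolding n_def by simp
    have "D i v w = (\<Sum>j<n. w j * D i v (unitv j))" unfolding n_def by (rule PolD_linear[OF D[OF i]])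
    also have "\<dots> = (\<Sum>j = 0..<n. J v $$ (i, j) * x $ j)" unfolding w_def J_def using i'
      by (intro sum.cong) (auto simp: mult.commute)
    also have "\<dots> = (J v *\<^sub>v x) $ i" using x(1) i' Jc[of v] unfolding J_def by (simp add: scalar_prod_def)
    also have "\<dots> = 0" using x(3) i' by simp
    finally show ?thesis .
  qed
  then show ?thesis using v(1) w by (intro exI[of _ v] exI[of _ w]) simp
qed

lemma (in place) PolD_congruent:
  assumes "PolD S n f D" "0 \<in> S" "1 \<in> S" "S \<subseteq> A" "\<And>i. i < n \<Longrightarrow> v i \<in> A" "\<And>i. i < n \<Longrightarrow> v' i \<in> A" "\<And>i. i < n \<Longrightarrow> v i - v' i \<in> m"
    "\<And>i. i < n \<Longrightarrow> w i \<in> A" "\<And>i. i < n \<Longrightarrow> w' i \<in> A" "\<And>i. i < n \<Longrightarrow> w i - w' i \<in> m"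
  shows "D v w - D v' w' \<in> m"
proof -
  have P: "(\<lambda>v. D v (unitv j)) \<in> Pol S n" for j by (rule PolD_partial_Pol[OF assms(1-3)])
  have inA: "D u (unitv j) \<in> A" if "\<And>i. i < n \<Longrightarrow> u i \<in> A" for u j by (rule Pol_value_in[OF P assms(4) add mult that])
  have "D v w - D v' w' = (\<Sum>j<n. w j * (D v (unitv j) - D v' (unitv j)) + D v' (unitv j) * (w j - w' j))"
    unfolding PolD_linear[OF assms(1), of v w] PolD_linear[OF assms(1), of v' w']
    by (simp add: sum_subtractf[symmetric] algebra_simps)
  also have "\<dots> \<in> m"
    by (intro m_sum m_add m_mult Pol_congruent[OF P assms(4)] inA assms) auto
  finally show ?thesis .
qed

text \<open>A complex critical pair is specialised at a place whose residue field is the field of algebraic numbers.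
  Euler's identity forces \<open>v\<close> and \<open>w\<close> to be independent, as \<open>F\<close> has no common zero.\<close>

lemma critical_pair:
  assumes F: "endo N d F" and d: "d \<ge> 2" and N: "N \<ge> 1"
  shows "\<exists>D v w. (\<forall>i\<le>N. PolD {x. algebraic x} (Suc N) (heval N d (F i)) (D i)) \<and> alg_vec N v \<and> alg_vec N w \<and>
    (\<forall>i\<le>N. D i v w = 0) \<and> (\<exists>i\<le>N. \<exists>j\<le>N. v i * w j - v j * w i \<noteq> 0)"
proof -
  let ?Q = "{x :: complex. algebraic x}"
  have "\<forall>i. \<exists>D. i \<le> N \<longrightarrow> PolD ?Q (Suc N) (heval N d (F i)) D"
    using PolD_exists[OF alg_hpoly_Pol] F unfolding endo_def by blast
  from choice[OF this] obtain D where D: "\<forall>i. i \<le> N \<longrightarrow> PolD ?Q (Suc N) (heval N d (F i)) (D i)" by (rule exE)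
  have Dmono: "PolD UNIV (Suc N) f E" if "PolD ?Q (Suc N) f E" for f E
    using that by induct (auto intro: PolD.intros)
  have "\<exists>v w. (\<exists>i\<le>N. v i \<noteq> 0) \<and> (\<exists>i\<le>N. w i \<noteq> 0) \<and> (\<forall>i\<le>N. D i v w = 0)"
    by (rule critical_pair_complex[where F = F and D = D, OF _ d N]) (use D Dmono in simp)
  then obtain v0 w0 where vw: "\<exists>i\<le>N. v0 i \<noteq> 0" "\<exists>i\<le>N. w0 i \<noteq> 0" "\<forall>i\<le>N. D i v0 w0 = 0"
    by (elim exE) (elim conjE, rule that)
  obtain A m where pl: "place A m" and alg: "?Q \<subseteq> A" and res: "\<forall>a\<in>A. \<exists>c. algebraic c \<and> a - c \<in> m"
    using place_over_algebraic by (elim exE conjE) (rule that)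
  interpret place A m by (rule pl)
  from primitive_multiple[OF vw(1)] obtain k y where y: "k \<le> N" "v0 k \<noteq> 0" "v0 = (\<lambda>i. v0 k * y i)" "primitive A N y" by (elim exE conjE) (rule that)
  from primitive_multiple[OF vw(2)] obtain l z where z: "l \<le> N" "w0 l \<noteq> 0" "w0 = (\<lambda>i. w0 l * z i)" "primitive A N z" by (elim exE conjE) (rule that)
  have Dyz: "D i y z = 0" if i: "i \<le> N" for i
  proof -
    have P: "PolD ?Q (Suc N) (heval N d (F i)) (D i)" using D i by simp
    have "0 = D i (\<lambda>j. v0 k * y j) (\<lambda>j. w0 l * z j)" using vw(3) i y(3) z(3) by simp
    also have "\<dots> = v0 k ^ (d - 1) * D i y (\<lambda>j. w0 l * z j)" using d y(2) by (intro PolD_homogeneous[OF P]) auto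
    also have "D i y (\<lambda>j. w0 l * z j) = w0 l * D i y z"
      unfolding PolD_linear[OF P, of y "\<lambda>j. w0 l * z j"] PolD_linear[OF P, of y z] by (simp only: sum_distrib_left mult.assoc)
    finally show ?thesis using y(2) z(2) by simp
  qed
  \<comment> \<open>The entry 1 of a primitive vector guarantees that its reduction is not
    zero.\<close>
  have red: "\<exists>c. alg_vec N c \<and> (\<forall>i\<le>N. u i - c i \<in> m) \<and> (\<exists>i\<le>N. c i \<noteq> 0)" if u: "primitive A N u" for u
  proof -
    have "\<forall>i. \<exists>c. i \<le> N \<longrightarrow> algebraic c \<and> u i - c \<in> m" using u res unfolding primitive_def by blast
    from choice[OF this] obtain c where c: "\<forall>i. i \<le> N \<longrightarrow> algebraic (c i) \<and> u i - c i \<in> m" by (rule exE)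
    obtain i where i: "i \<le> N" "u i = 1" using u unfolding primitive_def by auto
    have "c i \<noteq> 0"
    proof
      assume "c i = 0"
      then have "1 - 0 \<in> m" using c[rule_format, OF i(1)] i(2) by simp
      then show False using one_notin by simp
    qed
    then show ?thesis using c i(1) by (intro exI[of _ "\<lambda>i. if i \<le> N then c i else 0"]) (auto simp: alg_vec_def is_vec_def)
  qed
  from red[OF y(4)] obtain v where v: "alg_vec N v" "\<forall>i\<le>N. y i - v i \<in> m" "\<exists>i\<le>N. v i \<noteq> 0" by (elim exE) (elim conjE, rule that)
  from red[OF z(4)] obtain w where w: "alg_vec N w" "\<forall>i\<le>N. z i - w i \<in> m" "\<exists>i\<le>N. w i \<noteq> 0" by (elim exE) (elim conjE, rule that)
  have vA: "v i \<in> A" "w i \<in> A" "algebraic (v i)" "algebraic (w i)" if "i < Suc N" for i using v(1) w(1) that alg unfolding alg_vec_def by auto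
  have yA: "y i \<in> A" "z i \<in> A" "y i - v i \<in> m" "z i - w i \<in> m" if "i < Suc N" for i using y(4) z(4) v(2) w(2) that unfolding primitive_def by auto
  have Dvw: "D i v w = 0" if i: "i \<le> N" for i
  proof -
    have P: "PolD ?Q (Suc N) (heval N d (F i)) (D i)" using D i by simp
    have "D i y z - D i v w \<in> m" by (rule PolD_congruent[OF P _ _ alg yA(1) vA(1) yA(3) yA(2) vA(2) yA(4)]) auto
    then have "- (0 - D i v w) \<in> m" unfolding Dyz[OF i] by (rule m_minus)
    then have inm: "D i v w \<in> m" by simp
    have "algebraic (D i v (unitv j))" for j
    proof -
      have "(\<lambda>v. D i v (unitv j)) \<in> Pol ?Q (Suc N)" by (rule PolD_partial_Pol[OF P]) auto
      then have "D i v (unitv j) \<in> ?Q" by (rule Pol_value_in) (use vA in auto)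
      then show ?thesis by simp
    qed
    then have "algebraic (D i v w)" unfolding PolD_linear[OF P, of v w] using vA(4) by (intro algebraic_sum algebraic_mult) auto
    then show ?thesis using algebraic_in_m[OF alg] inm by simp
  qed
  have "\<exists>i\<le>N. \<exists>j\<le>N. v i * w j - v j * w i \<noteq> 0"
  proof (rule ccontr)
    assume "\<not> ?thesis"
    then have minors: "v i * w j = v j * w i" if "i \<le> N" "j \<le> N" for i j using that by auto
    obtain k where k: "k \<le> N" "v k \<noteq> 0" using v(3) by auto
    define t where "t = w k / v k"
    have wt: "w j = t * v j" if "j \<le> N" for j using minors[OF k(1) that] k(2) unfolding t_def by (simp add: field_simps)
    obtain l where l: "l \<le> N" "w l \<noteq> 0" using w(3) by auto
    have t0: "t \<noteq> 0" using wt[OF l(1)] l(2) by auto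
    have "heval N d (F i) v = 0" if i: "i \<le> N" for i
    proof -
      have P: "PolD ?Q (Suc N) (heval N d (F i)) (D i)" using D i by simp
      have "D i v w = t * D i v v"
        unfolding PolD_linear[OF P, of v w] PolD_linear[OF P, of v v] sum_distrib_left
        by (rule sum.cong) (simp_all add: wt)
      then have "D i v v = 0" using Dvw[OF i] t0 by simp
      then show ?thesis using PolD_euler[OF P, of v] d by simp
    qed
    then have "v = (\<lambda>_. 0)" using F v(1) unfolding endo_def by simp
    then show False using k(2) by simp
  qed
  then show ?thesis using D v(1) w(1) Dvw by (intro exI[of _ D] exI[of _ v] exI[of _ w]) simp
qed

section \<open>Finiteness of residue rings\<close>

text \<open>Write O for \<open>A \<inter> K\<close>. Elements of O that are independent modulo
  \<open>p\<close> are independent over the rationals, so their number is bounded by a finite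
  spanning set of \<open>K\<close>. A family with the largest such number spans O modulo
  \<open>p\<close>.\<close>

lemma (in place) finite_residues:
  assumes nf: "number_field K" and K: "is_subfield K" and p: "prime p" "of_nat p \<in> m"
  shows "\<exists>T. finite T \<and> T \<subseteq> A \<inter> K \<and> (\<forall>a\<in>A \<inter> K. \<exists>t\<in>T. \<exists>b\<in>A \<inter> K. a = t + of_nat p * b)"
proof -
  let ?O = "A \<inter> K"
  have O: "x + y \<in> ?O" "x - y \<in> ?O" "x * y \<in> ?O" if "x \<in> ?O" "y \<in> ?O" for x y using that K by (auto intro: add diff mult is_subfieldD)
  have Oi: "of_int k \<in> ?O" for k using is_subfield_of_int[OF K] by simp
  have O0: "0 \<in> ?O" using K by (simp add: is_subfieldD)
  have Osum: "sum f I \<in> ?O" if "\<And>i. i \<in> I \<Longrightarrow> f i \<in> ?O" for f and I :: "nat set"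
    using that by (auto intro!: sum is_subfield_sum[OF K])
  obtain B where B: "finite B" "\<forall>x\<in>K. \<exists>q. x = (\<Sum>b\<in>B. of_rat (q b) * b)" using nf unfolding number_field_def by blast
  define P where "P = (\<lambda>k. \<exists>f :: nat \<Rightarrow> complex. (\<forall>i<k. f i \<in> ?O) \<and>
     (\<forall>c :: nat \<Rightarrow> int. (\<exists>a\<in>?O. (\<Sum>i<k. of_int (c i) * f i) = of_nat p * a) \<longrightarrow> (\<forall>i<k. int p dvd c i)))"
  have P0: "P 0" unfolding P_def by simp
  have p2: "p \<ge> 2" using p(1) by (rule prime_ge_2_nat)
  have bound: "\<not> P (Suc (card B))"
  proof
    define k where "k = Suc (card B)"
    assume "P (Suc (card B))"
    then have "P k" unfolding k_def .
    then obtain f where f: "\<forall>i<k. f i \<in> ?O" 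
      "\<forall>c :: nat \<Rightarrow> int. (\<exists>a\<in>?O. (\<Sum>i<k. of_int (c i) * f i) = of_nat p * a) \<longrightarrow> (\<forall>i<k. int p dvd c i)"
      unfolding P_def by (elim exE conjE) (rule that)
    have "\<forall>i. \<exists>q. i < k \<longrightarrow> f i = (\<Sum>b\<in>B. of_rat (q b) * b)" using f(1) B(2) by blast
    from choice[OF this] obtain q where q: "\<forall>i. i < k \<longrightarrow> f i = (\<Sum>b\<in>B. of_rat (q i b) * b)" by (rule exE)
    obtain e :: "nat \<Rightarrow> rat" where e: "\<exists>i\<in>{..<k}. e i \<noteq> 0" "\<forall>b\<in>B. (\<Sum>i\<in>{..<k}. e i * q i b) = 0"
      using more_vectors_than_coordinates[OF B(1), of "{..<k}" q] unfolding k_def by auto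
    define s :: int where "s = (\<Prod>i<k. snd (quotient_of (e i)))"
    have s0: "s > 0" unfolding s_def by (intro prod_pos) (simp add: quotient_of_denom_pos')
    have "\<exists>z. of_int s * e i = of_int z" if "i < k" for i
    proof -
      define x y where "x = fst (quotient_of (e i))" and "y = snd (quotient_of (e i))"
      have eq: "e i = of_int x / of_int y" unfolding x_def y_def by (rule quotient_of_div) simp
      have sy: "s = y * (\<Prod>j\<in>{..<k} - {i}. snd (quotient_of (e j)))"
        unfolding s_def y_def using that by (intro prod.remove) auto
      have "y > 0" unfolding y_def by (rule quotient_of_denom_pos')
      then have "of_int s * e i = of_int ((\<Prod>j\<in>{..<k} - {i}. snd (quotient_of (e j))) * x)"
        unfolding eq sy by simp
      then show ?thesis by blast
    qed
    then have "\<forall>i. \<exists>z. i < k \<longrightarrow> of_int s * e i = of_int z" by blast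
    from choice[OF this] obtain c where c: "\<forall>i. i < k \<longrightarrow> of_int s * e i = of_int (c i)" by (rule exE)
    have cz: "(\<Sum>i<k. of_int (c i) * f i) = (0 :: complex)"
    proof -
      have "(\<Sum>i<k. of_int (c i) * f i) = (\<Sum>i<k. of_int s * (of_rat (e i) * (\<Sum>b\<in>B. of_rat (q i b) * b)))"
      proof (rule sum.cong[OF refl])
        fix i assume "i \<in> {..<k}"
        then have i: "i < k" by simp
        have "(of_int (c i) :: complex) = of_rat (of_int (c i))" by simp
        also have "\<dots> = of_int s * of_rat (e i)" using c[rule_format, OF i] by (metis of_rat_mult of_rat_of_int_eq)
        finally show "of_int (c i) * f i = of_int s * (of_rat (e i) * (\<Sum>b\<in>B. of_rat (q i b) * b))" using q i by simp
      qed
      also have "\<dots> = of_int s * (\<Sum>b\<in>B. of_rat (\<Sum>i<k. e i * q i b) * b)"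
        unfolding sum_distrib_left[symmetric]
        by (simp add: sum_distrib_left sum_distrib_right of_rat_sum of_rat_mult mult.assoc) (subst sum.swap, simp)
      also have "\<dots> = 0" using e(2) by simp
      finally show ?thesis .
    qed
    \<comment> \<open>In an integer relation all coefficients are divisible by \<open>p\<close>;
      dividing them by \<open>p\<close> gives a smaller relation, so only the trivial one
      exists.\<close>
    have descent: "\<forall>i<k. c i = 0" if "(\<Sum>i<k. of_int (c i) * f i) = (0 :: complex)" for c :: "nat \<Rightarrow> int"
      using that
    proof (induct "nat (\<Sum>i<k. \<bar>c i\<bar>)" arbitrary: c rule: less_induct)
      case less
      have "\<exists>a\<in>?O. (\<Sum>i<k. of_int (c i) * f i) = of_nat p * a" using less(2) O0 by (intro bexI[of _ 0]) auto
      then have dv: "\<forall>i<k. int p dvd c i" by (rule f(2)[THEN spec, THEN mp])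
      then have ce: "c i = int p * (c i div int p)" if "i < k" for i using that by simp
      define c' where "c' = (\<lambda>i. c i div int p)"
      have "(\<Sum>i<k. of_int (c i) * f i) = of_nat p * (\<Sum>i<k. of_int (c' i) * f i)"
        unfolding sum_distrib_left
      proof (rule sum.cong[OF refl])
        fix i assume "i \<in> {..<k}"
        then have "of_int (c i) = (of_int (int p * c' i) :: complex)" using ce[of i] unfolding c'_def by simp
        then show "of_int (c i) * f i = of_nat p * (of_int (c' i) * f i)" by simp
      qed
      then have z: "(\<Sum>i<k. of_int (c' i) * f i) = 0" using less(2) p2 by simp
      have S: "(\<Sum>i<k. \<bar>c i\<bar>) = int p * (\<Sum>i<k. \<bar>c' i\<bar>)"
        unfolding sum_distrib_left
      proof (rule sum.cong[OF refl])
        fix i assume "i \<in> {..<k}"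
        then have "c i = int p * c' i" using ce[of i] unfolding c'_def by simp
        then show "\<bar>c i\<bar> = int p * \<bar>c' i\<bar>" by (simp add: abs_mult)
      qed
      show ?case
      proof (cases "(\<Sum>i<k. \<bar>c i\<bar>) = 0")
        case True
        then show ?thesis by (subst (asm) sum_nonneg_eq_0_iff) auto
      next
        case False
        have ge: "(\<Sum>i<k. \<bar>c' i\<bar>) \<ge> 0" by (intro sum_nonneg) auto
        have "(\<Sum>i<k. \<bar>c' i\<bar>) \<noteq> 0" using False S by auto
        then have pos: "(\<Sum>i<k. \<bar>c' i\<bar>) > 0" using ge by linarith
        then have "1 * (\<Sum>i<k. \<bar>c' i\<bar>) < int p * (\<Sum>i<k. \<bar>c' i\<bar>)" using p2 by (intro mult_strict_right_mono) auto
        then have "nat (\<Sum>i<k. \<bar>c' i\<bar>) < nat (\<Sum>i<k. \<bar>c i\<bar>)" using S pos by simp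
        from less(1)[OF this z] have "\<forall>i<k. c' i = 0" .
        then show ?thesis using ce unfolding c'_def by simp
      qed
    qed
    from descent[OF cz] have "e i = 0" if "i < k" for i using c that s0 by auto
    then show False using e(1) by auto
  qed
  have "\<exists>k. P k \<and> \<not> P (Suc k)"
  proof (rule ccontr)
    assume "\<not> ?thesis"
    then have "P k" for k by (induct k) (use P0 in auto)
    then show False using bound by simp
  qed
  then obtain k where k: "P k" "\<not> P (Suc k)" by auto
  obtain f where f: "\<forall>i<k. f i \<in> ?O" 
      "\<forall>c :: nat \<Rightarrow> int. (\<exists>a\<in>?O. (\<Sum>i<k. of_int (c i) * f i) = of_nat p * a) \<longrightarrow> (\<forall>i<k. int p dvd c i)"
    using k(1) unfolding P_def by (elim exE conjE) (rule that)
  define T where "T = (\<lambda>r. \<Sum>i<k. of_int (r i) * f i) ` (PiE {..<k} (\<lambda>_. {0..<int p}))"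
  have "finite T" unfolding T_def by (intro finite_imageI finite_PiE) auto
  moreover have "T \<subseteq> ?O"
  proof
    fix x assume "x \<in> T"
    then obtain r where x: "x = (\<Sum>i<k. of_int (r i) * f i)" unfolding T_def by (elim imageE) (rule that)
    show "x \<in> ?O" unfolding x by (intro Osum O(3) Oi) (use f(1) in simp)
  qed
  moreover have "\<exists>t\<in>T. \<exists>b\<in>?O. a = t + of_nat p * b" if a: "a \<in> ?O" for a
  proof -
    have L: "\<exists>c. Q c \<and> \<not> R c" if "\<not> (\<forall>c. Q c \<longrightarrow> R c)" for Q R :: "(nat \<Rightarrow> int) \<Rightarrow> bool" using that by blast
    have "\<not> (\<forall>c :: nat \<Rightarrow> int. (\<exists>x\<in>?O. (\<Sum>i<Suc k. of_int (c i) * (f(k := a)) i) = of_nat p * x) \<longrightarrow> (\<forall>i<Suc k. int p dvd c i))"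
    proof
      assume all: "\<forall>c :: nat \<Rightarrow> int. (\<exists>x\<in>?O. (\<Sum>i<Suc k. of_int (c i) * (f(k := a)) i) = of_nat p * x) \<longrightarrow> (\<forall>i<Suc k. int p dvd c i)"
      have "\<forall>i<Suc k. (f(k := a)) i \<in> ?O" using f(1) a by (auto simp: less_Suc_eq)
      then have "P (Suc k)" unfolding P_def using all by (intro exI[of _ "f(k := a)"] conjI)
      then show False using k(2) by simp
    qed
    then have "\<exists>c :: nat \<Rightarrow> int. (\<exists>x\<in>?O. (\<Sum>i<Suc k. of_int (c i) * (f(k := a)) i) = of_nat p * x) \<and> \<not> (\<forall>i<Suc k. int p dvd c i)"
      by (rule L)
    then obtain c x where c: "x \<in> ?O" "(\<Sum>i<Suc k. of_int (c i) * (f(k := a)) i) = of_nat p * x" "\<not> (\<forall>i<Suc k. int p dvd c i)"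
      by (elim exE conjE bexE) (rule that)
    have eq: "(\<Sum>i<k. of_int (c i) * f i) + of_int (c k) * a = of_nat p * x"
    proof -
      have "(\<Sum>i<k. of_int (c i) * (f(k := a)) i) = (\<Sum>i<k. of_int (c i) * f i)" by (rule sum.cong) auto
      then show ?thesis using c(2) by simp
    qed
    \<comment> \<open>Otherwise the term of \<open>a\<close> could be moved to the right side,
      leaving a combination of the \<open>f i\<close> divisible by \<open>p\<close>, and all
      coefficients would be multiples of \<open>p\<close>.\<close>
    have nd: "\<not> int p dvd c k"
    proof
      assume dv: "int p dvd c k"
      then obtain c'' where c'': "c k = int p * c''" by (rule dvdE)
      have "(\<Sum>i<k. of_int (c i) * f i) = of_nat p * (x - of_int c'' * a)" using eq unfolding c'' by (simp add: algebra_simps)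
      moreover have "x - of_int c'' * a \<in> ?O" by (intro O Oi a c(1))
      ultimately have "\<exists>a\<in>?O. (\<Sum>i<k. of_int (c i) * f i) = of_nat p * a" by (rule bexI)
      then have "\<forall>i<k. int p dvd c i" by (rule f(2)[THEN spec, THEN mp])
      then show False using c(3) dv by (auto simp: less_Suc_eq)
    qed
    have "coprime (int p) (c k)" using nd p(1) by (intro prime_imp_coprime) auto
    then obtain u v where uv: "u * int p + v * c k = 1" by (metis bezout_int coprime_imp_gcd_eq_1)
    define r where "r = restrict (\<lambda>i. (- v * c i) mod int p) {..<k}"
    define s where "s = (\<lambda>i. (- v * c i) div int p)"
    have rs: "- v * c i = r i + int p * s i" if "i < k" for i unfolding r_def s_def using that by simp
    have "of_int (u * int p + v * c k) * a = a" unfolding uv by simp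
    then have "a = of_int u * of_nat p * a + of_int v * (of_int (c k) * a)" by (simp add: algebra_simps)
    also have "of_int (c k) * a = of_nat p * x - (\<Sum>i<k. of_int (c i) * f i)" using eq by (simp add: algebra_simps)
    also have "of_int u * of_nat p * a + of_int v * (of_nat p * x - (\<Sum>i<k. of_int (c i) * f i)) =
      of_nat p * (of_int u * a + of_int v * x) + (\<Sum>i<k. of_int (- v * c i) * f i)"
      by (simp add: algebra_simps sum_distrib_left sum_negf)
    also have "(\<Sum>i<k. of_int (- v * c i) * f i) = (\<Sum>i<k. of_int (r i) * f i) + of_nat p * (\<Sum>i<k. of_int (s i) * f i)"
      unfolding sum_distrib_left sum.distrib[symmetric]
    proof (rule sum.cong[OF refl])
      fix i assume "i \<in> {..<k}"
      then have "of_int (- v * c i) = (of_int (r i + int p * s i) :: complex)" using rs[of i] by simp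
      then show "of_int (- v * c i) * f i = of_int (r i) * f i + of_nat p * (of_int (s i) * f i)" by (simp add: distrib_right)
    qed
    finally have fin: "a = (\<Sum>i<k. of_int (r i) * f i) + of_nat p * (of_int u * a + of_int v * x + (\<Sum>i<k. of_int (s i) * f i))"
      by (simp add: algebra_simps)
    have "(\<Sum>i<k. of_int (r i) * f i) \<in> T" unfolding T_def
    proof (rule imageI)
      show "r \<in> PiE {..<k} (\<lambda>_. {0..<int p})" unfolding r_def using p2 by auto
    qed
    moreover have "of_int u * a + of_int v * x + (\<Sum>i<k. of_int (s i) * f i) \<in> ?O"
      using f(1) by (intro O Oi Osum a c(1)) auto
    ultimately show ?thesis using fin by blast
  qed
  ultimately show ?thesis by (intro exI[of _ T] conjI ballI)
qed


section \<open>Points that are not values of the map\<close>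

text \<open>On the line from \<open>x\<close> to \<open>y\<close> both functions become nonzero
  polynomials in one variable, hence so does their product.\<close>

lemma Pol_mult_nonzero:
  assumes "f \<in> Pol S n" "g \<in> Pol S n" "f x \<noteq> 0" "g y \<noteq> 0"
  shows "\<exists>z. f z * g z \<noteq> 0"
proof -
  define h where "h = (\<lambda>(t::complex) i. x i + t * (y i - x i))"
  have h: "\<exists>p. \<forall>t. h t i = poly p t" for i unfolding h_def by (intro exI[of _ "[:x i, y i - x i:]"]) simp
  obtain p where p: "\<forall>t. f (h t) = poly p t" using Pol_univariate[OF assms(1) h] by (rule exE)
  obtain q where q: "\<forall>t. g (h t) = poly q t" using Pol_univariate[OF assms(2) h] by (rule exE)
  have "h 0 = x" "h 1 = y" unfolding h_def by auto
  then have "poly p 0 \<noteq> 0" "poly q 1 \<noteq> 0" using p[rule_format, of 0] q[rule_format, of 1] assms(3,4) by simp_all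
  then have "p * q \<noteq> 0" by auto
  then obtain t where "poly (p * q) t \<noteq> 0" using poly_all_0_iff_0[of "p * q"] by auto
  then have "f (h t) * g (h t) \<noteq> 0" using p q by simp
  then show ?thesis by (intro exI)
qed

text \<open>A self-map of a finite set that is not injective is not surjective; this is applied to
  the map induced by \<open>f\<close> on the classes of \<open>E\<close>. There are finitely many
  classes because \<open>\<rho>\<close> takes finitely many values and separates them.\<close>

lemma missed_class:
  assumes f: "\<And>x. x \<in> X \<Longrightarrow> f x \<in> X"
    and refl: "\<And>x. x \<in> X \<Longrightarrow> E x x" and sym: "\<And>x y. x \<in> X \<Longrightarrow> y \<in> X \<Longrightarrow> E x y \<Longrightarrow> E y x"
    and trans: "\<And>x y z. x \<in> X \<Longrightarrow> y \<in> X \<Longrightarrow> z \<in> X \<Longrightarrow> E x y \<Longrightarrow> E y z \<Longrightarrow> E x z"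
    and compat: "\<And>x y. x \<in> X \<Longrightarrow> y \<in> X \<Longrightarrow> E x y \<Longrightarrow> E (f x) (f y)"
    and fin: "finite (\<rho> ` X)" "\<And>x y. x \<in> X \<Longrightarrow> y \<in> X \<Longrightarrow> \<rho> x = \<rho> y \<Longrightarrow> E x y"
    and c: "c \<in> X" "c' \<in> X" "E (f c) (f c')" "\<not> E c c'"
  shows "\<exists>x0\<in>X. \<forall>y\<in>X. \<not> E (f y) x0"
proof -
  define cl where "cl = (\<lambda>x. {y \<in> X. E x y})"
  have cl: "cl x = cl y \<longleftrightarrow> E x y" if xy: "x \<in> X" "y \<in> X" for x y
  proof
    assume "cl x = cl y"
    moreover have "y \<in> cl y" unfolding cl_def using xy refl by simp
    ultimately have "y \<in> cl x" by (simp only:)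
    then show "E x y" unfolding cl_def by simp
  next
    assume e: "E x y"
    then have e': "E y x" by (rule sym[OF xy])
    have "E x z \<longleftrightarrow> E y z" if "z \<in> X" for z
      using trans[OF xy that e] trans[OF xy(2,1) that e'] by blast
    then show "cl x = cl y" unfolding cl_def by blast
  qed
  define s where "s = (\<lambda>C. SOME y. y \<in> X \<and> cl y = C)"
  have s: "s (cl y) \<in> X \<and> cl (s (cl y)) = cl y" if "y \<in> X" for y
    unfolding s_def by (rule someI[of "\<lambda>z. z \<in> X \<and> cl z = cl y" y]) (use that in simp)
  define \<Phi> where "\<Phi> = (\<lambda>C. cl (f (s C)))"
  have \<Phi>: "\<Phi> (cl y) = cl (f y)" if y: "y \<in> X" for y
  proof -
    have "s (cl y) \<in> X" "E (s (cl y)) y" using s[OF y] cl[of "s (cl y)" y] y by simp_all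
    then have "E (f (s (cl y))) (f y)" using compat y by simp
    then show ?thesis unfolding \<Phi>_def using cl[of "f (s (cl y))" "f y"] f y \<open>s (cl y) \<in> X\<close> by simp
  qed
  have "cl ` X \<subseteq> (\<lambda>w. cl (inv_into X \<rho> w)) ` (\<rho> ` X)"
  proof
    fix C assume "C \<in> cl ` X"
    then obtain y where y: "y \<in> X" "C = cl y" by (elim imageE) (rule that)
    have "\<rho> y \<in> \<rho> ` X" using y(1) by (rule imageI)
    then have "inv_into X \<rho> (\<rho> y) \<in> X" "\<rho> (inv_into X \<rho> (\<rho> y)) = \<rho> y" by (rule inv_into_into, rule f_inv_into_f)
    then have "cl (inv_into X \<rho> (\<rho> y)) = cl y" using cl[of "inv_into X \<rho> (\<rho> y)" y] y(1) fin(2) by simp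
    then show "C \<in> (\<lambda>w. cl (inv_into X \<rho> w)) ` (\<rho> ` X)" unfolding y(2) using y(1) by (intro image_eqI[of _ _ "\<rho> y"]) simp_all
  qed
  then have finC: "finite (cl ` X)" by (rule finite_subset) (intro finite_imageI fin(1))
  have nb: "\<exists>x\<in>P. x \<notin> Q" if "\<not> P \<subseteq> Q" for P Q :: "'a set set" using that by blast
  have "\<not> inj_on \<Phi> (cl ` X)"
  proof
    assume inj: "inj_on \<Phi> (cl ` X)"
    have "\<Phi> (cl c) = \<Phi> (cl c')" unfolding \<Phi>[OF c(1)] \<Phi>[OF c(2)] using cl[OF f f, OF c(1,2)] c(3) by simp
    then have "cl c = cl c'" by (rule inj_onD[OF inj _ imageI[OF c(1)] imageI[OF c(2)]])
    then show False using c(4) unfolding cl[OF c(1,2)] by (rule notE[rotated])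
  qed
  then have "\<not> cl ` X \<subseteq> \<Phi> ` (cl ` X)" using finite_surj_inj[OF finC] by (rule contrapos_nn)
  then have "\<exists>C\<in>cl ` X. C \<notin> \<Phi> ` (cl ` X)" by (rule nb)
  then obtain x0 where x0: "x0 \<in> X" "cl x0 \<notin> \<Phi> ` (cl ` X)" by (elim bexE imageE) (rule that, simp, simp)
  have "\<not> E (f y) x0" if y: "y \<in> X" for y
  proof
    assume "E (f y) x0"
    then have "cl x0 = \<Phi> (cl y)" unfolding \<Phi>[OF y] using cl[OF f[OF y] x0(1)] by simp
    then show False using x0(2) y by simp
  qed
  then show ?thesis using x0(1) by (intro bexI[of _ x0] ballI)
qed

lemma (in place) Pol_lipschitz:
  assumes "f \<in> Pol S n" "S \<subseteq> A" "\<And>i. i < n \<Longrightarrow> v i \<in> A" "\<And>i. i < n \<Longrightarrow> w i \<in> A" "\<epsilon> \<in> A"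
  shows "\<exists>r\<in>A. f (\<lambda>i. v i + \<epsilon> * w i) = f v + \<epsilon> * r"
proof -
  have "f v \<in> A \<and> (\<exists>r\<in>A. f (\<lambda>i. v i + \<epsilon> * w i) = f v + \<epsilon> * r)"
    using assms(1)
  proof induct
    case (Pol_const c)
    then show ?case using assms(2) by (auto intro!: bexI[of _ 0])
  next
    case (Pol_var i)
    then show ?case using assms(3,4) by (auto intro!: bexI[of _ "w i"])
  next
    case (Pol_add f g)
    then obtain r s where *: "r \<in> A" "f (\<lambda>i. v i + \<epsilon> * w i) = f v + \<epsilon> * r"
      "s \<in> A" "g (\<lambda>i. v i + \<epsilon> * w i) = g v + \<epsilon> * s" by (elim conjE bexE) (rule that)
    have "f (\<lambda>i. v i + \<epsilon> * w i) + g (\<lambda>i. v i + \<epsilon> * w i) = f v + g v + \<epsilon> * (r + s)"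
      unfolding *(2,4) by (simp add: algebra_simps)
    then show ?case using Pol_add(2,4) add[OF *(1,3)] add by (intro conjI bexI[of _ "r + s"]) auto
  next
    case (Pol_mult f g)
    then obtain r s where *: "r \<in> A" "f (\<lambda>i. v i + \<epsilon> * w i) = f v + \<epsilon> * r"
      "s \<in> A" "g (\<lambda>i. v i + \<epsilon> * w i) = g v + \<epsilon> * s" by (elim conjE bexE) (rule that)
    have fg: "f v \<in> A" "g v \<in> A" using Pol_mult(2,4) by simp_all
    have "f (\<lambda>i. v i + \<epsilon> * w i) * g (\<lambda>i. v i + \<epsilon> * w i) = f v * g v + \<epsilon> * (f v * s + r * g v + \<epsilon> * (r * s))"
      unfolding *(2,4) by (simp add: algebra_simps)
    moreover have "f v * s + r * g v + \<epsilon> * (r * s) \<in> A" by (intro add mult fg *(1,3) assms(5))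
    ultimately show ?case using mult[OF fg] by (intro conjI bexI)
  qed
  then show ?thesis by simp
qed

text \<open>Integral lifts of \<open>K\<close>-points, normalised at the place. In contrast to
  \<open>primitive\<close>, a unit entry is enough, since this property survives an application of
  \<open>F\<close> at a place of good reduction.\<close>

definition unimodular :: "complex set \<Rightarrow> complex set \<Rightarrow> complex set \<Rightarrow> nat \<Rightarrow> (nat \<Rightarrow> complex) set" where
  "unimodular A m K N = {y. (\<forall>i\<le>N. y i \<in> A \<inter> K) \<and> (\<exists>i\<le>N. y i \<notin> m) \<and> is_vec N y}"

lemma unimodularD:
  assumes "y \<in> unimodular A m K N"
  shows "\<And>i. i \<le> N \<Longrightarrow> y i \<in> A" "\<And>i. i \<le> N \<Longrightarrow> y i \<in> K" "\<exists>i\<le>N. y i \<notin> m" "is_vec N y"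
  using assms unfolding unimodular_def by simp_all

text \<open>If all values were in \<open>m\<close>, the certificate would put a power of a unit
  entry of \<open>y\<close> into \<open>m\<close>.\<close>

lemma (in place) Fvec_unimodular:
  assumes cert: "certificate K N d F D g" and K: "is_subfield K"
    and FA: "\<And>i \<alpha>. i \<le> N \<Longrightarrow> \<alpha> \<in> monoms N d \<Longrightarrow> F i \<alpha> \<in> A" and gA: "\<And>i j. i \<le> N \<Longrightarrow> j \<le> N \<Longrightarrow> g i j \<in> Pol A (Suc N)"
    and y: "y \<in> unimodular A m K N"
  shows "Fvec N d F y \<in> unimodular A m K N"
proof -
  have yA: "y i \<in> A" if "i < Suc N" for i using unimodularD(1)[OF y] that by simp
  have yK: "y i \<in> K" for i
    using unimodularD(2,4)[OF y] is_subfieldD(1)[OF K] unfolding is_vec_def by (cases "i \<le> N") simp_all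
  have inA: "heval N d (F i) y \<in> A" if "i \<le> N" for i
    by (rule Pol_value_in[OF heval_Pol[of A] order_refl add mult yA]) (use FA that in simp_all)
  have inK: "heval N d (F i) y \<in> K" if "i \<le> N" for i
    using Fvec_in_subfield[where F = F and d = d and N = N and a = 1 and v = y and i = i, OF K certificateD(1)[OF cert] yK] that by (simp add: Fvec_def)
  have "\<exists>j\<le>N. heval N d (F j) y \<notin> m"
  proof (rule ccontr)
    assume "\<not> ?thesis"
    then have z: "heval N d (F j) y \<in> m" if "j \<le> N" for j using that by simp
    obtain i where i: "i \<le> N" "y i \<notin> m" using unimodularD(3)[OF y] by (elim exE conjE) (rule that)
    have "y i ^ D i \<in> m" unfolding certificateD(3)[OF cert i(1)]
    proof (rule m_sum)
      fix j assume "j \<in> {..N}"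
      then have j: "j \<le> N" by simp
      have "g i j y \<in> A" by (rule Pol_value_in[OF gA[OF i(1) j] order_refl add mult yA])
      then show "g i j y * heval N d (F j) y \<in> m" by (rule m_mult[OF _ z[OF j]])
    qed
    moreover have "y i \<in> A - m" using unimodularD(1)[OF y i(1)] i(2) by (rule DiffI)
    then have "y i ^ D i \<in> A - m" by (rule unit_power)
    ultimately show False by (elim DiffE) (rule notE)
  qed
  then obtain j where "j \<le> N" "heval N d (F j) y \<notin> m" by (elim exE conjE) (rule that)
  then show ?thesis using inA inK unfolding unimodular_def
    by (intro CollectI conjI is_vec_Fvec allI impI IntI exI[of _ j]) (simp_all add: Fvec_def)
qed

text \<open>Equality of projective points modulo \<open>q\<close>, the vectors being compared up to
  a unit of \<open>K\<close>.\<close>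

definition pcong :: "complex set \<Rightarrow> complex set \<Rightarrow> complex set \<Rightarrow> nat \<Rightarrow> complex \<Rightarrow> (nat \<Rightarrow> complex) \<Rightarrow> (nat \<Rightarrow> complex) \<Rightarrow> bool" where
  "pcong A m K N q y z \<longleftrightarrow> (\<exists>u\<in>K \<inter> (A - m). \<forall>i\<le>N. \<exists>a\<in>A. y i - u * z i = q * a)"

context place
begin

lemma pcong_congruent:
  assumes "is_subfield K" "\<And>i. i \<le> N \<Longrightarrow> \<exists>a\<in>A. y i - z i = q * a"
  shows "pcong A m K N q y z"
proof -
  have "1 \<in> K \<inter> (A - m)" using is_subfieldD(2)[OF assms(1)] one_notin by simp
  then show ?thesis unfolding pcong_def using assms(2) by (intro bexI[of _ 1]) simp_all
qed

lemma pcong_refl: "is_subfield K \<Longrightarrow> pcong A m K N q y y"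
  by (rule pcong_congruent) (auto intro!: bexI[of _ 0])

lemma pcong_sym:
  assumes K: "is_subfield K" and "pcong A m K N q y z"
  shows "pcong A m K N q z y"
proof -
  obtain u where u: "u \<in> K \<inter> (A - m)" "\<forall>i\<le>N. \<exists>a\<in>A. y i - u * z i = q * a" using assms(2) unfolding pcong_def by (elim bexE) (rule that)
  have u0: "u \<noteq> 0" using u(1) unit_nonzero by simp
  have iu: "inverse u \<in> K \<inter> (A - m)" using u(1) unit_inverse is_subfieldD(6)[OF K] by simp
  have "\<exists>a\<in>A. z i - inverse u * y i = q * a" if i: "i \<le> N" for i
  proof -
    obtain a where a: "a \<in> A" "y i - u * z i = q * a" using u(2)[rule_format, OF i] by (elim bexE) (rule that)
    have "z i - inverse u * y i = - inverse u * (y i - u * z i)" using u0 by (simp add: field_simps)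
    also have "\<dots> = q * (- inverse u * a)" unfolding a(2) by simp
    finally show ?thesis using mult[OF minus a(1), of "inverse u"] iu by (intro bexI) simp_all
  qed
  then show ?thesis unfolding pcong_def using iu by (intro bexI[OF _ iu] allI impI)
qed

lemma pcong_trans:
  assumes K: "is_subfield K" and "pcong A m K N q x y" "pcong A m K N q y z"
  shows "pcong A m K N q x z"
proof -
  obtain u where u: "u \<in> K \<inter> (A - m)" "\<forall>i\<le>N. \<exists>a\<in>A. x i - u * y i = q * a" using assms(2) unfolding pcong_def by (elim bexE) (rule that)
  obtain t where t: "t \<in> K \<inter> (A - m)" "\<forall>i\<le>N. \<exists>a\<in>A. y i - t * z i = q * a" using assms(3) unfolding pcong_def by (elim bexE) (rule that)
  have ut: "u * t \<in> K \<inter> (A - m)" using u(1) t(1) unit_mult is_subfieldD(5)[OF K] by simp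
  have "\<exists>a\<in>A. x i - (u * t) * z i = q * a" if i: "i \<le> N" for i
  proof -
    obtain a where a: "a \<in> A" "x i - u * y i = q * a" using u(2)[rule_format, OF i] by (elim bexE) (rule that)
    obtain b where b: "b \<in> A" "y i - t * z i = q * b" using t(2)[rule_format, OF i] by (elim bexE) (rule that)
    have "x i - (u * t) * z i = (x i - u * y i) + u * (y i - t * z i)" by (simp add: algebra_simps)
    also have "\<dots> = q * (a + u * b)" unfolding a(2) b(2) by (simp add: algebra_simps)
    finally show ?thesis using add[OF a(1) mult[OF _ b(1)], of u] u(1) by (intro bexI) simp_all
  qed
  then show ?thesis unfolding pcong_def using ut by (intro bexI[OF _ ut] allI impI)
qed

lemma pcong_Fvec:
  assumes K: "is_subfield K" and FA: "\<And>i \<alpha>. i \<le> N \<Longrightarrow> \<alpha> \<in> monoms N d \<Longrightarrow> F i \<alpha> \<in> A"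
    and z: "\<And>i. i \<le> N \<Longrightarrow> z i \<in> A" and q: "q \<in> A" and "pcong A m K N q y z"
  shows "pcong A m K N q (Fvec N d F y) (Fvec N d F z)"
proof -
  obtain u where u: "u \<in> K \<inter> (A - m)" "\<forall>i\<le>N. \<exists>a\<in>A. y i - u * z i = q * a" using assms(5) unfolding pcong_def by (elim bexE) (rule that)
  have "\<forall>i. \<exists>a. i \<le> N \<longrightarrow> a \<in> A \<and> y i - u * z i = q * a" using u(2) by blast
  from choice[OF this] obtain a where a: "\<forall>i. i \<le> N \<longrightarrow> a i \<in> A \<and> y i - u * z i = q * a i" by (rule exE)
  have ud: "u ^ d \<in> K \<inter> (A - m)" using u(1) unit_power is_subfield_power[OF K] by simp
  have "\<exists>b\<in>A. Fvec N d F y i - u ^ d * Fvec N d F z i = q * b" if i: "i \<le> N" for i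
  proof -
    have "\<exists>r\<in>A. heval N d (F i) (\<lambda>i. u * z i + q * a i) = heval N d (F i) (\<lambda>i. u * z i) + q * r"
    proof (rule Pol_lipschitz[OF _ order_refl])
      show "heval N d (F i) \<in> Pol A (Suc N)" by (rule heval_Pol) (use FA i in simp_all)
      show "u * z j \<in> A" if "j < Suc N" for j using z[of j] that u(1) by (intro mult) simp_all
      show "a j \<in> A" if "j < Suc N" for j using a that by simp
    qed (rule q)
    then obtain r where r: "r \<in> A" "heval N d (F i) (\<lambda>i. u * z i + q * a i) = heval N d (F i) (\<lambda>i. u * z i) + q * r" by (elim bexE) (rule that)
    have "heval N d (F i) y = heval N d (F i) (\<lambda>i. u * z i + q * a i)"
    proof (rule heval_cong)
      fix j assume "j \<le> N"
      then have "y j - u * z j = q * a j" using a by simp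
      then show "y j = u * z j + q * a j" by (simp add: algebra_simps)
    qed
    then have "heval N d (F i) y - u ^ d * heval N d (F i) z = q * r" using r(2) by (simp add: heval_scale)
    then show ?thesis using r(1) i unfolding Fvec_def by (intro bexI[of _ r]) simp_all
  qed
  then show ?thesis unfolding pcong_def using ud by (intro bexI[OF _ ud] allI impI)
qed

text \<open>Residues modulo \<open>p\<close>, used twice as two digits, give finitely many residues
  modulo the square of \<open>p\<close>; \<open>\<rho>\<close> records them entry by entry.\<close>

lemma pcong_finite:
  assumes nf: "number_field K" and K: "is_subfield K" and p: "prime p" "of_nat p \<in> m"
  shows "\<exists>\<rho> :: (nat \<Rightarrow> complex) \<Rightarrow> nat \<Rightarrow> complex. finite (\<rho> ` unimodular A m K N) \<and>
    (\<forall>x\<in>unimodular A m K N. \<forall>y\<in>unimodular A m K N. \<rho> x = \<rho> y \<longrightarrow> pcong A m K N (of_nat p ^ 2) x y)"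
proof -
  obtain T where T: "finite T" "T \<subseteq> A \<inter> K" "\<forall>a\<in>A \<inter> K. \<exists>t\<in>T. \<exists>b\<in>A \<inter> K. a = t + of_nat p * b"
    using finite_residues[OF nf K p] by (elim exE conjE) (rule that)
  define U where "U = (\<lambda>(t, t'). t + of_nat p * t') ` (T \<times> T)"
  have "finite U" unfolding U_def using T(1) by simp
  have U: "\<exists>s. s \<in> U \<and> (\<exists>b\<in>A. a = s + of_nat p ^ 2 * b)" if a: "a \<in> A \<inter> K" for a
  proof -
    obtain t b where t: "t \<in> T" "b \<in> A \<inter> K" "a = t + of_nat p * b" using T(3)[rule_format, OF a] by (elim bexE) (rule that)
    obtain t' b' where t': "t' \<in> T" "b' \<in> A \<inter> K" "b = t' + of_nat p * b'" using T(3)[rule_format, OF t(2)] by (elim bexE) (rule that)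
    have "a = (t + of_nat p * t') + of_nat p ^ 2 * b'" unfolding t(3) t'(3) by (simp add: algebra_simps power2_eq_square)
    moreover have "t + of_nat p * t' \<in> U" unfolding U_def using t(1) t'(1) by (intro image_eqI[of _ _ "(t, t')"]) simp_all
    ultimately show ?thesis using t'(2) by (intro exI[of _ "t + of_nat p * t'"] conjI bexI[of _ b']) simp_all
  qed
  define \<tau> where "\<tau> = (\<lambda>a. SOME s. s \<in> U \<and> (\<exists>b\<in>A. a = s + of_nat p ^ 2 * b))"
  have \<tau>: "\<tau> a \<in> U \<and> (\<exists>b\<in>A. a = \<tau> a + of_nat p ^ 2 * b)" if "a \<in> A \<inter> K" for a
    unfolding \<tau>_def by (rule someI_ex[OF U[OF that]])
  define \<rho> where "\<rho> = (\<lambda>y :: nat \<Rightarrow> complex. restrict (\<lambda>i. \<tau> (y i)) {..N})"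
  have "\<rho> ` unimodular A m K N \<subseteq> PiE {..N} (\<lambda>_. U)"
  proof
    fix z assume "z \<in> \<rho> ` unimodular A m K N"
    then obtain y where y: "y \<in> unimodular A m K N" "z = \<rho> y" by (elim imageE) (rule that)
    show "z \<in> PiE {..N} (\<lambda>_. U)" unfolding y(2) \<rho>_def
    proof (rule restrict_PiE_iff[THEN iffD2], rule ballI)
      fix i assume "i \<in> {..N}"
      then show "\<tau> (y i) \<in> U" using \<tau>[of "y i"] unimodularD(1,2)[OF y(1)] by simp
    qed
  qed
  then have "finite (\<rho> ` unimodular A m K N)" by (rule finite_subset) (intro finite_PiE \<open>finite U\<close>, simp)
  moreover have "pcong A m K N (of_nat p ^ 2) x y" if xy: "x \<in> unimodular A m K N" "y \<in> unimodular A m K N" and eq: "\<rho> x = \<rho> y" for x y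
  proof (rule pcong_congruent[OF K])
    fix i assume i: "i \<le> N"
    have "\<rho> x i = \<rho> y i" using eq by simp
    then have e: "\<tau> (x i) = \<tau> (y i)" unfolding \<rho>_def using i by simp
    have "\<exists>b\<in>A. x i = \<tau> (x i) + of_nat p ^ 2 * b" using \<tau>[of "x i"] unimodularD(1,2)[OF xy(1) i] by simp
    then obtain b where b: "b \<in> A" "x i = \<tau> (x i) + of_nat p ^ 2 * b" by (elim bexE) (rule that)
    have "\<exists>b\<in>A. y i = \<tau> (y i) + of_nat p ^ 2 * b" using \<tau>[of "y i"] unimodularD(1,2)[OF xy(2) i] by simp
    then obtain c where c: "c \<in> A" "y i = \<tau> (y i) + of_nat p ^ 2 * c" by (elim bexE) (rule that)
    have "x i - y i = of_nat p ^ 2 * (b - c)" using b(2) c(2) e by (simp add: algebra_simps)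
    then show "\<exists>a\<in>A. x i - y i = of_nat p ^ 2 * a" using diff[OF b(1) c(1)] by (rule bexI)
  qed
  ultimately show ?thesis by (intro exI[of _ \<rho>] conjI ballI impI)
qed

end

lemma PolD_unique:
  assumes "PolD S n f D" "PolD S' n f E" shows "D v w = E v w"
  by (rule DERIV_unique[OF PolD_deriv[OF assms(1)] PolD_deriv[OF assms(2)]])

lemma (in place) critical_point_unimodular:
  assumes K: "is_subfield K" and FA: "\<And>i \<alpha>. i \<le> N \<Longrightarrow> \<alpha> \<in> monoms N d \<Longrightarrow> F i \<alpha> \<in> A"
    and p: "prime p" "of_nat p \<in> m"
    and D: "\<And>i. i \<le> N \<Longrightarrow> PolD S (Suc N) (heval N d (F i)) (D i)" "\<And>i. i \<le> N \<Longrightarrow> D i v w = 0"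
    and v: "\<And>i. i \<le> N \<Longrightarrow> v i \<in> A \<inter> K" "is_vec N v" and w: "\<And>i. i \<le> N \<Longrightarrow> w i \<in> A \<inter> K" "is_vec N w"
    and ij: "i \<le> N" "j \<le> N" "v i * w j - v j * w i \<in> A - m"
  shows "\<exists>c\<in>unimodular A m K N. \<exists>c'\<in>unimodular A m K N.
    pcong A m K N (of_nat p ^ 2) (Fvec N d F c) (Fvec N d F c') \<and> \<not> pcong A m K N (of_nat p ^ 2) c c'"
proof -
  define v' where "v' = (\<lambda>l. v l + of_nat p * w l)"
  have p0: "of_nat p \<noteq> (0 :: complex)" using p(1) by (simp add: prime_gt_0_nat)
  have vA: "v l \<in> A" "w l \<in> A" "v l \<in> K" "w l \<in> K" if "l \<le> N" for l using v(1)[OF that] w(1)[OF that] by simp_all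
  have "\<exists>l\<le>N. v l \<notin> m"
  proof (rule ccontr)
    assume "\<not> ?thesis"
    then have "v i \<in> m" "v j \<in> m" using ij(1,2) by simp_all
    then have "v i * w j - v j * w i \<in> m" using vA ij(1,2) by (intro m_diff m_mult_right)
    then show False using ij(3) by simp
  qed
  then obtain l where l: "l \<le> N" "v l \<notin> m" by (elim exE conjE) (rule that)
  have "v \<in> unimodular A m K N" unfolding unimodular_def using v l by (intro CollectI conjI allI impI exI[of _ l])
  moreover have "v' \<in> unimodular A m K N" unfolding unimodular_def
  proof (intro CollectI conjI allI impI exI[of _ l] l(1))
    fix k assume "k \<le> N"
    then show "v' k \<in> A \<inter> K" unfolding v'_def using vA[of k] by (intro IntI add mult is_subfieldD(3,5)[OF K] is_subfield_of_nat[OF K] of_nat)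
  next
    have "v l + of_nat p * w l \<in> A - m" using l vA by (intro unit_add_m m_mult_right p(2)) simp_all
    then show "v' l \<notin> m" unfolding v'_def by simp
  next
    show "is_vec N v'" using v(2) w(2) unfolding v'_def is_vec_def by simp
  qed
  moreover have "pcong A m K N (of_nat p ^ 2) (Fvec N d F v') (Fvec N d F v)"
  proof (rule pcong_congruent[OF K])
    fix k assume k: "k \<le> N"
    have P: "heval N d (F k) \<in> Pol A (Suc N)" by (rule heval_Pol) (use FA k in simp_all)
    obtain E where E: "PolD A (Suc N) (heval N d (F k)) E" using PolD_exists[OF P] by (rule exE)
    have "\<exists>r\<in>A. heval N d (F k) (\<lambda>i. v i + of_nat p * w i) = heval N d (F k) v + of_nat p * E v w + of_nat p ^ 2 * r"
      by (rule PolD_taylor[OF E order_refl]) (use vA in simp_all)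
    then obtain r where r: "r \<in> A" "heval N d (F k) (\<lambda>i. v i + of_nat p * w i) = heval N d (F k) v + of_nat p * E v w + of_nat p ^ 2 * r" by (elim bexE) (rule that)
    \<comment> \<open>\<open>E\<close> is built from constants in \<open>A\<close> and
      \<open>D\<close> from constants in \<open>S\<close>, but both compute the analytic
      derivative.\<close>
    have "E v w = 0" using PolD_unique[OF E D(1)[OF k], of v w] D(2)[OF k] by simp
    then have "Fvec N d F v' k - Fvec N d F v k = of_nat p ^ 2 * r" using r(2) k unfolding Fvec_def v'_def by simp
    then show "\<exists>a\<in>A. Fvec N d F v' k - Fvec N d F v k = of_nat p ^ 2 * a"
      using r(1) by (rule bexI)
  qed
  then have "pcong A m K N (of_nat p ^ 2) (Fvec N d F v) (Fvec N d F v')" by (rule pcong_sym[OF K])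
  moreover have "\<not> pcong A m K N (of_nat p ^ 2) v v'"
  proof
    assume "pcong A m K N (of_nat p ^ 2) v v'"
    then obtain u where u: "u \<in> K \<inter> (A - m)" "\<forall>i\<le>N. \<exists>a\<in>A. v i - u * v' i = of_nat p ^ 2 * a" unfolding pcong_def by (elim bexE) (rule that)
    obtain a where a: "a \<in> A" "v i - u * v' i = of_nat p ^ 2 * a" using u(2)[rule_format, OF ij(1)] by (elim bexE) (rule that)
    obtain b where b: "b \<in> A" "v j - u * v' j = of_nat p ^ 2 * b" using u(2)[rule_format, OF ij(2)] by (elim bexE) (rule that)
    \<comment> \<open>Combining the two coordinates so that \<open>v i * v j\<close> cancels leaves
      \<open>u\<close> times the minor. It would have to be a multiple of \<open>p\<close>, yet it
      is a unit.\<close>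
    have "of_nat p * (u * (v i * w j - v j * w i)) = v j * (v i - u * v' i) - v i * (v j - u * v' j)"
      unfolding v'_def by (simp add: algebra_simps)
    also have "\<dots> = of_nat p * (of_nat p * (v j * a - v i * b))" unfolding a(2) b(2) by (simp add: algebra_simps power2_eq_square)
    finally have "u * (v i * w j - v j * w i) = of_nat p * (v j * a - v i * b)" using p0 by simp
    moreover have "of_nat p * (v j * a - v i * b) \<in> m" using vA ij(1,2) a(1) b(1) by (intro m_mult_right p(2) diff mult)
    moreover have "u * (v i * w j - v j * w i) \<in> A - m" using u(1) ij(3) by (intro unit_mult) simp_all
    ultimately show False by simp
  qed
  ultimately show ?thesis by (intro bexI[of _ v] bexI[of _ v'] conjI)
qed

lemma PN_K_E:
  assumes "P \<in> PN_K N K" "K \<subseteq> {x. algebraic x}"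
  obtains w where "P = proj w" "alg_vec N w" "w \<noteq> (\<lambda>_. 0)" "\<And>i. i \<le> N \<Longrightarrow> w i \<in> K"
proof -
  have "P \<in> PN N" "\<exists>w\<in>P. \<forall>i\<le>N. w i \<in> K" using assms(1) unfolding PN_K_def by simp_all
  then obtain w where w: "w \<in> P" "\<forall>i\<le>N. w i \<in> K" by (elim bexE) (rule that)
  obtain v where v: "P = proj v" "alg_vec N v" "v \<noteq> (\<lambda>_. 0)" using PN_E[OF \<open>P \<in> PN N\<close>] .
  obtain c where c: "c \<noteq> 0" "w = (\<lambda>i. c * v i)" using w(1) unfolding v(1) by (rule proj_memE)
  obtain k where k: "v k \<noteq> 0" using v(3) by auto
  show thesis
  proof (rule that)
    show "P = proj w" using proj_mem_eq[of w v] w(1) v(1) by simp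
    have "algebraic (w i)" if "i \<le> N" for i using w(2) assms(2) that by (simp add: subset_iff)
    then show "alg_vec N w" using v(2) unfolding alg_vec_def c(2) is_vec_def by simp
    have "w k \<noteq> 0" using c k by simp
    then show "w \<noteq> (\<lambda>_. 0)" by auto
  qed (use w(2) in simp)
qed

lemma PN_K_I:
  assumes "\<And>i. i \<le> N \<Longrightarrow> w i \<in> K" "K \<subseteq> {x. algebraic x}" "is_vec N w" "w \<noteq> (\<lambda>_. 0)"
  shows "proj w \<in> PN_K N K"
proof -
  have "algebraic (w i)" if "i \<le> N" for i using assms(1,2) that by (simp add: subset_iff)
  then have "alg_vec N w" using assms(3) unfolding alg_vec_def by simp
  then show ?thesis unfolding PN_K_def using PN_I[OF _ assms(4)] assms(1) by (intro CollectI conjI bexI[of _ w]) simp_all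
qed

lemma fmap_PN_K:
  assumes F: "endo N d F" "\<And>i \<alpha>. i \<le> N \<Longrightarrow> \<alpha> \<in> monoms N d \<Longrightarrow> F i \<alpha> \<in> K" and K: "is_subfield K" "K \<subseteq> {x. algebraic x}" and P: "P \<in> PN_K N K"
  shows "fmap N d F P \<in> PN_K N K"
proof -
  obtain w where w: "P = proj w" "alg_vec N w" "w \<noteq> (\<lambda>_. 0)" "\<And>i. i \<le> N \<Longrightarrow> w i \<in> K" by (rule PN_K_E[OF P K(2)]) (rule that)
  have wK: "w i \<in> K" for i
    using w(2,4) is_subfieldD(1)[OF K(1)] unfolding alg_vec_def is_vec_def by (cases "i \<le> N") simp_all
  have "Fvec N d F w i \<in> K" for i using Fvec_in_subfield[where F = F and d = d and N = N and a = 1 and v = w and i = i, OF K(1) F(2) wK] by simp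
  then show ?thesis unfolding w(1) fmap_proj by (intro PN_K_I K(2) is_vec_Fvec Fvec_nonzero[OF F(1) w(2,3)])
qed

text \<open>A lift of \<open>P\<close> that is primitive at the place has a unimodular image, which
  would be proportional to \<open>u\<close>. As \<open>u\<close> inherits a unit entry from
  \<open>x0\<close>, the scalar is a unit of \<open>K\<close>, so the image would be congruent to
  \<open>x0\<close>.\<close>

lemma (in place) congruent_point_not_image:
  assumes cert: "certificate K N d F D g" and F: "endo N d F" and K: "is_subfield K" "K \<subseteq> {x. algebraic x}"
    and FA: "\<And>i \<alpha>. i \<le> N \<Longrightarrow> \<alpha> \<in> monoms N d \<Longrightarrow> F i \<alpha> \<in> A" and gA: "\<And>i j. i \<le> N \<Longrightarrow> j \<le> N \<Longrightarrow> g i j \<in> Pol A (Suc N)"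
    and q: "q \<in> m" and x0: "x0 \<in> unimodular A m K N" "\<forall>y\<in>unimodular A m K N. \<not> pcong A m K N q (Fvec N d F y) x0"
    and u: "\<And>i. i \<le> N \<Longrightarrow> u i \<in> A \<inter> K" "is_vec N u" "\<And>i. i \<le> N \<Longrightarrow> \<exists>a\<in>A. u i - x0 i = q * a" and P: "P \<in> PN_K N K"
  shows "fmap N d F P \<noteq> proj u"
proof
  assume eq: "fmap N d F P = proj u"
  obtain w where w: "P = proj w" "alg_vec N w" "w \<noteq> (\<lambda>_. 0)" "\<And>i. i \<le> N \<Longrightarrow> w i \<in> K" by (rule PN_K_E[OF P K(2)]) (rule that)
  have "\<exists>i\<le>N. w i \<noteq> 0" using w(2,3) unfolding alg_vec_def is_vec_def by (metis not_le)
  from primitive_multiple[OF this] obtain k y where y: "k \<le> N" "w k \<noteq> 0" "w = (\<lambda>i. w k * y i)" "primitive A N y" by (elim exE conjE) (rule that)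
  have wy: "w i = w k * y i" for i using fun_cong[OF y(3), of i] .
  have yi: "y i = w i * inverse (w k)" for i using wy[of i] y(2) by (simp add: field_simps)
  have "y \<in> unimodular A m K N" unfolding unimodular_def
  proof (intro CollectI conjI allI impI IntI)
    show "y i \<in> A" if "i \<le> N" for i using y(4) that unfolding primitive_def by simp
    show "y i \<in> K" if "i \<le> N" for i unfolding yi using w(4) that y(1) by (intro is_subfieldD(5,6)[OF K(1)])
    obtain i where "i \<le> N" "y i = 1" using y(4) unfolding primitive_def by (elim conjE exE) (rule that)
    then show "\<exists>i\<le>N. y i \<notin> m" using one_notin by (intro exI[of _ i]) simp
    show "is_vec N y" using w(2) unfolding yi[abs_def] alg_vec_def is_vec_def by simp
  qed
  then have zX: "Fvec N d F y \<in> unimodular A m K N" and nc: "\<not> pcong A m K N q (Fvec N d F y) x0"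
    using Fvec_unimodular[OF cert K(1) FA gA] x0(2) by simp_all
  define z where "z = Fvec N d F y"
  have "P = proj y" unfolding w(1) using proj_scale[OF y(2), of y] y(3) by simp
  then have "proj z = proj u" using eq unfolding z_def by (simp add: fmap_proj)
  then have "z \<in> proj u" using proj_self[of z] by simp
  then obtain s where s: "s \<noteq> 0" "z = (\<lambda>i. s * u i)" by (rule proj_memE)
  obtain l where l: "l \<le> N" "x0 l \<notin> m" using unimodularD(3)[OF x0(1)] by (elim exE conjE) (rule that)
  obtain a where a: "a \<in> A" "u l - x0 l = q * a" using u(3)[OF l(1)] by (elim bexE) (rule that)
  have "x0 l \<in> A - m" using unimodularD(1)[OF x0(1) l(1)] l(2) by simp
  then have "x0 l + q * a \<in> A - m" by (intro unit_add_m m_mult_right q a(1))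
  then have ul: "u l \<in> A - m" using a(2) by (simp add: algebra_simps)
  then have "s = z l * inverse (u l)" using s(2) unit_nonzero[OF ul] by simp
  moreover have "z l \<in> A" "z l \<in> K" using unimodularD(1,2)[OF zX l(1)] unfolding z_def by simp_all
  moreover have "inverse (u l) \<in> A" using unit_inverse[OF ul] by simp
  moreover have "inverse (u l) \<in> K" using u(1)[OF l(1)] is_subfieldD(6)[OF K(1)] by simp
  ultimately have sA: "s \<in> A" "s \<in> K" using mult is_subfieldD(5)[OF K(1)] by simp_all
  obtain j where j: "j \<le> N" "z j \<notin> m" using unimodularD(3)[OF zX[folded z_def]] by (elim exE conjE) (rule that)
  have "s \<notin> m"
  proof
    assume "s \<in> m"
    then have "s * u j \<in> m" using u(1)[OF j(1)] by (intro m_mult_right) simp_all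
    then show False using j(2) s(2) by simp
  qed
  have "pcong A m K N q z x0" unfolding pcong_def
  proof (rule bexI[of _ s], intro allI impI)
    fix i assume "i \<le> N"
    from u(3)[OF this] obtain b where b: "b \<in> A" "u i - x0 i = q * b" by (elim bexE) (rule that)
    have "z i - s * x0 i = s * (u i - x0 i)" using s(2) by (simp add: algebra_simps)
    also have "\<dots> = q * (s * b)" unfolding b(2) by simp
    finally show "\<exists>a\<in>A. z i - s * x0 i = q * a" using mult[OF sA(1) b(1)] by (rule bexI)
  qed (use sA \<open>s \<notin> m\<close> in simp)
  then show False using nc unfolding z_def by simp
qed

text \<open>Modulo the square of a good prime, the reduction of the map identifies a critical point with
  a tangent neighbour, hence misses a residue class of the finite set of primitive vectors.\<close>

theorem images_part:
  assumes cert: "certificate K N d F E g" and F: "endo N d F" and K: "is_subfield K" "K \<subseteq> {x. algebraic x}" "number_field K"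
    and D: "\<And>i. i \<le> N \<Longrightarrow> PolD S (Suc N) (heval N d (F i)) (D i)" "\<And>i. i \<le> N \<Longrightarrow> D i v w = 0"
    and v: "\<And>i. i \<le> N \<Longrightarrow> v i \<in> K" "is_vec N v" and w: "\<And>i. i \<le> N \<Longrightarrow> w i \<in> K" "is_vec N w"
    and ij: "i \<le> N" "j \<le> N" "v i * w j - v j * w i \<noteq> 0"
    and Y: "zclosed N Y" "Y \<noteq> PN N"
  shows "zdense N (PN_K N K - (\<Union>P\<in>Y \<inter> PN_K N K. orbit (fmap N d F) P))"
proof -
  have algK: "algebraic x" if "x \<in> K" for x using K(2) that by (simp add: subset_iff)
  \<comment> \<open>Finitely many constants of \<open>K\<close> generate the polynomials of the
    certificate, so a place can be found at which all of them are integral.\<close>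
  define S0 where "S0 = (\<lambda>l k. SOME S. finite S \<and> S \<subseteq> K \<and> g l k \<in> Pol S (Suc N))"
  have S0: "finite (S0 l k)" "S0 l k \<subseteq> K" "g l k \<in> Pol (S0 l k) (Suc N)" if "l \<le> N" "k \<le> N" for l k
    using someI_ex[OF Pol_finite_coeffs[OF certificateD(2)[OF cert that]]] unfolding S0_def by simp_all
  define Z where "Z = (\<Union>l\<in>{..N}. F l ` monoms N d) \<union> (\<Union>l\<in>{..N}. \<Union>k\<in>{..N}. S0 l k) \<union> v ` {..N} \<union> w ` {..N} \<union> {v i * w j - v j * w i}"
  have finZ: "finite Z" unfolding Z_def using S0 by simp
  have ZK: "z \<in> K" if "z \<in> Z" for z
    using that unfolding Z_def
  proof (elim UnE)
    assume "z \<in> (\<Union>l\<in>{..N}. F l ` monoms N d)"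
    then show "z \<in> K" by (elim UN_E imageE) (simp add: certificateD(1)[OF cert])
  next
    assume "z \<in> (\<Union>l\<in>{..N}. \<Union>k\<in>{..N}. S0 l k)"
    then obtain l k where "l \<le> N" "k \<le> N" "z \<in> S0 l k" by (elim UN_E) (rule that, simp_all)
    then show "z \<in> K" using S0(2)[of l k] by (simp add: subset_iff)
  next
    assume "z \<in> {v i * w j - v j * w i}"
    then show "z \<in> K" using v(1) w(1) ij is_subfieldD(4,5)[OF K(1)] by simp
  qed (elim imageE, simp add: v w)+
  obtain A m and p :: nat where pl: "place A m" and p: "prime p" "of_nat p \<in> m" and ZA: "\<And>x. x \<in> Z \<Longrightarrow> x \<in> A" "\<And>x. x \<in> Z \<Longrightarrow> x \<noteq> 0 \<Longrightarrow> x \<in> A - m"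
    by (rule exists_good_place[OF finZ algK[OF ZK]]) (assumption, rule that)
  interpret place A m by (rule pl)
  have FA: "F l \<alpha> \<in> A" if "l \<le> N" "\<alpha> \<in> monoms N d" for l \<alpha>
    by (rule ZA(1)) (use that in \<open>auto simp: Z_def\<close>)
  have gA: "g l k \<in> Pol A (Suc N)" if "l \<le> N" "k \<le> N" for l k
  proof -
    have "S0 l k \<subseteq> Z" unfolding Z_def using that by auto
    then have "S0 l k \<subseteq> A" using ZA(1) by (simp add: subset_iff)
    then show ?thesis using Pol_mono[of "g l k" "S0 l k" "Suc N" A "Suc N"] S0 that by simp
  qed
  have vA: "v l \<in> A \<inter> K" "w l \<in> A \<inter> K" if "l \<le> N" for l
    using that v(1) w(1) ZA(1)[of "v l"] ZA(1)[of "w l"] unfolding Z_def by simp_all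
  have unit: "v i * w j - v j * w i \<in> A - m" by (rule ZA(2)[OF _ ij(3)]) (simp add: Z_def)
  have "\<exists>c\<in>unimodular A m K N. \<exists>c'\<in>unimodular A m K N.
    pcong A m K N (of_nat p ^ 2) (Fvec N d F c) (Fvec N d F c') \<and> \<not> pcong A m K N (of_nat p ^ 2) c c'"
    by (rule critical_point_unimodular[where F = F and d = d and D = D and v = v and w = w]) (fact K FA p D vA v w ij unit)+
  then obtain c c' where c: "c \<in> unimodular A m K N" "c' \<in> unimodular A m K N" 
    "pcong A m K N (of_nat p ^ 2) (Fvec N d F c) (Fvec N d F c')" "\<not> pcong A m K N (of_nat p ^ 2) c c'" by (elim bexE conjE) (rule that)
  obtain \<rho> :: "(nat \<Rightarrow> complex) \<Rightarrow> nat \<Rightarrow> complex" where \<rho>: "finite (\<rho> ` unimodular A m K N)"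
    "\<forall>x\<in>unimodular A m K N. \<forall>y\<in>unimodular A m K N. \<rho> x = \<rho> y \<longrightarrow> pcong A m K N (of_nat p ^ 2) x y"
    using pcong_finite[OF K(3,1) p, of N] by (elim exE conjE) (rule that)
  define q :: complex where "q = of_nat p ^ 2"
  have q: "q \<in> m" unfolding q_def by (intro m_power p(2)) simp
  have q0: "q \<noteq> 0" unfolding q_def using prime_gt_0_nat[OF p(1)] by simp
  have "\<exists>x0\<in>unimodular A m K N. \<forall>y\<in>unimodular A m K N. \<not> pcong A m K N q (Fvec N d F y) x0"
    unfolding q_def
  proof (rule missed_class[where \<rho> = \<rho> and c = c and c' = c'])
    show "Fvec N d F y \<in> unimodular A m K N" if "y \<in> unimodular A m K N" for y
      by (rule Fvec_unimodular[where F = F and g = g, OF cert K(1) FA gA that])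
    show "pcong A m K N (of_nat p ^ 2) (Fvec N d F x) (Fvec N d F y)" if "y \<in> unimodular A m K N" "pcong A m K N (of_nat p ^ 2) x y" for x y
      by (rule pcong_Fvec[where F = F and d = d and z = y, OF K(1) FA unimodularD(1)[OF that(1)] _ that(2)]) (simp_all add: power)
    show "pcong A m K N (of_nat p ^ 2) x y" if "x \<in> unimodular A m K N" "y \<in> unimodular A m K N" "\<rho> x = \<rho> y" for x y
      using \<rho>(2) that by simp
  qed (fact c \<rho>(1) | rule pcong_refl[OF K(1)] | erule pcong_sym[OF K(1)] | erule (1) pcong_trans[OF K(1)])+
  then obtain x0 where x0: "x0 \<in> unimodular A m K N" "\<forall>y\<in>unimodular A m K N. \<not> pcong A m K N q (Fvec N d F y) x0" by (elim bexE) (rule that)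
  have FK: "F l \<alpha> \<in> K" if "l \<le> N" "\<alpha> \<in> monoms N d" for l \<alpha> by (rule certificateD(1)[OF cert that])
  have iterK: "(fmap N d F ^^ k) P \<in> PN_K N K" if "P \<in> PN_K N K" for k P
    by (induct k) (use that fmap_PN_K[where F = F, OF F FK K(1,2)] in simp_all)
  obtain e0 c0 v0 where c0: "alg_hpoly N e0 c0" "alg_vec N v0" "v0 \<noteq> (\<lambda>_. 0)" "heval N e0 c0 v0 \<noteq> 0"
    "\<And>P w. P \<in> Y \<Longrightarrow> w \<in> P \<Longrightarrow> heval N e0 c0 w = 0"
    by (rule zclosed_proper_form[OF Y]) (rule that)
  show ?thesis
  proof (rule zdenseI)
    show "PN_K N K - (\<Union>P\<in>Y \<inter> PN_K N K. orbit (fmap N d F) P) \<subseteq> PN N" using PN_K_subset[of N K] by (rule subset_trans[OF Diff_subset])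
    fix e c1 v1 assume nz: "heval N e c1 v1 \<noteq> 0"
    have PU: "heval N e c \<in> Pol UNIV (Suc N)" for e c by (rule heval_Pol) simp_all
    \<comment> \<open>The second factor vanishes on \<open>Y\<close>: the point sought has to avoid
      the given hypersurface and \<open>Y\<close> at the same time.\<close>
    obtain z where z: "heval N e c1 z * heval N e0 c0 z \<noteq> 0" using Pol_mult_nonzero[OF PU PU nz c0(4)] by (rule exE)
    \<comment> \<open>Vectors with entries in these progressions are congruent to \<open>x0\<close>
      modulo \<open>q\<close>, and the progressions are infinite, so no nonzero polynomial vanishes
      at all such vectors.\<close>
    define G where "G = (\<lambda>i. range (\<lambda>k. x0 i + q * of_nat k))"
    have "\<exists>x. (\<forall>i<Suc N. x i \<in> G i) \<and> heval N e c1 x * heval N e0 c0 x \<noteq> 0"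
    proof (rule ccontr)
      assume no: "\<not> ?thesis"
      have "heval N e c1 z * heval N e0 c0 z = 0"
      proof (rule Pol_zero_grid[where f = "\<lambda>x. heval N e c1 x * heval N e0 c0 x" and n = "Suc N" and G = G])
        show "(\<lambda>x. heval N e c1 x * heval N e0 c0 x) \<in> Pol UNIV (Suc N)" by (rule Pol_mult[OF PU PU])
        show "infinite (G i)" for i unfolding G_def by (rule range_inj_infinite) (simp add: inj_on_def q0)
      qed (use no in blast)
      then show False using z by simp
    qed
    then obtain x where x: "\<forall>i<Suc N. x i \<in> G i" "heval N e c1 x * heval N e0 c0 x \<noteq> 0" by (elim exE conjE) (rule that)
    define u where "u = (\<lambda>i. if i \<le> N then x i else 0)"
    have "heval N e c u = heval N e c x" for e c by (rule heval_cong) (simp add: u_def)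
    then have u: "heval N e c1 u \<noteq> 0" "heval N e0 c0 u \<noteq> 0" using x(2) by simp_all
    have ux: "\<exists>k. u i = x0 i + q * of_nat k" if "i \<le> N" for i
    proof -
      have "u i \<in> G i" using x(1) that unfolding u_def by simp
      then show ?thesis unfolding G_def by (elim imageE) (rule exI)
    qed
    have uX: "u i \<in> A \<inter> K" "\<exists>a\<in>A. u i - x0 i = q * a" if i: "i \<le> N" for i
    proof -
      obtain k where k: "u i = x0 i + q * of_nat k" using ux[OF i] by (rule exE)
      have "q \<in> K" unfolding q_def by (intro is_subfield_power is_subfield_of_nat K(1))
      then show "u i \<in> A \<inter> K" unfolding k using unimodularD(1,2)[OF x0(1) i] m_sub q
        by (intro IntI add mult of_nat is_subfieldD(3,5)[OF K(1)] is_subfield_of_nat[OF K(1)]) auto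
      show "\<exists>a\<in>A. u i - x0 i = q * a" unfolding k by (intro bexI[of _ "of_nat k"]) simp_all
    qed
    have uv: "is_vec N u" unfolding is_vec_def u_def by simp
    have "u \<noteq> (\<lambda>_. 0)"
    proof
      assume u0: "u = (\<lambda>_. 0)"
      obtain l where l: "l \<le> N" "x0 l \<notin> m" using unimodularD(3)[OF x0(1)] by (elim exE conjE) (rule that)
      obtain a where a: "a \<in> A" "u l - x0 l = q * a" using uX(2)[OF l(1)] by (elim bexE) (rule that)
      have "- x0 l = q * a" using a(2) u0 by simp
      then have "x0 l = q * (- a)" by (metis minus_minus mult_minus_right)
      then have "x0 l \<in> m" using m_mult_right[OF q minus[OF a(1)]] by simp
      then show False using l(2) by simp
    qed
    then have "proj u \<in> PN_K N K" using uX(1) by (intro PN_K_I K(2) uv) simp_all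
    moreover have "proj u \<notin> orbit (fmap N d F) P" if P: "P \<in> Y" "P \<in> PN_K N K" for P
    proof
      assume "proj u \<in> orbit (fmap N d F) P"
      then obtain k where k: "proj u = (fmap N d F ^^ k) P" unfolding orbit_def by (elim CollectE exE conjE) (rule that)
      show False
      \<comment> \<open>At time 0 the point would lie on \<open>Y\<close>; at any later time it
        would be the image of a \<open>K\<close>-point.\<close>
      proof (cases k)
        case 0
        then have "u \<in> P" using k proj_self[of u] by simp
        then show False using c0(5)[OF P(1)] u(2) by simp
      next
        case (Suc k')
        then have "fmap N d F ((fmap N d F ^^ k') P) = proj u" using k by simp
        moreover have "fmap N d F ((fmap N d F ^^ k') P) \<noteq> proj u"
          by (rule congruent_point_not_image[where F = F and g = g and u = u, OF cert F K(1,2) FA gA q x0 uX(1) uv uX(2) iterK[OF P(2)]])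
        ultimately show False by simp
      qed
    qed
    ultimately show "\<exists>w. proj w \<in> PN_K N K - (\<Union>P\<in>Y \<inter> PN_K N K. orbit (fmap N d F) P) \<and> heval N e c1 w \<noteq> 0"
      using u(1) by (intro exI[of _ u] conjI DiffI) auto
  qed
qed


section \<open>Linear maps\<close>

locale linear_operator =
  fixes T :: "(nat \<Rightarrow> complex) \<Rightarrow> nat \<Rightarrow> complex"
  assumes linear: "T (\<lambda>i. a * v i + b * w i) = (\<lambda>i. a * T v i + b * T w i)"
begin

text \<open>Horner's scheme for p(T) v, which makes the vectors a module over the complex
  polynomials.\<close>

definition act :: "complex poly \<Rightarrow> (nat \<Rightarrow> complex) \<Rightarrow> nat \<Rightarrow> complex" where
  "act p v = fold_coeffs (\<lambda>a w i. a * v i + T w i) p (\<lambda>_. 0)"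

lemma T_zero: "T (\<lambda>_. 0) = (\<lambda>_. 0)" using linear[of 0 "\<lambda>_. 0" 0 "\<lambda>_. 0"] by simp

lemma T_scale: "T (\<lambda>i. a * v i) = (\<lambda>i. a * T v i)" using linear[of a v 0 v] by simp

lemma T_funpow_scale: "(T ^^ k) (\<lambda>i. a * v i) = (\<lambda>i. a * (T ^^ k) v i)"
  by (induct k) (simp_all add: T_scale)

lemma act_0 [simp]: "act 0 v = (\<lambda>_. 0)" unfolding act_def by simp

lemma act_pCons: "act (pCons a p) v = (\<lambda>i. a * v i + T (act p v) i)"
proof (cases "a = 0 \<and> p = 0")
  case False
  then have "fold_coeffs (\<lambda>a w i. a * v i + T w i) (pCons a p) = (\<lambda>w i. a * v i + T w i) \<circ> fold_coeffs (\<lambda>a w i. a * v i + T w i) p"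
    using fold_coeffs_pCons_coeff_not_0_eq[of a "\<lambda>a w i. a * v i + T w i" p] fold_coeffs_pCons_not_0_0_eq[of p "\<lambda>a w i. a * v i + T w i" a] by auto
  then show ?thesis unfolding act_def by simp
qed (simp add: T_zero)

lemma act_1 [simp]: "act 1 v = v" using act_pCons[of 1 0 v] by (simp add: one_pCons T_zero)

lemma act_add: "act (p + q) v = (\<lambda>i. act p v i + act q v i)"
proof (induct p q rule: poly_induct2)
  case (pCons a p b q)
  then show ?case using linear[of 1 "act p v" 1 "act q v"] by (simp add: act_pCons distrib_right add_ac)
qed simp

lemma act_smult: "act (Polynomial.smult c p) v = (\<lambda>i. c * act p v i)"
proof (induct p)
  case (pCons a p)
  then show ?case using T_scale[of c "act p v"] by (simp add: act_pCons distrib_left mult.assoc)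
qed simp

lemma act_mult: "act (p * q) v = act p (act q v)"
  by (induct p) (simp_all add: act_pCons act_add act_smult mult_pCons_left)

lemma act_sum: "act (\<Sum>j\<in>J. p j) v = (\<lambda>i. \<Sum>j\<in>J. act (p j) v i)"
  by (induct J rule: infinite_finite_induct) (simp_all add: act_add)

lemma act_monom: "act (monom c k) v = (\<lambda>i. c * (T ^^ k) v i)"
  by (induct k) (simp_all add: monom_0 monom_Suc act_pCons T_zero T_scale)

lemma T_act: "T (act p v) = act p (T v)"
  using act_mult[of "[:0, 1:]" p v] act_mult[of p "[:0, 1:]" v] by (simp add: act_pCons mult.commute T_zero)

lemma funpow_act: "(T ^^ k) (act p v) = act p ((T ^^ k) v)"
  by (induct k) (simp_all add: T_act)

end

text \<open>Newton's interpolation basis with nodes \<open>\<mu>\<close>. Multiplication by X is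
  bidiagonal in it; \<open>shift\<close> is its matrix.\<close>

definition chain :: "(nat \<Rightarrow> complex) \<Rightarrow> nat \<Rightarrow> complex poly" where
  "chain \<mu> j = (\<Prod>l<j. [:- \<mu> l, 1:])"

definition span_poly :: "(nat \<Rightarrow> complex) \<Rightarrow> nat \<Rightarrow> (nat \<Rightarrow> complex) \<Rightarrow> complex poly" where
  "span_poly \<mu> n y = (\<Sum>j<n. Polynomial.smult (y j) (chain \<mu> j))"

definition shift :: "(nat \<Rightarrow> complex) \<Rightarrow> (nat \<Rightarrow> complex) \<Rightarrow> nat \<Rightarrow> complex" where
  "shift \<mu> y = (\<lambda>j. \<mu> j * y j + (if j = 0 then 0 else y (j - 1)))"

lemma poly_chain: "poly (chain \<mu> j) x = (\<Prod>l<j. x - \<mu> l)"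
  unfolding chain_def by (simp add: poly_prod)

text \<open>The second summand is what leaves the span. It disappears when the polynomials act on a
  vector annihilated by \<open>chain \<mu> n\<close>.\<close>

lemma span_poly_shift:
  "[:0, 1:] * span_poly \<mu> n y = span_poly \<mu> n (shift \<mu> y) + Polynomial.smult (if n = 0 then 0 else y (n - 1)) (chain \<mu> n)"
proof (induct n)
  case (Suc n)
  have c: "chain \<mu> (Suc n) = [:- \<mu> n, 1:] * chain \<mu> n" unfolding chain_def by (simp add: mult.commute)
  have e: "[:0, 1:] = [:- \<mu> n, 1:] + [:\<mu> n:]" by simp
  have x: "[:0, 1:] * chain \<mu> n = chain \<mu> (Suc n) + Polynomial.smult (\<mu> n) (chain \<mu> n)"
    unfolding c e distrib_right by (simp del: mult_pCons_left add: mult_pCons_left[of "\<mu> n" 0])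
  have sp: "span_poly \<mu> (Suc n) z = span_poly \<mu> n z + Polynomial.smult (z n) (chain \<mu> n)" for z unfolding span_poly_def by simp
  have "[:0, 1:] * span_poly \<mu> (Suc n) y = [:0, 1:] * span_poly \<mu> n y + Polynomial.smult (y n) ([:0, 1:] * chain \<mu> n)"
    unfolding sp distrib_left mult_smult_right ..
  also have "\<dots> = span_poly \<mu> n (shift \<mu> y) + Polynomial.smult (if n = 0 then 0 else y (n - 1)) (chain \<mu> n) +
     (Polynomial.smult (y n) (chain \<mu> (Suc n)) + Polynomial.smult (y n * \<mu> n) (chain \<mu> n))"
    unfolding Suc x smult_add_right smult_smult ..
  also have "\<dots> = span_poly \<mu> (Suc n) (shift \<mu> y) + Polynomial.smult (y n) (chain \<mu> (Suc n))"
    unfolding sp shift_def smult_add_left by (simp add: mult.commute)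
  finally show ?case by simp
qed (simp add: span_poly_def)

lemma (in linear_operator) funpow_act_span_poly:
  assumes "act (chain \<mu> n) v = (\<lambda>_. 0)"
  shows "(T ^^ k) (act (span_poly \<mu> n y) v) = act (span_poly \<mu> n ((shift \<mu> ^^ k) y)) v"
proof (induct k)
  case (Suc k)
  have "T (act (span_poly \<mu> n z) v) = act (span_poly \<mu> n (shift \<mu> z)) v" for z
  proof -
    have "T (act (span_poly \<mu> n z) v) = act ([:0, 1:] * span_poly \<mu> n z) v" unfolding act_mult by (simp add: act_pCons T_zero)
    also have "\<dots> = act (span_poly \<mu> n (shift \<mu> z)) v" unfolding span_poly_shift by (simp add: act_add act_smult assms)
    finally show ?thesis .
  qed
  then show ?case using Suc by simp
qed simp

text \<open>The inverse is built node by node: adding a multiple of \<open>chain \<mu> n\<close> to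
  \<open>r\<close> changes the error factor \<open>s\<close> by the same multiple of
  \<open>q\<close>, and since \<open>q\<close> is nonzero at \<open>\<mu> n\<close>, the multiple
  can be chosen so that the next linear factor divides the new error.\<close>

lemma inverse_modulo_chain:
  assumes "\<And>j. j < n \<Longrightarrow> poly q (\<mu> j) \<noteq> 0"
  shows "\<exists>r s. r * q = 1 + s * chain \<mu> n"
  using assms
proof (induct n)
  case 0
  show ?case by (rule exI[of _ 0], rule exI[of _ "-1"]) (simp add: chain_def)
next
  case (Suc n)
  then obtain r s where rs: "r * q = 1 + s * chain \<mu> n" by auto
  define c where "c = - poly s (\<mu> n) / poly q (\<mu> n)"
  have "poly (s + Polynomial.smult c q) (\<mu> n) = 0" unfolding c_def using Suc(2)[of n] by simp
  then obtain t where t: "s + Polynomial.smult c q = [:- \<mu> n, 1:] * t" unfolding poly_eq_0_iff_dvd by (rule dvdE)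
  have "(r + Polynomial.smult c (chain \<mu> n)) * q = 1 + (s + Polynomial.smult c q) * chain \<mu> n"
    by (simp add: distrib_right rs) (simp add: mult.commute)
  also have "\<dots> = 1 + t * chain \<mu> (Suc n)" unfolding t chain_def by (simp only: prod.lessThan_Suc mult_ac)
  finally show ?case by (intro exI)
qed

section \<open>Vectors with widely spread valuations\<close>

text \<open>By uniqueness of digits in base \<open>b\<close>, distinct monomials with exponents below \<open>b\<close> have distinct
  valuations at such vectors.\<close>

definition spread :: "complex set \<Rightarrow> complex set \<Rightarrow> complex \<Rightarrow> nat \<Rightarrow> nat \<Rightarrow> (nat \<Rightarrow> complex) set" where
  "spread A m \<pi> b n = {y. \<forall>j<n. \<exists>s\<in>A - m. y j = \<pi> ^ (b ^ (n - Suc j)) * s}"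

context place
begin

text \<open>The correction \<open>y (j - 1)\<close> has a strictly larger valuation than
  \<open>\<mu> j * y j\<close>, which has the valuation of \<open>y j\<close>; so only the unit part
  changes.\<close>

lemma shift_spread:
  assumes "\<pi> \<in> m" "b \<ge> 2" "\<And>j. j < n \<Longrightarrow> \<mu> j \<in> A - m" "y \<in> spread A m \<pi> b n"
  shows "shift \<mu> y \<in> spread A m \<pi> b n"
  unfolding spread_def
proof (intro CollectI allI impI)
  fix j assume j: "j < n"
  obtain s where s: "s \<in> A - m" "y j = \<pi> ^ (b ^ (n - Suc j)) * s"
    using assms(4) j unfolding spread_def by blast
  have us: "\<mu> j * s \<in> A - m" by (rule unit_mult[OF assms(3)[OF j] s(1)])
  show "\<exists>s\<in>A - m. shift \<mu> y j = \<pi> ^ (b ^ (n - Suc j)) * s"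
  proof (cases j)
    case 0
    then show ?thesis using us s(2) unfolding shift_def by (intro bexI[OF _ us]) simp
  next
    case (Suc i)
    obtain t where t: "t \<in> A - m" "y i = \<pi> ^ (b ^ (n - j)) * t"
    proof -
      have "\<exists>t\<in>A - m. y i = \<pi> ^ (b ^ (n - Suc i)) * t" using assms(4) j Suc unfolding spread_def by simp
      then show thesis unfolding Suc[symmetric] by (elim bexE) (rule that)
    qed
    have "b ^ (n - Suc j) < b ^ (n - j)" using assms(2) j by (intro power_strict_increasing) auto
    then obtain k where k: "b ^ (n - j) = b ^ (n - Suc j) + k" "k > 0" using less_imp_add_positive by metis
    have "\<pi> ^ k * t \<in> m" using t(1) by (intro m_mult_right m_power assms(1) k(2)) simp
    then have u: "\<mu> j * s + \<pi> ^ k * t \<in> A - m" by (rule unit_add_m[OF us])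
    have "shift \<mu> y j = \<pi> ^ (b ^ (n - Suc j)) * (\<mu> j * s + \<pi> ^ k * t)"
      using s(2) t(2) Suc unfolding shift_def k(1) power_add by (simp add: algebra_simps)
    then show ?thesis by (rule bexI[OF _ u])
  qed
qed

lemma shift_spread_surj:
  assumes "\<pi> \<in> m" "b \<ge> 2" "\<And>j. j < n \<Longrightarrow> \<mu> j \<in> A - m" "\<And>j. \<mu> j \<noteq> 0" "y \<in> spread A m \<pi> b n"
  shows "\<exists>x\<in>spread A m \<pi> b n. shift \<mu> x = y"
proof -
  \<comment> \<open>The triangular system is solved at all indices, also beyond \<open>n\<close>, so
    that the result is an equation between functions. This is why every \<open>\<mu> j\<close> has
    to be nonzero.\<close>
  define x where "x = rec_nat (y 0 / \<mu> 0) (\<lambda>j w. (y (Suc j) - w) / \<mu> (Suc j))"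
  have x: "x 0 = y 0 / \<mu> 0" "x (Suc j) = (y (Suc j) - x j) / \<mu> (Suc j)" for j unfolding x_def by simp_all
  have "shift \<mu> x j = y j" for j using assms(4) unfolding shift_def by (cases j) (simp_all add: x)
  then have "shift \<mu> x = y" by (rule ext)
  moreover have "\<exists>s\<in>A - m. x j = \<pi> ^ (b ^ (n - Suc j)) * s" if "j < n" for j
    using that
  proof (induct j)
    case 0
    obtain s where s: "s \<in> A - m" "y 0 = \<pi> ^ (b ^ (n - Suc 0)) * s" using assms(5) 0 unfolding spread_def by blast
    have "inverse (\<mu> 0) * s \<in> A - m" by (intro unit_mult unit_inverse assms(3) 0 s(1))
    moreover have "x 0 = \<pi> ^ (b ^ (n - Suc 0)) * (inverse (\<mu> 0) * s)" unfolding x s(2) by (simp add: divide_inverse)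
    ultimately show ?case by (rule bexI[rotated])
  next
    case (Suc j)
    obtain s where s: "s \<in> A - m" "y (Suc j) = \<pi> ^ (b ^ (n - Suc (Suc j))) * s" using assms(5) Suc(2) unfolding spread_def by blast
    obtain t where t: "t \<in> A - m" "x j = \<pi> ^ (b ^ (n - Suc j)) * t" using Suc(1) Suc(2) by auto
    have "b ^ (n - Suc (Suc j)) < b ^ (n - Suc j)" using assms(2) Suc(2) by (intro power_strict_increasing) auto
    then obtain k where k: "b ^ (n - Suc j) = b ^ (n - Suc (Suc j)) + k" "k > 0" using less_imp_add_positive by metis
    have "- (\<pi> ^ k * t) \<in> m" using t(1) by (intro m_minus m_mult_right m_power assms(1) k(2)) simp
    then have u: "s + - (\<pi> ^ k * t) \<in> A - m" by (rule unit_add_m[OF s(1)])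
    have u: "inverse (\<mu> (Suc j)) * (s + - (\<pi> ^ k * t)) \<in> A - m" by (rule unit_mult[OF unit_inverse[OF assms(3)[OF Suc(2)]] u])
    have "x (Suc j) = \<pi> ^ (b ^ (n - Suc (Suc j))) * (inverse (\<mu> (Suc j)) * (s + - (\<pi> ^ k * t)))"
      unfolding x s(2) t(2) k(1) power_add by (simp add: divide_inverse algebra_simps)
    then show ?case by (rule bexI[OF _ u])
  qed
  ultimately show ?thesis unfolding spread_def by (intro bexI[of _ x] CollectI allI impI)
qed

text \<open>After division by the power with the least exponent a unit remains, plus terms in
  \<open>m\<close>.\<close>

lemma distinct_valuations_sum_nonzero:
  assumes "finite S" "S \<noteq> {}" "inj_on ex S" "\<And>\<alpha>. \<alpha> \<in> S \<Longrightarrow> c \<alpha> \<in> A - m" "\<pi> \<in> m" "\<pi> \<noteq> 0"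
  shows "(\<Sum>\<alpha>\<in>S. \<pi> ^ ex \<alpha> * c \<alpha>) \<noteq> 0"
proof -
  have "Min (ex ` S) \<in> ex ` S" using assms(1,2) by (intro Min_in) auto
  then obtain \<beta> where \<beta>: "\<beta> \<in> S" "ex \<beta> = Min (ex ` S)" by auto
  have lt: "ex \<beta> < ex \<alpha>" if "\<alpha> \<in> S - {\<beta>}" for \<alpha>
  proof -
    have "ex \<beta> \<le> ex \<alpha>" unfolding \<beta>(2) using that assms(1) by (intro Min_le) auto
    moreover have "ex \<beta> \<noteq> ex \<alpha>" using inj_onD[OF assms(3), of \<beta> \<alpha>] \<beta>(1) that by auto
    ultimately show ?thesis by simp
  qed
  have "(\<Sum>\<alpha>\<in>S. \<pi> ^ ex \<alpha> * c \<alpha>) = \<pi> ^ ex \<beta> * (c \<beta> + (\<Sum>\<alpha>\<in>S - {\<beta>}. \<pi> ^ (ex \<alpha> - ex \<beta>) * c \<alpha>))"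
  proof -
    have "(\<Sum>\<alpha>\<in>S. \<pi> ^ ex \<alpha> * c \<alpha>) = \<pi> ^ ex \<beta> * c \<beta> + (\<Sum>\<alpha>\<in>S - {\<beta>}. \<pi> ^ ex \<alpha> * c \<alpha>)" by (rule sum.remove[OF assms(1) \<beta>(1)])
    also have "(\<Sum>\<alpha>\<in>S - {\<beta>}. \<pi> ^ ex \<alpha> * c \<alpha>) = (\<Sum>\<alpha>\<in>S - {\<beta>}. \<pi> ^ ex \<beta> * (\<pi> ^ (ex \<alpha> - ex \<beta>) * c \<alpha>))"
    proof (rule sum.cong[OF refl])
      fix \<alpha> assume "\<alpha> \<in> S - {\<beta>}"
      then have "ex \<alpha> = ex \<beta> + (ex \<alpha> - ex \<beta>)" using lt[of \<alpha>] by simp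
      then have "\<pi> ^ ex \<alpha> = \<pi> ^ ex \<beta> * \<pi> ^ (ex \<alpha> - ex \<beta>)" by (metis power_add)
      then show "\<pi> ^ ex \<alpha> * c \<alpha> = \<pi> ^ ex \<beta> * (\<pi> ^ (ex \<alpha> - ex \<beta>) * c \<alpha>)" by simp
    qed
    finally show ?thesis by (simp add: distrib_left sum_distrib_left)
  qed
  moreover have "c \<beta> + (\<Sum>\<alpha>\<in>S - {\<beta>}. \<pi> ^ (ex \<alpha> - ex \<beta>) * c \<alpha>) \<in> A - m"
  proof (rule unit_add_m[OF assms(4)[OF \<beta>(1)] m_sum])
    fix \<alpha> assume a: "\<alpha> \<in> S - {\<beta>}"
    then have "c \<alpha> \<in> A" using assms(4)[of \<alpha>] by simp
    then show "\<pi> ^ (ex \<alpha> - ex \<beta>) * c \<alpha> \<in> m" using lt[OF a] by (intro m_mult_right m_power assms(5)) simp_all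
  qed
  ultimately show ?thesis using unit_nonzero assms(6) by simp
qed

lemma monomial_sum_nonzero_on_spread:
  assumes "finite S" "S \<noteq> {}" "\<And>\<alpha>. \<alpha> \<in> S \<Longrightarrow> c \<alpha> \<in> A - m" "\<pi> \<in> m" "\<pi> \<noteq> 0"
    "\<And>\<alpha> j. \<alpha> \<in> S \<Longrightarrow> \<alpha> j < b" "\<And>\<alpha> j. \<alpha> \<in> S \<Longrightarrow> j \<ge> n \<Longrightarrow> \<alpha> j = 0"
    "y \<in> spread A m \<pi> b n"
  shows "(\<Sum>\<alpha>\<in>S. c \<alpha> * (\<Prod>j<n. y j ^ \<alpha> j)) \<noteq> 0"
proof -
  have "\<forall>j. \<exists>s. j < n \<longrightarrow> s \<in> A - m \<and> y j = \<pi> ^ (b ^ (n - Suc j)) * s" using assms(8) unfolding spread_def by blast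
  from choice[OF this] obtain s where s: "\<forall>j. j < n \<longrightarrow> s j \<in> A - m \<and> y j = \<pi> ^ (b ^ (n - Suc j)) * s j" by (rule exE)
  define ex where "ex = (\<lambda>\<alpha>. \<Sum>j<n. \<alpha> j * b ^ (n - Suc j))"
  have "inj_on ex S"
  proof (rule inj_onI)
    fix \<alpha> \<beta> assume ab: "\<alpha> \<in> S" "\<beta> \<in> S" "ex \<alpha> = ex \<beta>"
    \<comment> \<open>In \<open>ex\<close> the digit at index 0 is the most significant one, whereas
      \<open>digits_unique\<close> expects the opposite order.\<close>
    have rev: "ex \<gamma> = (\<Sum>j<n. \<gamma> (n - Suc j) * b ^ j)" for \<gamma>
      unfolding ex_def by (rule sum.reindex_bij_witness[of _ "\<lambda>j. n - Suc j" "\<lambda>j. n - Suc j"]) auto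
    have "\<alpha> j = \<beta> j" for j
    proof (cases "j < n")
      case True
      have "\<alpha> (n - Suc (n - Suc j)) = \<beta> (n - Suc (n - Suc j))"
        by (rule digits_unique[where \<alpha> = "\<lambda>j. \<alpha> (n - Suc j)" and \<beta> = "\<lambda>j. \<beta> (n - Suc j)" and b = b and n = n])
          (use ab assms(6) True in \<open>simp_all add: rev\<close>)
      then show ?thesis using True by (simp add: Suc_diff_Suc)
    next
      case False
      then show ?thesis using assms(7)[OF ab(1), of j] assms(7)[OF ab(2), of j] by simp
    qed
    then show "\<alpha> = \<beta>" by (rule ext)
  qed
  moreover have "c \<alpha> * (\<Prod>j<n. s j ^ \<alpha> j) \<in> A - m" if "\<alpha> \<in> S" for \<alpha>
    using s by (intro unit_mult unit_prod unit_power assms(3) that) simp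
  ultimately have "(\<Sum>\<alpha>\<in>S. \<pi> ^ ex \<alpha> * (c \<alpha> * (\<Prod>j<n. s j ^ \<alpha> j))) \<noteq> 0"
    by (intro distinct_valuations_sum_nonzero assms(1,2,4,5))
  moreover have "(\<Prod>j<n. y j ^ \<alpha> j) = \<pi> ^ ex \<alpha> * (\<Prod>j<n. s j ^ \<alpha> j)" for \<alpha>
  proof -
    have "(\<Prod>j<n. y j ^ \<alpha> j) = (\<Prod>j<n. \<pi> ^ (\<alpha> j * b ^ (n - Suc j)) * s j ^ \<alpha> j)"
      using s by (intro prod.cong) (simp_all add: power_mult_distrib mult.commute flip: power_mult)
    then show ?thesis unfolding ex_def by (simp add: prod.distrib power_sum)
  qed
  ultimately show ?thesis by (simp add: mult_ac)
qed

end


section \<open>Linear endomorphisms\<close>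

lemma monoms_1:
  assumes "\<alpha> \<in> monoms N 1" shows "\<exists>k\<le>N. \<alpha> = (\<lambda>i. if i = k then 1 else 0)"
proof -
  have "(\<Sum>i\<le>N. \<alpha> i) = 1" and z: "\<forall>i>N. \<alpha> i = 0" using assms unfolding monoms_def by simp_all
  then obtain k where k: "k \<le> N" "\<alpha> k = 1" "\<forall>i\<in>{..N}. k \<noteq> i \<longrightarrow> \<alpha> i = 0" by (auto simp: sum_eq_1_iff simp del: One_nat_def)
  have "\<alpha> i = (if i = k then 1 else 0)" for i using k z by (cases "i \<le> N") auto
  then show ?thesis using k(1) by blast
qed

lemma heval_1_linear: "heval N 1 c (\<lambda>i. a * v i + b * w i) = a * heval N 1 c v + b * heval N 1 c w"
proof -
  have "(\<Prod>i\<le>N. (a * v i + b * w i) ^ \<alpha> i) = a * (\<Prod>i\<le>N. v i ^ \<alpha> i) + b * (\<Prod>i\<le>N. w i ^ \<alpha> i)" if \<alpha>: "\<alpha> \<in> monoms N 1" for \<alpha>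
  proof -
    obtain k where k: "k \<le> N" "\<alpha> = (\<lambda>i. if i = k then 1 else 0)" using monoms_1[OF \<alpha>] by blast
    have "(\<Prod>i\<le>N. x i ^ \<alpha> i) = x k" for x :: "nat \<Rightarrow> complex"
    proof -
      have "(\<Prod>i\<le>N. x i ^ \<alpha> i) = (\<Prod>i\<le>N. if i = k then x i else 1)" unfolding k(2) by (rule prod.cong) auto
      then show ?thesis using k(1) by simp
    qed
    then show ?thesis by simp
  qed
  then show ?thesis unfolding heval_def by (simp add: sum_distrib_left sum.distrib distrib_left mult_ac)
qed

lemma linear_operator_Fvec: "linear_operator (Fvec N 1 F)"
  by unfold_locales (simp add: Fvec_def heval_1_linear fun_eq_iff del: One_nat_def)

text \<open>Keep only the monomials of degree \<open>e\<close>. For fixed \<open>x\<close> the value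
  at t x is the polynomial \<open>f x * t ^ e\<close> in t, and its coefficient at
  \<open>t ^ e\<close> is the value of the part kept.\<close>

lemma homogeneous_Pol_form:
  assumes f: "f \<in> Pol {x. algebraic x} (Suc N)" and hom: "\<And>t x. f (\<lambda>i. t * x i) = t ^ e * f x"
  shows "\<exists>c. alg_hpoly N e c \<and> (\<forall>x. heval N e c x = f x)"
proof -
  have "monomial_sum {x. algebraic x} (Suc N) f" by (rule Pol_monomial_sum[OF f]) auto
  then obtain T c where T: "finite T" "\<forall>\<alpha>\<in>T. c \<alpha> \<in> {x. algebraic x} \<and> (\<forall>i\<ge>Suc N. \<alpha> i = (0::nat))"
     and fx: "f = (\<lambda>x. \<Sum>\<alpha>\<in>T. c \<alpha> * (\<Prod>i<Suc N. x i ^ \<alpha> i))" unfolding monomial_sum_def by (elim exE conjE) (rule that)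
  define c' where "c' = (\<lambda>\<alpha>. if \<alpha> \<in> T then c \<alpha> else 0)"
  have "alg_hpoly N e c'" unfolding alg_hpoly_def c'_def using T(2) by simp
  moreover have "heval N e c' x = f x" for x
  proof -
    define M where "M = (\<lambda>\<alpha>. \<Prod>i<Suc N. x i ^ \<alpha> i)"
    define P where "P = (\<Sum>\<alpha>\<in>T. monom (c \<alpha> * M \<alpha>) (\<Sum>i<Suc N. \<alpha> i))"
    have "poly P t = poly (monom (f x) e) t" for t
    proof -
      have "(\<Prod>i<Suc N. (t * x i) ^ \<alpha> i) = t ^ (\<Sum>i<Suc N. \<alpha> i) * M \<alpha>" for \<alpha>
        unfolding M_def by (simp only: power_mult_distrib prod.distrib power_sum)
      then have "poly P t = f (\<lambda>i. t * x i)" unfolding P_def fx by (simp only: poly_sum poly_monom mult_ac)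
      then show ?thesis unfolding hom by (simp add: poly_monom mult.commute)
    qed
    then have "P = monom (f x) e" using poly_eq_poly_eq_iff by blast
    then have "f x = coeff P e" by simp
    also have "\<dots> = (\<Sum>\<alpha>\<in>T. if (\<Sum>i<Suc N. \<alpha> i) = e then c \<alpha> * M \<alpha> else 0)" unfolding P_def by (simp add: coeff_sum)
    also have "\<dots> = (\<Sum>\<alpha>\<in>monoms N e. c' \<alpha> * M \<alpha>)"
    proof (rule sum.mono_neutral_cong)
      show "c' \<alpha> * M \<alpha> = 0" if "\<alpha> \<in> monoms N e - T" for \<alpha> using that unfolding c'_def by simp
      show "(if (\<Sum>i<Suc N. \<alpha> i) = e then c \<alpha> * M \<alpha> else 0) = 0" if "\<alpha> \<in> T - monoms N e" for \<alpha>
        using that T(2) unfolding monoms_def by (auto simp: lessThan_Suc_atMost)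
      show "(if (\<Sum>i<Suc N. \<alpha> i) = e then c \<alpha> * M \<alpha> else 0) = c' \<alpha> * M \<alpha>" if "\<alpha> \<in> T \<inter> monoms N e" for \<alpha>
        using that unfolding monoms_def c'_def by (simp add: lessThan_Suc_atMost)
    qed (use T(1) in simp_all)
    finally show ?thesis unfolding heval_def M_def lessThan_Suc_atMost by simp
  qed
  ultimately show ?thesis by (intro exI[of _ c']) simp
qed

lemma form_zero_on_algebraic:
  assumes "\<And>v. alg_vec N v \<Longrightarrow> heval N e c v = 0" shows "heval N e c x = 0"
proof (rule Pol_zero_grid[where G = "\<lambda>_. range of_nat" and n = "Suc N" and f = "heval N e c"])
  show "heval N e c \<in> Pol UNIV (Suc N)" by (rule heval_Pol) simp_all
  show "infinite (range (of_nat :: nat \<Rightarrow> complex))" by (rule range_inj_infinite) (simp add: inj_on_def)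
  fix x :: "nat \<Rightarrow> complex" assume x: "\<And>i. i < Suc N \<Longrightarrow> x i \<in> range of_nat"
  have "algebraic (x i)" if "i \<le> N" for i using x[of i] that by auto
  then have "alg_vec N (\<lambda>i. if i \<le> N then x i else 0)" unfolding alg_vec_def is_vec_def by simp
  from assms[OF this] show "heval N e c x = 0" using heval_cong[of N "\<lambda>i. if i \<le> N then x i else 0" x e c] by simp
qed

lemma orbit_vectors:
  "proj w \<in> orbit (fmap N d F) (proj v) \<longleftrightarrow> (\<exists>k t. t \<noteq> 0 \<and> w = (\<lambda>i. t * (Fvec N d F ^^ k) v i))"
proof
  assume "proj w \<in> orbit (fmap N d F) (proj v)"
  then obtain k where "proj w = proj ((Fvec N d F ^^ k) v)" unfolding orbit_def fmap_funpow_proj by (elim CollectE exE conjE) (rule that)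
  then have "w \<in> proj ((Fvec N d F ^^ k) v)" using proj_self[of w] by simp
  then show "\<exists>k t. t \<noteq> 0 \<and> w = (\<lambda>i. t * (Fvec N d F ^^ k) v i)" by (elim proj_memE) (intro exI conjI)
next
  assume "\<exists>k t. t \<noteq> 0 \<and> w = (\<lambda>i. t * (Fvec N d F ^^ k) v i)"
  then obtain k t where "t \<noteq> 0" "w = (\<lambda>i. t * (Fvec N d F ^^ k) v i)" by (elim exE conjE) (rule that)
  then have "proj w = (fmap N d F ^^ k) (proj v)" by (simp add: proj_scale fmap_funpow_proj)
  then show "proj w \<in> orbit (fmap N d F) (proj v)" unfolding orbit_def by (intro CollectI exI[of _ k]) simp
qed

section \<open>Endomorphisms with a linear lift\<close>

locale linear_endo = linear_operator "Fvec N d F" for N d F +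
  assumes endo: "endo N d F"
begin

lemma is_vec_funpow: "is_vec N v \<Longrightarrow> is_vec N ((Fvec N d F ^^ k) v)"
  by (cases k) (simp_all add: is_vec_Fvec)

text \<open>\<open>endo\<close> speaks of algebraic vectors only; the Nullstellensatz identity
  extends injectivity to complex ones.\<close>

lemma Fvec_kernel:
  assumes "is_vec N x" "Fvec N d F x = (\<lambda>_. 0)" shows "x = (\<lambda>_. 0)"
proof
  fix i show "x i = 0"
  proof (cases "i \<le> N")
    case True
    obtain D g where "\<forall>x. x i ^ D = (\<Sum>j\<le>N. g j x * heval N d (F j) x)" using endo_nullstellensatz[OF endo True] by (elim exE conjE) (rule that)
    then have "x i ^ D = (\<Sum>j\<le>N. g j x * Fvec N d F x j)" by (simp add: Fvec_def)
    also have "\<dots> = 0" unfolding assms(2) by simp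
    finally show ?thesis by simp
  next
    case False
    then show ?thesis using assms(1) unfolding is_vec_def by simp
  qed
qed

lemma funpow_kernel:
  assumes "is_vec N x" "(Fvec N d F ^^ k) x = (\<lambda>_. 0)" shows "x = (\<lambda>_. 0)"
  using assms(2)
proof (induct k)
  case (Suc k)
  then show ?case using Fvec_kernel[OF is_vec_funpow[OF assms(1)], of k] by simp
qed simp

lemma funpow_inj:
  assumes "is_vec N x" "is_vec N y" "(Fvec N d F ^^ k) x = (Fvec N d F ^^ k) y" shows "x = y"
proof -
  have lin: "(Fvec N d F ^^ k) (\<lambda>i. 1 * x i + (- 1) * y i) = (\<lambda>i. 1 * (Fvec N d F ^^ k) x i + (- 1) * (Fvec N d F ^^ k) y i)"
    by (induct k) (simp_all only: funpow.simps id_apply o_apply linear)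
  have "(\<lambda>i. 1 * x i + (- 1) * y i) = (\<lambda>_. 0)"
    by (rule funpow_kernel[where k = k]) (use assms lin in \<open>simp_all add: is_vec_def\<close>)
  then have "1 * x i + (- 1) * y i = 0" for i by (rule fun_cong)
  then show ?thesis by (intro ext) simp
qed

lemma is_vec_act: "is_vec N v \<Longrightarrow> is_vec N (act p v)"
  by (induct p) (simp_all add: act_pCons is_vec_Fvec[unfolded is_vec_def] is_vec_def)

text \<open>\<open>N + 2\<close> iterates in \<open>N + 1\<close> coordinates are dependent over the
  complex numbers. Normalising one coefficient to 1 turns the dependency into affine relations, and
  the retraction makes the remaining coefficients algebraic.\<close>

lemma algebraic_annihilator:
  assumes v: "alg_vec N v"
  shows "\<exists>q. q \<noteq> 0 \<and> (\<forall>i. algebraic (coeff q i)) \<and> act q v = (\<lambda>_. 0)"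
proof -
  have alg: "alg_vec N ((Fvec N d F ^^ k) v)" for k by (induct k) (simp_all add: v alg_vec_Fvec[OF endo])
  have algi: "algebraic ((Fvec N d F ^^ k) v i)" if "i \<le> N" for k i using alg[of k] that unfolding alg_vec_def by simp
  obtain e where e: "\<exists>k\<in>{..Suc N}. e k \<noteq> 0" "\<forall>i\<in>{..N}. (\<Sum>k\<in>{..Suc N}. e k * (Fvec N d F ^^ k) v i) = 0"
    using more_vectors_than_coordinates[of "{..N}" "{..Suc N}" "\<lambda>k. (Fvec N d F ^^ k) v"] by auto
  obtain k0 where k0: "k0 \<in> {..Suc N}" "e k0 \<noteq> 0" using e(1) by (rule bexE)
  define I where "I = {..Suc N} - {k0}"
  obtain \<pi> where \<pi>: "\<forall>k\<in>I. algebraic (\<pi> k)" "\<forall>a0 a. algebraic a0 \<and> (\<forall>i\<in>I. algebraic (a i)) \<and> a0 + (\<Sum>i\<in>I. a i * (e i / e k0)) = 0 \<longrightarrow>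
     a0 + (\<Sum>i\<in>I. a i * \<pi> i) = 0" using algebraic_linear_retraction[of I "\<lambda>i. e i / e k0"] unfolding I_def by auto
  define h where "h = (\<lambda>k. if k = k0 then 1 else \<pi> k)"
  define q where "q = (\<Sum>k\<in>{..Suc N}. monom (h k) k)"
  have coeff: "coeff q k = (if k \<in> {..Suc N} then h k else 0)" for k unfolding q_def by (simp add: coeff_sum)
  have "coeff q k0 = 1" unfolding coeff h_def using k0(1) by simp
  then have "q \<noteq> 0" by auto
  moreover have "algebraic (coeff q k)" for k unfolding coeff h_def using \<pi>(1) unfolding I_def by auto
  moreover have "act q v i = 0" for i
  proof (cases "i \<le> N")
    case True
    have "(\<Sum>k\<in>{..Suc N}. e k * (Fvec N d F ^^ k) v i) = 0" using e(2) True by simp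
    then have "e k0 * (Fvec N d F ^^ k0) v i + (\<Sum>k\<in>I. e k * (Fvec N d F ^^ k) v i) = 0"
      using sum.remove[OF _ k0(1), of "\<lambda>k. e k * (Fvec N d F ^^ k) v i"] unfolding I_def by simp
    then have h0: "inverse (e k0) * (e k0 * (Fvec N d F ^^ k0) v i + (\<Sum>k\<in>I. e k * (Fvec N d F ^^ k) v i)) = 0" by simp
    have "(Fvec N d F ^^ k0) v i + (\<Sum>k\<in>I. (Fvec N d F ^^ k) v i * (e k / e k0)) = 0"
    proof -
      have "inverse (e k0) * (e k0 * z) = z" for z using k0(2) by simp
      moreover have "inverse (e k0) * (\<Sum>k\<in>I. e k * (Fvec N d F ^^ k) v i) = (\<Sum>k\<in>I. (Fvec N d F ^^ k) v i * (e k / e k0))"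
        by (simp add: sum_distrib_left divide_inverse mult_ac)
      ultimately show ?thesis using h0 by (simp only: distrib_left)
    qed
    then have "(Fvec N d F ^^ k0) v i + (\<Sum>k\<in>I. (Fvec N d F ^^ k) v i * \<pi> k) = 0"
      by (intro \<pi>(2)[rule_format] conjI ballI algi True)
    moreover have "act q v i = (\<Sum>k\<in>{..Suc N}. h k * (Fvec N d F ^^ k) v i)" unfolding q_def act_sum act_monom ..
    moreover have "\<dots> = h k0 * (Fvec N d F ^^ k0) v i + (\<Sum>k\<in>I. h k * (Fvec N d F ^^ k) v i)"
      unfolding I_def by (rule sum.remove[OF _ k0(1)]) simp
    moreover have "(\<Sum>k\<in>I. h k * (Fvec N d F ^^ k) v i) = (\<Sum>k\<in>I. (Fvec N d F ^^ k) v i * \<pi> k)"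
      by (rule sum.cong) (simp_all add: h_def I_def)
    ultimately show ?thesis by (simp add: h_def)
  next
    case False
    then show ?thesis using is_vec_act[of v q] v unfolding alg_vec_def is_vec_def by simp
  qed
  then have "act q v = (\<lambda>_. 0)" by (rule ext)
  ultimately show ?thesis by (intro exI[of _ q] conjI allI)
qed

lemma triangular_basis:
  assumes v: "alg_vec N v"
  shows "\<exists>n \<mu>. (\<forall>j. \<mu> j \<noteq> 0 \<and> algebraic (\<mu> j)) \<and> act (chain \<mu> n) v = (\<lambda>_. 0)"
proof -
  define P where "P = (\<lambda>q. q \<noteq> 0 \<and> (\<forall>i. algebraic (coeff q i)) \<and> act q v = (\<lambda>_. 0))"
  have "\<exists>q. P q" using algebraic_annihilator[OF v] unfolding P_def .
  then obtain q where q: "P q" "\<forall>q'. P q' \<longrightarrow> degree q \<le> degree q'" using ex_has_least_nat[of P _ degree] by auto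
  have q': "q \<noteq> 0" "\<And>i. algebraic (coeff q i)" "act q v = (\<lambda>_. 0)" using q(1) unfolding P_def by simp_all
  \<comment> \<open>An annihilator of least degree does not have the root 0: a factor X could be
    dropped because the lift is injective.\<close>
  have root: "x \<noteq> 0" if "poly q x = 0" for x
  proof
    assume x0: "x = 0"
    obtain a p where p: "q = pCons a p" by (cases q)
    have "poly (pCons a p) 0 = 0" using that unfolding p x0 .
    then have a: "a = 0" by simp
    have "act (pCons 0 p) v = (\<lambda>_. 0)" using q'(3) unfolding p a .
    then have "Fvec N d F (act p v) = (\<lambda>_. 0)" unfolding act_pCons by simp
    moreover have "is_vec N (act p v)" using v unfolding alg_vec_def by (intro is_vec_act) simp
    ultimately have "act p v = (\<lambda>_. 0)" by (rule Fvec_kernel[rotated])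
    moreover have p0: "p \<noteq> 0" using q'(1) unfolding p a by simp
    moreover have "algebraic (coeff p i)" for i using q'(2)[of "Suc i"] unfolding p by simp
    ultimately have "P p" unfolding P_def by (intro conjI allI)
    then have "degree q \<le> degree p" by (rule q(2)[rule_format])
    then show False unfolding p using p0 by simp
  qed
  obtain as where as: "Polynomial.smult (coeff q (degree q)) (\<Prod>a\<leftarrow>as. [:- a, 1:]) = q" using fundamental_theorem_algebra_factorized[of q] by blast
  define n where "n = length as"
  \<comment> \<open>The value 1 beyond \<open>n\<close> keeps every \<open>\<mu> j\<close> nonzero
    and algebraic, which is later required at all indices.\<close>
  define \<mu> where "\<mu> = (\<lambda>j. if j < n then as ! j else 1)"
  have chain: "(\<Prod>a\<leftarrow>as. [:- a, 1:]) = chain \<mu> n"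
    unfolding chain_def n_def prod.list_conv_set_nth by (intro prod.cong) (auto simp: \<mu>_def n_def)
  have "poly q (\<mu> j) = 0" if "j < n" for j
  proof -
    have "poly (chain \<mu> n) (\<mu> j) = 0" unfolding poly_chain using that by (simp, intro bexI[of _ j]) simp_all
    then show ?thesis using as[unfolded chain] by (metis mult_zero_right poly_smult)
  qed
  then have "\<mu> j \<noteq> 0 \<and> algebraic (\<mu> j)" for j
    using root algebraic_coeffs_root[OF q'(1,2)] by (cases "j < n") (auto simp: \<mu>_def)
  moreover have "act (chain \<mu> n) v = (\<lambda>_. 0)"
  proof
    fix i
    have "coeff q (degree q) * act (chain \<mu> n) v i = act q v i" by (subst (3) as[unfolded chain, symmetric]) (simp add: act_smult)
    then show "act (chain \<mu> n) v i = 0" using q'(1,3) by simp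
  qed
  ultimately show ?thesis by (intro exI[of _ n] exI[of _ \<mu>]) simp
qed

lemma act_span_poly: "act (span_poly \<mu> n y) v i = (\<Sum>j<n. y j * act (chain \<mu> j) v i)"
  unfolding span_poly_def act_sum act_smult ..

lemma act_chain_Suc: "act (chain \<mu> (Suc j)) v = (\<lambda>i. - \<mu> j * act (chain \<mu> j) v i + Fvec N d F (act (chain \<mu> j) v) i)"
proof -
  have "chain \<mu> (Suc j) = [:- \<mu> j, 1:] * chain \<mu> j" unfolding chain_def by (simp add: mult.commute)
  then have "act (chain \<mu> (Suc j)) v = act [:- \<mu> j, 1:] (act (chain \<mu> j) v)" by (simp only: act_mult)
  then show ?thesis by (simp add: act_pCons T_zero)
qed

lemma act_chain_0: "act (chain \<mu> 0) v = v"
  unfolding chain_def by simp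

lemma act_chain_in_subfield:
  assumes K: "is_subfield K" and F: "\<And>i \<alpha>. i \<le> N \<Longrightarrow> \<alpha> \<in> monoms N d \<Longrightarrow> F i \<alpha> \<in> K"
    and v: "\<And>i. v i \<in> K" and \<mu>: "\<And>j. j < n \<Longrightarrow> \<mu> j \<in> K" and "j \<le> n"
  shows "act (chain \<mu> j) v i \<in> K"
  using assms(5)
proof (induct j arbitrary: i)
  case (Suc j)
  then have IH: "act (chain \<mu> j) v i \<in> K" for i by simp
  have "Fvec N d F (act (chain \<mu> j) v) i \<in> K"
    using Fvec_in_subfield[where F = F and d = d and N = N and a = 1 and v = "act (chain \<mu> j) v" and i = i, OF K F IH] by simp
  then show ?case unfolding act_chain_Suc using \<mu>[of j] Suc(2) by (intro is_subfieldD[OF K] IH) simp_all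
qed (simp add: act_chain_0 v)

lemma act_chain_Pol:
  assumes "\<And>j. algebraic (\<mu> j)" "i \<le> N"
  shows "(\<lambda>x. act (chain \<mu> j) x i) \<in> Pol {x. algebraic x} (Suc N)"
  using assms(2)
proof (induct j arbitrary: i)
  case 0
  then show ?case by (simp add: act_chain_0 Pol_var)
next
  case (Suc j)
  have "alg_hpoly N d (F i)" using endo Suc(2) unfolding endo_def by simp
  then have "heval N d (F i) \<in> Pol {x. algebraic x} (Suc N)" by (rule alg_hpoly_Pol)
  then have "(\<lambda>x. heval N d (F i) (\<lambda>i. act (chain \<mu> j) x i)) \<in> Pol {x. algebraic x} (Suc N)"
    by (rule Pol_comp) (rule Suc(1), simp)
  then have "(\<lambda>x. Fvec N d F (act (chain \<mu> j) x) i) \<in> Pol {x. algebraic x} (Suc N)" using Suc(2) by (simp add: Fvec_def)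
  moreover have "(\<lambda>x. - \<mu> j * act (chain \<mu> j) x i) \<in> Pol {x. algebraic x} (Suc N)"
    by (rule Pol_mult[OF Pol_const Suc(1)[OF Suc(2)]]) (simp add: assms(1))
  ultimately show ?case unfolding act_chain_Suc by (rule Pol_add[rotated])
qed

lemma act_scale: "act p (\<lambda>i. a * v i) = (\<lambda>i. a * act p v i)"
  using act_mult[of p "[:a:]" v] act_mult[of "[:a:]" p v] by (simp add: act_pCons T_zero mult.commute)

text \<open>If \<open>q\<close> is invertible modulo the annihilator of \<open>v\<close>, then \<open>v\<close> lies in the span of the orbit of \<open>q(T) v\<close>,
  so a form vanishing on the orbit of \<open>q(T) v\<close> pulls back along \<open>q(T)\<close> to one vanishing on the orbit of \<open>v\<close>.\<close>

lemma dense_orbit_act: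
  assumes dense: "zdense N (orbit (fmap N d F) (proj v))" and v: "is_vec N v"
    and q: "\<And>i. i \<le> N \<Longrightarrow> (\<lambda>x. act q x i) \<in> Pol {x. algebraic x} (Suc N)"
    and rs: "r * q = 1 + s * chain \<mu> n" "act (chain \<mu> n) v = (\<lambda>_. 0)"
    and u: "alg_vec N (act q v)" "act q v \<noteq> (\<lambda>_. 0)"
  shows "zdense N (orbit (fmap N d F) (proj (act q v)))"
proof (rule zdenseI)
  show "orbit (fmap N d F) (proj (act q v)) \<subseteq> PN N"
    unfolding orbit_def fmap_funpow_proj using alg_vec_Fvec_funpow[OF endo u] by (auto intro!: PN_I)
  fix e c v1 assume c: "alg_hpoly N e c" "alg_vec N v1" "heval N e c v1 \<noteq> 0"
  show "\<exists>w. proj w \<in> orbit (fmap N d F) (proj (act q v)) \<and> heval N e c w \<noteq> 0"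
  proof (rule ccontr)
    assume no: "\<not> ?thesis"
    have z: "heval N e c ((Fvec N d F ^^ k) (act q v)) = 0" for k
    proof -
      have "proj ((Fvec N d F ^^ k) (act q v)) \<in> orbit (fmap N d F) (proj (act q v))"
        unfolding orbit_vectors by (intro exI[of _ k] exI[of _ 1]) simp
      then show ?thesis using no by auto
    qed
    define h where "h = (\<lambda>x. heval N e c (\<lambda>i. act q x i))"
    have "\<exists>c'. alg_hpoly N e c' \<and> (\<forall>x. heval N e c' x = h x)"
    proof (rule homogeneous_Pol_form)
      show "h \<in> Pol {x. algebraic x} (Suc N)" unfolding h_def by (rule Pol_comp[OF alg_hpoly_Pol[OF c(1)]]) (rule q, simp)
      show "h (\<lambda>i. t * x i) = t ^ e * h x" for t x unfolding h_def act_scale heval_scale ..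
    qed
    then obtain c' where c': "alg_hpoly N e c'" "\<forall>x. heval N e c' x = h x" by (elim exE conjE) (rule that)
    have "heval N e c' w = 0" if orb: "proj w \<in> orbit (fmap N d F) (proj v)" for w
    proof -
      obtain k t where w: "w = (\<lambda>i. t * (Fvec N d F ^^ k) v i)" using orb unfolding orbit_vectors by (elim exE conjE) (rule that)
      have "h ((Fvec N d F ^^ k) v) = 0" using z[of k] unfolding h_def funpow_act .
      then show ?thesis unfolding w heval_scale using c'(2) by simp
    qed
    then have "heval N e c' x = 0" if "alg_vec N x" for x by (rule zdense_formD[OF dense c'(1) _ that])
    then have h0: "h x = 0" for x using form_zero_on_algebraic[of N e c' x] c'(2) by simp
    have "heval N e c ((Fvec N d F ^^ k) v) = 0" for k
    proof -
      have "act q (act r ((Fvec N d F ^^ k) v)) = act (1 + s * chain \<mu> n) ((Fvec N d F ^^ k) v)"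
        unfolding act_mult[symmetric] rs(1)[symmetric] by (simp add: mult.commute)
      also have "\<dots> = (Fvec N d F ^^ k) v"
        unfolding act_add act_mult funpow_act[symmetric] rs(2) using T_funpow_scale[of k 0 v] act_scale[of s 0 v] by simp
      finally show ?thesis using h0[of "act r ((Fvec N d F ^^ k) v)"] unfolding h_def by simp
    qed
    then have "heval N e c w = 0" if "proj w \<in> orbit (fmap N d F) (proj v)" for w
      using that unfolding orbit_vectors by (auto simp: heval_scale)
    then have "heval N e c v1 = 0" by (rule zdense_formD[OF dense c(1) _ c(2)])
    then show False using c(3) by simp
  qed
qed

end

text \<open>At \<open>x\<close> each Newton polynomial is 0 or a unit, and the one at index 0 is 1;
  the powers of \<open>\<pi>\<close> in front have distinct exponents, so the terms cannot cancel.
  Applied at the nodes, this makes the polynomial invertible modulo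
  \<open>chain \<mu> n\<close>.\<close>

lemma (in place) span_poly_spread_root:
  assumes "\<pi> \<in> m" "\<pi> \<noteq> 0" "b \<ge> 2" "n > 0" "\<And>i. i < n \<Longrightarrow> poly (chain \<mu> i) x \<noteq> 0 \<Longrightarrow> poly (chain \<mu> i) x \<in> A - m"
  shows "poly (span_poly \<mu> n (\<lambda>j. \<pi> ^ (b ^ (n - Suc j)))) x \<noteq> 0"
proof -
  define J where "J = {i \<in> {..<n}. poly (chain \<mu> i) x \<noteq> 0}"
  have "0 \<in> J" unfolding J_def using assms(4) by (simp add: chain_def)
  moreover have "inj_on (\<lambda>j. b ^ (n - Suc j)) J"
    unfolding J_def inj_on_def using assms(3) by auto
  ultimately have "(\<Sum>j\<in>J. \<pi> ^ (b ^ (n - Suc j)) * poly (chain \<mu> j) x) \<noteq> 0"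
    using assms(5) by (intro distinct_valuations_sum_nonzero assms(1,2)) (auto simp: J_def)
  moreover have "(\<Sum>j\<in>J. \<pi> ^ (b ^ (n - Suc j)) * poly (chain \<mu> j) x) = (\<Sum>j<n. \<pi> ^ (b ^ (n - Suc j)) * poly (chain \<mu> j) x)"
    unfolding J_def by (rule sum.mono_neutral_left) auto
  ultimately show ?thesis unfolding span_poly_def by (simp add: poly_sum)
qed

context linear_endo
begin

text \<open>The member of \<open>R\<close> equivalent to a given point is not under control, but up
  to a scalar its lift is \<open>L x\<close> for a spread \<open>x\<close> if the lift of the given
  point is of that form. It remains to find one such point with dense orbit.\<close>

theorem representatives_part:
  assumes K: "is_subfield K" "K \<subseteq> {x. algebraic x}" and FK: "\<And>i \<alpha>. i \<le> N \<Longrightarrow> \<alpha> \<in> monoms N d \<Longrightarrow> F i \<alpha> \<in> K"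
    and v: "\<And>i. v i \<in> K" "alg_vec N v" "v \<noteq> (\<lambda>_. 0)" and dense: "zdense N (orbit (fmap N d F) (proj v))"
    and \<mu>: "\<And>j. j < n \<Longrightarrow> \<mu> j \<in> K" "\<And>j. \<mu> j \<noteq> 0 \<and> algebraic (\<mu> j)" "act (chain \<mu> n) v = (\<lambda>_. 0)"
    and R: "R \<subseteq> dense_pts N d F K" "\<forall>P\<in>dense_pts N d F K. \<exists>!Q. Q \<in> R \<and> orb_equiv (fmap N d F) P Q"
  shows "zdense N R"
proof (rule zdenseI)
  have DPN: "dense_pts N d F K \<subseteq> PN N" unfolding dense_pts_def PN_K_def by auto
  then show "R \<subseteq> PN N" using R(1) by (rule subset_trans[rotated])
  have vN: "is_vec N v" using v(2) unfolding alg_vec_def by simp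
  have n: "n > 0" using \<mu>(3) v(3) act_chain_0[of \<mu> v] by (cases n) auto
  have bK: "act (chain \<mu> j) v i \<in> K" if "j < n" for i j
    by (rule act_chain_in_subfield[where n = n, OF K(1) FK v(1) \<mu>(1)]) (use that in simp_all)
  have algK: "algebraic x" if "x \<in> K" for x using K(2) that by (simp add: subset_iff)
  fix e c v1 assume c: "alg_hpoly N e c" "alg_vec N v1" "heval N e c v1 \<noteq> 0"
  define L where "L = (\<lambda>y. act (span_poly \<mu> n y) v)"
  have L: "L y = (\<lambda>i. \<Sum>j<n. y j * act (chain \<mu> j) v i)" for y unfolding L_def by (rule ext) (rule act_span_poly)
  have LT: "(Fvec N d F ^^ k) (L y) = L ((shift \<mu> ^^ k) y)" for k y unfolding L_def by (rule funpow_act_span_poly[OF \<mu>(3)])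
  have LN: "is_vec N (L y)" for y unfolding L_def by (rule is_vec_act[OF vN])
  define f where "f = (\<lambda>y. heval N e c (L y))"
  have "f \<in> Pol {x. algebraic x} n"
    unfolding f_def L
    by (rule Pol_comp[OF alg_hpoly_Pol[OF c(1)]], intro Pol_sum Pol_mult Pol_var Pol_const) (simp_all add: algK bK)
  then have "monomial_sum {x. algebraic x} n f" by (rule Pol_monomial_sum) auto
  then obtain S cc where S: "finite S" "\<forall>\<alpha>\<in>S. cc \<alpha> \<in> {x. algebraic x} \<and> (\<forall>i\<ge>n. \<alpha> i = (0::nat))"
     and fS: "f = (\<lambda>y. \<Sum>\<alpha>\<in>S. cc \<alpha> * (\<Prod>j<n. y j ^ \<alpha> j))" unfolding monomial_sum_def by (elim exE conjE) (rule that)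
  define S' where "S' = {\<alpha> \<in> S. cc \<alpha> \<noteq> 0}"
  have fS': "f y = (\<Sum>\<alpha>\<in>S'. cc \<alpha> * (\<Prod>j<n. y j ^ \<alpha> j))" for y
    unfolding fS S'_def by (rule sum.mono_neutral_right) (use S(1) in auto)
  have S'fin: "finite S'" unfolding S'_def using S(1) by simp
  \<comment> \<open>The lifts of the orbit of \<open>v\<close> are multiples of values of
    \<open>L\<close>; if \<open>f\<close> were zero, the form would vanish on this dense
    orbit.\<close>
  have "S' \<noteq> {}"
  proof
    assume "S' = {}"
    then have f0: "f y = 0" for y unfolding fS' by simp
    have L0: "L (\<lambda>j. if j = 0 then 1 else 0) = v"
      using n act_chain_0[of \<mu> v] unfolding L by (simp add: if_distrib[of "\<lambda>x. x * _"] cong: if_cong)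
    have "heval N e c w = 0" if orb: "proj w \<in> orbit (fmap N d F) (proj v)" for w
    proof -
      obtain k t where w: "w = (\<lambda>i. t * (Fvec N d F ^^ k) v i)" using orb unfolding orbit_vectors by (elim exE conjE) (rule that)
      have "(Fvec N d F ^^ k) v = L ((shift \<mu> ^^ k) (\<lambda>j. if j = 0 then 1 else 0))" using LT[of k "\<lambda>j. if j = 0 then 1 else 0"] unfolding L0 .
      then show ?thesis using f0 unfolding w heval_scale f_def by simp
    qed
    then have "heval N e c v1 = 0" by (rule zdense_formD[OF dense c(1) _ c(2)])
    then show False using c(3) by simp
  qed
  \<comment> \<open>Larger than every exponent occurring in \<open>f\<close>, so that exponents are
    digits in base \<open>b\<close>, and at least 2 even if all exponents are zero.\<close>
  define b where "b = (\<Sum>\<alpha>\<in>S'. \<Sum>j<n. \<alpha> j) + 2"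
  have b: "b \<ge> 2" unfolding b_def by simp
  have lt: "\<alpha> j < b" if a: "\<alpha> \<in> S'" for \<alpha> j
  proof (cases "j < n")
    case True
    have "\<alpha> j \<le> (\<Sum>j<n. \<alpha> j)" using True by (intro member_le_sum) auto
    also have "\<dots> \<le> (\<Sum>\<alpha>\<in>S'. \<Sum>j<n. \<alpha> j)" by (rule member_le_sum[OF a _ S'fin]) simp
    finally show ?thesis unfolding b_def by simp
  next
    case False
    have "\<forall>i\<ge>n. \<alpha> i = 0" using a S(2) unfolding S'_def by simp
    then show ?thesis using False b by simp
  qed
  \<comment> \<open>Units are wanted for the coefficients of \<open>f\<close>, for the
    \<open>\<mu> j\<close> and for the nonzero values of the Newton polynomials at the nodes; the
    last make \<open>q\<close> invertible modulo \<open>chain \<mu> n\<close>.\<close>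
  define Z where "Z = cc ` S' \<union> \<mu> ` {..<n} \<union> (\<lambda>(i, j). poly (chain \<mu> i) (\<mu> j)) ` ({..<n} \<times> {..<n})"
  have "finite Z" unfolding Z_def using S'fin by simp
  moreover have "algebraic z" if "z \<in> Z" for z
    using that unfolding Z_def
  proof (elim UnE imageE)
    fix \<alpha> assume "z = cc \<alpha>" "\<alpha> \<in> S'"
    then show ?thesis using S(2) unfolding S'_def by simp
  next
    fix x assume z: "z = (case x of (i, j) \<Rightarrow> poly (chain \<mu> i) (\<mu> j))"
    show ?thesis unfolding z poly_chain by (cases x) (use \<mu>(2) in \<open>auto intro!: algebraic_prod algebraic_diff\<close>)
  qed (use \<mu>(2) in simp)
  ultimately obtain A m and p :: nat where pl: "place A m" and p: "prime p" "of_nat p \<in> m" and ZA: "\<And>x. x \<in> Z \<Longrightarrow> x \<in> A" "\<And>x. x \<in> Z \<Longrightarrow> x \<noteq> 0 \<Longrightarrow> x \<in> A - m"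
    by (rule exists_good_place) (assumption, rule that)
  interpret place A m by (rule pl)
  define \<pi> :: complex where "\<pi> = of_nat p"
  have \<pi>: "\<pi> \<in> m" "\<pi> \<noteq> 0" unfolding \<pi>_def using p prime_gt_0_nat[OF p(1)] by simp_all
  have \<mu>u: "\<mu> j \<in> A - m" if "j < n" for j using that \<mu>(2)[of j] by (intro ZA(2)) (simp_all add: Z_def)
  have nonzero: "f y \<noteq> 0" if y: "y \<in> spread A m \<pi> b n" for y
    unfolding fS'
  proof (rule monomial_sum_nonzero_on_spread[OF S'fin \<open>S' \<noteq> {}\<close> _ \<pi> _ _ y])
    show "cc \<alpha> \<in> A - m" if "\<alpha> \<in> S'" for \<alpha> using that by (intro ZA(2)) (auto simp: Z_def S'_def)
    show "\<alpha> j < b" if "\<alpha> \<in> S'" for \<alpha> j by (rule lt[OF that])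
    show "\<alpha> j = 0" if "\<alpha> \<in> S'" "j \<ge> n" for \<alpha> j using S(2) that unfolding S'_def by simp
  qed
  \<comment> \<open>All unit parts are 1: the entries are powers of \<open>p\<close>, so
    \<open>L y\<close> has coordinates in \<open>K\<close>.\<close>
  define y where "y = (\<lambda>j. \<pi> ^ (b ^ (n - Suc j)))"
  have y: "y \<in> spread A m \<pi> b n" unfolding spread_def y_def using one_notin by (auto intro!: bexI[of _ 1])
  have u: "L y i \<in> K" for i unfolding L y_def \<pi>_def using bK
    by (intro is_subfield_sum is_subfieldD(5) is_subfield_power is_subfield_of_nat K(1)) simp
  then have "alg_vec N (L y)" using algK LN unfolding alg_vec_def by simp
  define q where "q = span_poly \<mu> n y"
  have "poly q (\<mu> j) \<noteq> 0" if j: "j < n" for j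
    unfolding q_def y_def
  proof (rule span_poly_spread_root[OF \<pi> b n])
    fix i assume "i < n" "poly (chain \<mu> i) (\<mu> j) \<noteq> 0"
    then show "poly (chain \<mu> i) (\<mu> j) \<in> A - m" using j by (intro ZA(2)) (auto simp: Z_def)
  qed
  then obtain r s where rs: "r * q = 1 + s * chain \<mu> n" using inverse_modulo_chain[of n q \<mu>] by blast
  have Lq: "L y = act q v" unfolding L_def q_def ..
  have Ly0: "L y \<noteq> (\<lambda>_. 0)"
  proof
    assume "L y = (\<lambda>_. 0)"
    then have "act (r * q) v = (\<lambda>_. 0)" unfolding act_mult Lq using act_scale[of r 0 v] by simp
    moreover have "act (r * q) v = v" unfolding rs act_add act_mult \<mu>(3) using act_scale[of s 0 v] by simp
    ultimately show False using v(3) by simp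
  qed
  have "zdense N (orbit (fmap N d F) (proj (L y)))" unfolding Lq
  proof (rule dense_orbit_act[OF dense vN _ rs \<mu>(3)])
    show "(\<lambda>x. act q x i) \<in> Pol {x. algebraic x} (Suc N)" if "i \<le> N" for i
      unfolding q_def act_span_poly
      by (intro Pol_sum Pol_mult Pol_const act_chain_Pol that)
        (use \<mu>(2) in \<open>auto simp: y_def \<pi>_def\<close>)
  qed (use \<open>alg_vec N (L y)\<close> Ly0 in \<open>simp_all add: Lq\<close>)
  moreover have "proj (L y) \<in> PN_K N K" by (rule PN_K_I[OF u K(2) LN Ly0])
  ultimately have "proj (L y) \<in> dense_pts N d F K" unfolding dense_pts_def by simp
  then have "\<exists>!Q. Q \<in> R \<and> orb_equiv (fmap N d F) (proj (L y)) Q" by (rule R(2)[rule_format])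
  then obtain Q where Q: "Q \<in> R" "orb_equiv (fmap N d F) (proj (L y)) Q" by (elim ex1E conjE) (rule that)
  have "Q \<in> PN N" using Q(1) R(1) DPN by (simp add: subset_iff)
  then obtain w where w: "Q = proj w" "alg_vec N w" "w \<noteq> (\<lambda>_. 0)" by (rule PN_E)
  obtain k l t where t: "t \<noteq> 0" "(Fvec N d F ^^ k) (L y) = (\<lambda>i. t * (Fvec N d F ^^ l) w i)"
    using Q(2) unfolding w(1) by (rule orb_equiv_projE)
  have "(shift \<mu> ^^ k) y \<in> spread A m \<pi> b n" by (induct k) (simp_all add: y shift_spread[where \<mu> = \<mu>, OF \<pi>(1) b \<mu>u])
  moreover have "\<exists>x\<in>spread A m \<pi> b n. (shift \<mu> ^^ l) x = z" if "z \<in> spread A m \<pi> b n" for z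
    using that
  proof (induct l arbitrary: z)
    case (Suc l)
    have "\<exists>x'\<in>spread A m \<pi> b n. shift \<mu> x' = z"
    proof (rule shift_spread_surj[OF \<pi>(1) b _ _ Suc(2)])
      show "\<mu> j \<in> A - m" if "j < n" for j by (rule \<mu>u[OF that])
      show "\<mu> j \<noteq> 0" for j using \<mu>(2)[of j] by (rule conjunct1)
    qed
    then obtain x' where x': "x' \<in> spread A m \<pi> b n" "shift \<mu> x' = z" by (elim bexE) (rule that)
    obtain x where "x \<in> spread A m \<pi> b n" "(shift \<mu> ^^ l) x = x'" using Suc(1)[OF x'(1)] by (elim bexE) (rule that)
    then show ?case using x'(2) by (intro bexI[of _ x]) simp_all
  qed (intro bexI[rotated], simp_all)
  \<comment> \<open>\<open>shift\<close> maps spread vectors to spread vectors and is surjective on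
    them up to their lifts \<open>L\<close>; so the \<open>k\<close>-th shift of \<open>y\<close> is
    the \<open>l\<close>-th shift of some spread \<open>x\<close>, and injectivity of the lift makes
    \<open>L x\<close> a multiple of \<open>w\<close>.\<close>
  ultimately obtain x where x: "x \<in> spread A m \<pi> b n" "(shift \<mu> ^^ l) x = (shift \<mu> ^^ k) y" by blast
  have "(Fvec N d F ^^ l) (L x) = (Fvec N d F ^^ l) (\<lambda>i. t * w i)"
    using t(2) unfolding LT x(2) T_funpow_scale .
  moreover have "is_vec N (\<lambda>i. t * w i)" using w(2) unfolding alg_vec_def is_vec_def by simp
  ultimately have "L x = (\<lambda>i. t * w i)" by (intro funpow_inj[OF LN])
  then have "t ^ e * heval N e c w \<noteq> 0" using nonzero[OF x(1)] unfolding f_def by (simp add: heval_scale)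
  then show "\<exists>w. proj w \<in> R \<and> heval N e c w \<noteq> 0" using Q(1) w(1) by (intro exI[of _ w]) simp
qed

end

section \<open>The main theorem\<close>

lemma field_of_definition:
  assumes F: "endo N d F" and Z: "finite Z" "\<And>z. z \<in> Z \<Longrightarrow> algebraic z"
  obtains K \<sigma>s D g where "number_field K" "is_subfield K" "Z \<subseteq> K" "K \<subseteq> {x. algebraic x}" "embeddings K \<sigma>s" "certificate K N d F D g"
proof -
  have "\<forall>i. \<exists>D g. i \<le> N \<longrightarrow> (\<forall>j\<le>N. g j \<in> Pol {x. algebraic x} (Suc N)) \<and> (\<forall>x. x i ^ D = (\<Sum>j\<le>N. g j x * heval N d (F j) x))"
    using endo_nullstellensatz[OF F] by blast
  from choice[OF this] obtain D where "\<forall>i. \<exists>g. i \<le> N \<longrightarrow> (\<forall>j\<le>N. g j \<in> Pol {x. algebraic x} (Suc N)) \<and> (\<forall>x. x i ^ D i = (\<Sum>j\<le>N. g j x * heval N d (F j) x))" by (rule exE)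
  from choice[OF this] obtain g where g: "\<forall>i. i \<le> N \<longrightarrow> (\<forall>j\<le>N. g i j \<in> Pol {x. algebraic x} (Suc N)) \<and> (\<forall>x. x i ^ D i = (\<Sum>j\<le>N. g i j x * heval N d (F j) x))" by (rule exE)
  define S where "S = (\<lambda>i j. SOME S. finite S \<and> S \<subseteq> {x. algebraic x} \<and> g i j \<in> Pol S (Suc N))"
  have S: "finite (S i j)" "S i j \<subseteq> {x. algebraic x}" "g i j \<in> Pol (S i j) (Suc N)" if "i \<le> N" "j \<le> N" for i j
  proof -
    have "g i j \<in> Pol {x. algebraic x} (Suc N)" using g that by simp
    from someI_ex[OF Pol_finite_coeffs[OF this]]
    show "finite (S i j)" "S i j \<subseteq> {x. algebraic x}" "g i j \<in> Pol (S i j) (Suc N)" unfolding S_def by simp_all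
  qed
  define Z' where "Z' = Z \<union> (\<Union>i\<in>{..N}. F i ` monoms N d) \<union> (\<Union>i\<in>{..N}. \<Union>j\<in>{..N}. S i j)"
  have fin: "finite Z'" unfolding Z'_def using Z(1) S(1) by simp
  have alg: "algebraic z" if "z \<in> Z'" for z
    using that unfolding Z'_def
  proof (elim UnE UN_E imageE)
    fix i \<alpha> assume "i \<in> {..N}" "z = F i \<alpha>" "\<alpha> \<in> monoms N d"
    then show ?thesis using F unfolding endo_def alg_hpoly_def by simp
  next
    fix i j assume "i \<in> {..N}" "j \<in> {..N}" "z \<in> S i j"
    then show ?thesis using S(2)[of i j] by (simp add: subset_iff)
  qed (rule Z(2))
  show thesis
  proof (rule number_field_with_embeddings[OF fin alg])
    show "z \<in> Z' \<Longrightarrow> z \<in> Z'" for z .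
    fix K \<sigma>s assume K: "number_field K" "is_subfield K" "Z' \<subseteq> K" "K \<subseteq> {x. algebraic x}" "embeddings K \<sigma>s"
    have "certificate K N d F D g" unfolding certificate_def
    proof (intro conjI allI impI ballI)
      show "F i \<alpha> \<in> K" if "i \<le> N" "\<alpha> \<in> monoms N d" for i \<alpha>
        by (rule subsetD[OF K(3)]) (use that in \<open>auto simp: Z'_def\<close>)
      show "g i j \<in> Pol K (Suc N)" if "i \<le> N" "j \<le> N" for i j
      proof -
        have "S i j \<subseteq> Z'" unfolding Z'_def using that by auto
        then have "S i j \<subseteq> K" using K(3) by (rule subset_trans)
        then show ?thesis by (rule Pol_mono[OF S(3)[OF that] _ order_refl])
      qed
      show "x i ^ D i = (\<Sum>j\<le>N. g i j x * heval N d (F j) x)" if "i \<le> N" for i x using g that by simp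
    qed
    moreover have "Z \<subseteq> K" using K(3) unfolding Z'_def by (simp add: subset_iff)
    ultimately show thesis using K(1,2,4,5) by (intro that)
  qed
qed

theorem theorem4p1:
  fixes N d :: nat and F :: "nat \<Rightarrow> (nat \<Rightarrow> nat) \<Rightarrow> complex"
    and P0 :: "(nat \<Rightarrow> complex) set"
  assumes "N \<ge> 1"
    and "endo N d F"
    and "P0 \<in> PN N"
    and "zdense N (orbit (fmap N d F) P0)"
  shows "\<exists>K. number_field K \<and> endo_defined_over N d F K \<and> P0 \<in> PN_K N K \<and>
    (d \<ge> 2 \<longrightarrow>
       (\<forall>Qs. finite Qs \<and> Qs \<subseteq> PN N \<longrightarrow>
          zdense N (PN_K N K - (\<Union>Q\<in>Qs. grand_orbit (fmap N d F) (PN N) Q))) \<and>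
       (\<exists>S. S \<subseteq> PN_K N K \<and> zdense N S \<and>
          (\<forall>P\<in>PN_K N K. \<exists>!Q. Q \<in> S \<and> orb_equiv (fmap N d F) P Q))) \<and>
    (d \<ge> 2 \<longrightarrow>
       (\<forall>Y. zclosed N Y \<and> Y \<noteq> PN N \<longrightarrow>
          zdense N (PN_K N K - (\<Union>P\<in>Y \<inter> PN_K N K. orbit (fmap N d F) P)))) \<and>
    (d = 1 \<longrightarrow>
       (\<forall>R. R \<subseteq> dense_pts N d F K \<and>
            (\<forall>P\<in>dense_pts N d F K. \<exists>!Q. Q \<in> R \<and> orb_equiv (fmap N d F) P Q)
          \<longrightarrow> zdense N R))"
proof -
  obtain v0 where v0: "P0 = proj v0" "alg_vec N v0" "v0 \<noteq> (\<lambda>_. 0)" using assms(3) by (rule PN_E)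
  have v0alg: "algebraic (v0 i)" if "i \<le> N" for i using v0(2) that unfolding alg_vec_def by simp
  have v0N: "is_vec N v0" using v0(2) unfolding alg_vec_def by simp
  have d: "d \<ge> 1" using assms(2) unfolding endo_def by simp
  have basic: "endo_defined_over N d F K" "P0 \<in> PN_K N K" "v0 i \<in> K"
    if K: "is_subfield K" "K \<subseteq> {x. algebraic x}" "certificate K N d F D g" "v0 ` {..N} \<subseteq> K" for K D g i
  proof -
    show "endo_defined_over N d F K" unfolding endo_defined_over_def
      using certificateD(1)[OF K(3)] by (intro exI[of _ 1]) simp
    have vK: "v0 i \<in> K" if "i \<le> N" for i using K(4) that by (simp add: image_subset_iff)
    then show "P0 \<in> PN_K N K" unfolding v0(1) by (rule PN_K_I[OF _ K(2) v0N v0(3)])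
    show "v0 i \<in> K" using vK v0N is_subfieldD(1)[OF K(1)] unfolding is_vec_def by (cases "i \<le> N") simp_all
  qed
  show ?thesis
  proof (cases "d \<ge> 2")
    case True
    obtain D v w where D: "\<forall>i\<le>N. PolD {x. algebraic x} (Suc N) (heval N d (F i)) (D i)"
      and vw: "alg_vec N v" "alg_vec N w" "\<forall>i\<le>N. D i v w = 0" "\<exists>i\<le>N. \<exists>j\<le>N. v i * w j - v j * w i \<noteq> 0"
      using critical_pair[OF assms(2) True assms(1)] by (elim exE) (elim conjE, rule that)
    obtain i j where ij: "i \<le> N" "j \<le> N" "v i * w j - v j * w i \<noteq> 0" using vw(4) by (elim exE conjE) (rule that)
    \<comment> \<open>Besides a lift of \<open>P0\<close> the field has to contain the critical
      pair, from which the residue class missed in (b) is obtained.\<close>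
    define Z where "Z = v0 ` {..N} \<union> v ` {..N} \<union> w ` {..N}"
    have finZ: "finite Z" unfolding Z_def by simp
    have algZ: "algebraic z" if "z \<in> Z" for z
      using that vw(1,2) v0alg unfolding Z_def alg_vec_def by auto
    obtain K \<sigma>s E g where K: "number_field K" "is_subfield K" "Z \<subseteq> K" "K \<subseteq> {x. algebraic x}" "embeddings K \<sigma>s" "certificate K N d F E g"
      by (rule field_of_definition[OF assms(2) finZ algZ]) (assumption, rule that)
    have "v0 ` {..N} \<subseteq> K" using K(3) unfolding Z_def by simp
    note b = basic[OF K(2,4,6) this]
    have vK: "v l \<in> K" "w l \<in> K" if "l \<le> N" for l using K(3) that unfolding Z_def by (simp_all add: image_subset_iff)
    have vN: "is_vec N v" "is_vec N w" using vw(1,2) unfolding alg_vec_def by simp_all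
    have D1: "PolD {x. algebraic x} (Suc N) (heval N d (F l)) (D l)" "D l v w = 0" if "l \<le> N" for l using D vw(3) that by simp_all
    note a = grand_orbits_part[OF K(6,2,4,5) True assms(1)]
    have c: "zdense N (PN_K N K - (\<Union>P\<in>Y \<inter> PN_K N K. orbit (fmap N d F) P))" if "zclosed N Y" "Y \<noteq> PN N" for Y
      by (rule images_part[where D = D and v = v and w = w, OF K(6) assms(2) K(2,4,1) D1 vK(1) vN(1) vK(2) vN(2) ij that])
    show ?thesis
      by (rule exI[of _ K]) (use K(1) b(1,2) a c True in \<open>intro conjI impI allI; (elim conjE)?; simp\<close>)
  next
    case False
    then have d1: "d = 1" using d by simp
    interpret linear_endo N d F
      using linear_operator_Fvec[of N F] assms(2) unfolding linear_endo_def linear_endo_axioms_def d1 by (rule conjI)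
    obtain n \<mu> where \<mu>: "\<forall>j. \<mu> j \<noteq> 0 \<and> algebraic (\<mu> j)" "act (chain \<mu> n) v0 = (\<lambda>_. 0)"
      using triangular_basis[OF v0(2)] by (elim exE conjE) (rule that)
    \<comment> \<open>With the nodes in \<open>K\<close> the basis vectors
      \<open>act (chain \<mu> j) v0\<close> have coordinates in \<open>K\<close>.\<close>
    define Z where "Z = v0 ` {..N} \<union> \<mu> ` {..<n}"
    have finZ: "finite Z" unfolding Z_def by simp
    have algZ: "algebraic z" if "z \<in> Z" for z
      using that \<mu>(1) v0alg unfolding Z_def by auto
    obtain K \<sigma>s E g where K: "number_field K" "is_subfield K" "Z \<subseteq> K" "K \<subseteq> {x. algebraic x}" "embeddings K \<sigma>s" "certificate K N d F E g"
      by (rule field_of_definition[OF assms(2) finZ algZ]) (assumption, rule that)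
    have "v0 ` {..N} \<subseteq> K" using K(3) unfolding Z_def by simp
    note b = basic[OF K(2,4,6) this]
    have \<mu>K: "\<mu> j \<in> K" if "j < n" for j using K(3) that unfolding Z_def by (simp add: image_subset_iff)
    have c: "zdense N R" if "R \<subseteq> dense_pts N d F K" "\<forall>P\<in>dense_pts N d F K. \<exists>!Q. Q \<in> R \<and> orb_equiv (fmap N d F) P Q" for R
      by (rule representatives_part[where v = v0 and \<mu> = \<mu> and n = n, OF K(2,4) certificateD(1)[OF K(6)] b(3) v0(2,3) assms(4)[unfolded v0(1)] \<mu>K \<mu>(1)[rule_format] \<mu>(2) that])
    show ?thesis
      by (rule exI[of _ K]) (use K(1) b(1,2) c False in \<open>intro conjI impI allI; (elim conjE)?; simp\<close>)
  qed
qed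

end
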